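(* Let $k$ be an algebraically closed field of characteristic zero and $A$ a complete local noetherian $k$-algebra with residue field $k$ and maximal ideal $\mathfrak m_A$. Let $\overline M_r$ ($r\ge1$) be the matrix factorization of $xy$ over $k[[x,y]]$ given by $$\overline\varphi=\begin{pmatrix}x1_r&0\\0&y1_r\end{pmatrix},\qquad \overline\psi=\begin{pmatrix}y1_r&0\\0&x1_r\end{pmatrix}.$$ (i) Every deformation of $\overline M_r$ to $A$ is isomorphic to a deformation of the form $\theta(P,Q)$, where $(P,Q)$ is a matrix factorization over $A$ of some $\pi\in\mathfrak m_A$. Moreover, if $\overline M_r$ is equipped with a quadratic or symplectic form $b$ (resp. a twisted quadratic or twisted symplectic form $q$), then every deformation of $(\overline M_r,b)$ (resp. $(\overline M_r,q)$) to $A$ is isomorphic to $\theta(P,Q)$ for some matrix factorization $(P,Q)$ equipped with a bilinear structure of the corresponding kind. Here $\theta(P,Q)$ carries the structure induced by that of $(P,Q)$: for $b$ quadratic (resp. symplectic), $(P,Q)$ is twisted quadratic (resp. twisted symplectic); for $q$ twisted quadratic (resp. twisted symplectic), $(P,Q)$ is symplectic (resp. quadratic). (ii) For every $\pi\in\mathfrak m_A$, the functor $\theta:\mathrm{MF}_A(\pi)\to\mathrm{MF}_{A[[x,y]]}(xy-\pi)$ between homotopy categories of matrix factorizations is an equivalence.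
   Context: Matrix factorizations. Let $S$ be a complete local noetherian $k$-algebra with residue field $k$, and $w$ in its maximal ideal. A matrix factorization (MF) of $w$ over $S$ is a $\mathbb Z/2$-graded free $S$-module of finite rank $M=M_0\oplus M_1$ with an odd $S$-linear map $Q=\begin{pmatrix}0&\psi\\ \varphi&0\end{pmatrix}$, $\varphi:M_0\to M_1$, $\psi:M_1\to M_0$, with $Q^2=w\cdot1$. We write $M=(\varphi,\psi)$. For MFs $M,M'$ of $w$, $\hom(M,M')$ is the graded module of all $S$-linear maps, with differential $D(f)=Q'f-(-1)^{|f|}fQ$, and $\mathrm{Ext}^\bullet(M,M')=\ker D/\operatorname{im}D$. $\mathrm{MF}_S(w)$ denotes the homotopy category, with the MFs of $w$ over $S$ as objects and $\mathrm{Ext}^0(M,M')$ as morphisms; it is triangulated. In part (ii), $\mathrm{MF}_A(\pi)$ uses $S=A$ and $\mathrm{MF}_{A[[x,y]]}(xy-\pi)$ uses $S=A[[x,y]]$. Duals and forms. $M^T$ is $M_0^*\xrightarrow{{}^t\psi}M_1^*\xrightarrow{{}^t\varphi}M_0^*$, and $M^*$ is $M_1^*\xrightarrow{-{}^t\varphi}M_0^*\xrightarrow{-{}^t\psi}M_1^*$. A quadratic (resp. symplectic) form on $M$ is an isomorphism of MFs $b:M\to M^*$, regarded as an odd map $M\to M^T$, with ${}^tb=-b$ (resp. ${}^tb=b$) and $b^{-1}\,{}^tQ\,b=-Q$. A twisted quadratic (resp. symplectic) form is an isomorphism of MFs $q:M\to M^T$ with ${}^tq=q$ (resp. ${}^tq=-q$)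 and $q^{-1}\,{}^tQ\,q=Q$. Deformations. A deformation of $\overline M_r$ to $A$ is an equivalence class of MFs over $A[[x,y]]$ of some potential $\omega$ in the maximal ideal of $A[[x,y]]$ lifting $xy$, which reduce to $\overline M_r$ modulo $\mathfrak m_A$. Two are equivalent (isomorphic) if related by a gauge transformation, i.e. an element of the semidirect product of the group of automorphisms of the underlying graded module $A[[x,y]]^{2r}\oplus A[[x,y]]^{2r}$ which reduce to the identity over $k$ (acting by $(S,T)\cdot(\varphi,\psi)=(T\varphi S^{-1},S\psi T^{-1})$) with the group of $A$-automorphisms of $A[[x,y]]$ reducing to the identity on $k[[x,y]]$. For $(\overline M_r,b)$ or $(\overline M_r,q)$ one considers MFs equipped with a form of the same type lifting $b$ or $q$, and the gauge transformations are required to respect these forms. Functor $\theta$. For an MF $(P,Q)$ of $\pi\in\mathfrak m_A$ over $A$, $\theta(P,Q)=(Q,-P)\otimes(x,y)$, where $(x,y)$ is the MF $k[[x,y]]\xrightarrow{x}k[[x,y]]\xrightarrow{y}k[[x,y]]$ of $xy$ and $\otimes$ is the $\mathbb Z/2$-graded tensor product with operator $Q\otimes1+1\otimes Q'$ (Koszul sign rule). Up to isomorphism, $$\varphi=\begin{pmatrix}x&P\\ Q&y\end{pmatrix},\qquad \psi=\begin{pmatrix}y&-P\\ -Q&x\end{pmatrix},$$ an MF of $xy-\pi$ over $A[[x,y]]$. In part (i), $P,Q$ are $r\times r$ matrices with entries in $\mathfrak m_A$. A form or twisted form on $(P,Q)$ induces a structure on $\theta(P,Q)$: transfer it to $(Q,-P)$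 (interchange its two components, changing the sign of one component in the twisted case), then tensor, with the Koszul sign rule, with the essentially unique quadratic form on $(x,y)$, $\beta_0=1,\ \beta_1=-1$. A twisted quadratic (resp. twisted symplectic) form gives a quadratic (resp. symplectic) form on $\theta(P,Q)$, and a quadratic (resp. symplectic) form gives a twisted symplectic (resp. twisted quadratic) form.
   Formalization: In (i) with a form b (or q) having non-constant entries, the gauge transformation to θ(P,Q) is only required to reduce to some automorphism of M̄_r chosen for b, not to the identity, since induced forms on θ(P,Q) have constant entries; for constant b the claim is literal. *)

theory Defs
  imports "Jordan_Normal_Form.Matrix" "HOL-Computational_Algebra.Computational_Algebra"
begin

section \<open>Complete local noetherian algebras\<close>

text \<open>The ring \<open>A\<close> is a whole type \<open>'a :: comm_ring_1\<close>; an ideal is a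
  \<^const>\<open>module.subspace\<close> of \<open>A\<close> regarded as a module over itself, and the ideal generated by
  a set is its \<^const>\<open>module.span\<close>.\<close>

abbreviation is_ideal :: "'a::comm_ring_1 set \<Rightarrow> bool" where
  "is_ideal I \<equiv> Modules.module.subspace (*) I"

abbreviation ideal_gen :: "'a::comm_ring_1 set \<Rightarrow> 'a set" where
  "ideal_gen B \<equiv> Modules.module.span (*) B"

text \<open>The set of non-units, which is the maximal ideal if the ring is local.\<close>

definition max_ideal :: "'a::comm_ring_1 set" where
  "max_ideal = {a. \<not> a dvd 1}"

definition ideal_pow :: "'a::comm_ring_1 set \<Rightarrow> nat \<Rightarrow> 'a set" where
  "ideal_pow I n = ideal_gen {prod_list as | as. length as = n \<and> set as \<subseteq> I}"

definition local_ring :: "'a::comm_ring_1 itself \<Rightarrow> bool" where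
  "local_ring _ \<longleftrightarrow> is_ideal (max_ideal :: 'a set)"

definition noetherian :: "'a::comm_ring_1 itself \<Rightarrow> bool" where
  "noetherian _ \<longleftrightarrow> (\<forall>I :: 'a set. is_ideal I \<longrightarrow> (\<exists>B. finite B \<and> I = ideal_gen B))"

text \<open>Bijectivity of \<open>A \<rightarrow> lim A / \<mm>\<^sup>n\<close>; a sequence \<open>s\<close> as below is a representative of an
  element of the inverse limit.\<close>

definition adically_complete :: "'a::comm_ring_1 itself \<Rightarrow> bool" where
  "adically_complete _ \<longleftrightarrow>
     (\<forall>s :: nat \<Rightarrow> 'a. (\<forall>n. s (Suc n) - s n \<in> ideal_pow max_ideal n) \<longrightarrow>
        (\<exists>!l. \<forall>n. l - s n \<in> ideal_pow max_ideal n))"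

text \<open>\<open>\<iota>\<close> is the structure map \<open>k \<rightarrow> A\<close>. The last condition says that \<open>k \<rightarrow> A \<rightarrow> A / \<mm>\<close> is
  bijective, i.e. that the residue field is \<open>k\<close>.\<close>

definition complete_local_noetherian_algebra :: "('k::field \<Rightarrow> 'a::comm_ring_1) \<Rightarrow> bool" where
  "complete_local_noetherian_algebra \<iota> \<longleftrightarrow>
     comm_ring_hom \<iota> \<and>
     local_ring TYPE('a) \<and> noetherian TYPE('a) \<and> adically_complete TYPE('a) \<and>
     (\<forall>a. \<exists>!c. a - \<iota> c \<in> max_ideal)"

definition residue :: "('k::field \<Rightarrow> 'a::comm_ring_1) \<Rightarrow> 'a \<Rightarrow> 'k" where
  "residue \<iota> a = (THE c. a - \<iota> c \<in> max_ideal)"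


section \<open>Power series in two variables\<close>

text \<open>\<open>A[[x,y]]\<close> is \<open>A[[x]][[y]]\<close>, i.e. \<open>'a fps fps\<close>: the coefficient of
  \<open>x\<^sup>i y\<^sup>j\<close> in \<open>f\<close> is \<open>fps_nth (fps_nth f j) i\<close>.\<close>

definition var_x :: "'a::comm_ring_1 fps fps" where "var_x = fps_const fps_X"

definition var_y :: "'a::comm_ring_1 fps fps" where "var_y = fps_X"

definition cst :: "'a::comm_ring_1 \<Rightarrow> 'a fps fps" where "cst a = fps_const (fps_const a)"

definition red :: "('k::field \<Rightarrow> 'a::comm_ring_1) \<Rightarrow> 'a fps fps \<Rightarrow> 'k fps fps" where
  "red \<iota> f = Abs_fps (\<lambda>j. Abs_fps (\<lambda>i. residue \<iota> (fps_nth (fps_nth f j) i)))"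


section \<open>Matrix factorizations\<close>

text \<open>Free modules of finite rank are coordinatized. A matrix factorization
  \<open>M\<^sub>0 \<rightarrow> M\<^sub>1 \<rightarrow> M\<^sub>0\<close> with \<open>M\<^sub>i = S\<^bsup>m\<^sub>i\<^esup>\<close> is the pair \<open>(\<phi>, \<psi>)\<close> of an \<open>m\<^sub>1 \<times> m\<^sub>0\<close> and an
  \<open>m\<^sub>0 \<times> m\<^sub>1\<close> matrix; \<open>m\<^sub>0 \<noteq> m\<^sub>1\<close> is allowed, and does occur when \<open>w\<close> is a zero divisor.
  A homogeneous linear map is also a pair of matrices, the first being its restriction to the
  even part of the source and the second its restriction to the odd part.\<close>

type_synonym 'a mat2 = "'a mat \<times> 'a mat"

definition rk0 :: "'a mat2 \<Rightarrow> nat" where "rk0 M = dim_col (fst M)"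

definition rk1 :: "'a mat2 \<Rightarrow> nat" where "rk1 M = dim_row (fst M)"

definition is_mf :: "'a::comm_ring_1 \<Rightarrow> 'a mat2 \<Rightarrow> bool" where
  "is_mf w M \<longleftrightarrow>
     snd M \<in> carrier_mat (rk0 M) (rk1 M) \<and>
     snd M * fst M = w \<cdot>\<^sub>m 1\<^sub>m (rk0 M) \<and>
     fst M * snd M = w \<cdot>\<^sub>m 1\<^sub>m (rk1 M)"

definition map2 :: "('a \<Rightarrow> 'b) \<Rightarrow> 'a mat2 \<Rightarrow> 'b mat2" where
  "map2 h M = (map_mat h (fst M), map_mat h (snd M))"

definition even_maps :: "'a mat2 \<Rightarrow> 'a mat2 \<Rightarrow> 'a mat2 set" where
  "even_maps M N = carrier_mat (rk0 N) (rk0 M) \<times> carrier_mat (rk1 N) (rk1 M)"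

definition odd_maps :: "'a mat2 \<Rightarrow> 'a mat2 \<Rightarrow> 'a mat2 set" where
  "odd_maps M N = carrier_mat (rk1 N) (rk0 M) \<times> carrier_mat (rk0 N) (rk1 M)"

text \<open>The differential \<open>D f = Q' f - (-1)\<^bsup>|f|\<^esup> f Q\<close> on even and on odd maps.\<close>

definition D_even :: "'a::comm_ring_1 mat2 \<Rightarrow> 'a mat2 \<Rightarrow> 'a mat2 \<Rightarrow> 'a mat2" where
  "D_even M N f = (fst N * fst f - snd f * fst M, snd N * snd f - fst f * snd M)"

definition D_odd :: "'a::comm_ring_1 mat2 \<Rightarrow> 'a mat2 \<Rightarrow> 'a mat2 \<Rightarrow> 'a mat2" where
  "D_odd M N h = (snd N * fst h + snd h * fst M, fst N * snd h + fst h * snd M)"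

definition mf_hom :: "'a::comm_ring_1 mat2 \<Rightarrow> 'a mat2 \<Rightarrow> 'a mat2 set" where
  "mf_hom M N =
     {f \<in> even_maps M N. D_even M N f = (0\<^sub>m (rk1 N) (rk0 M), 0\<^sub>m (rk0 N) (rk1 M))}"

definition mf_id :: "'a::comm_ring_1 mat2 \<Rightarrow> 'a mat2" where
  "mf_id M = (1\<^sub>m (rk0 M), 1\<^sub>m (rk1 M))"

definition mf_comp :: "'a::comm_ring_1 mat2 \<Rightarrow> 'a mat2 \<Rightarrow> 'a mat2" where
  "mf_comp g f = (fst g * fst f, snd g * snd f)"

definition mf_iso :: "'a::comm_ring_1 mat2 \<Rightarrow> 'a mat2 \<Rightarrow> 'a mat2 \<Rightarrow> bool" where
  "mf_iso M N f \<longleftrightarrow> f \<in> mf_hom M N \<and> invertible_mat (fst f) \<and> invertible_mat (snd f)"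

definition homotopic :: "'a::comm_ring_1 mat2 \<Rightarrow> 'a mat2 \<Rightarrow> ('a mat2 \<times> 'a mat2) set" where
  "homotopic M N = {(f, g). f \<in> mf_hom M N \<and> g \<in> mf_hom M N \<and>
     (\<exists>h \<in> odd_maps M N. (fst g - fst f, snd g - snd f) = D_odd M N h)}"

definition Ext0 :: "'a::comm_ring_1 mat2 \<Rightarrow> 'a mat2 \<Rightarrow> 'a mat2 set set" where
  "Ext0 M N = mf_hom M N // homotopic M N"


section \<open>Categories\<close>

record ('o, 'm) cat =
  Obj :: "'o set"
  Mor :: "'o \<Rightarrow> 'o \<Rightarrow> 'm set"
  Idt :: "'o \<Rightarrow> 'm"
  Cmp :: "'o \<Rightarrow> 'o \<Rightarrow> 'o \<Rightarrow> 'm \<Rightarrow> 'm \<Rightarrow> 'm"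

text \<open>\<open>Cmp C L M N g f\<close> is the composite of \<open>f : L \<rightarrow> M\<close> and \<open>g : M \<rightarrow> N\<close>. Morphism sets of
  different pairs of objects need not be disjoint.\<close>

definition category :: "('o, 'm) cat \<Rightarrow> bool" where
  "category C \<longleftrightarrow>
     (\<forall>M \<in> Obj C. Idt C M \<in> Mor C M M) \<and>
     (\<forall>L \<in> Obj C. \<forall>M \<in> Obj C. \<forall>N \<in> Obj C. \<forall>f \<in> Mor C L M. \<forall>g \<in> Mor C M N.
        Cmp C L M N g f \<in> Mor C L N) \<and>
     (\<forall>M \<in> Obj C. \<forall>N \<in> Obj C. \<forall>f \<in> Mor C M N.
        Cmp C M M N f (Idt C M) = f \<and> Cmp C M N N (Idt C N) f = f) \<and>
     (\<forall>K \<in> Obj C. \<forall>L \<in> Obj C. \<forall>M \<in> Obj C. \<forall>N \<in> Obj C.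
        \<forall>f \<in> Mor C K L. \<forall>g \<in> Mor C L M. \<forall>h \<in> Mor C M N.
        Cmp C K M N h (Cmp C K L M g f) = Cmp C K L N (Cmp C L M N h g) f)"

definition cat_iso :: "('o, 'm) cat \<Rightarrow> 'o \<Rightarrow> 'o \<Rightarrow> 'm \<Rightarrow> bool" where
  "cat_iso C M N f \<longleftrightarrow> f \<in> Mor C M N \<and>
     (\<exists>g \<in> Mor C N M. Cmp C M N M g f = Idt C M \<and> Cmp C N M N f g = Idt C N)"

text \<open>A functor is given by its action \<open>Fo\<close> on objects and \<open>Fm M N : Mor M N \<rightarrow> Mor (F M) (F N)\<close>
  on morphisms.\<close>

definition is_functor ::
  "('o, 'm) cat \<Rightarrow> ('p, 'n) cat \<Rightarrow> ('o \<Rightarrow> 'p) \<Rightarrow> ('o \<Rightarrow> 'o \<Rightarrow> 'm \<Rightarrow> 'n) \<Rightarrow> bool" where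
  "is_functor C D Fo Fm \<longleftrightarrow>
     category C \<and> category D \<and>
     (\<forall>M \<in> Obj C. Fo M \<in> Obj D) \<and>
     (\<forall>M \<in> Obj C. \<forall>N \<in> Obj C. \<forall>f \<in> Mor C M N. Fm M N f \<in> Mor D (Fo M) (Fo N)) \<and>
     (\<forall>M \<in> Obj C. Fm M M (Idt C M) = Idt D (Fo M)) \<and>
     (\<forall>L \<in> Obj C. \<forall>M \<in> Obj C. \<forall>N \<in> Obj C. \<forall>f \<in> Mor C L M. \<forall>g \<in> Mor C M N.
        Fm L N (Cmp C L M N g f) = Cmp D (Fo L) (Fo M) (Fo N) (Fm M N g) (Fm L M f))"

definition natural_iso ::
  "('o, 'm) cat \<Rightarrow> ('p, 'n) cat \<Rightarrow> ('o \<Rightarrow> 'p) \<Rightarrow> ('o \<Rightarrow> 'o \<Rightarrow> 'm \<Rightarrow> 'n) \<Rightarrow>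
     ('o \<Rightarrow> 'p) \<Rightarrow> ('o \<Rightarrow> 'o \<Rightarrow> 'm \<Rightarrow> 'n) \<Rightarrow> ('o \<Rightarrow> 'n) \<Rightarrow> bool" where
  "natural_iso C D Fo Fm Go Gm \<eta> \<longleftrightarrow>
     (\<forall>M \<in> Obj C. cat_iso D (Fo M) (Go M) (\<eta> M)) \<and>
     (\<forall>M \<in> Obj C. \<forall>N \<in> Obj C. \<forall>f \<in> Mor C M N.
        Cmp D (Fo M) (Go M) (Go N) (Gm M N f) (\<eta> M) =
        Cmp D (Fo M) (Fo N) (Go N) (\<eta> N) (Fm M N f))"

definition is_equivalence ::
  "('o, 'm) cat \<Rightarrow> ('p, 'n) cat \<Rightarrow> ('o \<Rightarrow> 'p) \<Rightarrow> ('o \<Rightarrow> 'o \<Rightarrow> 'm \<Rightarrow> 'n) \<Rightarrow> bool" where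
  "is_equivalence C D Fo Fm \<longleftrightarrow>
     is_functor C D Fo Fm \<and>
     (\<exists>Go Gm. is_functor D C Go Gm \<and>
        (\<exists>\<eta>. natural_iso C C (\<lambda>M. M) (\<lambda>M N f. f)
               (\<lambda>M. Go (Fo M)) (\<lambda>M N f. Gm (Fo M) (Fo N) (Fm M N f)) \<eta>) \<and>
        (\<exists>\<epsilon>. natural_iso D D (\<lambda>M. Fo (Go M)) (\<lambda>M N f. Fm (Go M) (Go N) (Gm M N f))
               (\<lambda>M. M) (\<lambda>M N f. f) \<epsilon>))"

text \<open>The homotopy category of matrix factorizations of \<open>w\<close>. The classes of \<open>f\<close> and \<open>g\<close> compose
  to the class of the composite of \<open>f\<close> and \<open>g\<close>.\<close>

definition MF :: "'a::comm_ring_1 \<Rightarrow> ('a mat2, 'a mat2 set) cat" where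
  "MF w = \<lparr>
     Obj = {M. is_mf w M},
     Mor = Ext0,
     Idt = (\<lambda>M. homotopic M M `` {mf_id M}),
     Cmp = (\<lambda>L M N G F. homotopic L N `` {mf_comp g f | g f. g \<in> G \<and> f \<in> F})\<rparr>"


section \<open>Duals and forms\<close>

definition dual_T :: "'a mat2 \<Rightarrow> 'a mat2" where
  "dual_T M = (transpose_mat (snd M), transpose_mat (fst M))"

definition dual_star :: "'a::comm_ring_1 mat2 \<Rightarrow> 'a mat2" where
  "dual_star M = (- transpose_mat (fst M), - transpose_mat (snd M))"

datatype form_kind = Quadratic | Symplectic | TwQuadratic | TwSymplectic

fun twisted :: "form_kind \<Rightarrow> bool" where
  "twisted Quadratic = False"
| "twisted Symplectic = False"
| "twisted TwQuadratic = True"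
| "twisted TwSymplectic = True"

text \<open>A form \<open>b : M \<rightarrow> M\<^sup>*\<close> has components \<open>b\<^sub>0 : M\<^sub>0 \<rightarrow> M\<^sub>1\<^sup>*\<close> and \<open>b\<^sub>1 : M\<^sub>1 \<rightarrow> M\<^sub>0\<^sup>*\<close>, so the
  transpose of \<open>b\<close>, regarded as an odd map \<open>M \<rightarrow> M\<^sup>T\<close>, interchanges the two components; the
  transpose of a twisted form \<open>q : M \<rightarrow> M\<^sup>T\<close> does not.
  That \<open>b\<close> is closed is the equation \<open>\<^sup>tQ b = - b Q\<close> and that \<open>q\<close> is closed is \<open>\<^sup>tQ q = q Q\<close>, where
  \<open>Q\<close> is the operator of \<open>M\<close>.\<close>

fun is_form :: "form_kind \<Rightarrow> 'a::comm_ring_1 mat2 \<Rightarrow> 'a mat2 \<Rightarrow> bool" where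
  "is_form Quadratic M b \<longleftrightarrow> mf_iso M (dual_star M) b \<and>
     (transpose_mat (snd b), transpose_mat (fst b)) = (- fst b, - snd b)"
| "is_form Symplectic M b \<longleftrightarrow> mf_iso M (dual_star M) b \<and>
     (transpose_mat (snd b), transpose_mat (fst b)) = (fst b, snd b)"
| "is_form TwQuadratic M q \<longleftrightarrow> mf_iso M (dual_T M) q \<and>
     (transpose_mat (fst q), transpose_mat (snd q)) = (fst q, snd q)"
| "is_form TwSymplectic M q \<longleftrightarrow> mf_iso M (dual_T M) q \<and>
     (transpose_mat (fst q), transpose_mat (snd q)) = (- fst q, - snd q)"

text \<open>\<open>preserves_form kind f b b'\<close>: the pullback of the form \<open>b'\<close> along \<open>f : M \<rightarrow> M'\<close> is \<open>b\<close>.\<close>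

definition preserves_form ::
  "form_kind \<Rightarrow> 'a::comm_ring_1 mat2 \<Rightarrow> 'a mat2 \<Rightarrow> 'a mat2 \<Rightarrow> bool" where
  "preserves_form kind f b b' \<longleftrightarrow>
     (if twisted kind
      then b = (transpose_mat (fst f) * fst b' * fst f, transpose_mat (snd f) * snd b' * snd f)
      else b = (transpose_mat (snd f) * fst b' * fst f, transpose_mat (fst f) * snd b' * snd f))"


section \<open>Tensor products\<close>

definition kron :: "'a::comm_ring_1 mat \<Rightarrow> 'a mat \<Rightarrow> 'a mat" where
  "kron A B = mat (dim_row A * dim_row B) (dim_col A * dim_col B)
     (\<lambda>(i, j). A $$ (i div dim_row B, j div dim_col B) * B $$ (i mod dim_row B, j mod dim_col B))"

definition diag_block :: "'a::comm_ring_1 mat \<Rightarrow> 'a mat \<Rightarrow> 'a mat" where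
  "diag_block A D =
     four_block_mat A (0\<^sub>m (dim_row A) (dim_col D)) (0\<^sub>m (dim_row D) (dim_col A)) D"

definition antidiag_block :: "'a::comm_ring_1 mat \<Rightarrow> 'a mat \<Rightarrow> 'a mat" where
  "antidiag_block B C =
     four_block_mat (0\<^sub>m (dim_row B) (dim_col C)) B C (0\<^sub>m (dim_row C) (dim_col B))"

text \<open>The tensor product of \<open>M = (\<phi>, \<psi>)\<close> and \<open>N = (\<phi>', \<psi>')\<close>, with operator
  \<open>(Q \<otimes> 1 + 1 \<otimes> Q')(m \<otimes> n) = Q m \<otimes> n + (-1)\<^bsup>|m|\<^esup> m \<otimes> Q' n\<close>. The even part is decomposed as
  \<open>M\<^sub>0 \<otimes> N\<^sub>0 \<oplus> M\<^sub>1 \<otimes> N\<^sub>1\<close> and the odd part as \<open>M\<^sub>0 \<otimes> N\<^sub>1 \<oplus> M\<^sub>1 \<otimes> N\<^sub>0\<close>.\<close>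

definition mf_tensor :: "'a::comm_ring_1 mat2 \<Rightarrow> 'a mat2 \<Rightarrow> 'a mat2" where
  "mf_tensor M N =
    (four_block_mat
       (kron (1\<^sub>m (rk0 M)) (fst N)) (kron (snd M) (1\<^sub>m (rk1 N)))
       (kron (fst M) (1\<^sub>m (rk0 N))) (- kron (1\<^sub>m (rk1 M)) (snd N)),
     four_block_mat
       (kron (1\<^sub>m (rk0 M)) (snd N)) (kron (snd M) (1\<^sub>m (rk0 N)))
       (kron (fst M) (1\<^sub>m (rk1 N))) (- kron (1\<^sub>m (rk1 M)) (fst N)))"

text \<open>\<open>f \<otimes> g\<close> for even maps.\<close>

definition map_tensor :: "'a::comm_ring_1 mat2 \<Rightarrow> 'a mat2 \<Rightarrow> 'a mat2" where
  "map_tensor f g =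
    (diag_block (kron (fst f) (fst g)) (kron (snd f) (snd g)),
     diag_block (kron (fst f) (snd g)) (kron (snd f) (fst g)))"

text \<open>\<open>(c \<otimes> \<beta>)(m \<otimes> n) = (-1)\<^bsup>|m|\<^esup> c m \<otimes> \<beta> n\<close> for a form \<open>c\<close> on \<open>M\<close> and an untwisted (hence odd)
  form \<open>\<beta>\<close> on \<open>N\<close>. This is an odd map \<open>M \<otimes> N \<rightarrow> (M \<otimes> N)\<^sup>T\<close> if \<open>c\<close> is twisted, and an even one
  otherwise.\<close>

definition form_tensor :: "bool \<Rightarrow> 'a::comm_ring_1 mat2 \<Rightarrow> 'a mat2 \<Rightarrow> 'a mat2" where
  "form_tensor tw c \<beta> =
    (if tw then
      (diag_block (kron (fst c) (fst \<beta>)) (- kron (snd c) (snd \<beta>)),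
       diag_block (kron (fst c) (snd \<beta>)) (- kron (snd c) (fst \<beta>)))
     else
      (antidiag_block (- kron (snd c) (snd \<beta>)) (kron (fst c) (fst \<beta>)),
       antidiag_block (- kron (snd c) (fst \<beta>)) (kron (fst c) (snd \<beta>))))"


section \<open>The functor \<open>\<theta>\<close>\<close>

text \<open>The factorization \<open>(x, y)\<close> of \<open>x y\<close>, and the quadratic form on it.\<close>

definition mf_xy :: "'a::comm_ring_1 fps fps mat2" where
  "mf_xy = (var_x \<cdot>\<^sub>m 1\<^sub>m 1, var_y \<cdot>\<^sub>m 1\<^sub>m 1)"

definition beta :: "'a::comm_ring_1 fps fps mat2" where
  "beta = (1\<^sub>m 1, - 1\<^sub>m 1)"

definition shift :: "'a::comm_ring_1 mat2 \<Rightarrow> 'a mat2" where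
  "shift M = (snd M, - fst M)"

definition shift_form :: "bool \<Rightarrow> 'a::comm_ring_1 mat2 \<Rightarrow> 'a mat2" where
  "shift_form tw c = (snd c, if tw then - fst c else fst c)"

text \<open>In the basis used by \<^const>\<open>mf_tensor\<close> the tensor product \<open>(Q, -P) \<otimes> (x, y)\<close> has the matrix
  \<open>(x, -P; Q, -y)\<close>. Changing the sign of the basis of the second even summand gives the
  matrices of \<open>\<theta>(P, Q)\<close> in the form \<open>(x, P; Q, y)\<close>, \<open>(y, -P; -Q, x)\<close>, which reduces to
  \<open>M\<^sub>r\<close> (and not only to a factorization isomorphic to it) if \<open>P\<close>, \<open>Q\<close> vanish
  modulo \<open>\<mm>\<close>; see the lemma \<open>theta_explicit\<close>. Maps and forms are transported accordingly.\<close>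

definition sgn_block :: "nat \<Rightarrow> nat \<Rightarrow> 'a::comm_ring_1 mat" where
  "sgn_block m n = diag_block (1\<^sub>m m) (- 1\<^sub>m n)"

definition theta :: "'a::comm_ring_1 mat2 \<Rightarrow> 'a fps fps mat2" where
  "theta M =
    (let \<sigma> = sgn_block (rk1 M) (rk0 M); T = mf_tensor (map2 cst (shift M)) mf_xy
     in (fst T * \<sigma>, \<sigma> * snd T))"

definition theta_map :: "'a::comm_ring_1 mat2 \<Rightarrow> 'a fps fps mat2" where
  "theta_map f =
    (let \<sigma> = sgn_block (dim_col (snd f)) (dim_col (fst f));
         \<sigma>' = sgn_block (dim_row (snd f)) (dim_row (fst f));
         t = map_tensor (map2 cst (snd f, fst f)) (mf_id mf_xy)
     in (\<sigma>' * fst t * \<sigma>, snd t))"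

text \<open>The action of \<open>\<theta>\<close> on homotopy classes.\<close>

definition theta_class ::
  "'a::comm_ring_1 mat2 \<Rightarrow> 'a mat2 \<Rightarrow> 'a mat2 set \<Rightarrow> 'a fps fps mat2 set" where
  "theta_class M N F = homotopic (theta M) (theta N) `` (theta_map ` F)"

text \<open>The form on \<open>\<theta>(P, Q)\<close> induced by a form \<open>c\<close> of the given kind on \<open>(P, Q)\<close>.\<close>

definition theta_form :: "form_kind \<Rightarrow> 'a::comm_ring_1 mat2 \<Rightarrow> 'a fps fps mat2" where
  "theta_form kind c =
    (let \<sigma> = sgn_block (dim_col (snd c)) (dim_col (fst c));
         t = form_tensor (twisted kind) (map2 cst (shift_form (twisted kind) c)) beta
     in if twisted kind then (fst t * \<sigma>, \<sigma> * snd t) else (\<sigma> * fst t * \<sigma>, snd t))"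

text \<open>The kind of form on \<open>(P, Q)\<close> that induces a form of the given kind on \<open>\<theta>(P, Q)\<close>.\<close>

fun source_kind :: "form_kind \<Rightarrow> form_kind" where
  "source_kind Quadratic = TwQuadratic"
| "source_kind Symplectic = TwSymplectic"
| "source_kind TwQuadratic = Symplectic"
| "source_kind TwSymplectic = Quadratic"


section \<open>Deformations\<close>

definition Mbar :: "nat \<Rightarrow> 'k::field fps fps mat2" where
  "Mbar r = (diag_block (var_x \<cdot>\<^sub>m 1\<^sub>m r) (var_y \<cdot>\<^sub>m 1\<^sub>m r), diag_block (var_y \<cdot>\<^sub>m 1\<^sub>m r) (var_x \<cdot>\<^sub>m 1\<^sub>m r))"

text \<open>Deformations are handled through representatives, and their equivalence through
  \<open>gauge_equivalent\<close>.\<close>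

definition is_deformation :: "('k::field \<Rightarrow> 'a::comm_ring_1) \<Rightarrow> nat \<Rightarrow> 'a fps fps mat2 \<Rightarrow> bool" where
  "is_deformation \<iota> r M \<longleftrightarrow>
     (\<exists>\<omega> \<in> max_ideal. red \<iota> \<omega> = var_x * var_y \<and> is_mf \<omega> M) \<and> map2 (red \<iota>) M = Mbar r"

definition is_form_deformation ::
  "('k::field \<Rightarrow> 'a::comm_ring_1) \<Rightarrow> nat \<Rightarrow> form_kind \<Rightarrow> 'k fps fps mat2 \<Rightarrow>
     'a fps fps mat2 \<Rightarrow> 'a fps fps mat2 \<Rightarrow> bool" where
  "is_form_deformation \<iota> r kind b M B \<longleftrightarrow>
     is_deformation \<iota> r M \<and> is_form kind M B \<and> map2 (red \<iota>) B = b"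

text \<open>\<open>A\<close>-algebra automorphisms of \<open>A[[x,y]]\<close> reducing to the identity of \<open>k[[x,y]]\<close>.\<close>

definition gauge_aut ::
  "('k::field \<Rightarrow> 'a::comm_ring_1) \<Rightarrow> ('a fps fps \<Rightarrow> 'a fps fps) \<Rightarrow> bool" where
  "gauge_aut \<iota> \<alpha> \<longleftrightarrow> comm_ring_hom \<alpha> \<and> bij \<alpha> \<and> (\<forall>a. \<alpha> (cst a) = cst a) \<and>
     (\<forall>f. red \<iota> (\<alpha> f) = red \<iota> f)"

text \<open>The gauge transformation given by \<open>\<alpha>\<close> and \<open>f = (S, T)\<close> takes \<open>M\<close> to \<open>M'\<close>: multiplied out,
  the equations \<open>M' = (T \<alpha>(\<phi>) S\<^sup>-\<^sup>1, S \<alpha>(\<psi>) T\<^sup>-\<^sup>1)\<close> say that \<open>f\<close> is an isomorphism of matrix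
  factorizations from \<open>\<alpha>(M)\<close> to \<open>M'\<close>.\<close>

definition gauge_takes ::
  "('k::field \<Rightarrow> 'a::comm_ring_1) \<Rightarrow> ('a fps fps \<Rightarrow> 'a fps fps) \<Rightarrow> 'a fps fps mat2 \<Rightarrow>
     'a fps fps mat2 \<Rightarrow> 'a fps fps mat2 \<Rightarrow> bool" where
  "gauge_takes \<iota> \<alpha> f M M' \<longleftrightarrow> gauge_aut \<iota> \<alpha> \<and> mf_iso (map2 \<alpha> M) M' f"

definition gauge_equivalent ::
  "('k::field \<Rightarrow> 'a::comm_ring_1) \<Rightarrow> nat \<Rightarrow> 'a fps fps mat2 \<Rightarrow> 'a fps fps mat2 \<Rightarrow> bool" where
  "gauge_equivalent \<iota> r M M' \<longleftrightarrow>
     (\<exists>\<alpha> f. gauge_takes \<iota> \<alpha> f M M' \<and> map2 (red \<iota>) f = mf_id (Mbar r))"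

text \<open>Equivalence of deformations \<open>(M, B)\<close> of \<open>(M\<^sub>r, b)\<close> with forms, relative to an automorphism
  \<open>g\<close> of \<open>M\<^sub>r\<close>: the gauge transformation is required to reduce to \<open>g\<close>. For \<open>g = id\<close> this is
  equivalence by gauge transformations reducing to the identity. Other \<open>g\<close> are needed because
  the forms on the \<open>\<theta>(P, Q)\<close> have constant entries, and so lift \<open>b\<close> only if \<open>b\<close> has constant
  entries; any \<open>b\<close> has to be brought into this shape first.\<close>

definition form_gauge_equivalent ::
  "('k::field \<Rightarrow> 'a::comm_ring_1) \<Rightarrow> form_kind \<Rightarrow> 'k fps fps mat2 \<Rightarrow>
     'a fps fps mat2 \<Rightarrow> 'a fps fps mat2 \<Rightarrow> 'a fps fps mat2 \<Rightarrow> 'a fps fps mat2 \<Rightarrow> bool" where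
  "form_gauge_equivalent \<iota> kind g M B M' B' \<longleftrightarrow>
     (\<exists>\<alpha> f. gauge_takes \<iota> \<alpha> f M M' \<and> map2 (red \<iota>) f = g \<and> preserves_form kind f (map2 \<alpha> B) B')"

definition constant_entries :: "'a::comm_ring_1 fps fps mat2 \<Rightarrow> bool" where
  "constant_entries b \<longleftrightarrow> (\<exists>b\<^sub>0. b = map2 cst b\<^sub>0)"


section \<open>The explicit shape of \<open>\<theta>\<close>\<close>

lemma cst_simps [simp]:
  "cst 0 = 0" "cst 1 = 1" "cst (- a) = - cst a"
  by (simp_all add: cst_def)

lemma kron_one_right: "kron A (1\<^sub>m (Suc 0)) = A"
  by (rule eq_matI) (auto simp: kron_def)

lemma kron_minus_one_right: "kron A (- 1\<^sub>m (Suc 0)) = - A"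
  by (rule eq_matI) (auto simp: kron_def)

lemma kron_scalar_right: "kron (1\<^sub>m n) (c \<cdot>\<^sub>m 1\<^sub>m (Suc 0)) = c \<cdot>\<^sub>m 1\<^sub>m n"
  by (rule eq_matI) (auto simp: kron_def)

lemma four_block_times_sgn_block:
  assumes "A \<in> carrier_mat n1 m1" "B \<in> carrier_mat n1 m2"
    "C \<in> carrier_mat n2 m1" "D \<in> carrier_mat n2 m2"
  shows "four_block_mat A B C D * sgn_block m1 m2 = four_block_mat A (- B) C (- D)"
proof -
  have "- B = B * (- 1\<^sub>m m2)" "- D = D * (- 1\<^sub>m m2)"
    using assms by simp_all
  then show ?thesis
    unfolding sgn_block_def diag_block_def
    using assms by (subst mult_four_block_mat[where ?nr1.0=n1 and ?n1.0=m1 and ?n2.0=m2 and ?nr2.0=n2]) auto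
qed

lemma sgn_block_times_four_block:
  assumes "A \<in> carrier_mat n1 m1" "B \<in> carrier_mat n1 m2"
    "C \<in> carrier_mat n2 m1" "D \<in> carrier_mat n2 m2"
  shows "sgn_block n1 n2 * four_block_mat A B C D = four_block_mat A B (- C) (- D)"
proof -
  have "- C = (- 1\<^sub>m n2) * C" "- D = (- 1\<^sub>m n2) * D"
    using assms by simp_all
  then show ?thesis
    unfolding sgn_block_def diag_block_def
    using assms by (subst mult_four_block_mat[where ?nr1.0=n1 and ?n1.0=n1 and ?n2.0=n2 and ?nr2.0=n2]) auto
qed

lemma map_cst_uminus: "map_mat cst (- A) = - map_mat cst A"
  by (rule eq_matI) auto

lemma uminus_zero_mat: "- 0\<^sub>m m n = (0\<^sub>m m n :: 'a::comm_ring_1 mat)"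
  by (rule eq_matI) auto

lemma theta_explicit:
  assumes "P \<in> carrier_mat n1 n0" "Q \<in> carrier_mat n0 n1"
  shows "theta (P, Q) =
    (four_block_mat (var_x \<cdot>\<^sub>m 1\<^sub>m n1) (map_mat cst P) (map_mat cst Q) (var_y \<cdot>\<^sub>m 1\<^sub>m n0),
     four_block_mat (var_y \<cdot>\<^sub>m 1\<^sub>m n1) (- map_mat cst P) (- map_mat cst Q) (var_x \<cdot>\<^sub>m 1\<^sub>m n0))"
  using assms
  by (simp add: theta_def Let_def mf_tensor_def map2_def shift_def mf_xy_def rk0_def rk1_def
      kron_one_right kron_scalar_right map_cst_uminus
      four_block_times_sgn_block[where ?n1.0=n1 and ?n2.0=n0]
      sgn_block_times_four_block[where ?m1.0=n1 and ?m2.0=n0])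

lemma theta_map_explicit:
  assumes "f0 \<in> carrier_mat m0 n0" "f1 \<in> carrier_mat m1 n1"
  shows "theta_map (f0, f1) =
    (diag_block (map_mat cst f1) (map_mat cst f0), diag_block (map_mat cst f1) (map_mat cst f0))"
  using assms
  by (simp add: theta_map_def Let_def map_tensor_def map2_def mf_id_def mf_xy_def rk0_def rk1_def
      kron_one_right diag_block_def uminus_zero_mat
      sgn_block_times_four_block[where ?n1.0=m1 and ?n2.0=m0 and ?m1.0=n1 and ?m2.0=n0]
      four_block_times_sgn_block[where ?n1.0=m1 and ?n2.0=m0 and ?m1.0=n1 and ?m2.0=n0])

lemma theta_form_twisted_explicit:
  assumes "q0 \<in> carrier_mat n0 n0" "q1 \<in> carrier_mat n1 n1" "twisted kind"
  shows "theta_form kind (q0, q1) =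
    (diag_block (map_mat cst q1) (map_mat cst q0),
     diag_block (- map_mat cst q1) (- map_mat cst q0))"
  using assms
  by (simp add: theta_form_def Let_def form_tensor_def map2_def shift_form_def beta_def
      kron_one_right kron_minus_one_right diag_block_def map_cst_uminus uminus_zero_mat
      sgn_block_times_four_block[where ?n1.0=n1 and ?n2.0=n0 and ?m1.0=n1 and ?m2.0=n0]
      four_block_times_sgn_block[where ?n1.0=n1 and ?n2.0=n0 and ?m1.0=n1 and ?m2.0=n0])

lemma theta_form_untwisted_explicit:
  assumes "b0 \<in> carrier_mat n1 n0" "b1 \<in> carrier_mat n0 n1" "\<not> twisted kind"
  shows "theta_form kind (b0, b1) =
    (antidiag_block (- map_mat cst b0) (- map_mat cst b1),
     antidiag_block (- map_mat cst b0) (- map_mat cst b1))"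
  using assms
  by (simp add: theta_form_def Let_def form_tensor_def map2_def shift_form_def beta_def
      kron_one_right kron_minus_one_right antidiag_block_def uminus_zero_mat
      sgn_block_times_four_block[where ?n1.0=n1 and ?n2.0=n0 and ?m1.0=n1 and ?m2.0=n0]
      four_block_times_sgn_block[where ?n1.0=n1 and ?n2.0=n0 and ?m1.0=n1 and ?m2.0=n0])

end

theory Submission
  imports Defs "Jordan_Normal_Form.Determinant"
begin

section \<open>Powers of the maximal ideal\<close>

lemma module_ring: "Modules.module ((*) :: 'a::comm_ring_1 \<Rightarrow> 'a \<Rightarrow> 'a)"
  by unfold_locales (auto simp: algebra_simps)

text \<open>Not an interpretation, which would make \<open>a * (b * c) = a * b * c\<close> a rewrite rule.\<close>

lemmas ring_span_base = module.span_base[OF module_ring]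
lemmas ring_span_eq_iff = module.span_eq_iff[OF module_ring]
lemmas ring_span_minimal = module.span_minimal[OF module_ring]
lemmas ring_span_scale = module.span_scale[OF module_ring]
lemmas ring_subspaceI = module.subspaceI[OF module_ring]
lemmas ring_subspace_0 = module.subspace_0[OF module_ring]
lemmas ring_subspace_add = module.subspace_add[OF module_ring]
lemmas ring_subspace_diff = module.subspace_diff[OF module_ring]
lemmas ring_subspace_neg = module.subspace_neg[OF module_ring]
lemmas ring_subspace_scale = module.subspace_scale[OF module_ring]
lemmas ring_subspace_span = module.subspace_span[OF module_ring]
lemmas ring_subspace_sum = module.subspace_sum[OF module_ring]

lemma is_ideal_pow: "is_ideal (ideal_pow I n)"
  unfolding ideal_pow_def by (rule ring_subspace_span)

lemma ideal_pow_0: "ideal_pow I 0 = UNIV"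
proof -
  have "1 \<in> ideal_pow I 0" unfolding ideal_pow_def
    by (rule ring_span_base) simp
  then have "a * 1 \<in> ideal_pow I 0" for a
    by (rule ring_subspace_scale[OF is_ideal_pow])
  then show ?thesis by auto
qed

lemma ideal_pow_Suc: "ideal_pow I (Suc n) \<subseteq> ideal_pow I n"
  unfolding ideal_pow_def
proof (rule ring_span_minimal[OF _ ring_subspace_span], clarify)
  fix as :: "'a list" assume as: "length as = Suc n" "set as \<subseteq> I"
  then obtain b bs where b: "as = b # bs" by (cases as) auto
  have "prod_list bs \<in> {prod_list as |as. length as = n \<and> set as \<subseteq> I}"
    using as b by auto
  then have "b * prod_list bs \<in> ideal_gen {prod_list as |as. length as = n \<and> set as \<subseteq> I}"
    by (intro ring_span_scale ring_span_base)
  then show "prod_list as \<in> ideal_gen {prod_list as |as. length as = n \<and> set as \<subseteq> I}"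
    by (simp add: b)
qed

lemma ideal_pow_anti: "m \<le> n \<Longrightarrow> ideal_pow I n \<subseteq> ideal_pow I m"
proof (induction n rule: dec_induct)
  case (step k)
  show ?case by (rule order_trans[OF ideal_pow_Suc step.IH])
qed simp

lemma ideal_pow_1: "is_ideal I \<Longrightarrow> ideal_pow I 1 = I"
proof -
  assume I: "is_ideal I"
  have "{prod_list as |as. length as = 1 \<and> set as \<subseteq> I} = I"
  proof (intro equalityI subsetI)
    fix a assume "a \<in> {prod_list as |as. length as = 1 \<and> set as \<subseteq> I}"
    then show "a \<in> I" by (auto simp: length_Suc_conv)
  next
    fix a assume "a \<in> I"
    then have "a = prod_list [a] \<and> length [a] = 1 \<and> set [a] \<subseteq> I" by simp
    then show "a \<in> {prod_list as |as. length as = 1 \<and> set as \<subseteq> I}" by blast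
  qed
  then show ?thesis unfolding ideal_pow_def using I by (simp add: ring_span_eq_iff)
qed

lemma is_ideal_transporter: "is_ideal {a. a * c \<in> ideal_pow I k}"
proof (rule ring_subspaceI, goal_cases)
  case 1 then show ?case by (simp add: ring_subspace_0[OF is_ideal_pow])
next
  case (2 x y)
  then show ?case by (simp add: distrib_right ring_subspace_add[OF is_ideal_pow])
next
  case (3 d x)
  then show ?case by (simp add: mult.assoc ring_subspace_scale[OF is_ideal_pow])
qed

lemma ideal_pow_mult:
  assumes a: "a \<in> ideal_pow I m" and b: "b \<in> ideal_pow I n"
  shows "a * b \<in> ideal_pow I (m + n)"
proof -
  have 1: "a * prod_list bs \<in> ideal_pow I (m + n)" if "length bs = n" "set bs \<subseteq> I" for bs
  proof -
    have "prod_list xs * prod_list bs \<in> ideal_pow I (m + n)" if "length xs = m" "set xs \<subseteq> I" for xs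
    proof -
      have "length (xs @ bs) = m + n \<and> set (xs @ bs) \<subseteq> I"
        using \<open>length bs = n\<close> \<open>set bs \<subseteq> I\<close> that by simp
      then have "prod_list (xs @ bs) \<in> ideal_pow I (m + n)"
        unfolding ideal_pow_def by (intro ring_span_base CollectI exI[of _ "xs @ bs"] conjI refl) auto
      then show ?thesis by simp
    qed
    then have "{prod_list as |as. length as = m \<and> set as \<subseteq> I} \<subseteq> {a. a * prod_list bs \<in> ideal_pow I (m + n)}"
      by blast
    then have "ideal_pow I m \<subseteq> {a. a * prod_list bs \<in> ideal_pow I (m + n)}"
      unfolding ideal_pow_def[of I m] by (rule ring_span_minimal[OF _ is_ideal_transporter])
    with a show ?thesis by blast
  qed
  have "{prod_list as |as. length as = n \<and> set as \<subseteq> I} \<subseteq> {b. b * a \<in> ideal_pow I (m + n)}"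
    using 1 by (auto simp only: mult.commute[of _ a])
  then have "ideal_pow I n \<subseteq> {b. b * a \<in> ideal_pow I (m + n)}"
    unfolding ideal_pow_def[of I n] by (rule ring_span_minimal[OF _ is_ideal_transporter])
  with b have "b * a \<in> ideal_pow I (m + n)" by blast
  then show ?thesis by (simp only: mult.commute[of b a])
qed

section \<open>The weight filtration of \<open>A[[x,y]]\<close>\<close>

definition cf :: "'a::zero fps fps \<Rightarrow> nat \<Rightarrow> nat \<Rightarrow> 'a" where
  "cf f i j = fps_nth (fps_nth f j) i"

lemma cf_ext: "(\<And>i j. cf f i j = cf g i j) \<Longrightarrow> f = g"
  unfolding cf_def by (intro fps_ext) auto

lemma cf_simps [simp]:
  "cf 0 i j = 0"
  "cf (f + g) i j = cf f i j + cf (g :: 'a::comm_ring_1 fps fps) i j"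
  "cf (- f) i j = - cf (f :: 'a::comm_ring_1 fps fps) i j"
  "cf (f - g) i j = cf f i j - cf (g :: 'a::comm_ring_1 fps fps) i j"
  by (simp_all add: cf_def)

lemma cf_Abs [simp]: "cf (Abs_fps (\<lambda>j. Abs_fps (\<lambda>i. g i j))) i j = g i j"
  by (simp add: cf_def)

lemma cf_sum: "cf (sum g K) i j = (\<Sum>k\<in>K. cf (g k :: 'a::comm_ring_1 fps fps) i j)"
  by (induction K rule: infinite_finite_induct) auto

lemma cf_mult:
  "cf (f * g) i j = (\<Sum>b=0..j. \<Sum>a=0..i. cf f a b * cf (g :: 'a::comm_ring_1 fps fps) (i - a) (j - b))"
  unfolding cf_def by (simp add: fps_mult_nth fps_sum_nth)

lemma cf_cst: "cf (cst a) i j = (if i = 0 \<and> j = 0 then a else 0)"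
  by (simp add: cf_def cst_def fps_const_def)

lemma cf_1: "cf 1 i j = (if i = 0 \<and> j = 0 then 1 else 0 :: 'a::comm_ring_1)"
  using cf_cst[of "1 :: 'a"] by simp

lemma cf_var_x_mult: "cf (var_x * f) i j = (if i = 0 then 0 else cf (f :: 'a::comm_ring_1 fps fps) (i - 1) j)"
  by (simp add: cf_def var_x_def)

lemma cf_var_y_mult: "cf (var_y * f) i j = (if j = 0 then 0 else cf (f :: 'a::comm_ring_1 fps fps) i (j - 1))"
  by (simp add: cf_def var_y_def)

lemma cf_cst_mult: "cf (cst a * f) i j = a * cf (f :: 'a::comm_ring_1 fps fps) i j"
  by (simp add: cf_def cst_def)

lemma cst_add: "cst (a + b) = cst a + cst (b :: 'a::comm_ring_1)"
  and cst_mult: "cst (a * b) = cst a * cst (b :: 'a::comm_ring_1)"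
  and cst_diff: "cst (a - b) = cst a - cst (b :: 'a::comm_ring_1)"
  by (simp_all add: cst_def fps_const_add[symmetric] fps_const_mult[symmetric] fps_const_sub[symmetric]
      del: fps_const_add fps_const_mult fps_const_sub)

lemma cst_sum: "cst (sum h K) = (\<Sum>k\<in>K. cst (h k :: 'a::comm_ring_1))"
  by (induction K rule: infinite_finite_induct) (simp_all add: cst_add)

lemma cst_hom: "comm_ring_hom (cst :: 'a::comm_ring_1 \<Rightarrow> 'a fps fps)"
  by unfold_locales (simp_all add: cst_add cst_mult)

text \<open>The variables have weight \<open>1\<close> and \<open>\<mm>\<close> has weight \<open>2\<close>, so that \<open>x y - \<pi>\<close> is homogeneous for
  \<open>\<pi> \<in> \<mm>\<close>, and the entries \<open>P, Q\<close> of \<open>\<theta>(P, Q)\<close> have greater weight than \<open>x, y\<close>.\<close>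

definition W :: "nat \<Rightarrow> 'a::comm_ring_1 fps fps set" where
  "W n = {f. \<forall>i j. cf f i j \<in> ideal_pow max_ideal ((n + 1 - i - j) div 2)}"

lemma W_ideal:
  "0 \<in> W n" "f \<in> W n \<Longrightarrow> g \<in> W n \<Longrightarrow> f + g \<in> W n" "f \<in> W n \<Longrightarrow> - f \<in> W n"
  "f \<in> W n \<Longrightarrow> g \<in> W n \<Longrightarrow> f - g \<in> W n"
  unfolding W_def
  by (auto intro: ring_subspace_0[OF is_ideal_pow] ring_subspace_add[OF is_ideal_pow]
      ring_subspace_neg[OF is_ideal_pow] ring_subspace_diff[OF is_ideal_pow])

lemma W_0 [simp]: "W 0 = UNIV"
  by (auto simp: W_def ideal_pow_0)

lemma W_anti: "m \<le> n \<Longrightarrow> f \<in> W n \<Longrightarrow> f \<in> W m"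
proof -
  assume mn: "m \<le> n" and f: "f \<in> W n"
  have "cf f i j \<in> ideal_pow max_ideal ((m + 1 - i - j) div 2)" for i j
  proof -
    have "(m + 1 - i - j) div 2 \<le> (n + 1 - i - j) div 2" using mn by (intro div_le_mono) simp
    then show ?thesis using f ideal_pow_anti unfolding W_def by blast
  qed
  then show ?thesis unfolding W_def by blast
qed

lemma W_sum: "(\<And>k. k \<in> K \<Longrightarrow> f k \<in> W n) \<Longrightarrow> sum f K \<in> W n"
  by (induction K rule: infinite_finite_induct) (auto intro: W_ideal)

lemma W_mult: "f \<in> W m \<Longrightarrow> g \<in> W n \<Longrightarrow> f * g \<in> W (m + n)"
  unfolding W_def
proof clarify
  fix i j
  assume f: "\<forall>i j. cf f i j \<in> ideal_pow max_ideal ((m + 1 - i - j) div 2)"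
    and g: "\<forall>i j. cf g i j \<in> ideal_pow max_ideal ((n + 1 - i - j) div 2)"
  have "cf f a b * cf g (i - a) (j - b) \<in> ideal_pow max_ideal ((m + n + 1 - i - j) div 2)"
    if "a \<le> i" "b \<le> j" for a b
  proof -
    have "(m + n + 1 - i - j) div 2 \<le> (m + 1 - a - b) div 2 + (n + 1 - (i - a) - (j - b)) div 2"
    proof -
      define s t where "s = m + 1 - a - b" and "t = n + 1 - (i - a) - (j - b)"
      have s: "m + 1 \<le> s + a + b" unfolding s_def by simp
      have "n + 1 \<le> t + (i - a) + (j - b)" unfolding t_def by simp
      then have "n + 1 + a + b \<le> t + i + j" using that by simp
      then have "m + n + 1 - (i + j) \<le> s + t - 1" using s by simp
      then have "m + n + 1 - i - j \<le> s + t - 1" by (simp only: diff_diff_left)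
      then have "(m + n + 1 - i - j) div 2 \<le> (s + t - 1) div 2" by (rule div_le_mono)
      also have "\<dots> \<le> s div 2 + t div 2" by linarith
      finally show ?thesis unfolding s_def t_def .
    qed
    then show ?thesis
      using ideal_pow_mult[OF f[rule_format, of a b] g[rule_format, of "i - a" "j - b"]]
        ideal_pow_anti by blast
  qed
  then show "cf (f * g) i j \<in> ideal_pow max_ideal ((m + n + 1 - i - j) div 2)"
    unfolding cf_mult by (intro ring_subspace_sum[OF is_ideal_pow]) auto
qed

lemma W_mult_left: "g \<in> W n \<Longrightarrow> f * g \<in> W n"
  using W_mult[of f 0 g n] by simp

lemma W_mult_right: "f \<in> W n \<Longrightarrow> f * g \<in> W n"
  using W_mult[of f n g 0] by simp

lemma var_W: "var_x \<in> (W 1 :: 'a::comm_ring_1 fps fps set)" "var_y \<in> (W 1 :: 'a fps fps set)"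
proof -
  have "cf var_x i j = (if i = 1 \<and> j = 0 then 1 else 0 :: 'a)" for i j
    using cf_var_x_mult[of 1 i j] by (auto simp: cf_1)
  moreover have "cf var_y i j = (if i = 0 \<and> j = 1 then 1 else 0 :: 'a)" for i j
    using cf_var_y_mult[of 1 i j] by (auto simp: cf_1)
  ultimately show "var_x \<in> (W 1 :: 'a fps fps set)" "var_y \<in> (W 1 :: 'a fps fps set)" unfolding W_def
    by (auto simp: ideal_pow_0 ring_subspace_0[OF is_ideal_pow])
qed

lemma cst_W: "a \<in> ideal_pow max_ideal n \<Longrightarrow> cst a \<in> W (2 * n)"
  unfolding W_def by (auto simp: cf_cst ring_subspace_0[OF is_ideal_pow])

text \<open>Every \<open>f\<close> is \<open>f(0,0) + x Dx f + y Dy0 f\<close> and also \<open>f(x,0) + y Ey f\<close>; \<open>at_x0 f = f(0,y)\<close>,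
  \<open>at_y0 f = f(x,0)\<close>, and \<open>Dy0 f\<close> does not involve \<open>x\<close>.\<close>

definition Dx :: "'a::comm_ring_1 fps fps \<Rightarrow> 'a fps fps" where
  "Dx f = Abs_fps (\<lambda>j. Abs_fps (\<lambda>i. cf f (Suc i) j))"

definition Ey :: "'a::comm_ring_1 fps fps \<Rightarrow> 'a fps fps" where
  "Ey f = Abs_fps (\<lambda>j. Abs_fps (\<lambda>i. cf f i (Suc j)))"

definition at_x0 :: "'a::comm_ring_1 fps fps \<Rightarrow> 'a fps fps" where
  "at_x0 f = Abs_fps (\<lambda>j. Abs_fps (\<lambda>i. if i = 0 then cf f i j else 0))"

definition at_y0 :: "'a::comm_ring_1 fps fps \<Rightarrow> 'a fps fps" where
  "at_y0 f = Abs_fps (\<lambda>j. Abs_fps (\<lambda>i. if j = 0 then cf f i j else 0))"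

definition Dy0 :: "'a::comm_ring_1 fps fps \<Rightarrow> 'a fps fps" where
  "Dy0 f = Ey (at_x0 f)"

lemma cf_ops [simp]:
  "cf (Dx f) i j = cf f (Suc i) j" "cf (Ey f) i j = cf f i (Suc j)"
  "cf (at_x0 f) i j = (if i = 0 then cf f i j else 0)"
  "cf (at_y0 f) i j = (if j = 0 then cf f i j else 0)"
  "cf (Dy0 f) i j = (if i = 0 then cf f i (Suc j) else 0)"
  by (simp_all add: Dx_def Ey_def at_x0_def at_y0_def Dy0_def)

lemma split_x0: "f = at_x0 f + var_x * Dx f"
  by (rule cf_ext) (auto simp: cf_var_x_mult)

lemma split_y0: "f = at_y0 f + var_y * Ey f"
  by (rule cf_ext) (auto simp: cf_var_y_mult)

lemma split_00: "f = cst (cf f 0 0) + var_x * Dx f + var_y * Dy0 f"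
  by (rule cf_ext) (auto simp: cf_var_x_mult cf_var_y_mult cf_cst)

lemma ops_add:
  "Dx (f + g) = Dx f + Dx g" "Ey (f + g) = Ey f + Ey g" "at_x0 (f + g) = at_x0 f + at_x0 g"
  "at_y0 (f + g) = at_y0 f + at_y0 g" "Dy0 (f + g) = Dy0 f + Dy0 g"
  by (rule cf_ext; simp)+

lemma ops_diff:
  "Dx (f - g) = Dx f - Dx g" "Ey (f - g) = Ey f - Ey g" "at_x0 (f - g) = at_x0 f - at_x0 g"
  "at_y0 (f - g) = at_y0 f - at_y0 g" "Dy0 (f - g) = Dy0 f - Dy0 g"
  by (rule cf_ext; simp)+

lemma ops_cst_mult:
  "Dx (cst a * f) = cst a * Dx f" "Dx (f * cst a) = Dx f * cst a"
  "Dy0 (cst a * f) = cst a * Dy0 f" "Dy0 (f * cst a) = Dy0 f * cst a"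
  "cf (cst a * f) 0 0 = a * cf f 0 0" "cf (f * cst a) 0 0 = cf f 0 0 * a"
  by (rule cf_ext; simp add: cf_cst_mult mult.commute[of _ "cst a"] mult.commute[of _ a])+
    (simp_all add: cf_cst_mult mult.commute[of _ "cst a"] mult.commute[of _ a])

lemma ops_var_mult:
  "Dx (var_x * f) = f" "Ey (var_y * f) = f" "at_x0 (var_x * f) = 0" "at_y0 (var_y * f) = 0"
  "Dx (var_y * f) = var_y * Dx f" "Dy0 (var_x * f) = 0" "Dy0 (var_y * f) = at_x0 f"
  "cf (var_x * f) 0 0 = 0" "cf (var_y * f) 0 0 = 0"
  by (rule cf_ext; simp add: cf_var_x_mult cf_var_y_mult)+ (simp_all add: cf_var_x_mult cf_var_y_mult)

lemma ops_cst: "Dx (cst a) = 0" "Ey (cst a) = 0" "Dy0 (cst a) = 0" "cf (cst a) 0 0 = a"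
  by (rule cf_ext; simp add: cf_cst)+ (simp add: cf_cst)

lemma ops_W:
  assumes "f \<in> W (Suc n)"
  shows "Dx f \<in> W n" "Ey f \<in> W n" "Dy0 f \<in> W n"
proof -
  have "cf f (Suc i) j \<in> ideal_pow max_ideal ((n + 1 - i - j) div 2)"
    and "cf f i (Suc j) \<in> ideal_pow max_ideal ((n + 1 - i - j) div 2)" for i j
  proof -
    have "Suc n + 1 - Suc i - j = n + 1 - i - j" "Suc n + 1 - i - Suc j = n + 1 - i - j" by auto
    then show "cf f (Suc i) j \<in> ideal_pow max_ideal ((n + 1 - i - j) div 2)"
      "cf f i (Suc j) \<in> ideal_pow max_ideal ((n + 1 - i - j) div 2)"
      using assms unfolding W_def mem_Collect_eq by metis+
  qed
  note * = this
  show "Dx f \<in> W n" "Ey f \<in> W n" using * by (auto simp: W_def)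
  show "Dy0 f \<in> W n" using *(2)[of 0]
    by (auto simp: W_def ring_subspace_0[OF is_ideal_pow])
qed

lemma at_W: 
  assumes "f \<in> W n"
  shows "at_x0 f \<in> W n" "at_y0 f \<in> W n" "cst (cf f 0 0) \<in> W n"
proof -
  have *: "cf f i j \<in> ideal_pow max_ideal ((n + 1 - i - j) div 2)" for i j
    using assms by (simp add: W_def)
  show "at_x0 f \<in> W n" "at_y0 f \<in> W n" "cst (cf f 0 0) \<in> W n"
    using *[of 0] *[of _ 0] *[of 0 0] by (auto simp: W_def ring_subspace_0[OF is_ideal_pow] cf_cst)
qed

section \<open>Complete local algebras\<close>

definition coeffs_in_m :: "'a::comm_ring_1 fps fps set" where
  "coeffs_in_m = {f. \<forall>i j. cf f i j \<in> max_ideal}"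

locale complete_algebra =
  fixes \<iota> :: "'k::field \<Rightarrow> 'a::comm_ring_1"
  assumes algebra: "complete_local_noetherian_algebra \<iota>"

lemma (in complete_algebra) m_ideal: "is_ideal (max_ideal :: 'a set)"
  using algebra unfolding complete_local_noetherian_algebra_def local_ring_def by blast

lemma (in complete_algebra) m_closed:
  "(0::'a) \<in> max_ideal" "a \<in> max_ideal \<Longrightarrow> b \<in> max_ideal \<Longrightarrow> a + b \<in> (max_ideal :: 'a set)"
  "a \<in> max_ideal \<Longrightarrow> - a \<in> (max_ideal :: 'a set)"
  "a \<in> max_ideal \<Longrightarrow> b \<in> max_ideal \<Longrightarrow> a - b \<in> (max_ideal :: 'a set)"
  "b \<in> max_ideal \<Longrightarrow> a * b \<in> (max_ideal :: 'a set)"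
  "a \<in> max_ideal \<Longrightarrow> a * b \<in> (max_ideal :: 'a set)"
proof -
  have *: "b \<in> max_ideal \<Longrightarrow> a * b \<in> (max_ideal :: 'a set)" for a b
    by (rule ring_subspace_scale[OF m_ideal])
  show "b \<in> max_ideal \<Longrightarrow> a * b \<in> (max_ideal :: 'a set)" by (rule *)
  show "a \<in> max_ideal \<Longrightarrow> a * b \<in> (max_ideal :: 'a set)" using *[of a b] by (simp add: mult.commute)
qed (rule ring_subspace_0[OF m_ideal] ring_subspace_add[OF m_ideal]
      ring_subspace_neg[OF m_ideal] ring_subspace_diff[OF m_ideal]; assumption)+

lemma (in complete_algebra) m_pow_1: "ideal_pow max_ideal 1 = (max_ideal :: 'a set)"
  by (rule ideal_pow_1[OF m_ideal])

lemma (in complete_algebra) complete: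
  assumes "\<And>n. s (Suc n) - s n \<in> ideal_pow (max_ideal :: 'a set) n"
  obtains l where "\<And>n. l - s n \<in> ideal_pow max_ideal n"
proof -
  have "adically_complete TYPE('a)"
    using algebra unfolding complete_local_noetherian_algebra_def by blast
  with assms show ?thesis using that unfolding adically_complete_def by blast
qed

lemma (in complete_algebra) separated:
  assumes "\<And>n. a \<in> ideal_pow (max_ideal :: 'a set) n"
  shows "a = 0"
proof -
  have "adically_complete TYPE('a)"
    using algebra unfolding complete_local_noetherian_algebra_def by blast
  then have "\<exists>!l. \<forall>n. l - (\<lambda>_. 0) n \<in> ideal_pow (max_ideal :: 'a set) n"
    unfolding adically_complete_def
    by (elim allE[of _ "\<lambda>_. 0"]) (simp add: ring_subspace_0[OF is_ideal_pow])
  then show ?thesis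
    using assms ring_subspace_0[OF is_ideal_pow, of "max_ideal :: 'a set"] by auto
qed

lemma (in complete_algebra) W_separated:
  assumes "\<And>n. f \<in> W n"
  shows "f = (0 :: 'a fps fps)"
proof (rule cf_ext)
  fix i j
  have "cf f i j \<in> ideal_pow max_ideal n" for n
  proof -
    have "cf f i j \<in> ideal_pow max_ideal ((2 * n + i + j + 1 - i - j) div 2)"
      using assms[of "2 * n + i + j"] unfolding W_def by blast
    then show ?thesis by simp
  qed
  then show "cf f i j = cf 0 i j" using separated by simp
qed

lemma W_chain:
  assumes "\<And>k. s (Suc k) - s k \<in> W k" "k \<le> l"
  shows "s l - s k \<in> W k"
  using assms(2)
proof (induction l rule: dec_induct)
  case base then show ?case by (simp add: W_ideal)
next
  case (step l)
  have "(s (Suc l) - s l) + (s l - s k) \<in> W k"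
    using assms(1)[of l] step by (intro W_ideal(2)) (auto intro: W_anti)
  then show ?case by simp
qed

lemma (in complete_algebra) W_complete:
  assumes "\<And>k. s (Suc k) - s k \<in> W k"
  obtains l :: "'a fps fps" where "\<And>k. l - s k \<in> W k"
proof -
  have "\<exists>l. \<forall>n. l - cf (s (2 * n + i + j)) i j \<in> ideal_pow max_ideal n" for i j
  proof -
    have "cf (s (2 * Suc n + i + j)) i j - cf (s (2 * n + i + j)) i j \<in> ideal_pow max_ideal n" for n
    proof -
      have "s (2 * Suc n + i + j) - s (2 * n + i + j) \<in> W (2 * n + i + j)"
        by (rule W_chain[OF assms]) simp
      then have "cf (s (2 * Suc n + i + j) - s (2 * n + i + j)) i j
          \<in> ideal_pow max_ideal ((2 * n + i + j + 1 - i - j) div 2)"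
        unfolding W_def by blast
      then show ?thesis by simp
    qed
    then show ?thesis using complete[of "\<lambda>n. cf (s (2 * n + i + j)) i j"] by blast
  qed
  then obtain c where c: "\<And>i j n. c i j - cf (s (2 * n + i + j)) i j \<in> ideal_pow max_ideal n"
    by metis
  define l where "l = Abs_fps (\<lambda>j. Abs_fps (\<lambda>i. c i j))"
  have "l - s k \<in> W k" for k
  proof -
    have "c i j - cf (s k) i j \<in> ideal_pow max_ideal ((k + 1 - i - j) div 2)" for i j
    proof (cases "k + 1 - i - j < 2")
      case True
      then have "(k + 1 - i - j) div 2 = 0" by simp
      then show ?thesis by (simp only: ideal_pow_0 UNIV_I)
    next
      case False
      define n where "n = (k + 1 - i - j) div 2"
      have le: "k \<le> 2 * n + i + j" using False unfolding n_def by linarith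
      from W_chain[OF assms le] have "cf (s (2 * n + i + j)) i j - cf (s k) i j \<in> ideal_pow max_ideal n"
        unfolding W_def n_def by auto
      with c[of i j n]
      have "(c i j - cf (s (2 * n + i + j)) i j) + (cf (s (2 * n + i + j)) i j - cf (s k) i j)
          \<in> ideal_pow max_ideal n"
        by (rule ring_subspace_add[OF is_ideal_pow])
      then show ?thesis by (simp add: n_def)
    qed
    then show ?thesis by (simp add: W_def l_def)
  qed
  then show ?thesis using that by blast
qed

definition W_closed :: "'a::comm_ring_1 fps fps set \<Rightarrow> bool" where
  "W_closed C \<longleftrightarrow> (\<forall>s l. (\<forall>k. s k \<in> C) \<longrightarrow> (\<forall>k::nat. l - s k \<in> W k) \<longrightarrow> l \<in> C)"

text \<open>Banach's fixed point theorem in the complete ring \<open>A[[x,y]]\<close>, for a family of unknowns.\<close>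

lemma (in complete_algebra) W_fixed_point:
  fixes \<Phi> :: "('i \<Rightarrow> 'a fps fps) \<Rightarrow> 'i \<Rightarrow> 'a fps fps"
  assumes closed: "W_closed C" "0 \<in> C"
    and maps: "\<And>f i. (\<And>i. f i \<in> C) \<Longrightarrow> \<Phi> f i \<in> C"
    and contr: "\<And>f g n i. (\<And>i. f i \<in> C) \<Longrightarrow> (\<And>i. g i \<in> C) \<Longrightarrow> (\<And>i. f i - g i \<in> W n)
      \<Longrightarrow> \<Phi> f i - \<Phi> g i \<in> W (Suc n)"
  obtains f where "\<And>i. f i \<in> C" "\<Phi> f = f"
proof -
  define s where "s k = (\<Phi> ^^ k) (\<lambda>_. 0)" for k
  have s0: "s 0 = (\<lambda>_. 0)" and sS: "s (Suc k) = \<Phi> (s k)" for k by (simp_all add: s_def)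
  have sC: "s k i \<in> C" for k i
  proof (induction k arbitrary: i)
    case 0 show ?case unfolding s0 by (rule closed(2))
  next
    case (Suc k) show ?case unfolding sS by (rule maps[OF Suc])
  qed
  have step: "s (Suc k) i - s k i \<in> W k" for k i
  proof (induction k arbitrary: i)
    case (Suc k)
    have "\<Phi> (s (Suc k)) i - \<Phi> (s k) i \<in> W (Suc k)" by (rule contr[OF sC sC Suc])
    then show ?case by (simp only: sS)
  qed simp
  have "\<exists>l. \<forall>k. l - s k i \<in> W k" for i
    by (rule W_complete[of "\<lambda>k. s k i", OF step]) (rule exI, rule allI)
  then have "\<forall>i. \<exists>l. \<forall>k. l - s k i \<in> W k" ..
  from choice[OF this] obtain f where f: "f i - s k i \<in> W k" for i k by blast
  have fC: "f i \<in> C" for i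
    using closed(1)[unfolded W_closed_def, rule_format, of "\<lambda>k. s k i" "f i", OF sC f] .
  have "\<Phi> f i - f i \<in> W n" for i n
  proof -
    have "\<Phi> f i - \<Phi> (s n) i \<in> W (Suc n)" by (rule contr[OF fC sC f])
    then have "\<Phi> f i - s (Suc n) i \<in> W n" by (simp add: sS W_anti[of n "Suc n"])
    moreover have "f i - s (Suc n) i \<in> W n" using f[of i "Suc n"] by (simp add: W_anti[of n "Suc n"])
    ultimately have "(\<Phi> f i - s (Suc n) i) - (f i - s (Suc n) i) \<in> W n" by (rule W_ideal)
    then show ?thesis by simp
  qed
  then have "\<Phi> f i - f i = 0" for i by (rule W_separated)
  then have "\<Phi> f = f" by (intro ext) simp
  with fC show ?thesis by (rule that)
qed

lemma W_closed_UNIV: "W_closed UNIV" by (simp add: W_closed_def)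

lemma W_closed_Int: "W_closed C \<Longrightarrow> W_closed D \<Longrightarrow> W_closed (C \<inter> D)"
  unfolding W_closed_def by blast

lemma W_closed_W: "W_closed (W n)"
  unfolding W_closed_def
proof clarify
  fix s l assume "\<forall>k. s k \<in> W n" "\<forall>k. l - s k \<in> W k"
  then have "(l - s n) + s n \<in> W n" by (intro W_ideal(2)) auto
  then show "l \<in> W n" by simp
qed

lemma (in complete_algebra) W_closed_coeffs_in_m: "W_closed (coeffs_in_m :: 'a fps fps set)"
  unfolding W_closed_def coeffs_in_m_def
proof clarify
  fix s :: "nat \<Rightarrow> 'a fps fps" and l i j
  assume s: "\<forall>k. s k \<in> {f. \<forall>i j. cf f i j \<in> max_ideal}" and l: "\<forall>k. l - s k \<in> W k"
  have "cf (l - s (i + j + 1)) i j \<in> ideal_pow max_ideal ((i + j + 1 + 1 - i - j) div 2)"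
    using l unfolding W_def by blast
  then have "cf l i j - cf (s (i + j + 1)) i j \<in> max_ideal" using m_pow_1 by simp
  with s have "(cf l i j - cf (s (i + j + 1)) i j) + cf (s (i + j + 1)) i j \<in> max_ideal"
    by (intro m_closed(2)) auto
  then show "cf l i j \<in> max_ideal" by simp
qed

lemma (in complete_algebra) coeffs_in_m_closed:
  "0 \<in> (coeffs_in_m :: 'a fps fps set)"
  "f \<in> coeffs_in_m \<Longrightarrow> g \<in> coeffs_in_m \<Longrightarrow> f + g \<in> (coeffs_in_m :: 'a fps fps set)"
  "f \<in> coeffs_in_m \<Longrightarrow> - f \<in> (coeffs_in_m :: 'a fps fps set)"
  "f \<in> coeffs_in_m \<Longrightarrow> g \<in> coeffs_in_m \<Longrightarrow> f - g \<in> (coeffs_in_m :: 'a fps fps set)"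
  "g \<in> coeffs_in_m \<Longrightarrow> f * g \<in> (coeffs_in_m :: 'a fps fps set)"
  "f \<in> coeffs_in_m \<Longrightarrow> f * g \<in> (coeffs_in_m :: 'a fps fps set)"
  "(\<And>k. k \<in> K \<Longrightarrow> h k \<in> coeffs_in_m) \<Longrightarrow> sum h K \<in> (coeffs_in_m :: 'a fps fps set)"
proof -
  show "g \<in> coeffs_in_m \<Longrightarrow> f * g \<in> (coeffs_in_m :: 'a fps fps set)"
    unfolding coeffs_in_m_def by (auto simp: cf_mult intro!: ring_subspace_sum[OF m_ideal] m_closed(5))
  show "f \<in> coeffs_in_m \<Longrightarrow> f * g \<in> (coeffs_in_m :: 'a fps fps set)"
    unfolding coeffs_in_m_def by (auto simp: cf_mult intro!: ring_subspace_sum[OF m_ideal] m_closed(6))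
qed (auto simp: coeffs_in_m_def cf_sum m_closed intro!: ring_subspace_sum[OF m_ideal])

lemma (in complete_algebra) coeffs_in_m_ops:
  assumes "f \<in> (coeffs_in_m :: 'a fps fps set)"
  shows "Dx f \<in> coeffs_in_m" "Ey f \<in> coeffs_in_m" "Dy0 f \<in> coeffs_in_m"
    "at_x0 f \<in> coeffs_in_m" "at_y0 f \<in> coeffs_in_m" "cst (cf f 0 0) \<in> coeffs_in_m"
  using assms unfolding coeffs_in_m_def by (auto simp: m_closed cf_cst)

lemma (in complete_algebra) W1_iff: "f \<in> W 1 \<longleftrightarrow> cf f 0 0 \<in> (max_ideal :: 'a set)"
proof
  assume "f \<in> W 1"
  then have "cf f 0 0 \<in> ideal_pow max_ideal ((1 + 1 - 0 - 0) div 2)" unfolding W_def by blast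
  then show "cf f 0 0 \<in> max_ideal" using m_pow_1 by simp
next
  assume *: "cf f 0 0 \<in> (max_ideal :: 'a set)"
  have "cf f i j \<in> ideal_pow max_ideal ((1 + 1 - i - j) div 2)" for i j
    using * m_pow_1 by (cases "i = 0 \<and> j = 0") (auto simp: ideal_pow_0)
  then show "f \<in> W 1" unfolding W_def by blast
qed

lemma (in complete_algebra) W2_iff:
  "f \<in> W 2 \<longleftrightarrow> cf f 0 0 \<in> (max_ideal :: 'a set) \<and> cf f 1 0 \<in> max_ideal \<and> cf f 0 1 \<in> max_ideal"
proof
  assume "f \<in> W 2"
  then have "cf f i j \<in> ideal_pow max_ideal ((2 + 1 - i - j) div 2)" for i j unfolding W_def by blast
  from this[of 0 0] this[of 1 0] this[of 0 1]
  show "cf f 0 0 \<in> max_ideal \<and> cf f 1 0 \<in> max_ideal \<and> cf f 0 1 \<in> max_ideal"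
    using m_pow_1 by simp
next
  assume *: "cf f 0 0 \<in> (max_ideal :: 'a set) \<and> cf f 1 0 \<in> max_ideal \<and> cf f 0 1 \<in> max_ideal"
  have "cf f i j \<in> ideal_pow max_ideal ((2 + 1 - i - j) div 2)" for i j
  proof (cases "i + j \<le> 1")
    case True
    then have "i = 0 \<and> j = 0 \<or> i = 1 \<and> j = 0 \<or> i = 0 \<and> j = 1" by linarith
    then show ?thesis using * m_pow_1 by auto
  next
    case False
    then have "(2 + 1 - i - j) div 2 = 0" by simp
    then show ?thesis by (simp only: ideal_pow_0 UNIV_I)
  qed
  then show "f \<in> W 2" unfolding W_def by blast
qed

lemma (in complete_algebra) coeffs_in_m_W2: "f \<in> coeffs_in_m \<Longrightarrow> f \<in> (W 2 :: 'a fps fps set)"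
  unfolding W2_iff coeffs_in_m_def by blast

lemma (in complete_algebra) cst_W2: "a \<in> max_ideal \<Longrightarrow> cst a \<in> (W 2 :: 'a fps fps set)"
  unfolding W2_iff by (simp add: cf_cst m_closed)

lemma (in complete_algebra) unit_iff: "(a :: 'a) dvd 1 \<longleftrightarrow> a \<notin> max_ideal"
  by (simp add: max_ideal_def)

lemma (in complete_algebra) residue_unique: "\<exists>!c. a - \<iota> c \<in> (max_ideal :: 'a set)"
  using algebra unfolding complete_local_noetherian_algebra_def by blast

lemma (in complete_algebra) residue_mem: "a - \<iota> (residue \<iota> a) \<in> (max_ideal :: 'a set)"
  unfolding residue_def by (rule theI'[OF residue_unique])

lemma (in complete_algebra) residue_eqI: "a - \<iota> c \<in> (max_ideal :: 'a set) \<Longrightarrow> residue \<iota> a = c"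
  using residue_unique residue_mem by blast

lemma (in complete_algebra) iota_hom: "comm_ring_hom \<iota>"
  using algebra unfolding complete_local_noetherian_algebra_def by blast

lemma (in complete_algebra) residue_iota [simp]: "residue \<iota> (\<iota> c) = c"
  by (rule residue_eqI) (simp add: m_closed)

lemma (in complete_algebra) residue_hom: "comm_ring_hom (residue \<iota>)"
proof -
  interpret comm_ring_hom \<iota> by (rule iota_hom)
  show ?thesis
  proof
    show "residue \<iota> 0 = 0" "residue \<iota> 1 = 1"
      using residue_iota[of 0] residue_iota[of 1] by simp_all
  next
    fix a b
    have "(a - \<iota> (residue \<iota> a)) + (b - \<iota> (residue \<iota> b)) \<in> max_ideal"
      by (intro m_closed residue_mem)
    then show "residue \<iota> (a + b) = residue \<iota> a + residue \<iota> b"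
      by (intro residue_eqI) (simp add: hom_add algebra_simps)
    have "a * (b - \<iota> (residue \<iota> b)) + (a - \<iota> (residue \<iota> a)) * \<iota> (residue \<iota> b) \<in> max_ideal"
      by (intro m_closed(2) m_closed(5)[OF residue_mem] m_closed(6)[OF residue_mem])
    then show "residue \<iota> (a * b) = residue \<iota> a * residue \<iota> b"
      by (intro residue_eqI) (simp add: hom_mult algebra_simps)
  qed
qed

lemma (in complete_algebra) residue_zero_iff: "residue \<iota> a = 0 \<longleftrightarrow> a \<in> max_ideal"
proof -
  interpret comm_ring_hom \<iota> by (rule iota_hom)
  show ?thesis using residue_mem[of a] residue_eqI[of a 0] by auto
qed

lemma (in complete_algebra) residue_eq_iff: "residue \<iota> a = residue \<iota> b \<longleftrightarrow> a - b \<in> max_ideal"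
proof -
  interpret comm_ring_hom "residue \<iota>" by (rule residue_hom)
  show ?thesis using residue_zero_iff[of "a - b"] by (simp add: hom_minus)
qed

lemma cf_red [simp]: "cf (red \<iota> f) i j = residue \<iota> (cf f i j)"
  by (simp add: red_def cf_def)

lemma (in complete_algebra) red_hom: "comm_ring_hom (red \<iota>)"
proof -
  interpret comm_ring_hom "residue \<iota>" by (rule residue_hom)
  show ?thesis
    by unfold_locales
      (auto intro!: cf_ext simp: cf_1 cf_mult hom_add hom_mult hom_sum)
qed

lemma (in complete_algebra) red_eq_iff: "red \<iota> f = red \<iota> g \<longleftrightarrow> f - g \<in> coeffs_in_m"
proof -
  have "red \<iota> f = red \<iota> g \<longleftrightarrow> (\<forall>i j. cf (red \<iota> f) i j = cf (red \<iota> g) i j)"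
    using cf_ext[of "red \<iota> f" "red \<iota> g"] by metis
  then show ?thesis by (simp add: coeffs_in_m_def residue_eq_iff)
qed

lemma (in complete_algebra) red_simps [simp]:
  "red \<iota> var_x = var_x" "red \<iota> var_y = var_y" "red \<iota> (cst a) = cst (residue \<iota> a)"
proof -
  interpret comm_ring_hom "residue \<iota>" by (rule residue_hom)
  have *: "cf var_x i j = (if i = 1 \<and> j = 0 then 1 else 0 :: 'c::comm_ring_1)"
    "cf var_y i j = (if i = 0 \<and> j = 1 then 1 else 0 :: 'c::comm_ring_1)" for i j
    using cf_var_x_mult[of "1 :: 'c fps fps" i j] cf_var_y_mult[of "1 :: 'c fps fps" i j] by (auto simp: cf_1)
  show "red \<iota> var_x = var_x" "red \<iota> var_y = var_y" "red \<iota> (cst a) = cst (residue \<iota> a)"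
    by (rule cf_ext; simp add: * cf_cst)+
qed

lemma (in complete_algebra) unit_power_series:
  "f dvd 1 \<longleftrightarrow> cf f 0 0 \<notin> (max_ideal :: 'a set)"
proof
  assume "f dvd 1"
  then obtain g where "1 = f * g" by (auto simp: dvd_def)
  then have "cf f 0 0 * cf g 0 0 = 1" using cf_mult[of f g 0 0] by (simp add: cf_1)
  then have "cf f 0 0 dvd 1" by (metis dvd_triv_left)
  then show "cf f 0 0 \<notin> max_ideal" by (simp add: unit_iff)
next
  assume "cf f 0 0 \<notin> max_ideal"
  then obtain c where "fps_nth (fps_nth f 0) 0 * c = 1"
    using unit_iff[of "cf f 0 0"] by (auto simp: cf_def dvd_def)
  then have "fps_nth f 0 * fps_right_inverse (fps_nth f 0) c = 1" by (rule fps_right_inverse)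
  then have "f * fps_right_inverse f (fps_right_inverse (fps_nth f 0) c) = 1" by (rule fps_right_inverse)
  then show "f dvd 1" by (metis dvd_triv_left)
qed

lemma (in complete_algebra) max_ideal_power_series:
  "max_ideal = {f. cf f 0 0 \<in> (max_ideal :: 'a set)}" "max_ideal = (W 1 :: 'a fps fps set)"
  unfolding max_ideal_def[where 'a = "'a fps fps"] using unit_power_series W1_iff by auto

section \<open>Substitution\<close>

definition subst_partial :: "'a::comm_ring_1 fps fps \<Rightarrow> 'a fps fps \<Rightarrow> nat \<Rightarrow> 'a fps fps \<Rightarrow> 'a fps fps" where
  "subst_partial X Y n f = (\<Sum>(i, j) \<in> {..<n} \<times> {..<n}. cst (cf f i j) * (X ^ i * Y ^ j))"

lemma W_power: "X \<in> W 1 \<Longrightarrow> X ^ i \<in> W i"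
proof (induction i)
  case (Suc i)
  then show ?case using W_mult[of X 1 "X ^ i" i] by simp
qed simp

lemma cf_cst_coeff_W:
  assumes "f \<in> W n"
  shows "cst (cf f i j) \<in> W (n - (i + j))"
proof -
  have "cf f i j \<in> ideal_pow max_ideal ((n + 1 - i - j) div 2)" using assms unfolding W_def by blast
  then have "cst (cf f i j) \<in> W (2 * ((n + 1 - i - j) div 2))" by (rule cst_W)
  moreover have "n - (i + j) \<le> 2 * ((n + 1 - i - j) div 2)" by linarith
  ultimately show ?thesis by (rule W_anti[rotated])
qed

lemma subst_term_W:
  assumes "X \<in> W 1" "Y \<in> W 1" "f \<in> W n"
  shows "cst (cf f i j) * (X ^ i * Y ^ j) \<in> W n" "cst (cf f i j) * (X ^ i * Y ^ j) \<in> W (i + j)"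
proof -
  have XY: "X ^ i * Y ^ j \<in> W (i + j)" by (intro W_mult W_power assms)
  from W_mult[OF cf_cst_coeff_W[OF assms(3)] XY]
  show "cst (cf f i j) * (X ^ i * Y ^ j) \<in> W n"
    by (rule W_anti[rotated]) simp
  show "cst (cf f i j) * (X ^ i * Y ^ j) \<in> W (i + j)" using XY by (rule W_mult_left)
qed

lemma subst_partial_W:
  assumes "X \<in> W 1" "Y \<in> W 1" "f \<in> W n"
  shows "subst_partial X Y m f \<in> W n"
  unfolding subst_partial_def by (rule W_sum) (auto intro: subst_term_W(1) assms)

lemma subst_partial_step:
  assumes "X \<in> W 1" "Y \<in> W 1"
  shows "subst_partial X Y (Suc n) f - subst_partial X Y n f \<in> W n"
proof -
  let ?t = "\<lambda>(i, j). cst (cf f i j) * (X ^ i * Y ^ j)"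
  have "subst_partial X Y (Suc n) f - subst_partial X Y n f
      = sum ?t ({..<Suc n} \<times> {..<Suc n} - {..<n} \<times> {..<n})"
    unfolding subst_partial_def by (subst sum_diff) auto
  also have "\<dots> \<in> W n"
  proof (rule W_sum)
    fix p assume "p \<in> {..<Suc n} \<times> {..<Suc n} - {..<n} \<times> {..<n}"
    then obtain i j where p: "p = (i, j)" "n \<le> i + j" by (cases p) auto
    have "cst (cf f i j) * (X ^ i * Y ^ j) \<in> W (i + j)"
      by (rule subst_term_W(2)[OF assms, of f 0]) simp
    then show "?t p \<in> W n" using p by (auto intro: W_anti)
  qed
  finally show ?thesis .
qed

lemma subst_partial_add:
  "subst_partial X Y n (f + g) = subst_partial X Y n f + subst_partial X Y n g"
  unfolding subst_partial_def by (simp add: cst_add distrib_right sum.distrib case_prod_beta)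

lemma cf_mono_gen:
  "cf (var_x ^ a * (f :: 'a::comm_ring_1 fps fps)) i j = (if i < a then 0 else cf f (i - a) j)"
  "cf (var_y ^ a * (f :: 'a::comm_ring_1 fps fps)) i j = (if j < a then 0 else cf f i (j - a))"
  by (induction a arbitrary: i j) (auto simp: cf_var_x_mult cf_var_y_mult mult.assoc)

lemma cf_monomial:
  fixes c :: "'a::comm_ring_1"
  shows "cf (cst c * (var_x ^ a * var_y ^ b)) i j = (if i = a \<and> j = b then c else 0)"
  using cf_mono_gen(2)[of b "1 :: 'a fps fps" "i - a" j]
  by (auto simp: cf_cst_mult cf_mono_gen(1) cf_1)

lemma cf_trunc:
  "cf (subst_partial var_x var_y n f) i j = (if i < n \<and> j < n then cf f i j else 0 :: 'a::comm_ring_1)"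
proof -
  have "cf (subst_partial var_x var_y n f) i j
      = (\<Sum>p \<in> {..<n} \<times> {..<n}. if p = (i, j) then cf f i j else 0)"
    unfolding subst_partial_def cf_sum
    by (rule sum.cong) (auto simp: cf_monomial split: if_splits)
  also have "\<dots> = (if i < n \<and> j < n then cf f i j else 0)" by (subst sum.delta) auto
  finally show ?thesis .
qed

lemma trunc_approx: "f - subst_partial var_x var_y n f \<in> W n"
proof -
  have "cf f i j - (if i < n \<and> j < n then cf f i j else 0) \<in> ideal_pow max_ideal ((n + 1 - i - j) div 2)" for i j
  proof (cases "i < n \<and> j < n")
    case False
    then have "(n + 1 - i - j) div 2 = 0" by auto
    then show ?thesis by (simp only: ideal_pow_0 UNIV_I)
  qed (simp add: ring_subspace_0[OF is_ideal_pow])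
  then show ?thesis unfolding W_def by (simp add: cf_trunc)
qed

definition subst :: "'a::comm_ring_1 fps fps \<Rightarrow> 'a fps fps \<Rightarrow> 'a fps fps \<Rightarrow> 'a fps fps" where
  "subst X Y f = (SOME l. \<forall>n. l - subst_partial X Y n f \<in> W n)"

lemma (in complete_algebra) subst_approx:
  assumes "X \<in> W 1" "Y \<in> W 1"
  shows "subst X Y f - subst_partial X Y n f \<in> (W n :: 'a fps fps set)"
proof -
  have "\<exists>l. \<forall>n. l - subst_partial X Y n f \<in> W n"
    by (rule W_complete[of "\<lambda>n. subst_partial X Y n f", OF subst_partial_step[OF assms]]) blast
  from someI_ex[OF this] show ?thesis unfolding subst_def by blast
qed

lemma (in complete_algebra) eq_if_W: "(\<And>n. f - g \<in> (W n :: 'a fps fps set)) \<Longrightarrow> f = g"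
  using W_separated[of "f - g"] by simp

lemma (in complete_algebra) subst_add:
  assumes "X \<in> W 1" "Y \<in> W 1"
  shows "subst X Y (f + g) = subst X Y f + subst X Y (g :: 'a fps fps)"
proof (rule eq_if_W)
  fix n
  have "(subst X Y (f + g) - subst_partial X Y n (f + g)) - ((subst X Y f - subst_partial X Y n f)
      + (subst X Y g - subst_partial X Y n g)) \<in> W n"
    by (intro W_ideal(2,4) subst_approx assms)
  then show "subst X Y (f + g) - (subst X Y f + subst X Y g) \<in> W n"
    by (simp add: subst_partial_add algebra_simps)
qed

lemma (in complete_algebra) subst_additive:
  assumes "X \<in> W 1" "Y \<in> W 1"
  shows "subst X Y 0 = (0 :: 'a fps fps)"
    "subst X Y (f - g) = subst X Y f - subst X Y (g :: 'a fps fps)"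
    "subst X Y (sum h K) = (\<Sum>k\<in>K. subst X Y (h k :: 'a fps fps))"
proof -
  show 0: "subst X Y 0 = (0 :: 'a fps fps)" using subst_add[OF assms, of 0 0] by simp
  show "subst X Y (f - g) = subst X Y f - subst X Y g" using subst_add[OF assms, of "f - g" g] by simp
  show "subst X Y (sum h K) = (\<Sum>k\<in>K. subst X Y (h k))"
    by (induction K rule: infinite_finite_induct) (simp_all add: 0 subst_add[OF assms])
qed

lemma (in complete_algebra) subst_W:
  assumes "X \<in> W 1" "Y \<in> W 1" "f \<in> (W n :: 'a fps fps set)"
  shows "subst X Y f \<in> W n"
  using W_ideal(2)[OF subst_approx[OF assms(1,2), of f n] subst_partial_W[OF assms, of n]] by simp

lemma (in complete_algebra) subst_monomial:
  assumes "X \<in> W 1" "Y \<in> W 1"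
  shows "subst X Y (cst c * (var_x ^ a * var_y ^ b)) = cst (c :: 'a) * (X ^ a * Y ^ b)"
proof (rule eq_if_W)
  fix n
  let ?f = "cst c * (var_x ^ a * var_y ^ b) :: 'a fps fps" and ?N = "Suc (n + a + b)"
  have "subst_partial X Y ?N ?f = (\<Sum>p \<in> {..<?N} \<times> {..<?N}. if p = (a, b) then cst c * (X ^ a * Y ^ b) else 0)"
    unfolding subst_partial_def by (rule sum.cong) (auto simp: cf_monomial split: if_splits)
  also have "\<dots> = cst c * (X ^ a * Y ^ b)" by (subst sum.delta) auto
  finally have "subst X Y ?f - cst c * (X ^ a * Y ^ b) \<in> W ?N" using subst_approx[OF assms, of ?f ?N] by simp
  then show "subst X Y ?f - cst c * (X ^ a * Y ^ b) \<in> W n" by (rule W_anti[rotated]) simp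
qed

lemma (in complete_algebra) subst_mult:
  assumes "X \<in> W 1" "Y \<in> W 1"
  shows "subst X Y (f * g) = subst X Y f * subst X Y (g :: 'a fps fps)"
proof (rule eq_if_W)
  fix n
  let ?p = "subst_partial X Y n" and ?t = "subst_partial var_x var_y n" and ?s = "subst X Y"
  have "?t f * ?t g = (\<Sum>(i, j) \<in> {..<n} \<times> {..<n}. \<Sum>(k, l) \<in> {..<n} \<times> {..<n}.
      cst (cf f i j * cf g k l) * (var_x ^ (i + k) * var_y ^ (j + l)))"
    unfolding subst_partial_def sum_product
    by (auto intro!: sum.cong simp: case_prod_beta cst_mult power_add algebra_simps)
  then have "?s (?t f * ?t g) = (\<Sum>(i, j) \<in> {..<n} \<times> {..<n}. \<Sum>(k, l) \<in> {..<n} \<times> {..<n}.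
      cst (cf f i j * cf g k l) * (X ^ (i + k) * Y ^ (j + l)))"
    by (simp add: subst_additive[OF assms] subst_monomial[OF assms] case_prod_beta)
  also have "\<dots> = ?p f * ?p g"
    unfolding subst_partial_def sum_product
    by (auto intro!: sum.cong simp: case_prod_beta cst_mult power_add algebra_simps)
  finally have mult: "?s (?t f * ?t g) = ?p f * ?p g" .
  have "f * g - ?t f * ?t g = f * (g - ?t g) + (f - ?t f) * ?t g" by (simp add: algebra_simps)
  also have "\<dots> \<in> W n" by (intro W_ideal(2) W_mult_left W_mult_right trunc_approx)
  finally have "?s (f * g) - ?p f * ?p g \<in> W n"
    using subst_W[OF assms] by (simp add: mult[symmetric] subst_additive(2)[OF assms, symmetric])
  moreover have "?s f * ?s g - ?p f * ?p g = ?s f * (?s g - ?p g) + (?s f - ?p f) * ?p g"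
    by (simp add: algebra_simps)
  then have "?s f * ?s g - ?p f * ?p g \<in> W n"
    by (simp only:) (intro W_ideal(2) W_mult_left W_mult_right subst_approx assms)
  ultimately have "(?s (f * g) - ?p f * ?p g) - (?s f * ?s g - ?p f * ?p g) \<in> W n" by (rule W_ideal)
  then show "?s (f * g) - ?s f * ?s g \<in> W n" by simp
qed

lemma (in complete_algebra) subst_cst:
  assumes "X \<in> W 1" "Y \<in> W 1"
  shows "subst X Y (cst a) = cst (a :: 'a)" "subst X Y var_x = X" "subst X Y var_y = Y"
  using subst_monomial[OF assms, of a 0 0] subst_monomial[OF assms, of 1 1 0]
    subst_monomial[OF assms, of 1 0 1] by simp_all

lemma (in complete_algebra) subst_hom:
  assumes "X \<in> W 1" "Y \<in> W 1"
  shows "comm_ring_hom (subst X Y :: 'a fps fps \<Rightarrow> 'a fps fps)"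
  by unfold_locales (simp_all add: subst_add[OF assms] subst_mult[OF assms] subst_additive[OF assms]
      subst_cst(1)[OF assms, of 1, simplified])

text \<open>A perturbation of the variables by elements of \<open>\<mm>[[x,y]]\<close> raises the weight by one; this is
  what makes it invertible.\<close>

locale perturbation = complete_algebra \<iota> for \<iota> :: "'k::field \<Rightarrow> 'a::comm_ring_1" +
  fixes u v :: "'a fps fps"
  assumes u: "u \<in> coeffs_in_m" and v: "v \<in> coeffs_in_m"

abbreviation (in perturbation) "\<sigma> \<equiv> subst (var_x + u) (var_y + v)"

lemma (in perturbation) XY_W: "var_x + u \<in> W 1" "var_y + v \<in> W 1"
  by (intro W_ideal(2) var_W W_anti[OF _ coeffs_in_m_W2] u v; simp)+

lemma (in complete_algebra) power_perturb_W:
  assumes "X - x \<in> W 2" "X \<in> W 1" "x \<in> (W 1 :: 'a fps fps set)"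
  shows "X ^ i - x ^ i \<in> W (Suc i)"
proof (induction i)
  case (Suc i)
  have "X ^ Suc i - x ^ Suc i = X * (X ^ i - x ^ i) + (X - x) * x ^ i" by (simp add: algebra_simps)
  moreover have "X * (X ^ i - x ^ i) \<in> W (Suc (Suc i))" using W_mult[OF assms(2) Suc] by simp
  moreover have "(X - x) * x ^ i \<in> W (Suc (Suc i))"
    using W_mult[OF assms(1) W_power[OF assms(3), of i]] by simp
  ultimately show ?case by (simp only: W_ideal(2))
qed (simp add: W_ideal)

lemma (in complete_algebra) power_perturb_m:
  assumes "X - x \<in> (coeffs_in_m :: 'a fps fps set)"
  shows "X ^ i - x ^ i \<in> coeffs_in_m"
proof (induction i)
  case (Suc i)
  have "X ^ Suc i - x ^ Suc i = X * (X ^ i - x ^ i) + (X - x) * x ^ i" by (simp add: algebra_simps)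
  then show ?case using Suc assms by (simp add: coeffs_in_m_closed)
qed (simp add: coeffs_in_m_closed)

lemma (in perturbation) sigma_approx:
  "(\<sigma> f - f) - (subst_partial (var_x + u) (var_y + v) n f - subst_partial var_x var_y n f) \<in> W n"
proof -
  have "(\<sigma> f - subst_partial (var_x + u) (var_y + v) n f) - (f - subst_partial var_x var_y n f) \<in> W n"
    by (intro W_ideal(4) subst_approx XY_W trunc_approx)
  then show ?thesis by (simp add: algebra_simps)
qed

lemma (in perturbation) sigma_raises_weight:
  assumes "f \<in> W n"
  shows "\<sigma> f - f \<in> W (Suc n)"
proof -
  let ?X = "var_x + u" and ?Y = "var_y + v"
  have XY: "?X ^ i * ?Y ^ j - var_x ^ i * var_y ^ j \<in> W (Suc (i + j))" for i j
  proof -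
    have "?X ^ i * ?Y ^ j - var_x ^ i * var_y ^ j
        = ?X ^ i * (?Y ^ j - var_y ^ j) + (?X ^ i - var_x ^ i) * var_y ^ j"
      by (simp add: algebra_simps)
    moreover have "?X ^ i * (?Y ^ j - var_y ^ j) \<in> W (i + Suc j)"
      by (intro W_mult W_power XY_W power_perturb_W var_W) (simp add: coeffs_in_m_W2 v)
    moreover have "(?X ^ i - var_x ^ i) * var_y ^ j \<in> W (Suc i + j)"
      by (intro W_mult W_power XY_W power_perturb_W var_W) (simp add: coeffs_in_m_W2 u)
    ultimately show ?thesis by (simp add: W_ideal)
  qed
  have "subst_partial ?X ?Y (Suc n) f - subst_partial var_x var_y (Suc n) f
      = (\<Sum>(i, j) \<in> {..<Suc n} \<times> {..<Suc n}. cst (cf f i j) * (?X ^ i * ?Y ^ j - var_x ^ i * var_y ^ j))"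
    unfolding subst_partial_def by (simp add: sum_subtractf[symmetric] case_prod_beta right_diff_distrib)
  also have "\<dots> \<in> W (Suc n)"
  proof (rule W_sum, clarify)
    fix i j
    show "cst (cf f i j) * (?X ^ i * ?Y ^ j - var_x ^ i * var_y ^ j) \<in> W (Suc n)"
      by (rule W_anti[OF _ W_mult[OF cf_cst_coeff_W[OF assms] XY]]) simp
  qed
  finally have "((\<sigma> f - f) - (subst_partial ?X ?Y (Suc n) f - subst_partial var_x var_y (Suc n) f))
      + (subst_partial ?X ?Y (Suc n) f - subst_partial var_x var_y (Suc n) f) \<in> W (Suc n)"
    by (intro W_ideal(2) sigma_approx)
  then show ?thesis by simp
qed

lemma (in perturbation) sigma_red: "\<sigma> f - f \<in> coeffs_in_m"
proof -
  let ?X = "var_x + u" and ?Y = "var_y + v"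
  have XY: "?X ^ i * ?Y ^ j - var_x ^ i * var_y ^ j \<in> coeffs_in_m" for i j
  proof -
    have "?X ^ i * ?Y ^ j - var_x ^ i * var_y ^ j
        = ?X ^ i * (?Y ^ j - var_y ^ j) + (?X ^ i - var_x ^ i) * var_y ^ j"
      by (simp add: algebra_simps)
    then show ?thesis
      using power_perturb_m[of ?X var_x i] power_perturb_m[of ?Y var_y j] u v
      by (simp add: coeffs_in_m_closed)
  qed
  have "subst_partial ?X ?Y n f - subst_partial var_x var_y n f
      = (\<Sum>(i, j) \<in> {..<n} \<times> {..<n}. cst (cf f i j) * (?X ^ i * ?Y ^ j - var_x ^ i * var_y ^ j))" for n
    unfolding subst_partial_def by (simp add: sum_subtractf[symmetric] case_prod_beta right_diff_distrib)
  then have "subst_partial ?X ?Y n f - subst_partial var_x var_y n f \<in> coeffs_in_m" for n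
    by (simp only:) (rule coeffs_in_m_closed(7), auto intro: coeffs_in_m_closed(5)[OF XY])
  then show ?thesis
    by (rule W_closed_coeffs_in_m[unfolded W_closed_def, rule_format, OF _ sigma_approx])
qed

lemma (in perturbation) sigma_bij: "bij \<sigma>"
proof (rule bijI)
  show "inj \<sigma>"
  proof (rule injI)
    fix f g assume "\<sigma> f = \<sigma> g"
    then have 0: "\<sigma> (f - g) = 0" by (simp add: subst_additive[OF XY_W])
    have "f - g \<in> W n" for n
    proof (induction n)
      case (Suc n)
      from sigma_raises_weight[OF this] have "- (f - g) \<in> W (Suc n)" by (simp add: 0)
      from W_ideal(3)[OF this] show ?case by simp
    qed simp
    then show "f = g" by (rule eq_if_W)
  qed
  show "surj \<sigma>"
  proof (rule surjI)
    fix g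
    have "\<exists>f. \<sigma> f = g"
    proof (rule W_fixed_point[of UNIV "\<lambda>f (_::unit). g - (\<sigma> (f ()) - f ())"])
      fix f h :: "unit \<Rightarrow> 'a fps fps" and n i
      assume "\<And>i. f i - h i \<in> W n"
      then have "\<sigma> (f () - h ()) - (f () - h ()) \<in> W (Suc n)" by (intro sigma_raises_weight)
      from W_ideal(3)[OF this]
      show "(g - (\<sigma> (f ()) - f ())) - (g - (\<sigma> (h ()) - h ())) \<in> W (Suc n)"
        by (simp add: subst_additive[OF XY_W] algebra_simps)
    next
      fix f :: "unit \<Rightarrow> 'a fps fps"
      assume "(\<lambda>_. g - (\<sigma> (f ()) - f ())) = f"
      then have "g - (\<sigma> (f ()) - f ()) = f ()" by (rule fun_cong)
      then show ?thesis by (auto simp: algebra_simps)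
    qed (simp_all add: W_closed_UNIV)
    then show "\<sigma> (SOME f. \<sigma> f = g) = g" by (rule someI_ex)
  qed
qed

section \<open>Normal form of the potential\<close>

text \<open>Completing \<open>x y\<close>: a deformation of \<open>x y\<close> is \<open>(x + u) (y + v) - \<pi>\<close>. The equation
  \<open>x v + y u - \<pi> = \<epsilon> - u v\<close> is solved by iteration, since \<open>u v\<close> is small.\<close>

lemma (in complete_algebra) morse:
  assumes "\<epsilon> \<in> (coeffs_in_m :: 'a fps fps set)"
  obtains u v \<pi> where "u \<in> coeffs_in_m" "v \<in> coeffs_in_m" "\<pi> \<in> max_ideal"
    "var_x * var_y + \<epsilon> = (var_x + u) * (var_y + v) - cst \<pi>"
proof -
  let ?e = "\<lambda>f. \<epsilon> - f True * f False"
  let ?\<Phi> = "\<lambda>f b. if b then Dy0 (?e f) else Dx (?e f)"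
  have e_m: "?e f \<in> coeffs_in_m" if "\<And>i. f i \<in> coeffs_in_m" for f
    using assms that by (simp add: coeffs_in_m_closed)
  show ?thesis
  proof (rule W_fixed_point[of coeffs_in_m ?\<Phi>])
    fix f :: "bool \<Rightarrow> 'a fps fps" and i
    assume "\<And>i. f i \<in> coeffs_in_m"
    from coeffs_in_m_ops[OF e_m[of f, OF this]] show "?\<Phi> f i \<in> coeffs_in_m" by simp
  next
    fix f g :: "bool \<Rightarrow> 'a fps fps" and n i
    assume f: "\<And>i. f i \<in> coeffs_in_m" and g: "\<And>i. g i \<in> coeffs_in_m" and fg: "\<And>i. f i - g i \<in> W n"
    have "?e f - ?e g = - (f True * (f False - g False) + (f True - g True) * g False)"
      by (simp add: algebra_simps)
    moreover have "f True * (f False - g False) \<in> W (2 + n)"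
      by (intro W_mult coeffs_in_m_W2 f fg)
    moreover have "(f True - g True) * g False \<in> W (n + 2)"
      by (intro W_mult coeffs_in_m_W2 g fg)
    ultimately have "?e f - ?e g \<in> W (Suc (Suc n))" by (simp add: W_ideal)
    from ops_W[OF this] show "?\<Phi> f i - ?\<Phi> g i \<in> W (Suc n)" by (simp add: ops_diff)
  next
    fix f :: "bool \<Rightarrow> 'a fps fps"
    assume f: "\<And>i. f i \<in> coeffs_in_m" and fix_pt: "?\<Phi> f = f"
    from fun_cong[OF fix_pt, of True] fun_cong[OF fix_pt, of False]
    have uv: "f True = Dy0 (?e f)" "f False = Dx (?e f)" by simp_all
    define c where "c = cf (?e f) 0 0"
    have "?e f = cst c + var_x * Dx (?e f) + var_y * Dy0 (?e f)" unfolding c_def by (rule split_00)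
    then have "?e f = cst c + var_x * f False + var_y * f True" by (simp only: uv[symmetric])
    then have "\<epsilon> = cst c + var_x * f False + var_y * f True + f True * f False"
      by (simp add: algebra_simps)
    then have "var_x * var_y + \<epsilon> = (var_x + f True) * (var_y + f False) - cst (- cf (?e f) 0 0)"
      unfolding c_def[symmetric] by (simp add: algebra_simps)
    moreover have "- cf (?e f) 0 0 \<in> max_ideal"
      using e_m[of f, OF f] unfolding coeffs_in_m_def by (auto simp del: cf_simps intro: m_closed)
    ultimately show ?thesis using that f by blast
  qed (simp_all add: W_closed_coeffs_in_m coeffs_in_m_closed)
qed

lemma (in complete_algebra) normalize_potential:
  assumes "red \<iota> \<omega> = var_x * var_y"
  obtains \<alpha> \<pi> where "gauge_aut \<iota> \<alpha>" "\<pi> \<in> max_ideal" "\<alpha> \<omega> = var_x * var_y - cst \<pi>"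
proof -
  interpret red: comm_ring_hom "red \<iota>" by (rule red_hom)
  have "red \<iota> \<omega> = red \<iota> (var_x * var_y)" by (simp add: assms red.hom_mult)
  then have "\<omega> - var_x * var_y \<in> coeffs_in_m" by (simp only: red_eq_iff)
  then obtain u v \<pi> where uv: "u \<in> coeffs_in_m" "v \<in> coeffs_in_m" and \<pi>: "\<pi> \<in> max_ideal"
    and \<omega>: "var_x * var_y + (\<omega> - var_x * var_y) = (var_x + u) * (var_y + v) - cst \<pi>"
    by (rule morse)
  interpret perturbation \<iota> u v by unfold_locales (fact uv)+
  let ?s = "subst (var_x + u) (var_y + v)"
  let ?t = "inv_into UNIV ?s"
  interpret sub: comm_ring_hom ?s by (rule subst_hom[OF XY_W])
  have "?s (var_x * var_y - cst \<pi>) = \<omega>"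
    using \<omega> by (simp add: sub.hom_minus sub.hom_mult subst_cst[OF XY_W])
  then have "?t \<omega> = var_x * var_y - cst \<pi>"
    by (metis inv_f_f[OF bij_is_inj[OF sigma_bij]])
  moreover have "gauge_aut \<iota> ?t"
    unfolding gauge_aut_def
  proof (intro conjI allI)
    have inv: "?s (?t f) = f" "?t (?s f) = f" for f
      using sigma_bij by (auto simp: bij_is_surj surj_f_inv_f bij_is_inj)
    have eqI: "?t f = g" if "f = ?s g" for f g using inv(2)[of g] that by simp
    show "comm_ring_hom ?t"
      by unfold_locales (auto intro!: eqI simp: sub.hom_add sub.hom_mult inv)
    show "bij ?t" by (rule bij_imp_bij_inv[OF sigma_bij])
    show "?t (cst a) = cst a" for a by (rule eqI) (simp add: subst_cst[OF XY_W])
    show "red \<iota> (?t f) = red \<iota> f" for f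
      using sigma_red[of "?t f"] red_eq_iff[of f "?t f"] by (simp add: inv)
  qed
  ultimately show ?thesis using that \<pi> by blast
qed

section \<open>Matrices\<close>

definition mat_in :: "'a set \<Rightarrow> 'a mat \<Rightarrow> bool" where
  "mat_in C A \<longleftrightarrow> (\<forall>i < dim_row A. \<forall>j < dim_col A. A $$ (i, j) \<in> C)"

lemma mat_inD: "mat_in C A \<Longrightarrow> i < dim_row A \<Longrightarrow> j < dim_col A \<Longrightarrow> A $$ (i, j) \<in> C"
  by (simp add: mat_in_def)

lemma mult_entry:
  "i < dim_row A \<Longrightarrow> j < dim_col B \<Longrightarrow> dim_col A = dim_row B \<Longrightarrow>
    (A * B) $$ (i, j) = (\<Sum>k < dim_row B. A $$ (i, k) * B $$ (k, j))"
  by (simp add: scalar_prod_def atLeast0LessThan)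

text \<open>The matrix laws with hypotheses on dimensions, which the simplifier can solve.\<close>

lemma mat_assoc:
  fixes A :: "'a::comm_ring_1 mat"
  shows "dim_col A = dim_row B \<Longrightarrow> dim_col B = dim_row C \<Longrightarrow> A * B * C = A * (B * C)"
  by (rule assoc_mult_mat[of A "dim_row A" "dim_row B" B "dim_row C" C "dim_col C"]) auto

lemma mat_distrib:
  fixes A :: "'a::comm_ring_1 mat"
  shows "dim_col A = dim_row B \<Longrightarrow> dim_row B = dim_row C \<Longrightarrow> dim_col B = dim_col C \<Longrightarrow> A * (B + C) = A * B + A * C"
    "dim_col A = dim_row B \<Longrightarrow> dim_row B = dim_row C \<Longrightarrow> dim_col B = dim_col C \<Longrightarrow> A * (B - C) = A * B - A * C"
    "dim_row A = dim_row B \<Longrightarrow> dim_col A = dim_col B \<Longrightarrow> dim_col A = dim_row C \<Longrightarrow> (A + B) * C = A * C + B * C"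
    "dim_row A = dim_row B \<Longrightarrow> dim_col A = dim_col B \<Longrightarrow> dim_col A = dim_row C \<Longrightarrow> (A - B) * C = A * C - B * C"
     apply (rule mult_add_distrib_mat[of _ "dim_row A" "dim_row B" _ "dim_col B"]; auto)
    apply (rule mult_minus_distrib_mat[of _ "dim_row A" "dim_row B" _ "dim_col B"]; auto)
   apply (rule add_mult_distrib_mat[of _ "dim_row A" "dim_col A" _ _ "dim_col C"]; auto)
  apply (rule minus_mult_distrib_mat[of _ "dim_row A" "dim_col A" _ _ "dim_col C"]; auto)
  done

lemma mat_smult:
  fixes A :: "'a::comm_ring_1 mat"
  shows "dim_col A = dim_row B \<Longrightarrow> (c \<cdot>\<^sub>m A) * B = c \<cdot>\<^sub>m (A * B)"
    "dim_col A = dim_row B \<Longrightarrow> A * (c \<cdot>\<^sub>m B) = c \<cdot>\<^sub>m (A * B)"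
  by (rule eq_matI; simp add: mult_entry sum_distrib_left algebra_simps del: index_mult_mat(1))+

lemma mat_one:
  fixes A :: "'a::comm_ring_1 mat"
  shows "dim_row A = n \<Longrightarrow> 1\<^sub>m n * A = A" "dim_col A = n \<Longrightarrow> A * 1\<^sub>m n = A"
  by auto

lemma mat_transpose_mult:
  fixes A :: "'a::comm_ring_1 mat"
  shows "dim_col A = dim_row B \<Longrightarrow> transpose_mat (A * B) = transpose_mat B * transpose_mat A"
  by (rule transpose_mult[of A "dim_row A" "dim_row B" B "dim_col B"]) auto

lemma mat_eq_if_diff_zero:
  fixes A :: "'a::comm_ring_1 mat"
  assumes "A - B = 0\<^sub>m m n" "A \<in> carrier_mat m n" "B \<in> carrier_mat m n"
  shows "A = B"
proof (rule eq_matI)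
  fix i j assume "i < dim_row B" "j < dim_col B"
  moreover from this have "(A - B) $$ (i, j) = 0" unfolding assms(1) using assms by auto
  ultimately show "A $$ (i, j) = B $$ (i, j)" by simp
qed (use assms in auto)

lemma mat_in_W_mult:
  assumes "mat_in (W a) A" "mat_in (W b) B" "dim_col A = dim_row B"
  shows "mat_in (W (a + b)) (A * B)"
  using assms unfolding mat_in_def
  by (auto simp: mult_entry simp del: index_mult_mat(1) intro!: W_sum W_mult)

lemma mat_in_W_anti: "mat_in (W n) A \<Longrightarrow> m \<le> n \<Longrightarrow> mat_in (W m) A"
  unfolding mat_in_def by (auto intro: W_anti)

lemma mat_in_W_add:
  "mat_in (W n) A \<Longrightarrow> mat_in (W n) B \<Longrightarrow> dim_row A = dim_row B \<Longrightarrow> dim_col A = dim_col B \<Longrightarrow> mat_in (W n) (A + B)"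
  "mat_in (W n) A \<Longrightarrow> mat_in (W n) B \<Longrightarrow> dim_row A = dim_row B \<Longrightarrow> dim_col A = dim_col B \<Longrightarrow> mat_in (W n) (A - B)"
  unfolding mat_in_def by (auto intro: W_ideal)

lemma invertible_mat_iff:
  assumes "A \<in> carrier_mat n n"
  shows "invertible_mat A \<longleftrightarrow> (\<exists>B \<in> carrier_mat n n. A * B = 1\<^sub>m n \<and> B * A = 1\<^sub>m n)"
proof
  assume "invertible_mat A"
  then obtain B where B: "A * B = 1\<^sub>m (dim_row A)" "B * A = 1\<^sub>m (dim_row B)"
    unfolding invertible_mat_def inverts_mat_def by blast
  have "dim_row B = n" using arg_cong[OF B(2), of dim_col] assms by auto
  moreover have "dim_col B = n" using arg_cong[OF B(1), of dim_col] assms by auto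
  ultimately show "\<exists>B \<in> carrier_mat n n. A * B = 1\<^sub>m n \<and> B * A = 1\<^sub>m n"
    using B assms by (intro bexI[of _ B]) auto
next
  assume "\<exists>B \<in> carrier_mat n n. A * B = 1\<^sub>m n \<and> B * A = 1\<^sub>m n"
  then show "invertible_mat A"
    using assms unfolding invertible_mat_def inverts_mat_def by (auto simp: square_mat.simps)
qed

lemma invertible_if_det_unit:
  fixes A :: "'a::comm_ring_1 mat"
  assumes A: "A \<in> carrier_mat n n" and "det A dvd 1"
  shows "invertible_mat A"
proof -
  obtain c where c: "det A * c = 1" using assms by (auto simp: dvd_def)
  have "A * (c \<cdot>\<^sub>m adj_mat A) = 1\<^sub>m n" "(c \<cdot>\<^sub>m adj_mat A) * A = 1\<^sub>m n"
    using adj_mat[OF A] A c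
    by (auto simp: mat_smult mult.commute[of c] mult.assoc[symmetric] intro!: eq_matI)
  then show ?thesis unfolding invertible_mat_iff[OF A] using adj_mat(1)[OF A]
    by (intro bexI[of _ "c \<cdot>\<^sub>m adj_mat A"]) auto
qed

lemma invertible_mat_mult:
  fixes A :: "'a::comm_ring_1 mat"
  assumes "A \<in> carrier_mat n n" "B \<in> carrier_mat n n" "invertible_mat A" "invertible_mat B"
  shows "invertible_mat (A * B)"
proof -
  obtain A' B' where *: "A' \<in> carrier_mat n n" "B' \<in> carrier_mat n n"
    "A * A' = 1\<^sub>m n" "A' * A = 1\<^sub>m n" "B * B' = 1\<^sub>m n" "B' * B = 1\<^sub>m n"
    using assms invertible_mat_iff by meson
  have "A * B * (B' * A') = A * (B * B') * A'" "B' * A' * (A * B) = B' * (A' * A) * B"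
    using assms(1,2) *(1,2) by (simp_all add: mat_assoc)
  then have "A * B * (B' * A') = 1\<^sub>m n" "B' * A' * (A * B) = 1\<^sub>m n"
    using assms(1,2) * by simp_all
  moreover have "A * B \<in> carrier_mat n n" "B' * A' \<in> carrier_mat n n" using assms(1,2) *(1,2) by simp_all
  ultimately show ?thesis using invertible_mat_iff by blast
qed

lemma (in complete_algebra) residue_00_hom: "comm_ring_hom (\<lambda>f. residue \<iota> (cf f 0 0))"
proof -
  interpret comm_ring_hom "residue \<iota>" by (rule residue_hom)
  show ?thesis by unfold_locales (simp_all add: cf_1 cf_mult hom_add hom_mult)
qed

lemma (in complete_algebra) invertible_over_power_series:
  fixes A :: "'a fps fps mat"
  assumes A: "A \<in> carrier_mat n n" and "det (map_mat (\<lambda>f. residue \<iota> (cf f 0 0)) A) \<noteq> 0"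
  shows "invertible_mat A"
proof (rule invertible_if_det_unit[OF A])
  interpret comm_ring_hom "\<lambda>f :: 'a fps fps. residue \<iota> (cf f 0 0)" by (rule residue_00_hom)
  have "residue \<iota> (cf (det A) 0 0) \<noteq> 0" using assms(2) by (simp add: hom_det)
  then show "det A dvd 1" unfolding unit_power_series by (simp add: residue_zero_iff)
qed

lemma (in complete_algebra) invertible_one_plus_W1:
  fixes A :: "'a fps fps mat"
  assumes A: "A \<in> carrier_mat n n" and "mat_in (W 1) (A - 1\<^sub>m n)"
  shows "invertible_mat A"
proof (rule invertible_over_power_series[OF A])
  interpret comm_ring_hom "\<lambda>f :: 'a fps fps. residue \<iota> (cf f 0 0)" by (rule residue_00_hom)
  have "map_mat (\<lambda>f. residue \<iota> (cf f 0 0)) A = 1\<^sub>m n"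
  proof (rule eq_matI)
    fix i j assume ij: "i < dim_row (1\<^sub>m n)" "j < dim_col (1\<^sub>m n)"
    then have "(A - 1\<^sub>m n) $$ (i, j) \<in> W 1" using assms by (intro mat_inD) auto
    then have "cf (A $$ (i, j) - (if i = j then 1 else 0)) 0 0 \<in> max_ideal"
      unfolding W1_iff using ij by simp
    then have "residue \<iota> (cf (A $$ (i, j)) 0 0) = residue \<iota> (cf (if i = j then 1 else 0) 0 0)"
      by (simp add: residue_eq_iff)
    then show "map_mat (\<lambda>f. residue \<iota> (cf f 0 0)) A $$ (i, j) = 1\<^sub>m n $$ (i, j)"
      using ij A hom_one by (auto simp: residue_zero_iff m_closed)
  qed (use A in auto)
  then show "det (map_mat (\<lambda>f. residue \<iota> (cf f 0 0)) A) \<noteq> 0" by simp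
qed

text \<open>A Sylvester equation: square roots near \<open>1\<close> are unique, and are compatible with whatever
  intertwines the squares.\<close>

lemma (in complete_algebra) sylvester:
  fixes X :: "'a fps fps mat"
  assumes two: "(2 :: 'a) dvd 1"
    and s: "s \<in> carrier_mat m m" "mat_in (W 1) (s - 1\<^sub>m m)"
    and t: "t \<in> carrier_mat n n" "mat_in (W 1) (t - 1\<^sub>m n)"
    and X: "X \<in> carrier_mat m n" and eq: "s * s * X = X * (t * t)"
  shows "s * X = X * t"
proof -
  define d where "d = s * X - X * t"
  have d: "d \<in> carrier_mat m n" unfolding d_def by (intro minus_carrier_mat mult_carrier_mat[OF X t(1)])
  have "s * d + d * t = s * s * X - X * (t * t)"
  proof -
    have "s * d = s * s * X - s * X * t" "d * t = s * X * t - X * (t * t)"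
      unfolding d_def using s t X by (simp_all add: mat_distrib mat_assoc)
    then show ?thesis using s t X by (intro eq_matI) auto
  qed
  also have "\<dots> = 0\<^sub>m m n" unfolding eq using X t by simp
  finally have 0: "s * d + d * t = 0\<^sub>m m n" .
  obtain h :: 'a where h: "2 * h = 1" using two by (auto simp: dvd_def)
  have h': "cst h * 2 = 1" using h cst_mult[of 2 h] cst_add[of 1 "1 :: 'a"] by (simp add: mult.commute)
  have step: "mat_in (W (Suc k)) d" if "mat_in (W k) d" for k
  proof -
    have "mat_in (W (1 + k)) ((s - 1\<^sub>m m) * d)" "mat_in (W (k + 1)) (d * (t - 1\<^sub>m n))"
      using s t d that by (intro mat_in_W_mult; simp)+
    then have r: "mat_in (W (Suc k)) ((s - 1\<^sub>m m) * d + d * (t - 1\<^sub>m n))"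
      using s t d by (intro mat_in_W_add) auto
    have "(s - 1\<^sub>m m) * d = s * d - d" "d * (t - 1\<^sub>m n) = d * t - d"
      using s t d by (simp_all add: mat_distrib)
    with r have r: "mat_in (W (Suc k)) (s * d - d + (d * t - d))" by simp
    show ?thesis unfolding mat_in_def
    proof (intro allI impI)
      fix i j assume ij: "i < dim_row d" "j < dim_col d"
      have "(s * d) $$ (i, j) + (d * t) $$ (i, j) = 0"
        using arg_cong[OF 0, of "\<lambda>X. X $$ (i, j)"] ij s t d by (simp del: index_mult_mat(1))
      moreover have "(s * d - d + (d * t - d)) $$ (i, j) = (s * d) $$ (i, j) + (d * t) $$ (i, j) - 2 * d $$ (i, j)"
        using ij s t d by (simp del: index_mult_mat(1) add: algebra_simps)
      moreover have "(s * d - d + (d * t - d)) $$ (i, j) \<in> W (Suc k)"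
        using ij s t d by (intro mat_inD[OF r]) auto
      ultimately have "- (2 * d $$ (i, j)) \<in> W (Suc k)" by simp
      from W_mult_left[OF W_ideal(3)[OF this], of "cst h"]
      have "(cst h * 2) * d $$ (i, j) \<in> W (Suc k)" by (simp only: minus_minus mult.assoc)
      then show "d $$ (i, j) \<in> W (Suc k)" by (simp only: h' mult_1_left)
    qed
  qed
  have all: "mat_in (W k) d" for k
  proof (induction k)
    case 0 show ?case by (simp add: mat_in_def)
  qed (rule step)
  have "d = 0\<^sub>m m n"
  proof (rule eq_matI)
    fix i j assume ij: "i < dim_row (0\<^sub>m m n)" "j < dim_col (0\<^sub>m m n)"
    have "d $$ (i, j) \<in> W k" for k using ij d by (intro mat_inD[OF all]) auto
    then have "d $$ (i, j) = 0" by (rule W_separated)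
    then show "d $$ (i, j) = 0\<^sub>m m n $$ (i, j)" using ij by simp
  qed (use d in auto)
  then show ?thesis unfolding d_def by (rule mat_eq_if_diff_zero) (use s t X in auto)
qed

lemma (in complete_algebra) sqrt_exists:
  fixes f :: "'a fps fps mat"
  assumes two: "(2 :: 'a) dvd 1"
    and f: "f \<in> carrier_mat n n" "mat_in (W 1) (f - 1\<^sub>m n)"
  obtains s where "s \<in> carrier_mat n n" "mat_in (W 1) (s - 1\<^sub>m n)" "s * s = f"
proof -
  obtain h :: 'a where h: "2 * h = 1" using two by (auto simp: dvd_def)
  have h': "cst h * 2 = 1" using h cst_mult[of 2 h] cst_add[of 1 "1 :: 'a"] by (simp add: mult.commute)
  define e where "e = (\<lambda>(i, j). if i < n \<and> j < n then (f - 1\<^sub>m n) $$ (i, j) else 0)"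
  let ?\<Phi> = "\<lambda>z (i, j). cst h * (e (i, j) - (\<Sum>k<n. z (i, k) * z (k, j)))"
  have e: "e p \<in> W 1" for p
  proof (cases p)
    case (Pair i j)
    then show ?thesis using mat_inD[OF f(2), of i j] f(1) by (auto simp: e_def W_ideal)
  qed
  show ?thesis
  proof (rule W_fixed_point[of "W 1" ?\<Phi>])
    fix z :: "nat \<times> nat \<Rightarrow> 'a fps fps" and p :: "nat \<times> nat"
    assume z: "\<And>p. z p \<in> W 1"
    obtain i j where p: "p = (i, j)" by (cases p)
    show "?\<Phi> z p \<in> W 1" unfolding p prod.case
      by (intro W_mult_left W_ideal(4) e W_sum W_mult_right z)
  next
    fix z z' :: "nat \<times> nat \<Rightarrow> 'a fps fps" and m and p :: "nat \<times> nat"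
    assume z: "\<And>p. z p \<in> W 1" and z': "\<And>p. z' p \<in> W 1" and d: "\<And>p. z p - z' p \<in> W m"
    obtain i j where p: "p = (i, j)" by (cases p)
    have "?\<Phi> z p - ?\<Phi> z' p
      = cst h * - (\<Sum>k<n. z (i, k) * (z (k, j) - z' (k, j)) + (z (i, k) - z' (i, k)) * z' (k, j))"
      unfolding p by (simp add: algebra_simps sum.distrib sum_subtractf)
    also have "\<dots> \<in> W (Suc m)"
    proof (rule W_mult_left, rule W_ideal(3), rule W_sum, rule W_ideal(2))
      fix k
      show "z (i, k) * (z (k, j) - z' (k, j)) \<in> W (Suc m)" using W_mult[OF z d] by simp
      show "(z (i, k) - z' (i, k)) * z' (k, j) \<in> W (Suc m)" using W_mult[OF d z'] by simp
    qed
    finally show "?\<Phi> z p - ?\<Phi> z' p \<in> W (Suc m)" .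
  next
    fix z :: "nat \<times> nat \<Rightarrow> 'a fps fps"
    assume z: "\<And>p. z p \<in> W 1" and fix_pt: "?\<Phi> z = z"
    define Z where "Z = mat n n z"
    define s where "s = 1\<^sub>m n + Z"
    have Z: "Z \<in> carrier_mat n n" and s: "s \<in> carrier_mat n n" by (auto simp: Z_def s_def)
    have "Z * Z + Z + Z = f - 1\<^sub>m n"
    proof (rule eq_matI)
      fix i j assume ij: "i < dim_row (f - 1\<^sub>m n)" "j < dim_col (f - 1\<^sub>m n)"
      have "z (i, j) = cst h * (e (i, j) - (\<Sum>k<n. z (i, k) * z (k, j)))"
        using fun_cong[OF fix_pt, of "(i, j)"] by simp
      then have "z (i, j) + z (i, j) = cst h * 2 * (e (i, j) - (\<Sum>k<n. z (i, k) * z (k, j)))"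
        by (simp only: mult_2_right distrib_right)
      then have "z (i, j) + z (i, j) = e (i, j) - (\<Sum>k<n. z (i, k) * z (k, j))" by (simp add: h')
      moreover have "e (i, j) = (f - 1\<^sub>m n) $$ (i, j)" using ij f by (simp add: e_def)
      ultimately show "(Z * Z + Z + Z) $$ (i, j) = (f - 1\<^sub>m n) $$ (i, j)"
        using ij f(1) by (simp add: Z_def mult_entry del: index_mult_mat(1))
    qed (use f Z in auto)
    moreover have "s * s = 1\<^sub>m n + (Z * Z + Z + Z)"
    proof -
      have "s * s = 1\<^sub>m n + Z + (Z + Z * Z)"
        unfolding s_def using Z by (simp add: mat_distrib)
      then show ?thesis using Z by (intro eq_matI) auto
    qed
    ultimately have "s * s = 1\<^sub>m n + (f - 1\<^sub>m n)" by simp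
    then have "s * s = f" using f by (intro eq_matI) auto
    moreover have "s - 1\<^sub>m n = Z" using Z unfolding s_def by (intro eq_matI) auto
    then have "mat_in (W 1) (s - 1\<^sub>m n)" using z by (auto simp: mat_in_def Z_def)
    ultimately show ?thesis using that s by blast
  qed (simp_all add: W_closed_W W_ideal)
qed

section \<open>Normal form of a matrix factorization\<close>

definition diag_var :: "nat \<Rightarrow> nat \<Rightarrow> 'a::comm_ring_1 fps fps" where
  "diag_var p i = (if i < p then var_x else var_y)"

definition diag_xy :: "nat \<Rightarrow> nat \<Rightarrow> 'a::comm_ring_1 fps fps mat" where
  "diag_xy p n = mat n n (\<lambda>(i, j). if i = j then diag_var p i else 0)"

definition diag_yx :: "nat \<Rightarrow> nat \<Rightarrow> 'a::comm_ring_1 fps fps mat" where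
  "diag_yx p n = mat n n (\<lambda>(i, j). if i = j then (if i < p then var_y else var_x) else 0)"

lemma diag_xy_carrier [simp]: "diag_xy p n \<in> carrier_mat n n" "diag_yx p n \<in> carrier_mat n n"
  "dim_row (diag_xy p n) = n" "dim_col (diag_xy p n) = n"
  "dim_row (diag_yx p n) = n" "dim_col (diag_yx p n) = n"
  by (simp_all add: diag_xy_def diag_yx_def)

lemma diag_mult_entry:
  assumes "A \<in> carrier_mat n n" "i < n" "j < n"
  shows "(diag_xy p n * A) $$ (i, j) = diag_var p i * A $$ (i, j)"
    "(A * diag_xy p n) $$ (i, j) = A $$ (i, j) * diag_var p j"
    "(diag_yx p n * A) $$ (i, j) = (if i < p then var_y else var_x) * A $$ (i, j)"
    "(A * diag_yx p n) $$ (i, j) = A $$ (i, j) * (if j < p then var_y else var_x)"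
  using assms
  by (simp_all add: mult_entry diag_xy_def diag_yx_def if_distrib[of "\<lambda>t. t * _"] if_distrib[of "(*) _"]
      sum.delta sum.delta' cong: if_cong del: index_mult_mat(1))

text \<open>Every \<open>f\<close> is \<open>d\<^sub>i sg + nu - ta d\<^sub>j\<close>, where \<open>d\<close> is the diagonal matrix with entries \<open>x, y\<close> and
  \<open>nu\<close> does not involve \<open>x\<close> in the first diagonal block, does not involve \<open>y\<close> in the second
  one, and is constant in the other two blocks.\<close>

definition sg :: "nat \<Rightarrow> nat \<Rightarrow> nat \<Rightarrow> 'a::comm_ring_1 fps fps \<Rightarrow> 'a fps fps" where
  "sg p i j f = (if i < p then Dx f else if j < p then Dy0 f else Ey f)"

definition ta :: "nat \<Rightarrow> nat \<Rightarrow> nat \<Rightarrow> 'a::comm_ring_1 fps fps \<Rightarrow> 'a fps fps" where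
  "ta p i j f = (if i < p \<and> \<not> j < p then - Dy0 f else if \<not> i < p \<and> j < p then - Dx f else 0)"

definition nu :: "nat \<Rightarrow> nat \<Rightarrow> nat \<Rightarrow> 'a::comm_ring_1 fps fps \<Rightarrow> 'a fps fps" where
  "nu p i j f = (if i < p \<and> j < p then at_x0 f else if \<not> i < p \<and> \<not> j < p then at_y0 f else cst (cf f 0 0))"

lemma sg_nu_ta: "diag_var p i * sg p i j f + nu p i j f - ta p i j f * diag_var p j = f"
  using split_x0[of f] split_y0[of f] split_00[of f]
  by (simp add: diag_var_def sg_def nu_def ta_def algebra_simps)

lemma nu_fixed: "nu p i j (nu p i j f) = nu p i j f"
  unfolding nu_def by (auto intro!: cf_ext simp: cf_cst)

lemma sg_nu_ta_W:
  "f \<in> W (Suc n) \<Longrightarrow> sg p i j f \<in> W n" "f \<in> W (Suc n) \<Longrightarrow> ta p i j f \<in> W n" "f \<in> W n \<Longrightarrow> nu p i j f \<in> W n"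
  by (auto simp: sg_def ta_def nu_def intro: ops_W at_W W_ideal)

lemma sg_nu_ta_diff:
  "sg p i j (f - g) = sg p i j f - sg p i j g" "ta p i j (f - g) = ta p i j f - ta p i j g"
  "nu p i j (f - g) = nu p i j f - nu p i j g"
  by (simp_all add: sg_def ta_def nu_def ops_diff cst_diff)

lemma (in complete_algebra) sg_nu_ta_m:
  assumes "f \<in> (coeffs_in_m :: 'a fps fps set)"
  shows "sg p i j f \<in> coeffs_in_m" "ta p i j f \<in> coeffs_in_m" "nu p i j f \<in> coeffs_in_m"
  using coeffs_in_m_ops[OF assms] by (simp_all add: sg_def ta_def nu_def coeffs_in_m_closed)

text \<open>The equation \<open>(1 + \<tau>) (d + \<epsilon>) = (d + \<nu>) (1 + \<sigma>)\<close> reads \<open>d \<sigma> + \<nu> - \<tau> d = \<epsilon> + \<tau> \<epsilon> - \<nu> \<sigma>\<close>. The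
  common value \<open>e\<close> of the two sides determines \<open>\<sigma>, \<nu>, \<tau>\<close> and is the unknown of a fixed point
  problem, which is contracting because \<open>\<epsilon>\<close> and \<open>\<nu>\<close> have weight at least two. The set \<open>C\<close> is
  either the whole ring or \<open>\<mm>[[x,y]]\<close>.\<close>

lemma (in complete_algebra) matrix_normal_form:
  fixes \<phi> :: "'a fps fps mat"
  assumes \<phi>: "\<phi> \<in> carrier_mat n n" and C: "C = UNIV \<or> C = coeffs_in_m"
    and \<epsilon>: "mat_in (C \<inter> W 2) (\<phi> - diag_xy p n)"
  obtains T S N where "T \<in> carrier_mat n n" "S \<in> carrier_mat n n" "N \<in> carrier_mat n n"
    "T * \<phi> = N * S" "mat_in (C \<inter> W 1) (T - 1\<^sub>m n)" "mat_in (C \<inter> W 1) (S - 1\<^sub>m n)"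
    "\<And>i j. i < n \<Longrightarrow> j < n \<Longrightarrow> (N - diag_xy p n) $$ (i, j) \<in> W 2"
    "\<And>i j. i < n \<Longrightarrow> j < n \<Longrightarrow> nu p i j ((N - diag_xy p n) $$ (i, j)) = (N - diag_xy p n) $$ (i, j)"
proof -
  define E where "E = (\<lambda>(i, j). if i < n \<and> j < n then (\<phi> - diag_xy p n) $$ (i, j) else 0)"
  let ?s = "\<lambda>e i j. sg p i j (e (i, j))" and ?t = "\<lambda>e i j. ta p i j (e (i, j))"
    and ?n = "\<lambda>e i j. nu p i j (e (i, j))"
  let ?\<Phi> = "\<lambda>e (i, j). E (i, j) + (\<Sum>k<n. ?t e i k * E (k, j)) - (\<Sum>k<n. ?n e i k * ?s e k j)"
  have C_closed: "0 \<in> C" "a \<in> C \<Longrightarrow> b \<in> C \<Longrightarrow> a + b \<in> C" "a \<in> C \<Longrightarrow> b \<in> C \<Longrightarrow> a - b \<in> C"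
    "a \<in> C \<Longrightarrow> a * b \<in> C" "(\<And>k. k \<in> K \<Longrightarrow> h k \<in> C) \<Longrightarrow> sum h K \<in> C"
    "a \<in> C \<Longrightarrow> sg p i j a \<in> C" "a \<in> C \<Longrightarrow> ta p i j a \<in> C" "a \<in> C \<Longrightarrow> nu p i j a \<in> C" for a b h i j and K :: "nat set"
    using C by (auto simp: coeffs_in_m_closed sg_nu_ta_m)
  have "W_closed C" using C by (auto simp: W_closed_UNIV W_closed_coeffs_in_m)
  then have closed: "W_closed (C \<inter> W 2)" by (intro W_closed_Int W_closed_W)
  have E: "E q \<in> C" "E q \<in> W 2" for q
  proof -
    obtain i j where q: "q = (i, j)" by (cases q)
    have "E q \<in> C \<inter> W 2"
    proof (cases "i < n \<and> j < n")
      case True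
      then have "(\<phi> - diag_xy p n) $$ (i, j) \<in> C \<inter> W 2" by (intro mat_inD[OF \<epsilon>]) auto
      with True show ?thesis by (simp add: q E_def)
    next
      case False
      then show ?thesis by (auto simp: q E_def C_closed W_ideal)
    qed
    then show "E q \<in> C" "E q \<in> W 2" by auto
  qed
  have W2: "f \<in> W 2 \<Longrightarrow> sg p i j f \<in> W 1" "f \<in> W 2 \<Longrightarrow> ta p i j f \<in> W 1"
     for f :: "'a fps fps" and i j
    using sg_nu_ta_W[of f 1] by (simp_all add: numeral_2_eq_2)
  show ?thesis
  proof (rule W_fixed_point[of "C \<inter> W 2" ?\<Phi>])
    fix e :: "nat \<times> nat \<Rightarrow> 'a fps fps" and q :: "nat \<times> nat"
    assume e: "\<And>q. e q \<in> C \<inter> W 2"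
    then have eC: "e q \<in> C" and eW: "e q \<in> W 2" for q by auto
    obtain i j where q: "q = (i, j)" by (cases q)
    have "?t e i k * E (k, j) \<in> W 2" "?n e i k * ?s e k j \<in> W 2" for k
      by (intro W_mult_left E, intro W_mult_right sg_nu_ta_W(3) eW)
    then have "?\<Phi> e q \<in> W 2" unfolding q prod.case by (intro W_ideal(2,4) W_sum E)
    moreover have "?\<Phi> e q \<in> C" unfolding q prod.case by (intro C_closed(2-8) E eC)
    ultimately show "?\<Phi> e q \<in> C \<inter> W 2" by blast
  next
    fix e e' :: "nat \<times> nat \<Rightarrow> 'a fps fps" and m and q :: "nat \<times> nat"
    assume "\<And>q. e q \<in> C \<inter> W 2" "\<And>q. e' q \<in> C \<inter> W 2" and d: "\<And>q. e q - e' q \<in> W m"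
    then have eW: "e q \<in> W 2" and eW': "e' q \<in> W 2" for q by auto
    obtain i j where q: "q = (i, j)" by (cases q)
    have d1: "sg p i j (e (i, j)) - sg p i j (e' (i, j)) \<in> W (m - 1)"
      "ta p i j (e (i, j)) - ta p i j (e' (i, j)) \<in> W (m - 1)"
      "nu p i j (e (i, j)) - nu p i j (e' (i, j)) \<in> W m" for i j
      using sg_nu_ta_W(1,2)[of "e (i, j) - e' (i, j)" "m - 1"] sg_nu_ta_W(3)[OF d] d[of "(i, j)"]
      by (cases m; simp add: sg_nu_ta_diff)+
    have "?\<Phi> e q - ?\<Phi> e' q = (\<Sum>k<n. (?t e i k - ?t e' i k) * E (k, j))
        - (\<Sum>k<n. ?n e i k * (?s e k j - ?s e' k j) + (?n e i k - ?n e' i k) * ?s e' k j)"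
      unfolding q by (simp add: algebra_simps sum.distrib sum_subtractf)
    also have "\<dots> \<in> W (Suc m)"
    proof (rule W_ideal(4); rule W_sum)
      fix k
      show "(?t e i k - ?t e' i k) * E (k, j) \<in> W (Suc m)"
        by (rule W_anti[OF _ W_mult[OF d1(2) E(2)]]) simp
      have "?n e i k * (?s e k j - ?s e' k j) \<in> W (Suc m)"
        by (rule W_anti[OF _ W_mult[OF sg_nu_ta_W(3)[OF eW] d1(1)]]) simp
      moreover have "(?n e i k - ?n e' i k) * ?s e' k j \<in> W (Suc m)"
        by (rule W_anti[OF _ W_mult[OF d1(3) W2(1)[OF eW']]]) simp
      ultimately show "?n e i k * (?s e k j - ?s e' k j) + (?n e i k - ?n e' i k) * ?s e' k j \<in> W (Suc m)"
        by (rule W_ideal(2))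
    qed
    finally show "?\<Phi> e q - ?\<Phi> e' q \<in> W (Suc m)" .
  next
    fix e :: "nat \<times> nat \<Rightarrow> 'a fps fps"
    assume e: "\<And>q. e q \<in> C \<inter> W 2" and fix_pt: "?\<Phi> e = e"
    then have eC: "e q \<in> C" and eW: "e q \<in> W 2" for q by auto
    define s t v where "s = mat n n (\<lambda>(i, j). ?s e i j)" and "t = mat n n (\<lambda>(i, j). ?t e i j)"
      and "v = mat n n (\<lambda>(i, j). ?n e i j)"
    note mats = s_def t_def v_def
    let ?d = "diag_xy p n :: 'a fps fps mat" and ?\<epsilon> = "\<phi> - diag_xy p n"
    have c: "s \<in> carrier_mat n n" "t \<in> carrier_mat n n" "v \<in> carrier_mat n n" "?\<epsilon> \<in> carrier_mat n n"
      using \<phi> by (auto simp: mats)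
    have eq: "?\<epsilon> + t * ?d + t * ?\<epsilon> = ?d * s + v + v * s"
    proof (rule eq_matI)
      fix i j assume "i < dim_row (?d * s + v + v * s)" "j < dim_col (?d * s + v + v * s)"
      then have ij: "i < n" "j < n" using c by auto
      have "e (i, j) = E (i, j) + (\<Sum>k<n. ?t e i k * E (k, j)) - (\<Sum>k<n. ?n e i k * ?s e k j)"
        using fun_cong[OF fix_pt, of "(i, j)"] by simp
      also have "(\<Sum>k<n. ?t e i k * E (k, j)) = (t * ?\<epsilon>) $$ (i, j)"
        using ij \<phi> by (simp add: mult_entry t_def E_def del: index_mult_mat(1))
      also have "(\<Sum>k<n. ?n e i k * ?s e k j) = (v * s) $$ (i, j)"
        using ij by (simp add: mult_entry mats del: index_mult_mat(1))
      also have "E (i, j) = ?\<epsilon> $$ (i, j)" using ij by (simp add: E_def)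
      finally have "diag_var p i * ?s e i j + ?n e i j - ?t e i j * diag_var p j
          = ?\<epsilon> $$ (i, j) + (t * ?\<epsilon>) $$ (i, j) - (v * s) $$ (i, j)" by (simp only: sg_nu_ta)
      moreover have "(?d * s) $$ (i, j) = diag_var p i * ?s e i j" "(t * ?d) $$ (i, j) = ?t e i j * diag_var p j"
        "v $$ (i, j) = ?n e i j"
        using ij diag_mult_entry(1)[OF c(1) ij] diag_mult_entry(2)[OF c(2) ij]
        by (simp_all add: mats del: index_mult_mat(1))
      moreover have "(?\<epsilon> + t * ?d + t * ?\<epsilon>) $$ (i, j) = ?\<epsilon> $$ (i, j) + (t * ?d) $$ (i, j) + (t * ?\<epsilon>) $$ (i, j)"
        "(?d * s + v + v * s) $$ (i, j) = (?d * s) $$ (i, j) + v $$ (i, j) + (v * s) $$ (i, j)"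
        using ij c \<phi> by (simp_all del: index_mult_mat(1) index_minus_mat(1))
      ultimately show "(?\<epsilon> + t * ?d + t * ?\<epsilon>) $$ (i, j) = (?d * s + v + v * s) $$ (i, j)"
        by (simp add: algebra_simps)
    qed (use c \<phi> in auto)
    show ?thesis
    proof (rule that[of "1\<^sub>m n + t" "1\<^sub>m n + s" "?d + v"])
      have "\<phi> = ?d + ?\<epsilon>" using \<phi> by (intro eq_matI) auto
      then have "(1\<^sub>m n + t) * \<phi> = (1\<^sub>m n + t) * (?d + ?\<epsilon>)" by simp
      also have "\<dots> = ?d + (?\<epsilon> + t * ?d + t * ?\<epsilon>)"
      proof -
        have "(1\<^sub>m n + t) * (?d + ?\<epsilon>) = ?d + t * ?d + (?\<epsilon> + t * ?\<epsilon>)"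
          using c \<phi> by (simp add: mat_distrib(1,3))
        then show ?thesis using c \<phi> by (intro eq_matI) (auto simp del: index_mult_mat(1))
      qed
      also have "\<dots> = (?d + v) * (1\<^sub>m n + s)"
      proof -
        have "(?d + v) * (1\<^sub>m n + s) = ?d + v + (?d * s + v * s)"
          using c \<phi> by (simp add: mat_distrib(1,3))
        then show ?thesis unfolding eq using c by (intro eq_matI) (auto simp del: index_mult_mat(1))
      qed
      finally show "(1\<^sub>m n + t) * \<phi> = (?d + v) * (1\<^sub>m n + s)" .
      have "1\<^sub>m n + t - 1\<^sub>m n = t" "1\<^sub>m n + s - 1\<^sub>m n = s" using c by (auto intro!: eq_matI)
      then show "mat_in (C \<inter> W 1) (1\<^sub>m n + t - 1\<^sub>m n)" "mat_in (C \<inter> W 1) (1\<^sub>m n + s - 1\<^sub>m n)"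
        by (auto simp: mat_in_def mats C_closed(6,7)[OF eC] simp del: One_nat_def intro: W2 eW)
      have "?d + v - ?d = v" using c by (auto intro!: eq_matI)
      then show "(?d + v - ?d) $$ (i, j) \<in> W 2" "nu p i j ((?d + v - ?d) $$ (i, j)) = (?d + v - ?d) $$ (i, j)"
        if "i < n" "j < n" for i j using that
        by (auto simp: mats nu_fixed intro: sg_nu_ta_W(3) eW)
    qed (use c \<phi> in auto)
  qed (use closed C_closed W_ideal in auto)
qed

text \<open>In the normal form \<open>N = d + \<rho> + \<mu>\<close> the diagonal blocks \<open>\<rho>\<close> vanish. With \<open>K\<close> the deviation of
  the other half \<open>\<psi>\<close> of the factorization from the expected matrix \<open>d\<^sup>^ - \<mu>\<close>, where \<open>d d\<^sup>^ = x y\<close>,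
  the equation \<open>N \<psi> = x y - \<pi>\<close> becomes \<open>\<rho> d\<^sup>^ + d K + (\<pi> - \<mu>\<^sup>2) = \<rho> \<mu> - (\<rho> + \<mu>) K\<close>. The terms on the
  left do not interfere with each other, and the right-hand side is small; so the weights of \<open>\<rho>\<close> and
  \<open>K\<close> increase indefinitely.\<close>

lemma (in complete_algebra) normal_form_rigid:
  fixes N :: "'a fps fps mat"
  assumes N: "N \<in> carrier_mat n n"
    and N_W: "\<And>i j. i < n \<Longrightarrow> j < n \<Longrightarrow> (N - diag_xy p n) $$ (i, j) \<in> W 2"
    and N_nu: "\<And>i j. i < n \<Longrightarrow> j < n \<Longrightarrow> nu p i j ((N - diag_xy p n) $$ (i, j)) = (N - diag_xy p n) $$ (i, j)"
    and \<psi>: "\<psi> \<in> carrier_mat n n" "mat_in (W 1) \<psi>"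
    and eq: "N * \<psi> = (var_x * var_y - cst \<pi>) \<cdot>\<^sub>m 1\<^sub>m n"
  obtains \<mu> where "\<mu> \<in> carrier_mat n n" "N = diag_xy p n + \<mu>" "\<psi> = diag_yx p n - \<mu>"
    "\<mu> * \<mu> = cst \<pi> \<cdot>\<^sub>m 1\<^sub>m n"
    "\<And>i j. i < n \<Longrightarrow> j < n \<Longrightarrow> (i < p \<longleftrightarrow> j < p) \<Longrightarrow> \<mu> $$ (i, j) = 0"
    "\<And>i j. i < n \<Longrightarrow> j < n \<Longrightarrow> \<mu> $$ (i, j) = cst (cf (\<mu> $$ (i, j)) 0 0)"
    "\<And>i j. i < n \<Longrightarrow> j < n \<Longrightarrow> cf (\<mu> $$ (i, j)) 0 0 \<in> max_ideal"
proof -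
  let ?d = "diag_xy p n :: 'a fps fps mat" and ?d' = "diag_yx p n :: 'a fps fps mat"
  let ?on = "\<lambda>i j. i < p \<longleftrightarrow> j < p"
  define \<mu> where "\<mu> = mat n n (\<lambda>(i, j). if ?on i j then 0 else (N - ?d) $$ (i, j))"
  define \<rho> where "\<rho> = mat n n (\<lambda>(i, j). if ?on i j then (N - ?d) $$ (i, j) else 0)"
  define K where "K = \<psi> - (?d' - \<mu>)"
  have c: "\<mu> \<in> carrier_mat n n" "\<rho> \<in> carrier_mat n n" "K \<in> carrier_mat n n"
    using \<psi> by (auto simp: \<mu>_def \<rho>_def K_def)
  have N_eq: "N = ?d + \<rho> + \<mu>" using N by (intro eq_matI) (auto simp: \<rho>_def \<mu>_def)
  have \<psi>_eq: "\<psi> = ?d' - \<mu> + K" using \<psi> c by (intro eq_matI) (auto simp: K_def)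
  have \<mu>_W: "mat_in (W 2) \<mu>" and \<rho>_W: "mat_in (W 2) \<rho>"
    using N_W by (auto simp: mat_in_def \<mu>_def \<rho>_def W_ideal simp del: index_minus_mat)
  have \<mu>_cst: "\<mu> $$ (i, j) = cst (cf (\<mu> $$ (i, j)) 0 0)" if "i < n" "j < n" for i j
    using N_nu[OF that] that by (auto simp: \<mu>_def nu_def ops_cst simp del: index_minus_mat split: if_splits)
  have dd': "?d * ?d' = (var_x * var_y) \<cdot>\<^sub>m 1\<^sub>m n"
    by (intro eq_matI) (auto simp: diag_mult_entry diag_var_def diag_yx_def mult.commute simp del: index_mult_mat(1))
  have d\<mu>: "?d * \<mu> = \<mu> * ?d'"
    using c by (intro eq_matI) (auto simp: diag_mult_entry diag_var_def \<mu>_def mult.commute simp del: index_mult_mat(1))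
  define R where "R = \<rho> * \<mu> - (\<rho> + \<mu>) * K"
  have expand: "N * \<psi> = ?d * ?d' - ?d * \<mu> + ?d * K + (\<rho> * ?d' - \<rho> * \<mu> + \<rho> * K)
      + (\<mu> * ?d' - \<mu> * \<mu> + \<mu> * K)"
    unfolding N_eq \<psi>_eq using c by (simp add: mat_distrib) (rule eq_matI; simp del: index_mult_mat(1))
  have main: "(\<rho> * ?d') $$ (i, j) + (?d * K) $$ (i, j) + ((cst \<pi> \<cdot>\<^sub>m 1\<^sub>m n) $$ (i, j) - (\<mu> * \<mu>) $$ (i, j)) = R $$ (i, j)"
    if ij: "i < n" "j < n" for i j
  proof -
    have "(N * \<psi>) $$ (i, j) = (?d * ?d') $$ (i, j) - (?d * \<mu>) $$ (i, j) + (?d * K) $$ (i, j)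
        + ((\<rho> * ?d') $$ (i, j) - (\<rho> * \<mu>) $$ (i, j) + (\<rho> * K) $$ (i, j))
        + ((\<mu> * ?d') $$ (i, j) - (\<mu> * \<mu>) $$ (i, j) + (\<mu> * K) $$ (i, j))"
      unfolding expand using ij c by (simp del: index_mult_mat(1))
    moreover have "(cst \<pi> \<cdot>\<^sub>m 1\<^sub>m n) $$ (i, j) = (?d * ?d') $$ (i, j) - (N * \<psi>) $$ (i, j)"
      unfolding eq dd' using ij by (simp add: algebra_simps)
    moreover have "R $$ (i, j) = (\<rho> * \<mu>) $$ (i, j) - ((\<rho> * K) $$ (i, j) + (\<mu> * K) $$ (i, j))"
      unfolding R_def using ij c by (simp add: mat_distrib(3) del: index_mult_mat(1))
    ultimately show ?thesis unfolding d\<mu> by (simp only:) (simp add: algebra_simps)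
  qed
  have \<mu>\<mu>: "(cst \<pi> \<cdot>\<^sub>m 1\<^sub>m n) $$ (i, j) - (\<mu> * \<mu>) $$ (i, j)
      = (if ?on i j then cst (cf ((cst \<pi> \<cdot>\<^sub>m 1\<^sub>m n) $$ (i, j) - (\<mu> * \<mu>) $$ (i, j)) 0 0) else 0)"
    if ij: "i < n" "j < n" for i j
  proof (cases "?on i j")
    case True
    have "(\<mu> * \<mu>) $$ (i, j) = (\<Sum>k<n. \<mu> $$ (i, k) * \<mu> $$ (k, j))" using ij c by (simp add: mult_entry del: index_mult_mat(1))
    also have "\<dots> = (\<Sum>k<n. cst (cf (\<mu> $$ (i, k)) 0 0 * cf (\<mu> $$ (k, j)) 0 0))"
      using ij \<mu>_cst by (intro sum.cong refl) (simp add: cst_mult)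
    also have "\<dots> = cst (\<Sum>k<n. cf (\<mu> $$ (i, k)) 0 0 * cf (\<mu> $$ (k, j)) 0 0)"
      by (rule cst_sum[symmetric])
    finally have *: "(\<mu> * \<mu>) $$ (i, j) = cst (\<Sum>k<n. cf (\<mu> $$ (i, k)) 0 0 * cf (\<mu> $$ (k, j)) 0 0)" .
    have "(cst \<pi> \<cdot>\<^sub>m 1\<^sub>m n) $$ (i, j) = cst (if i = j then \<pi> else 0)" using ij by simp
    then show ?thesis unfolding * using True by (simp add: cst_diff[symmetric] ops_cst)
  next
    case False
    have "(\<mu> * \<mu>) $$ (i, j) = (\<Sum>k<n. \<mu> $$ (i, k) * \<mu> $$ (k, j))" using ij c by (simp add: mult_entry del: index_mult_mat(1))
    also have "\<dots> = 0" using ij False by (intro sum.neutral) (auto simp: \<mu>_def)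
    finally show ?thesis using ij False by auto
  qed
  have step: "mat_in (W (Suc m)) \<rho> \<and> mat_in (W (Suc m)) K" if m: "mat_in (W m) \<rho>" "mat_in (W m) K" for m
  proof -
    have "mat_in (W (m + 2)) (\<rho> * \<mu>)" "mat_in (W (2 + m)) ((\<rho> + \<mu>) * K)"
      using c by (intro mat_in_W_mult mat_in_W_add m \<mu>_W \<rho>_W; simp)+
    then have R: "mat_in (W (Suc (Suc m))) R" unfolding R_def using c by (intro mat_in_W_add) auto
    have "\<rho> $$ (i, j) \<in> W (Suc m) \<and> K $$ (i, j) \<in> W (Suc m)" if ij: "i < n" "j < n" for i j
    proof -
      let ?r = "\<rho> $$ (i, j)" and ?k = "K $$ (i, j)"
      define z where "z = (if ?on i j then cf ((cst \<pi> \<cdot>\<^sub>m 1\<^sub>m n) $$ (i, j) - (\<mu> * \<mu>) $$ (i, j)) 0 0 else 0)"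
      have "R $$ (i, j) \<in> W (Suc (Suc m))" using ij c by (intro mat_inD[OF R]) (auto simp: R_def)
      moreover have "R $$ (i, j) = ?r * (if j < p then var_y else var_x) + diag_var p i * ?k + cst z"
        using main[OF ij] \<mu>\<mu>[OF ij] diag_mult_entry(4)[OF c(2) ij, of p] diag_mult_entry(1)[OF c(3) ij, of p]
        by (auto simp: z_def split: if_splits)
      ultimately have *: "?r * (if j < p then var_y else var_x) + diag_var p i * ?k + cst z \<in> W (Suc (Suc m))" by simp
      have r_nu: "?on i j \<Longrightarrow> ?r = (if i < p then at_x0 ?r else at_y0 ?r)" "\<not> ?on i j \<Longrightarrow> ?r = 0"
        using N_nu[OF ij] ij by (auto simp: \<rho>_def nu_def simp del: index_minus_mat)
      have z0: "\<not> ?on i j \<Longrightarrow> z = 0" by (simp add: z_def)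
      consider (xx) "i < p" "j < p" | (yy) "\<not> i < p" "\<not> j < p" | (xy) "i < p" "\<not> j < p" | (yx) "\<not> i < p" "j < p"
        by blast
      then show ?thesis
      proof cases
        case xx
        then have r: "?r = at_x0 ?r" using r_nu by simp
        have Dr: "Dx ?r = 0" by (subst r) (auto intro!: cf_ext)
        have "var_y * ?r + var_x * ?k + cst z \<in> W (Suc (Suc m))" using * xx by (simp add: diag_var_def mult.commute)
        from ops_W(1)[OF this] ops_W(3)[OF this] show ?thesis
          using r by (simp add: ops_add ops_var_mult ops_cst Dr)
      next
        case yy
        then have r: "?r = at_y0 ?r" using r_nu by simp
        have Er: "Ey (var_x * ?r) = 0" by (subst r) (auto intro!: cf_ext simp: cf_var_x_mult)
        have 1: "var_x * ?r + var_y * ?k + cst z \<in> W (Suc (Suc m))" using * yy by (simp add: diag_var_def mult.commute)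
        from ops_W(2)[OF this] have k: "?k \<in> W (Suc m)" by (simp add: ops_add ops_var_mult ops_cst Er)
        have "(var_x * ?r + var_y * ?k + cst z) - var_y * ?k \<in> W (Suc (Suc m))"
          using W_mult[OF var_W(2) k] by (intro W_ideal(4)[OF 1]) simp
        from ops_W(1)[OF this] have "?r \<in> W (Suc m)" by (simp add: ops_add ops_diff ops_var_mult ops_cst)
        with k show ?thesis by blast
      next
        case xy
        then have "var_x * ?k \<in> W (Suc (Suc m))" using * r_nu(2) z0 by (simp add: diag_var_def)
        from ops_W(1)[OF this] show ?thesis using xy r_nu(2) by (simp add: ops_var_mult W_ideal)
      next
        case yx
        then have "var_y * ?k \<in> W (Suc (Suc m))" using * r_nu(2) z0 by (simp add: diag_var_def)
        from ops_W(2)[OF this] show ?thesis using yx r_nu(2) by (simp add: ops_var_mult W_ideal)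
      qed
    qed
    then show ?thesis using c by (auto simp: mat_in_def)
  qed
  have "mat_in (W 1) ?d'" using var_W by (auto simp: mat_in_def diag_yx_def W_ideal)
  then have "mat_in (W 1) K"
    unfolding K_def using \<psi> c mat_in_W_anti[OF \<mu>_W, of 1] by (intro mat_in_W_add) auto
  then have "mat_in (W (Suc m)) \<rho> \<and> mat_in (W (Suc m)) K" for m
  proof (induction m)
    case 0 then show ?case using mat_in_W_anti[OF \<rho>_W, of 1] by simp
  next
    case (Suc m) then show ?case by (intro step) auto
  qed
  then have all: "mat_in (W m) \<rho>" "mat_in (W m) K" for m
    using mat_in_W_anti[of "Suc m" \<rho> m] mat_in_W_anti[of "Suc m" K m] by auto
  have zero: "A = 0\<^sub>m n n" if "\<And>m. mat_in (W m) A" "A \<in> carrier_mat n n" for A :: "'a fps fps mat"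
  proof (rule eq_matI)
    fix i j assume ij: "i < dim_row (0\<^sub>m n n)" "j < dim_col (0\<^sub>m n n)"
    then have "A $$ (i, j) \<in> W m" for m using that by (intro mat_inD) auto
    from W_separated[OF this] show "A $$ (i, j) = 0\<^sub>m n n $$ (i, j)" using ij by simp
  qed (use that in auto)
  have \<rho>0: "\<rho> = 0\<^sub>m n n" and K0: "K = 0\<^sub>m n n" using zero all c by auto
  show ?thesis
  proof (rule that[of \<mu>])
    show "N = ?d + \<mu>" unfolding N_eq \<rho>0 using c by simp
    show "\<psi> = ?d' - \<mu>" unfolding \<psi>_eq K0 using c by (intro eq_matI) auto
    show "\<mu> * \<mu> = cst \<pi> \<cdot>\<^sub>m 1\<^sub>m n"
    proof (rule eq_matI)
      fix i j assume "i < dim_row (cst \<pi> \<cdot>\<^sub>m 1\<^sub>m n)" "j < dim_col (cst \<pi> \<cdot>\<^sub>m 1\<^sub>m n)"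
      then have ij: "i < n" "j < n" by auto
      have "R = 0\<^sub>m n n" unfolding R_def \<rho>0 K0 using c by simp
      moreover have "\<rho> * ?d' = 0\<^sub>m n n" "?d * K = 0\<^sub>m n n" unfolding \<rho>0 K0 by simp_all
      ultimately show "(\<mu> * \<mu>) $$ (i, j) = (cst \<pi> \<cdot>\<^sub>m 1\<^sub>m n) $$ (i, j)" using main[OF ij] ij
        by (simp del: index_mult_mat(1) index_smult_mat)
    qed (use c in auto)
    show "\<mu> $$ (i, j) = 0" if "i < n" "j < n" "i < p \<longleftrightarrow> j < p" for i j
      using that by (simp add: \<mu>_def)
    show "cf (\<mu> $$ (i, j)) 0 0 \<in> max_ideal" if "i < n" "j < n" for i j
      using mat_inD[OF \<mu>_W, of i j] that c by (simp add: W2_iff)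
  qed (use c \<mu>_cst in auto)
qed

section \<open>Morphisms of matrix factorizations\<close>

definition mf_shape :: "'a mat2 \<Rightarrow> bool" where
  "mf_shape M \<longleftrightarrow> snd M \<in> carrier_mat (rk0 M) (rk1 M)"

lemma fst_carrier: "fst M \<in> carrier_mat (rk1 M) (rk0 M)"
  by (simp add: rk0_def rk1_def)

lemma is_mf_shape: "is_mf w M \<Longrightarrow> mf_shape M"
  by (simp add: is_mf_def mf_shape_def)

lemma mf_hom_iff:
  assumes "mf_shape M" "mf_shape (N :: 'a::comm_ring_1 mat2)"
  shows "f \<in> mf_hom M N \<longleftrightarrow>
    fst f \<in> carrier_mat (rk0 N) (rk0 M) \<and> snd f \<in> carrier_mat (rk1 N) (rk1 M) \<and>
    fst N * fst f = snd f * fst M \<and> snd N * snd f = fst f * snd M"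
proof -
  have c: "fst M \<in> carrier_mat (rk1 M) (rk0 M)" "fst N \<in> carrier_mat (rk1 N) (rk0 N)"
    "snd M \<in> carrier_mat (rk0 M) (rk1 M)" "snd N \<in> carrier_mat (rk0 N) (rk1 N)"
    using assms by (auto simp: fst_carrier mf_shape_def)
  have "D_even M N f = (0\<^sub>m (rk1 N) (rk0 M), 0\<^sub>m (rk0 N) (rk1 M)) \<longleftrightarrow>
      fst N * fst f = snd f * fst M \<and> snd N * snd f = fst f * snd M"
    if f: "fst f \<in> carrier_mat (rk0 N) (rk0 M)" "snd f \<in> carrier_mat (rk1 N) (rk1 M)"
  proof -
    have m: "fst N * fst f \<in> carrier_mat (rk1 N) (rk0 M)" "snd f * fst M \<in> carrier_mat (rk1 N) (rk0 M)"
      "snd N * snd f \<in> carrier_mat (rk0 N) (rk1 M)" "fst f * snd M \<in> carrier_mat (rk0 N) (rk1 M)"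
      using c f by simp_all
    show ?thesis
      using mat_eq_if_diff_zero[OF _ m(1,2)] mat_eq_if_diff_zero[OF _ m(3,4)] m
      unfolding D_even_def by auto
  qed
  then show ?thesis
    unfolding mf_hom_def even_maps_def by (cases f) auto
qed

lemma mf_iso_iff:
  assumes "mf_shape M" "mf_shape (N :: 'a::comm_ring_1 mat2)" "rk0 M = n0" "rk0 N = n0" "rk1 M = n1" "rk1 N = n1"
  shows "mf_iso M N f \<longleftrightarrow>
    fst f \<in> carrier_mat n0 n0 \<and> snd f \<in> carrier_mat n1 n1 \<and>
    fst N * fst f = snd f * fst M \<and> snd N * snd f = fst f * snd M \<and>
    invertible_mat (fst f) \<and> invertible_mat (snd f)"
  unfolding mf_iso_def mf_hom_iff[OF assms(1,2)] assms(3-6) by auto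

lemma four_block_inject:
  assumes "four_block_mat A B C D = four_block_mat A' B' C' D'"
    and "A \<in> carrier_mat m n" "B \<in> carrier_mat m n'" "C \<in> carrier_mat m' n" "D \<in> carrier_mat m' n'"
    and "A' \<in> carrier_mat m n" "B' \<in> carrier_mat m n'" "C' \<in> carrier_mat m' n" "D' \<in> carrier_mat m' n'"
  shows "A = A'" "B = B'" "C = C'" "D = D'"
proof -
  have *: "four_block_mat A B C D $$ (i, j) = four_block_mat A' B' C' D' $$ (i, j)" for i j
    using assms(1) by simp
  show "A = A'"
  proof (rule eq_matI)
    fix i j assume "i < dim_row A'" "j < dim_col A'"
    then show "A $$ (i, j) = A' $$ (i, j)" using *[of i j] assms(2-) by auto
  qed (use assms in auto)
  show "B = B'"
  proof (rule eq_matI)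
    fix i j assume "i < dim_row B'" "j < dim_col B'"
    then show "B $$ (i, j) = B' $$ (i, j)" using *[of i "n + j"] assms(2-) by auto
  qed (use assms in auto)
  show "C = C'"
  proof (rule eq_matI)
    fix i j assume "i < dim_row C'" "j < dim_col C'"
    then show "C $$ (i, j) = C' $$ (i, j)" using *[of "m + i" j] assms(2-) by auto
  qed (use assms in auto)
  show "D = D'"
  proof (rule eq_matI)
    fix i j assume "i < dim_row D'" "j < dim_col D'"
    then show "D $$ (i, j) = D' $$ (i, j)" using *[of "m + i" "n + j"] assms(2-) by auto
  qed (use assms in auto)
qed

lemma map_cst_mult:
  assumes "dim_col A = dim_row B"
  shows "map_mat cst (A * B) = map_mat cst A * map_mat cst (B :: 'a::comm_ring_1 mat)"
  by (rule semiring_hom.mat_hom_mult[of cst A "dim_row A" "dim_row B" B "dim_col B"])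
    (use assms comm_ring_hom.axioms(1)[OF cst_hom] ring_hom.axioms(1) in auto)

lemma map_cst_inject: "map_mat cst A = map_mat cst B \<Longrightarrow> A = (B :: 'a::comm_ring_1 mat)"
proof (rule eq_matI)
  assume *: "map_mat cst A = map_mat cst B"
  show d: "dim_row A = dim_row B" "dim_col A = dim_col B"
    using arg_cong[OF *, of dim_row] arg_cong[OF *, of dim_col] by simp_all
  fix i j assume "i < dim_row B" "j < dim_col B"
  then have "cst (A $$ (i, j)) = cst (B $$ (i, j))"
    using arg_cong[OF *, of "\<lambda>X. X $$ (i, j)"] d by simp
  from arg_cong[OF this, of "\<lambda>f. cf f 0 0"] show "A $$ (i, j) = B $$ (i, j)" by (simp add: ops_cst)
qed

lemma map_cst_smult_one: "map_mat cst (c \<cdot>\<^sub>m 1\<^sub>m n) = cst (c :: 'a::comm_ring_1) \<cdot>\<^sub>m 1\<^sub>m n"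
  by (rule eq_matI) auto

lemma theta_rk:
  assumes "P \<in> carrier_mat n1 n0" "Q \<in> carrier_mat n0 n1"
  shows "rk0 (theta (P, Q)) = n1 + n0" "rk1 (theta (P, Q)) = n1 + n0"
    "fst (theta (P, Q)) \<in> carrier_mat (n1 + n0) (n1 + n0)"
    "snd (theta (P, Q)) \<in> carrier_mat (n1 + n0) (n1 + n0)" "mf_shape (theta (P, Q))"
  using assms by (auto simp: theta_explicit rk0_def rk1_def mf_shape_def)

lemma is_mf_theta:
  assumes P: "P \<in> carrier_mat n1 n0" "Q \<in> carrier_mat n0 n1" and mf: "is_mf \<pi> (P, Q)"
  shows "is_mf (var_x * var_y - cst \<pi>) (theta (P, Q))"
proof -
  let ?P = "map_mat cst P" and ?Q = "map_mat cst Q"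
  have "P * Q = \<pi> \<cdot>\<^sub>m 1\<^sub>m n1" "Q * P = \<pi> \<cdot>\<^sub>m 1\<^sub>m n0"
    using mf P by (simp_all add: is_mf_def rk0_def rk1_def)
  then have PQ: "?P * ?Q = cst \<pi> \<cdot>\<^sub>m 1\<^sub>m n1" "?Q * ?P = cst \<pi> \<cdot>\<^sub>m 1\<^sub>m n0"
    using P by (simp_all add: map_cst_mult[symmetric] map_cst_smult_one)
  have "snd (theta (P, Q)) * fst (theta (P, Q)) = (var_x * var_y - cst \<pi>) \<cdot>\<^sub>m 1\<^sub>m (n1 + n0)"
    unfolding theta_explicit[OF P] fst_conv snd_conv
    by (subst mult_four_block_mat[of _ n1 n1 _ n0 _ n0 _ _ n1 _ n0])
      (use P PQ in \<open>auto simp: mat_smult mat_one algebra_simps intro!: eq_matI simp del: index_mult_mat(1)\<close>)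
  moreover have "fst (theta (P, Q)) * snd (theta (P, Q)) = (var_x * var_y - cst \<pi>) \<cdot>\<^sub>m 1\<^sub>m (n1 + n0)"
    unfolding theta_explicit[OF P] fst_conv snd_conv
    by (subst mult_four_block_mat[of _ n1 n1 _ n0 _ n0 _ _ n1 _ n0])
      (use P PQ in \<open>auto simp: mat_smult mat_one algebra_simps intro!: eq_matI simp del: index_mult_mat(1)\<close>)
  ultimately show ?thesis
    using theta_rk[OF P] by (simp add: is_mf_def)
qed

lemma (in complete_algebra) mf_normal_form:
  assumes mf: "is_mf (var_x * var_y - cst \<pi>) M" and n: "fst M \<in> carrier_mat n n" "n = p + q"
    and C: "C = UNIV \<or> C = (coeffs_in_m :: 'a fps fps set)"
    and near: "mat_in (C \<inter> W 2) (fst M - diag_xy p n)" "mat_in (W 1) (snd M)"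
  obtains P Q f where "P \<in> carrier_mat p q" "Q \<in> carrier_mat q p"
    "mat_in max_ideal P" "mat_in max_ideal Q" "is_mf \<pi> (P, Q)" "mf_iso M (theta (P, Q)) f"
    "mat_in C (fst f - 1\<^sub>m n)" "mat_in C (snd f - 1\<^sub>m n)"
proof -
  obtain T S N where c: "T \<in> carrier_mat n n" "S \<in> carrier_mat n n" "N \<in> carrier_mat n n"
    and TN: "T * fst M = N * S" and T1: "mat_in (C \<inter> W 1) (T - 1\<^sub>m n)" and S1: "mat_in (C \<inter> W 1) (S - 1\<^sub>m n)"
    and N: "\<And>i j. i < n \<Longrightarrow> j < n \<Longrightarrow> (N - diag_xy p n) $$ (i, j) \<in> W 2"
      "\<And>i j. i < n \<Longrightarrow> j < n \<Longrightarrow> nu p i j ((N - diag_xy p n) $$ (i, j)) = (N - diag_xy p n) $$ (i, j)"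
    using matrix_normal_form[OF n(1) C near(1)] by metis
  let ?w = "var_x * var_y - cst \<pi>"
  have rk: "rk0 M = n" "rk1 M = n" using n by (auto simp: rk0_def rk1_def)
  have M: "snd M \<in> carrier_mat n n" "fst M * snd M = ?w \<cdot>\<^sub>m 1\<^sub>m n" "snd M * fst M = ?w \<cdot>\<^sub>m 1\<^sub>m n"
    using mf by (simp_all add: is_mf_def rk)
  have inv: "invertible_mat T" "invertible_mat S"
    using T1 S1 c by (auto intro!: invertible_one_plus_W1 simp: mat_in_def simp del: index_minus_mat)
  then obtain T' where T': "T' \<in> carrier_mat n n" "T * T' = 1\<^sub>m n" "T' * T = 1\<^sub>m n"
    using invertible_mat_iff[OF c(1)] by blast
  define \<psi> where "\<psi> = S * snd M * T'"
  have \<psi>: "\<psi> \<in> carrier_mat n n" using c M T' by (simp add: \<psi>_def)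
  have "mat_in (W (0 + 1 + 0)) \<psi>"
    unfolding \<psi>_def using c M T' near(2) by (intro mat_in_W_mult) (auto simp: mat_in_def simp del: One_nat_def)
  then have \<psi>_W: "mat_in (W 1) \<psi>" by simp
  have "N * \<psi> = (N * S) * snd M * T'" unfolding \<psi>_def using c M T' by (simp add: mat_assoc)
  also have "\<dots> = T * (fst M * snd M) * T'" unfolding TN[symmetric] using c M n T' by (simp add: mat_assoc)
  also have "\<dots> = ?w \<cdot>\<^sub>m 1\<^sub>m n" unfolding M using c T' by (simp add: mat_smult)
  finally have N\<psi>: "N * \<psi> = ?w \<cdot>\<^sub>m 1\<^sub>m n" .
  obtain \<mu> where \<mu>: "\<mu> \<in> carrier_mat n n" and N_eq: "N = diag_xy p n + \<mu>" and \<psi>_eq: "\<psi> = diag_yx p n - \<mu>"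
    and \<mu>\<mu>: "\<mu> * \<mu> = cst \<pi> \<cdot>\<^sub>m 1\<^sub>m n"
    and on: "\<And>i j. i < n \<Longrightarrow> j < n \<Longrightarrow> (i < p \<longleftrightarrow> j < p) \<Longrightarrow> \<mu> $$ (i, j) = 0"
    and cst: "\<And>i j. i < n \<Longrightarrow> j < n \<Longrightarrow> cst (cf (\<mu> $$ (i, j)) 0 0) = \<mu> $$ (i, j)"
    and m: "\<And>i j. i < n \<Longrightarrow> j < n \<Longrightarrow> cf (\<mu> $$ (i, j)) 0 0 \<in> max_ideal"
    using normal_form_rigid[OF c(3) N \<psi> \<psi>_W N\<psi>] by metis
  define P where "P = mat p q (\<lambda>(i, j). cf (\<mu> $$ (i, p + j)) 0 0)"
  define Q where "Q = mat q p (\<lambda>(i, j). cf (\<mu> $$ (p + i, j)) 0 0)"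
  have PQ: "P \<in> carrier_mat p q" "Q \<in> carrier_mat q p" by (simp_all add: P_def Q_def)
  have \<mu>_block: "\<mu> = four_block_mat (0\<^sub>m p p) (map_mat cst P) (map_mat cst Q) (0\<^sub>m q q)"
    using \<mu> n(2) on cst by (intro eq_matI) (auto simp: P_def Q_def)
  have "four_block_mat (map_mat cst P * map_mat cst Q) (0\<^sub>m p q) (0\<^sub>m q p) (map_mat cst Q * map_mat cst P)
      = four_block_mat (cst \<pi> \<cdot>\<^sub>m 1\<^sub>m p) (0\<^sub>m p q) (0\<^sub>m q p) (cst \<pi> \<cdot>\<^sub>m 1\<^sub>m q)"
  proof -
    have "\<mu> * \<mu> = four_block_mat (map_mat cst P * map_mat cst Q) (0\<^sub>m p q) (0\<^sub>m q p) (map_mat cst Q * map_mat cst P)"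
      unfolding \<mu>_block by (subst mult_four_block_mat[of _ p p _ q _ q _ _ p _ q]) (use PQ in auto)
    moreover have "cst \<pi> \<cdot>\<^sub>m 1\<^sub>m n = four_block_mat (cst \<pi> \<cdot>\<^sub>m 1\<^sub>m p) (0\<^sub>m p q) (0\<^sub>m q p) (cst \<pi> \<cdot>\<^sub>m 1\<^sub>m q)"
      using n(2) by (intro eq_matI) auto
    ultimately show ?thesis using \<mu>\<mu> by simp
  qed
  from four_block_inject(1)[OF this, of p p q q] four_block_inject(4)[OF this, of p p q q] PQ
  have "map_mat cst (P * Q) = map_mat cst (\<pi> \<cdot>\<^sub>m 1\<^sub>m p)" "map_mat cst (Q * P) = map_mat cst (\<pi> \<cdot>\<^sub>m 1\<^sub>m q)"
    by (simp_all add: map_cst_mult map_cst_smult_one)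
  then have "P * Q = \<pi> \<cdot>\<^sub>m 1\<^sub>m p" "Q * P = \<pi> \<cdot>\<^sub>m 1\<^sub>m q" by (blast intro: map_cst_inject)+
  then have mf_PQ: "is_mf \<pi> (P, Q)" using PQ by (simp add: is_mf_def rk0_def rk1_def)
  have fst_theta: "fst (theta (P, Q)) = N"
    unfolding theta_explicit[OF PQ] N_eq \<mu>_block using PQ n(2)
    by (intro eq_matI) (auto simp: diag_xy_def diag_var_def)
  have snd_theta: "snd (theta (P, Q)) = \<psi>"
    unfolding theta_explicit[OF PQ] \<psi>_eq \<mu>_block using PQ n(2)
    by (intro eq_matI) (auto simp: diag_yx_def)
  have "mf_iso M (theta (P, Q)) (S, T)"
  proof (subst mf_iso_iff[of M "theta (P, Q)" n n])
    have "\<psi> * T = S * snd M" unfolding \<psi>_def using c M T' by (simp add: mat_assoc)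
    then show "fst (S, T) \<in> carrier_mat n n \<and> snd (S, T) \<in> carrier_mat n n \<and>
      fst (theta (P, Q)) * fst (S, T) = snd (S, T) * fst M \<and>
      snd (theta (P, Q)) * snd (S, T) = fst (S, T) * snd M \<and>
      invertible_mat (fst (S, T)) \<and> invertible_mat (snd (S, T))"
      using c inv TN by (simp add: fst_theta snd_theta)
  qed (use theta_rk[OF PQ] rk n is_mf_shape[OF mf] in auto)
  moreover have "mat_in max_ideal P" "mat_in max_ideal Q"
    using m n(2) by (auto simp: mat_in_def P_def Q_def)
  ultimately show ?thesis using that PQ mf_PQ T1 S1
    by (auto simp: mat_in_def simp del: index_minus_mat)
qed

section \<open>Change of rings\<close>

lemma map_hom_mult:
  assumes "comm_ring_hom h" "dim_col A = dim_row B"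
  shows "map_mat h (A * B) = map_mat h A * map_mat h (B :: 'a::comm_ring_1 mat)"
  by (rule semiring_hom.mat_hom_mult[of h A "dim_row A" "dim_row B" B "dim_col B"])
    (use assms comm_ring_hom.axioms(1) ring_hom.axioms(1) in auto)

lemma map_hom_simps:
  assumes "comm_ring_hom h"
  shows "map_mat h (1\<^sub>m n) = 1\<^sub>m n" "map_mat h (0\<^sub>m m n) = 0\<^sub>m m n"
    "map_mat h (c \<cdot>\<^sub>m A) = h c \<cdot>\<^sub>m map_mat h A" "map_mat h (- A) = - map_mat h A"
    "dim_row A = dim_row B \<Longrightarrow> dim_col A = dim_col B \<Longrightarrow> map_mat h (A - B) = map_mat h A - map_mat h B"
    "dim_row A = dim_row B \<Longrightarrow> dim_col A = dim_col B \<Longrightarrow> map_mat h (A + B) = map_mat h A + map_mat h B"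
    "map_mat h (transpose_mat A) = transpose_mat (map_mat h A)"
proof -
  interpret comm_ring_hom h by (rule assms)
  show "map_mat h (1\<^sub>m n) = 1\<^sub>m n" "map_mat h (0\<^sub>m m n) = 0\<^sub>m m n"
    "map_mat h (c \<cdot>\<^sub>m A) = h c \<cdot>\<^sub>m map_mat h A" "map_mat h (- A) = - map_mat h A"
    "map_mat h (transpose_mat A) = transpose_mat (map_mat h A)"
    by (auto intro!: eq_matI simp: hom_mult hom_uminus)
  show "dim_row A = dim_row B \<Longrightarrow> dim_col A = dim_col B \<Longrightarrow> map_mat h (A - B) = map_mat h A - map_mat h B"
    "dim_row A = dim_row B \<Longrightarrow> dim_col A = dim_col B \<Longrightarrow> map_mat h (A + B) = map_mat h A + map_mat h B"
    by (auto intro!: eq_matI simp: hom_minus hom_add)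
qed

lemma map2_simps [simp]:
  "fst (map2 h M) = map_mat h (fst M)" "snd (map2 h M) = map_mat h (snd M)"
  "rk0 (map2 h M) = rk0 M" "rk1 (map2 h M) = rk1 M"
  by (simp_all add: map2_def rk0_def rk1_def)

lemma mf_shape_map2 [simp]: "mf_shape (map2 h M) \<longleftrightarrow> mf_shape M"
  by (simp add: mf_shape_def)

lemma is_mf_map2:
  assumes h: "comm_ring_hom h" and mf: "is_mf w M"
  shows "is_mf (h w) (map2 h M)"
proof -
  have M: "fst M \<in> carrier_mat (rk1 M) (rk0 M)" "snd M \<in> carrier_mat (rk0 M) (rk1 M)"
    using mf by (auto simp: is_mf_def fst_carrier)
  have "map_mat h (snd M * fst M) = h w \<cdot>\<^sub>m 1\<^sub>m (rk0 M)" "map_mat h (fst M * snd M) = h w \<cdot>\<^sub>m 1\<^sub>m (rk1 M)"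
    using mf by (simp_all add: is_mf_def map_hom_simps[OF h])
  then show ?thesis using M by (simp add: is_mf_def map_hom_mult[OF h])
qed

lemma invertible_map_mat:
  assumes h: "comm_ring_hom h" and A: "A \<in> carrier_mat n n" "invertible_mat A"
  shows "invertible_mat (map_mat h A)"
proof -
  obtain B where B: "B \<in> carrier_mat n n" "A * B = 1\<^sub>m n" "B * A = 1\<^sub>m n"
    using A invertible_mat_iff by blast
  have "map_mat h A * map_mat h B = 1\<^sub>m n" "map_mat h B * map_mat h A = 1\<^sub>m n"
    using map_hom_mult[OF h, of A B] map_hom_mult[OF h, of B A] A B by (simp_all add: map_hom_simps[OF h])
  then show ?thesis using A B by (subst invertible_mat_iff[of _ n]) auto
qed

lemma mf_iso_map2:
  assumes h: "comm_ring_hom h" and M: "mf_shape M" "mf_shape N" "rk0 M = n0" "rk0 N = n0" "rk1 M = n1" "rk1 N = n1"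
    and f: "mf_iso M N f"
  shows "mf_iso (map2 h M) (map2 h N) (map2 h f)"
proof -
  have c: "fst M \<in> carrier_mat n1 n0" "snd M \<in> carrier_mat n0 n1" "fst N \<in> carrier_mat n1 n0" "snd N \<in> carrier_mat n0 n1"
    using M fst_carrier[of M] fst_carrier[of N] by (auto simp: mf_shape_def)
  have f': "fst f \<in> carrier_mat n0 n0" "snd f \<in> carrier_mat n1 n1"
    "fst N * fst f = snd f * fst M" "snd N * snd f = fst f * snd M"
    "invertible_mat (fst f)" "invertible_mat (snd f)"
    using f mf_iso_iff[OF M] by auto
  have "map_mat h (fst N * fst f) = map_mat h (snd f * fst M)" "map_mat h (snd N * snd f) = map_mat h (fst f * snd M)"
    using f' by simp_all
  then have "map_mat h (fst N) * map_mat h (fst f) = map_mat h (snd f) * map_mat h (fst M)"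
    "map_mat h (snd N) * map_mat h (snd f) = map_mat h (fst f) * map_mat h (snd M)"
    using c f'(1,2) by (simp_all add: map_hom_mult[OF h])
  then show ?thesis
    using f' invertible_map_mat[OF h f'(1,5)] invertible_map_mat[OF h f'(2,6)]
    by (subst mf_iso_iff[of _ _ n0 n1]) (use M in auto)
qed

section \<open>Deformations without forms\<close>

lemma Mbar_eq: "Mbar r = (diag_xy r (r + r), diag_yx r (r + r))"
  unfolding Mbar_def diag_block_def
  by (auto intro!: eq_matI simp: diag_xy_def diag_yx_def diag_var_def)

lemma theta_zero: "theta (0\<^sub>m r r, 0\<^sub>m r r) = Mbar r"
proof -
  have "map_mat cst (0\<^sub>m r r) = 0\<^sub>m r r" by (rule eq_matI) auto
  then show ?thesis
    by (subst theta_explicit[of _ r r]) (auto simp: Mbar_def diag_block_def uminus_zero_mat)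
qed

lemma (in complete_algebra) red_mat_eq_iff:
  assumes "A \<in> carrier_mat m n" "B \<in> carrier_mat m n"
  shows "map_mat (red \<iota>) A = map_mat (red \<iota>) B \<longleftrightarrow> mat_in coeffs_in_m (A - B)"
proof
  assume *: "map_mat (red \<iota>) A = map_mat (red \<iota>) B"
  have "A $$ (i, j) - B $$ (i, j) \<in> coeffs_in_m" if "i < m" "j < n" for i j
    using arg_cong[OF *, of "\<lambda>X. X $$ (i, j)"] that assms by (simp add: red_eq_iff)
  then show "mat_in coeffs_in_m (A - B)" using assms by (auto simp: mat_in_def)
next
  assume *: "mat_in coeffs_in_m (A - B)"
  show "map_mat (red \<iota>) A = map_mat (red \<iota>) B"
    using assms * by (intro eq_matI) (auto simp: mat_in_def red_eq_iff)
qed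

lemma (in complete_algebra) deformation_normal_form:
  assumes "is_deformation \<iota> r M"
  obtains \<alpha> \<pi> P Q f where "gauge_aut \<iota> \<alpha>" "\<pi> \<in> max_ideal" "P \<in> carrier_mat r r" "Q \<in> carrier_mat r r"
    "mat_in max_ideal P" "mat_in max_ideal Q" "is_mf \<pi> (P, Q)" "mf_iso (map2 \<alpha> M) (theta (P, Q)) f"
    "map2 (red \<iota>) f = mf_id (Mbar r)" "mf_shape (map2 \<alpha> M)" "rk0 M = r + r" "rk1 M = r + r"
proof -
  obtain \<omega> where \<omega>: "red \<iota> \<omega> = var_x * var_y" "is_mf \<omega> M" and M: "map2 (red \<iota>) M = Mbar r"
    using assms unfolding is_deformation_def by blast
  obtain \<alpha> \<pi> where \<alpha>: "gauge_aut \<iota> \<alpha>" and \<pi>: "\<pi> \<in> max_ideal" and \<alpha>\<omega>: "\<alpha> \<omega> = var_x * var_y - cst \<pi>"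
    using normalize_potential[OF \<omega>(1)] by blast
  have \<alpha>_hom: "comm_ring_hom \<alpha>" and \<alpha>_red: "red \<iota> (\<alpha> f) = red \<iota> f" for f
    using \<alpha> by (simp_all add: gauge_aut_def)
  let ?n = "r + r"
  have rk: "rk0 M = ?n" "rk1 M = ?n"
    using arg_cong[OF M, of rk0] arg_cong[OF M, of rk1] by (simp_all add: Mbar_eq rk0_def rk1_def)
  have c: "fst M \<in> carrier_mat ?n ?n" "snd M \<in> carrier_mat ?n ?n"
    using fst_carrier[of M] is_mf_shape[OF \<omega>(2)] by (simp_all add: rk mf_shape_def)
  have d: "map_mat (red \<iota>) (diag_xy r ?n) = diag_xy r ?n" "map_mat (red \<iota>) (diag_yx r ?n) = diag_yx r ?n"
  proof -
    interpret red: comm_ring_hom "red \<iota>" by (rule red_hom)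
    show "map_mat (red \<iota>) (diag_xy r ?n) = diag_xy r ?n" "map_mat (red \<iota>) (diag_yx r ?n) = diag_yx r ?n"
      by (auto intro!: eq_matI simp: diag_xy_def diag_yx_def diag_var_def)
  qed
  let ?M = "map2 \<alpha> M"
  have comp: "map_mat (red \<iota>) (map_mat \<alpha> X) = map_mat (red \<iota>) X" for X
    by (rule eq_matI) (auto simp: \<alpha>_red)
  have red_fst: "map_mat (red \<iota>) (map_mat \<alpha> (fst M)) = map_mat (red \<iota>) (diag_xy r ?n)"
    and red_snd: "map_mat (red \<iota>) (map_mat \<alpha> (snd M)) = map_mat (red \<iota>) (diag_yx r ?n)"
    unfolding comp d using arg_cong[OF M, of fst] arg_cong[OF M, of snd] by (simp_all add: Mbar_eq)
  have 1: "mat_in coeffs_in_m (fst ?M - diag_xy r ?n)" "mat_in coeffs_in_m (snd ?M - diag_yx r ?n)"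
    using red_fst red_snd c by (subst red_mat_eq_iff[symmetric, of _ ?n ?n]; simp)+
  have near: "mat_in (coeffs_in_m \<inter> W 2) (fst ?M - diag_xy r ?n)"
    using 1 coeffs_in_m_W2 by (auto simp: mat_in_def simp del: index_minus_mat)
  have "mat_in (W 1) (diag_yx r ?n :: 'a fps fps mat)" using var_W by (auto simp: mat_in_def diag_yx_def W_ideal)
  moreover have "mat_in (W 1) (snd ?M - diag_yx r ?n)"
    using 1(2) coeffs_in_m_W2 W_anti[of 1 2] by (auto simp: mat_in_def simp del: index_minus_mat One_nat_def)
  ultimately have "mat_in (W 1) ((snd ?M - diag_yx r ?n) + diag_yx r ?n)"
    using c by (intro mat_in_W_add(1)) auto
  moreover have "(snd ?M - diag_yx r ?n) + diag_yx r ?n = snd ?M" using c by (intro eq_matI) auto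
  ultimately have near1: "mat_in (W 1) (snd ?M)" by simp
  have mf: "is_mf (var_x * var_y - cst \<pi>) ?M" using is_mf_map2[OF \<alpha>_hom \<omega>(2)] by (simp add: \<alpha>\<omega>)
  have cM: "fst ?M \<in> carrier_mat ?n ?n" using c by simp
  obtain P Q f where PQ: "P \<in> carrier_mat r r" "Q \<in> carrier_mat r r"
    "mat_in max_ideal P" "mat_in max_ideal Q" "is_mf \<pi> (P, Q)" and f: "mf_iso ?M (theta (P, Q)) f"
    "mat_in coeffs_in_m (fst f - 1\<^sub>m ?n)" "mat_in coeffs_in_m (snd f - 1\<^sub>m ?n)"
    using mf_normal_form[OF mf cM refl disjI2[OF refl] near near1] by metis
  have fc: "fst f \<in> carrier_mat ?n ?n" "snd f \<in> carrier_mat ?n ?n"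
    using f(1) mf_iso_iff[of ?M "theta (P, Q)" ?n ?n f] theta_rk[OF PQ(1,2)] rk is_mf_shape[OF mf] by auto
  have "map_mat (red \<iota>) (fst f) = map_mat (red \<iota>) (1\<^sub>m ?n)" "map_mat (red \<iota>) (snd f) = map_mat (red \<iota>) (1\<^sub>m ?n)"
    using f fc by (subst red_mat_eq_iff[of _ ?n ?n]; simp)+
  then have "map2 (red \<iota>) f = mf_id (Mbar r)"
    by (simp add: map2_def mf_id_def map_hom_simps[OF red_hom] Mbar_eq rk0_def rk1_def)
  then show ?thesis using that \<alpha> \<pi> PQ f(1) is_mf_shape[OF mf] rk by blast
qed

lemma elements_mat_subset: "elements_mat A \<subseteq> C \<longleftrightarrow> mat_in C A"
  unfolding elements_mat_def mat_in_def by fastforce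

lemma (in complete_algebra) deformation_is_theta:
  assumes "is_deformation \<iota> r M"
  shows "\<exists>\<pi> \<in> max_ideal. \<exists>P Q.
           P \<in> carrier_mat r r \<and> elements_mat P \<subseteq> max_ideal \<and>
           Q \<in> carrier_mat r r \<and> elements_mat Q \<subseteq> max_ideal \<and>
           is_mf \<pi> (P, Q) \<and> gauge_equivalent \<iota> r M (theta (P, Q))"
  using deformation_normal_form[OF assms]
  unfolding elements_mat_subset gauge_equivalent_def gauge_takes_def by metis

section \<open>Forms\<close>

fun form_sign :: "form_kind \<Rightarrow> 'a::comm_ring_1" where
  "form_sign Quadratic = - 1"
| "form_sign Symplectic = 1"
| "form_sign TwQuadratic = 1"
| "form_sign TwSymplectic = - 1"

lemma form_sign_sq: "form_sign kind * form_sign kind = 1"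
  by (cases kind) auto

definition form_dual :: "form_kind \<Rightarrow> 'a::comm_ring_1 mat2 \<Rightarrow> 'a mat2" where
  "form_dual kind M = (if twisted kind then dual_T M else dual_star M)"

lemma form_dual_simps:
  "rk0 (form_dual kind M) = (if twisted kind then dim_row (snd M) else rk1 M)"
  "rk1 (form_dual kind M) = (if twisted kind then dim_col (snd M) else rk0 M)"
  by (simp_all add: form_dual_def dual_T_def dual_star_def rk0_def rk1_def)

lemma minus_one_smult: "(- 1 :: 'a::comm_ring_1) \<cdot>\<^sub>m A = - A" "(1 :: 'a) \<cdot>\<^sub>m A = A"
  by (auto intro!: eq_matI)

lemma is_form_iff:
  "is_form kind M b \<longleftrightarrow> mf_iso M (form_dual kind M) b \<and>
    (if twisted kind then transpose_mat (fst b) = form_sign kind \<cdot>\<^sub>m fst b \<and> transpose_mat (snd b) = form_sign kind \<cdot>\<^sub>m snd b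
     else transpose_mat (snd b) = form_sign kind \<cdot>\<^sub>m fst b \<and> transpose_mat (fst b) = form_sign kind \<cdot>\<^sub>m snd b)"
  by (cases kind; cases b) (auto simp: form_dual_def minus_one_smult)

lemma form_dual_map2:
  assumes "comm_ring_hom h"
  shows "form_dual kind (map2 h M) = map2 h (form_dual kind M)"
  by (simp add: form_dual_def dual_T_def dual_star_def map2_def map_hom_simps[OF assms])

lemma form_dual_shape:
  assumes "fst M \<in> carrier_mat n n" "snd M \<in> carrier_mat n n"
  shows "mf_shape (form_dual kind M)" "rk0 (form_dual kind M) = n" "rk1 (form_dual kind M) = n"
    "fst (form_dual kind M) \<in> carrier_mat n n" "snd (form_dual kind M) \<in> carrier_mat n n"
  using assms by (auto simp: form_dual_def mf_shape_def dual_T_def dual_star_def rk0_def rk1_def)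

lemma hom_form_sign: "comm_ring_hom h \<Longrightarrow> h (form_sign kind) = form_sign kind"
proof -
  assume "comm_ring_hom h"
  then interpret comm_ring_hom h .
  show ?thesis by (cases kind) (auto simp: hom_uminus)
qed

lemma is_form_square:
  assumes "fst M \<in> carrier_mat n n" "snd M \<in> carrier_mat n n"
  shows "is_form kind M b \<longleftrightarrow>
    fst b \<in> carrier_mat n n \<and> snd b \<in> carrier_mat n n \<and> invertible_mat (fst b) \<and> invertible_mat (snd b) \<and>
    fst (form_dual kind M) * fst b = snd b * fst M \<and> snd (form_dual kind M) * snd b = fst b * snd M \<and>
    (if twisted kind then transpose_mat (fst b) = form_sign kind \<cdot>\<^sub>m fst b \<and> transpose_mat (snd b) = form_sign kind \<cdot>\<^sub>m snd b
     else transpose_mat (snd b) = form_sign kind \<cdot>\<^sub>m fst b \<and> transpose_mat (fst b) = form_sign kind \<cdot>\<^sub>m snd b)"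
proof -
  have "mf_shape M" "rk0 M = n" "rk1 M = n" using assms by (auto simp: mf_shape_def rk0_def rk1_def)
  then show ?thesis
    unfolding is_form_iff using mf_iso_iff[of M "form_dual kind M" n n b] form_dual_shape[OF assms, of kind] by auto
qed

lemma is_form_map2:
  assumes h: "comm_ring_hom h" and M: "fst M \<in> carrier_mat n n" "snd M \<in> carrier_mat n n" and b: "is_form kind M b"
  shows "is_form kind (map2 h M) (map2 h b)"
proof -
  have s: "mf_shape M" "rk0 M = n" "rk1 M = n" using M by (auto simp: mf_shape_def rk0_def rk1_def)
  have "mf_iso (map2 h M) (map2 h (form_dual kind M)) (map2 h b)"
    using b form_dual_shape[OF M, of kind] s by (intro mf_iso_map2[OF h, of _ _ n n]) (auto simp: is_form_iff)
  moreover have "map_mat h (transpose_mat (snd b)) = map_mat h (form_sign kind \<cdot>\<^sub>m fst b)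
      \<and> map_mat h (transpose_mat (fst b)) = map_mat h (form_sign kind \<cdot>\<^sub>m snd b)" if "\<not> twisted kind"
    using b that by (auto simp: is_form_iff)
  moreover have "map_mat h (transpose_mat (fst b)) = map_mat h (form_sign kind \<cdot>\<^sub>m fst b)
      \<and> map_mat h (transpose_mat (snd b)) = map_mat h (form_sign kind \<cdot>\<^sub>m snd b)" if "twisted kind"
    using b that by (auto simp: is_form_iff)
  ultimately show ?thesis
    unfolding is_form_iff form_dual_map2[OF h]
    by (simp add: map_hom_simps[OF h] hom_form_sign[OF h])
qed

lemma preserves_form_comp:
  assumes c: "fst f \<in> carrier_mat n n" "snd f \<in> carrier_mat n n" "fst g \<in> carrier_mat n n" "snd g \<in> carrier_mat n n"
    "fst b'' \<in> carrier_mat n n" "snd b'' \<in> carrier_mat n n"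
    and "preserves_form kind f b b'" "preserves_form kind g b' b''"
  shows "preserves_form kind (mf_comp g f) b b''"
  using assms(7,8) c unfolding preserves_form_def mf_comp_def
  by (auto simp: mat_transpose_mult mat_assoc split: if_splits)

lemma preserves_form_map2:
  assumes h: "comm_ring_hom h"
    and c: "fst f \<in> carrier_mat n n" "snd f \<in> carrier_mat n n" "fst b' \<in> carrier_mat n n" "snd b' \<in> carrier_mat n n"
    and "preserves_form kind f b b'"
  shows "preserves_form kind (map2 h f) (map2 h b) (map2 h b')"
  using assms(6) c unfolding preserves_form_def map2_def
  by (auto simp: map_hom_mult[OF h] map_hom_simps[OF h] split: if_splits)

lemma mf_iso_comp:
  assumes M: "mf_shape L" "mf_shape M" "mf_shape N" "rk0 L = n0" "rk0 M = n0" "rk0 N = n0" "rk1 L = n1" "rk1 M = n1" "rk1 N = n1"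
    and "mf_iso L M f" "mf_iso M N g"
  shows "mf_iso L N (mf_comp g (f :: 'a::comm_ring_1 mat2))"
proof -
  have c: "fst L \<in> carrier_mat n1 n0" "snd L \<in> carrier_mat n0 n1" "fst M \<in> carrier_mat n1 n0" "snd M \<in> carrier_mat n0 n1"
    "fst N \<in> carrier_mat n1 n0" "snd N \<in> carrier_mat n0 n1"
    using M fst_carrier[of L] fst_carrier[of M] fst_carrier[of N] by (auto simp: mf_shape_def)
  have f: "fst f \<in> carrier_mat n0 n0" "snd f \<in> carrier_mat n1 n1" "fst M * fst f = snd f * fst L"
    "snd M * snd f = fst f * snd L" "invertible_mat (fst f)" "invertible_mat (snd f)"
    using mf_iso_iff[of L M n0 n1 f] assms by auto
  have g: "fst g \<in> carrier_mat n0 n0" "snd g \<in> carrier_mat n1 n1" "fst N * fst g = snd g * fst M"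
    "snd N * snd g = fst g * snd M" "invertible_mat (fst g)" "invertible_mat (snd g)"
    using mf_iso_iff[of M N n0 n1 g] assms by auto
  have "fst N * (fst g * fst f) = fst N * fst g * fst f" using c f(1,2) g(1,2) by (simp add: mat_assoc)
  also have "\<dots> = snd g * (fst M * fst f)" unfolding g(3) using c f(1,2) g(1,2) by (simp add: mat_assoc)
  also have "\<dots> = snd g * snd f * fst L" unfolding f(3) using c f(1,2) g(1,2) by (simp add: mat_assoc)
  finally have 1: "fst N * (fst g * fst f) = snd g * snd f * fst L" .
  have "snd N * (snd g * snd f) = snd N * snd g * snd f" using c f(1,2) g(1,2) by (simp add: mat_assoc)
  also have "\<dots> = fst g * (snd M * snd f)" unfolding g(4) using c f(1,2) g(1,2) by (simp add: mat_assoc)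
  also have "\<dots> = fst g * fst f * snd L" unfolding f(4) using c f(1,2) g(1,2) by (simp add: mat_assoc)
  finally have 2: "snd N * (snd g * snd f) = fst g * fst f * snd L" .
  show ?thesis
    by (subst mf_iso_iff[of L N n0 n1])
      (use M f(1,2,5,6) g(1,2,5,6) 1 2 in \<open>auto simp: mf_comp_def intro: invertible_mat_mult\<close>)
qed

lemma transpose_invertible:
  fixes A :: "'a::comm_ring_1 mat"
  assumes "A \<in> carrier_mat n n" "invertible_mat A"
  shows "invertible_mat (transpose_mat A)"
proof -
  obtain B where B: "B \<in> carrier_mat n n" "A * B = 1\<^sub>m n" "B * A = 1\<^sub>m n"
    using assms invertible_mat_iff by blast
  have "transpose_mat (A * B) = 1\<^sub>m n" "transpose_mat (B * A) = 1\<^sub>m n"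
    unfolding B by simp_all
  then have "transpose_mat B * transpose_mat A = 1\<^sub>m n" "transpose_mat A * transpose_mat B = 1\<^sub>m n"
    using mat_transpose_mult[of A B] mat_transpose_mult[of B A] assms(1) B(1) by auto
  then show ?thesis using assms B by (subst invertible_mat_iff[of _ n]) auto
qed

lemma transpose_smult: "transpose_mat (c \<cdot>\<^sub>m A) = c \<cdot>\<^sub>m transpose_mat A"
  by (auto intro!: eq_matI)

lemma form_transport:
  fixes M N :: "'a::comm_ring_1 mat2"
  assumes M: "fst M \<in> carrier_mat n n" "snd M \<in> carrier_mat n n" and N: "fst N \<in> carrier_mat n n" "snd N \<in> carrier_mat n n"
    and f: "mf_iso M N f" and b: "is_form kind M b"
  obtains b' where "is_form kind N b'" "preserves_form kind f b b'"
proof -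
  have "mf_shape M" "mf_shape N" "rk0 M = n" "rk1 M = n" "rk0 N = n" "rk1 N = n"
    using M N by (auto simp: mf_shape_def rk0_def rk1_def)
  then have f': "fst f \<in> carrier_mat n n" "snd f \<in> carrier_mat n n" "fst N * fst f = snd f * fst M"
    "snd N * snd f = fst f * snd M" "invertible_mat (fst f)" "invertible_mat (snd f)"
    using mf_iso_iff[of M N n n f] f by auto
  obtain g0 where g0: "g0 \<in> carrier_mat n n" "fst f * g0 = 1\<^sub>m n" "g0 * fst f = 1\<^sub>m n"
    using f' invertible_mat_iff by blast
  obtain g1 where g1: "g1 \<in> carrier_mat n n" "snd f * g1 = 1\<^sub>m n" "g1 * snd f = 1\<^sub>m n"
    using f' invertible_mat_iff by blast
  have inv: "invertible_mat g0" "invertible_mat g1"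
    using g0 g1 f'(1,2) invertible_mat_iff by blast+
  have b': "fst b \<in> carrier_mat n n" "snd b \<in> carrier_mat n n" "invertible_mat (fst b)" "invertible_mat (snd b)"
    "fst (form_dual kind M) * fst b = snd b * fst M" "snd (form_dual kind M) * snd b = fst b * snd M"
    using b is_form_square[OF M, of kind b] by auto
  have cancel: "snd f * (g1 * X) = X" "fst f * (g0 * X) = X" "g0 * (fst f * X) = X" "g1 * (snd f * X) = X"
    if "X \<in> carrier_mat n n" for X
    using that f'(1,2) g0 g1 by (simp_all add: mat_assoc[symmetric] del: assoc_mult_mat)
  have "fst N * fst f * g0 = snd f * fst M * g0" "snd N * snd f * g1 = fst f * snd M * g1" using f'(3,4) by simp_all
  then have N_eq: "fst N = snd f * (fst M * g0)" "snd N = fst f * (snd M * g1)"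
    using f'(1,2) g0 g1 M N by (simp_all add: mat_assoc)
  have "g1 * fst N = fst M * g0" "g0 * snd N = snd M * g1"
    unfolding N_eq by (rule cancel(4) cancel(3), rule mult_carrier_mat[OF _ g0(1)] mult_carrier_mat[OF _ g1(1)], rule M)+
  note gN = this
  from arg_cong[OF this(1), of transpose_mat] arg_cong[OF this(2), of transpose_mat]
  have gNt: "transpose_mat (fst N) * transpose_mat g1 = transpose_mat g0 * transpose_mat (fst M)"
    "transpose_mat (snd N) * transpose_mat g0 = transpose_mat g1 * transpose_mat (snd M)"
    using g0 g1 M N by (simp_all add: mat_transpose_mult)
  have ft: "transpose_mat (fst f) * transpose_mat g0 = 1\<^sub>m n" "transpose_mat (snd f) * transpose_mat g1 = 1\<^sub>m n"
  proof -
    have "transpose_mat (g0 * fst f) = 1\<^sub>m n" "transpose_mat (g1 * snd f) = 1\<^sub>m n"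
      unfolding g0 g1 by simp_all
    then show "transpose_mat (fst f) * transpose_mat g0 = 1\<^sub>m n" "transpose_mat (snd f) * transpose_mat g1 = 1\<^sub>m n"
      using mat_transpose_mult[of g0 "fst f"] mat_transpose_mult[of g1 "snd f"] f'(1,2) g0(1) g1(1) by auto
  qed
  define k0 k1 where "k0 = (if twisted kind then g0 else g1)" and "k1 = (if twisted kind then g1 else g0)"
  have k: "k0 \<in> carrier_mat n n" "k1 \<in> carrier_mat n n" "invertible_mat k0" "invertible_mat k1"
    using g0 g1 inv by (auto simp: k0_def k1_def)
  let ?D = "form_dual kind"
  have kD: "fst (?D N) * transpose_mat k0 = transpose_mat k1 * fst (?D M)" "snd (?D N) * transpose_mat k1 = transpose_mat k0 * snd (?D M)"
    using gNt g0 g1 M N by (auto simp: form_dual_def dual_T_def dual_star_def k0_def k1_def)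
  define B where "B = (transpose_mat k0 * fst b * g0, transpose_mat k1 * snd b * g1)"
  have D: "fst (?D M) \<in> carrier_mat n n" "snd (?D M) \<in> carrier_mat n n" "fst (?D N) \<in> carrier_mat n n" "snd (?D N) \<in> carrier_mat n n"
    using form_dual_shape[OF M, of kind] form_dual_shape[OF N, of kind] by auto
  have "is_form kind N B"
    unfolding is_form_square[OF N]
  proof (intro conjI)
    show "fst B \<in> carrier_mat n n" "snd B \<in> carrier_mat n n" using k g0 g1 b'(1,2) by (auto simp: B_def)
    show "invertible_mat (fst B)" "invertible_mat (snd B)"
      unfolding B_def fst_conv snd_conv using k g0 g1 b' inv
      by (auto intro!: invertible_mat_mult[of _ n] transpose_invertible[of _ n])
    have "fst (?D N) * fst B = (fst (?D N) * transpose_mat k0) * fst b * g0"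
      using D k(1,2) g0(1) b'(1,2) by (simp add: B_def mat_assoc)
    also have "\<dots> = transpose_mat k1 * (fst (?D M) * fst b) * g0"
      unfolding kD using D k(1,2) g0(1) b'(1,2) by (simp add: mat_assoc)
    also have "\<dots> = transpose_mat k1 * snd b * (fst M * g0)"
      unfolding b' using M k(1,2) g0(1) b'(1,2) by (simp add: mat_assoc)
    also have "\<dots> = snd B * fst N" unfolding gN[symmetric] using N k(1,2) g1(1) b'(1,2) by (simp add: B_def mat_assoc)
    finally show "fst (?D N) * fst B = snd B * fst N" .
    have "snd (?D N) * snd B = (snd (?D N) * transpose_mat k1) * snd b * g1"
      using D k(1,2) g1(1) b'(1,2) by (simp add: B_def mat_assoc)
    also have "\<dots> = transpose_mat k0 * (snd (?D M) * snd b) * g1"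
      unfolding kD using D k(1,2) g1(1) b'(1,2) by (simp add: mat_assoc)
    also have "\<dots> = transpose_mat k0 * fst b * (snd M * g1)"
      unfolding b' using M k(1,2) g1(1) b'(1,2) by (simp add: mat_assoc)
    also have "\<dots> = fst B * snd N" unfolding gN[symmetric] using N k(1,2) g0(1) b'(1,2) by (simp add: B_def mat_assoc)
    finally show "snd (?D N) * snd B = fst B * snd N" .
    have "if twisted kind then transpose_mat (fst b) = form_sign kind \<cdot>\<^sub>m fst b \<and> transpose_mat (snd b) = form_sign kind \<cdot>\<^sub>m snd b
      else transpose_mat (snd b) = form_sign kind \<cdot>\<^sub>m fst b \<and> transpose_mat (fst b) = form_sign kind \<cdot>\<^sub>m snd b"
      using b by (simp add: is_form_iff)
    then show "if twisted kind then transpose_mat (fst B) = form_sign kind \<cdot>\<^sub>m fst B \<and> transpose_mat (snd B) = form_sign kind \<cdot>\<^sub>m snd B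
      else transpose_mat (snd B) = form_sign kind \<cdot>\<^sub>m fst B \<and> transpose_mat (fst B) = form_sign kind \<cdot>\<^sub>m snd B"
      using g0(1) g1(1) b'(1,2)
      by (auto simp: B_def k0_def k1_def mat_transpose_mult mat_assoc mat_smult split: if_splits)
  qed
  moreover have "preserves_form kind f b B"
  proof -
    have "A = transpose_mat x * (transpose_mat y * A * z) * w"
      if "transpose_mat x * transpose_mat y = 1\<^sub>m n" "z * w = 1\<^sub>m n" "A \<in> carrier_mat n n"
        "x \<in> carrier_mat n n" "y \<in> carrier_mat n n" "z \<in> carrier_mat n n" "w \<in> carrier_mat n n"
      for A x y z w :: "'a mat"
    proof -
      have "transpose_mat x * (transpose_mat y * A * z) * w = (transpose_mat x * transpose_mat y) * A * (z * w)"
        using that(3-) by (simp add: mat_assoc)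
      also have "\<dots> = A" unfolding that(1,2) using that(3) by simp
      finally show ?thesis by (rule sym)
    qed
    note * = this
    have "fst b = transpose_mat (if twisted kind then fst f else snd f) * fst B * fst f"
      "snd b = transpose_mat (if twisted kind then snd f else fst f) * snd B * snd f"
      unfolding B_def k0_def k1_def fst_conv snd_conv
      using *[OF ft(1) g0(3) b'(1) f'(1) g0(1,1) f'(1)] *[OF ft(2) g0(3) b'(1) f'(2) g1(1) g0(1) f'(1)]
        *[OF ft(2) g1(3) b'(2) f'(2) g1(1,1) f'(2)] *[OF ft(1) g1(3) b'(2) f'(1) g0(1) g1(1) f'(2)]
      by (cases "twisted kind"; simp del: assoc_mult_mat)+
    then show ?thesis unfolding preserves_form_def by (cases b) auto
  qed
  ultimately show ?thesis by (rule that)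
qed

lemma mat_cancel_left:
  fixes Y :: "'a::comm_ring_1 mat"
  assumes eq: "Y * U = Y * V" and Y: "Y \<in> carrier_mat n n" "invertible_mat Y"
    and U: "U \<in> carrier_mat n m" and V: "V \<in> carrier_mat n m"
  shows "U = V"
proof -
  obtain Z where Z: "Z \<in> carrier_mat n n" "Z * Y = 1\<^sub>m n"
    using Y(2) unfolding invertible_mat_iff[OF Y(1)] by blast
  have "U = Z * Y * U" unfolding Z(2) using U by simp
  also have "\<dots> = Z * (Y * U)" by (rule assoc_mult_mat[OF Z(1) Y(1) U])
  also have "\<dots> = Z * Y * V" unfolding eq by (rule assoc_mult_mat[OF Z(1) Y(1) V, symmetric])
  also have "\<dots> = V" unfolding Z(2) using V by simp
  finally show ?thesis .
qed

text \<open>Two forms that agree modulo the maximal ideal differ by an automorphism, the square root of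
  their quotient.\<close>

lemma (in complete_algebra) form_sqrt:
  fixes N :: "'a fps fps mat2"
  assumes two: "(2 :: 'a) dvd 1" and N: "fst N \<in> carrier_mat n n" "snd N \<in> carrier_mat n n"
    and B: "is_form kind N B" and X: "is_form kind N X"
    and near: "mat_in (W 1) (fst B - fst X)" "mat_in (W 1) (snd B - snd X)"
  obtains s where "mf_iso N N s" "preserves_form kind s B X"
    "fst s \<in> carrier_mat n n" "snd s \<in> carrier_mat n n"
    "mat_in (W 1) (fst s - 1\<^sub>m n)" "mat_in (W 1) (snd s - 1\<^sub>m n)"
    "fst X * (fst s * fst s) = fst B" "snd X * (snd s * snd s) = snd B"
proof -
  let ?D = "form_dual kind N"
  have B': "fst B \<in> carrier_mat n n" "snd B \<in> carrier_mat n n"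
    "fst ?D * fst B = snd B * fst N" "snd ?D * snd B = fst B * snd N"
    using B is_form_square[OF N, of kind B] by auto
  have X': "fst X \<in> carrier_mat n n" "snd X \<in> carrier_mat n n" "invertible_mat (fst X)" "invertible_mat (snd X)"
    "fst ?D * fst X = snd X * fst N" "snd ?D * snd X = fst X * snd N"
    using X is_form_square[OF N, of kind X] by auto
  have D: "fst ?D \<in> carrier_mat n n" "snd ?D \<in> carrier_mat n n" using form_dual_shape[OF N, of kind] by auto
  have root: "\<exists>s. s \<in> carrier_mat n n \<and> mat_in (W 1) (s - 1\<^sub>m n) \<and> Y * (s * s) = A"
    if Y: "Y \<in> carrier_mat n n" "invertible_mat Y" and A: "A \<in> carrier_mat n n" "mat_in (W 1) (A - Y)"
    for Y A :: "'a fps fps mat"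
  proof -
    obtain Z where Z: "Z \<in> carrier_mat n n" "Y * Z = 1\<^sub>m n" "Z * Y = 1\<^sub>m n" using Y invertible_mat_iff by blast
    have "mat_in (W (0 + 1)) (Z * (A - Y))" using Z Y A by (intro mat_in_W_mult) (auto simp: mat_in_def)
    moreover have "Z * (A - Y) = Z * A - 1\<^sub>m n" using Z Y A by (simp add: mat_distrib)
    ultimately have "mat_in (W 1) (Z * A - 1\<^sub>m n)" by simp
    then obtain s where s: "s \<in> carrier_mat n n" "mat_in (W 1) (s - 1\<^sub>m n)" "s * s = Z * A"
      using sqrt_exists[OF two, of "Z * A" n] Z A by auto
    have "Y * (s * s) = Y * Z * A" unfolding s(3) by (rule assoc_mult_mat[OF Y(1) Z(1) A(1), symmetric])
    also have "\<dots> = A" unfolding Z(2) using A by simp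
    finally show ?thesis using s by blast
  qed
  obtain s0 where "s0 \<in> carrier_mat n n \<and> mat_in (W 1) (s0 - 1\<^sub>m n) \<and> fst X * (s0 * s0) = fst B"
    by (rule exE[OF root[OF X'(1,3) B'(1) near(1)]])
  then have s0: "s0 \<in> carrier_mat n n" "mat_in (W 1) (s0 - 1\<^sub>m n)" "fst X * (s0 * s0) = fst B" by blast+
  obtain s1 where "s1 \<in> carrier_mat n n \<and> mat_in (W 1) (s1 - 1\<^sub>m n) \<and> snd X * (s1 * s1) = snd B"
    by (rule exE[OF root[OF X'(2,4) B'(2) near(2)]])
  then have s1: "s1 \<in> carrier_mat n n" "mat_in (W 1) (s1 - 1\<^sub>m n)" "snd X * (s1 * s1) = snd B" by blast+
  have "s1 * s1 * fst N = fst N * (s0 * s0)"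
  proof (rule mat_cancel_left[OF _ X'(2,4), where m = n])
    have "snd X * (s1 * s1 * fst N) = snd B * fst N" unfolding s1(3)[symmetric] using X'(1,2) s1(1) N by (simp add: mat_assoc)
    also have "\<dots> = fst ?D * (fst X * (s0 * s0))" unfolding B'(3)[symmetric] s0(3) ..
    also have "\<dots> = snd X * fst N * (s0 * s0)" unfolding X'(5)[symmetric] using D X'(1,2) s0(1) by (simp add: mat_assoc)
    finally show "snd X * (s1 * s1 * fst N) = snd X * (fst N * (s0 * s0))" using X'(1,2) s0(1) N by (simp add: mat_assoc)
  qed (use s0(1) s1(1) N in auto)
  from sylvester[OF two s1(1,2) s0(1,2) N(1) this] have h1: "s1 * fst N = fst N * s0" .
  have "s0 * s0 * snd N = snd N * (s1 * s1)"
  proof (rule mat_cancel_left[OF _ X'(1,3), where m = n])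
    have "fst X * (s0 * s0 * snd N) = fst B * snd N" unfolding s0(3)[symmetric] using X'(1,2) s0(1) N by (simp add: mat_assoc)
    also have "\<dots> = snd ?D * (snd X * (s1 * s1))" unfolding B'(4)[symmetric] s1(3) ..
    also have "\<dots> = fst X * snd N * (s1 * s1)" unfolding X'(6)[symmetric] using D X'(1,2) s1(1) by (simp add: mat_assoc)
    finally show "fst X * (s0 * s0 * snd N) = fst X * (snd N * (s1 * s1))" using X'(1,2) s1(1) N by (simp add: mat_assoc)
  qed (use s0(1) s1(1) N in auto)
  from sylvester[OF two s0(1,2) s1(1,2) N(2) this] have h2: "s0 * snd N = snd N * s1" .
  have iso: "mf_iso N N (s0, s1)"
  proof (subst mf_iso_iff[of N N n n])
    show "fst (s0, s1) \<in> carrier_mat n n \<and> snd (s0, s1) \<in> carrier_mat n n \<and>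
      fst N * fst (s0, s1) = snd (s0, s1) * fst N \<and> snd N * snd (s0, s1) = fst (s0, s1) * snd N \<and>
      invertible_mat (fst (s0, s1)) \<and> invertible_mat (snd (s0, s1))"
      using s0(1) s1(1) h1 h2 invertible_one_plus_W1[OF s0(1,2)] invertible_one_plus_W1[OF s1(1,2)] by simp
  qed (use N in \<open>auto simp: mf_shape_def rk0_def rk1_def\<close>)
  have adj: "transpose_mat t * Y * s = A"
    if Y: "Y * (s * s) = A" "Y' * (t * t) = A'" and tr: "transpose_mat A' = form_sign kind \<cdot>\<^sub>m A" "transpose_mat Y' = form_sign kind \<cdot>\<^sub>m Y"
      and c: "Y \<in> carrier_mat n n" "Y' \<in> carrier_mat n n" "s \<in> carrier_mat n n" "t \<in> carrier_mat n n"
      and W: "mat_in (W 1) (s - 1\<^sub>m n)" "mat_in (W 1) (t - 1\<^sub>m n)"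
    for s t Y Y' A A' :: "'a fps fps mat"
  proof -
    have "form_sign kind \<cdot>\<^sub>m A = form_sign kind \<cdot>\<^sub>m (transpose_mat t * transpose_mat t * Y)"
      unfolding tr(1)[symmetric] Y(2)[symmetric] using c by (simp add: mat_transpose_mult tr(2) mat_smult)
    then have "form_sign kind \<cdot>\<^sub>m (form_sign kind \<cdot>\<^sub>m A) = form_sign kind \<cdot>\<^sub>m (form_sign kind \<cdot>\<^sub>m (transpose_mat t * transpose_mat t * Y))"
      by simp
    moreover have "form_sign kind \<cdot>\<^sub>m (form_sign kind \<cdot>\<^sub>m Z) = Z" for Z :: "'a fps fps mat"
      using form_sign_sq[of kind, where ?'a = "'a fps fps"] by (intro eq_matI) (auto simp: mult.assoc[symmetric])
    ultimately have "transpose_mat t * transpose_mat t * Y = Y * (s * s)" using Y(1) by simp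
    moreover have "transpose_mat t - 1\<^sub>m n = transpose_mat (t - 1\<^sub>m n)"
      using c(4) by (intro eq_matI) auto
    then have "mat_in (W 1) (transpose_mat t - 1\<^sub>m n)" using W(2) by (simp add: mat_in_def)
    ultimately have "transpose_mat t * Y = Y * s"
      using c W(1) by (intro sylvester[OF two, of "transpose_mat t" n s n Y]) auto
    then have "transpose_mat t * Y * s = Y * s * s" by simp
    also have "\<dots> = Y * (s * s)" by (rule assoc_mult_mat[OF c(1,3,3)])
    finally show ?thesis unfolding Y(1) .
  qed
  have "preserves_form kind (s0, s1) B X"
  proof (cases "twisted kind")
    case True
    then have "transpose_mat (fst B) = form_sign kind \<cdot>\<^sub>m fst B" "transpose_mat (snd B) = form_sign kind \<cdot>\<^sub>m snd B"
      "transpose_mat (fst X) = form_sign kind \<cdot>\<^sub>m fst X" "transpose_mat (snd X) = form_sign kind \<cdot>\<^sub>m snd X"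
      using B X by (auto simp: is_form_iff)
    note tr = this
    show ?thesis
      using True adj[OF s0(3) s0(3) tr(1,3) X'(1,1) s0(1,1,2,2)] adj[OF s1(3) s1(3) tr(2,4) X'(2,2) s1(1,1,2,2)]
      by (cases B) (simp add: preserves_form_def)
  next
    case False
    then have "transpose_mat (snd B) = form_sign kind \<cdot>\<^sub>m fst B" "transpose_mat (fst B) = form_sign kind \<cdot>\<^sub>m snd B"
      "transpose_mat (snd X) = form_sign kind \<cdot>\<^sub>m fst X" "transpose_mat (fst X) = form_sign kind \<cdot>\<^sub>m snd X"
      using B X by (auto simp: is_form_iff)
    note tr = this
    show ?thesis
      using False adj[OF s0(3) s1(3) tr(1,3) X'(1,2) s0(1) s1(1) s0(2) s1(2)]
        adj[OF s1(3) s0(3) tr(2,4) X'(2,1) s1(1) s0(1) s1(2) s0(2)]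
      by (cases B) (simp add: preserves_form_def)
  qed
  then show ?thesis using that[of "(s0, s1)"] iso s0 s1 by simp
qed

section \<open>Constant forms\<close>

lemma form_sign_source:
  "form_sign (source_kind kind) = (if twisted kind then form_sign kind else - form_sign kind :: 'a::comm_ring_1)"
  by (cases kind) auto

lemma twisted_source: "twisted (source_kind kind) \<longleftrightarrow> \<not> twisted kind"
  by (cases kind) auto

lemma block_mult:
  fixes A B C D :: "'a::comm_ring_1 mat"
  assumes "A \<in> carrier_mat r r" "B \<in> carrier_mat r r" "C \<in> carrier_mat r r" "D \<in> carrier_mat r r"
    "A' \<in> carrier_mat r r" "B' \<in> carrier_mat r r" "C' \<in> carrier_mat r r" "D' \<in> carrier_mat r r"
  shows "four_block_mat A B C D * four_block_mat A' B' C' D'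
    = four_block_mat (A * A' + B * C') (A * B' + B * D') (C * A' + D * C') (C * B' + D * D')"
  by (rule mult_four_block_mat[OF assms])

lemma invertible_matE:
  assumes "invertible_mat A" "A \<in> carrier_mat n n"
  obtains B where "B \<in> carrier_mat n n" "A * B = 1\<^sub>m n" "B * A = 1\<^sub>m n"
  using assms invertible_mat_iff by metis

lemma right_inverse_invertible:
  fixes A B :: "'a::comm_ring_1 mat"
  assumes "A \<in> carrier_mat n n" "B \<in> carrier_mat n n" "A * B = 1\<^sub>m n"
  shows "invertible_mat A"
proof (rule invertible_if_det_unit[OF assms(1)])
  have "det A * det B = det (1\<^sub>m n :: 'a mat)"
    unfolding assms(3)[symmetric] by (rule det_mult[OF assms(1,2), symmetric])
  then have "1 = det A * det B" by simp
  then show "det A dvd 1" by (rule dvdI)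
qed

lemma antidiag_invertible:
  fixes A B :: "'a::comm_ring_1 mat"
  assumes c: "A \<in> carrier_mat r r" "B \<in> carrier_mat r r"
  shows "invertible_mat (four_block_mat (0\<^sub>m r r) A B (0\<^sub>m r r)) \<longleftrightarrow> invertible_mat A \<and> invertible_mat B"
proof
  let ?X = "four_block_mat (0\<^sub>m r r) A B (0\<^sub>m r r)"
  have X: "?X \<in> carrier_mat (r + r) (r + r)"
    by (rule four_block_carrier_mat[OF zero_carrier_mat zero_carrier_mat])
  note mult = block_mult[OF zero_carrier_mat c zero_carrier_mat]
  show "invertible_mat A \<and> invertible_mat B" if inv: "invertible_mat ?X"
  proof -
    obtain Y where Y: "Y \<in> carrier_mat (r + r) (r + r)" "?X * Y = 1\<^sub>m (r + r)"
      by (rule invertible_matE[OF inv X])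
    obtain Y1 Y2 Y3 Y4 where sp: "split_block Y r r = (Y1, Y2, Y3, Y4)" by (rule prod_cases4)
    have Yc: "Y1 \<in> carrier_mat r r" "Y2 \<in> carrier_mat r r" "Y3 \<in> carrier_mat r r" "Y4 \<in> carrier_mat r r"
      "Y = four_block_mat Y1 Y2 Y3 Y4" using split_block[OF sp, of r r] Y(1) by auto
    have "four_block_mat (A * Y3) (A * Y4) (B * Y1) (B * Y2)
        = four_block_mat (1\<^sub>m r) (0\<^sub>m r r) (0\<^sub>m r r) (1\<^sub>m r)"
      using Y(2) mult[OF Yc(1-4)] c Yc(1-4) by (simp add: Yc(5))
    from four_block_inject(1)[OF this, of r r r r] four_block_inject(4)[OF this, of r r r r]
    have "A * Y3 = 1\<^sub>m r" "B * Y2 = 1\<^sub>m r" using c Yc(1-4) by auto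
    then show ?thesis
      using right_inverse_invertible[OF c(1) Yc(3)] right_inverse_invertible[OF c(2) Yc(2)] by simp
  qed
  assume *: "invertible_mat A \<and> invertible_mat B"
  obtain A' where A': "A' \<in> carrier_mat r r" "A * A' = 1\<^sub>m r"
    by (rule invertible_matE[OF conjunct1[OF *] c(1)])
  obtain B' where B': "B' \<in> carrier_mat r r" "B * B' = 1\<^sub>m r"
    by (rule invertible_matE[OF conjunct2[OF *] c(2)])
  have "?X * four_block_mat (0\<^sub>m r r) B' A' (0\<^sub>m r r) = 1\<^sub>m (r + r)"
    using mult[OF zero_carrier_mat B'(1) A'(1) zero_carrier_mat] c A' B' by simp
  then show "invertible_mat ?X"
    by (rule right_inverse_invertible[OF X four_block_carrier_mat[OF zero_carrier_mat zero_carrier_mat]])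
qed

lemma diag_invertible:
  fixes A B :: "'a::comm_ring_1 mat"
  assumes c: "A \<in> carrier_mat r r" "B \<in> carrier_mat r r" and i: "invertible_mat A" "invertible_mat B"
  shows "invertible_mat (four_block_mat A (0\<^sub>m r r) (0\<^sub>m r r) B)"
proof -
  obtain A' where A': "A' \<in> carrier_mat r r" "A * A' = 1\<^sub>m r"
    by (rule invertible_matE[OF i(1) c(1)])
  obtain B' where B': "B' \<in> carrier_mat r r" "B * B' = 1\<^sub>m r"
    by (rule invertible_matE[OF i(2) c(2)])
  have "four_block_mat A (0\<^sub>m r r) (0\<^sub>m r r) B * four_block_mat A' (0\<^sub>m r r) (0\<^sub>m r r) B' = 1\<^sub>m (r + r)"
    using block_mult[OF c(1) zero_carrier_mat zero_carrier_mat c(2) A'(1) zero_carrier_mat zero_carrier_mat B'(1)] c A' B' by simp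
  then show ?thesis
    by (rule right_inverse_invertible[OF four_block_carrier_mat[OF c] four_block_carrier_mat[OF A'(1) B'(1)]])
qed

lemma diag_invertible_blocks:
  fixes A B :: "'a::comm_ring_1 mat"
  assumes c: "A \<in> carrier_mat r r" "B \<in> carrier_mat r r"
    and i: "invertible_mat (four_block_mat A (0\<^sub>m r r) (0\<^sub>m r r) B)"
  shows "invertible_mat A \<and> invertible_mat B"
proof -
  let ?X = "four_block_mat A (0\<^sub>m r r) (0\<^sub>m r r) B"
  obtain Y where Y: "Y \<in> carrier_mat (r + r) (r + r)" "?X * Y = 1\<^sub>m (r + r)"
    by (rule invertible_matE[OF i four_block_carrier_mat[OF c]])
  obtain Y1 Y2 Y3 Y4 where sp: "split_block Y r r = (Y1, Y2, Y3, Y4)" by (rule prod_cases4)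
  have Yc: "Y1 \<in> carrier_mat r r" "Y2 \<in> carrier_mat r r" "Y3 \<in> carrier_mat r r" "Y4 \<in> carrier_mat r r"
    "Y = four_block_mat Y1 Y2 Y3 Y4" using split_block[OF sp, of r r] Y(1) by auto
  have "four_block_mat (A * Y1) (A * Y2) (B * Y3) (B * Y4)
      = four_block_mat (1\<^sub>m r) (0\<^sub>m r r) (0\<^sub>m r r) (1\<^sub>m r)"
    using Y(2) block_mult[OF c(1) zero_carrier_mat zero_carrier_mat c(2) Yc(1-4)] c Yc(1-4) by (simp add: Yc(5))
  from four_block_inject(1)[OF this, of r r r r] four_block_inject(4)[OF this, of r r r r]
  have "A * Y1 = 1\<^sub>m r" "B * Y4 = 1\<^sub>m r" using c Yc(1-4) by auto
  then show ?thesis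
    using right_inverse_invertible[OF c(1) Yc(1)] right_inverse_invertible[OF c(2) Yc(4)] by simp
qed

lemma invertible_uminus:
  fixes A :: "'a::comm_ring_1 mat"
  assumes "A \<in> carrier_mat n n" "invertible_mat A"
  shows "invertible_mat (- A)"
proof -
  obtain B where B: "B \<in> carrier_mat n n" "A * B = 1\<^sub>m n"
    by (rule invertible_matE[OF assms(2,1)])
  have "(- A) * (- B) = 1\<^sub>m n" using assms(1) B by simp
  then show ?thesis using assms(1) B(1) by (intro right_inverse_invertible[of _ n "- B"]) auto
qed

lemma theta_form_is_form:
  fixes P Q :: "'a::comm_ring_1 mat"
  assumes PQ: "P \<in> carrier_mat r r" "Q \<in> carrier_mat r r" and c: "is_form (source_kind kind) (P, Q) c"
  shows "is_form kind (theta (P, Q)) (theta_form (source_kind kind) c)"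
proof -
  let ?s = "source_kind kind"
  obtain c0 c1 where c01: "c = (c0, c1)" by (cases c)
  have c': "c0 \<in> carrier_mat r r" "c1 \<in> carrier_mat r r" "invertible_mat c0" "invertible_mat c1"
    "fst (form_dual ?s (P, Q)) * c0 = c1 * P" "snd (form_dual ?s (P, Q)) * c1 = c0 * Q"
    using c is_form_square[of "(P, Q)" r ?s c] PQ by (auto simp: c01)
  define p where "p = map_mat cst P" define q where "q = map_mat cst Q"
  define d0 where "d0 = map_mat cst c0" define d1 where "d1 = map_mat cst c1"
  have car: "p \<in> carrier_mat r r" "q \<in> carrier_mat r r" "d0 \<in> carrier_mat r r" "d1 \<in> carrier_mat r r"
    using PQ c' by (simp_all add: p_def q_def d0_def d1_def)
  have inv: "invertible_mat d0" "invertible_mat d1"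
    unfolding d0_def d1_def using c' by (auto intro: invertible_map_mat[OF cst_hom])
  have th: "fst (theta (P, Q)) = four_block_mat (var_x \<cdot>\<^sub>m 1\<^sub>m r) p q (var_y \<cdot>\<^sub>m 1\<^sub>m r)"
    "snd (theta (P, Q)) = four_block_mat (var_y \<cdot>\<^sub>m 1\<^sub>m r) (- p) (- q) (var_x \<cdot>\<^sub>m 1\<^sub>m r)"
    using theta_explicit[OF PQ] by (simp_all add: p_def q_def)
  have th_t: "transpose_mat (fst (theta (P, Q))) = four_block_mat (var_x \<cdot>\<^sub>m 1\<^sub>m r) (transpose_mat q) (transpose_mat p) (var_y \<cdot>\<^sub>m 1\<^sub>m r)"
    "transpose_mat (snd (theta (P, Q))) = four_block_mat (var_y \<cdot>\<^sub>m 1\<^sub>m r) (- transpose_mat q) (- transpose_mat p) (var_x \<cdot>\<^sub>m 1\<^sub>m r)"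
    unfolding th using car by (auto intro!: eq_matI)
  have tr: "map_mat cst (transpose_mat A) = transpose_mat (map_mat cst A)" for A :: "'a mat" by (rule map_hom_simps(7)[OF cst_hom])
  note N = theta_rk(3,4)[OF PQ]
  show ?thesis
  proof (cases "twisted kind")
    case True
    then have ns: "\<not> twisted ?s" by (simp add: twisted_source)
    define X where "X = four_block_mat (0\<^sub>m r r) (- d0) (- d1) (0\<^sub>m r r)"
    have X: "theta_form ?s c = (X, X)"
      unfolding c01 X_def using theta_form_untwisted_explicit[OF c'(1,2) ns] c'(1,2)
      by (simp add: antidiag_block_def d0_def d1_def)
    have e1: "transpose_mat p * d0 = - (d1 * p)" "transpose_mat q * d1 = - (d0 * q)"
    proof -
      have "- (transpose_mat P * c0) = c1 * P" "- (transpose_mat Q * c1) = c0 * Q"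
        using c'(5,6) ns PQ c'(1,2) by (simp_all add: form_dual_def dual_star_def)
      then have "transpose_mat P * c0 = - (c1 * P)" "transpose_mat Q * c1 = - (c0 * Q)"
        by (metis uminus_uminus_mat)+
      then have "map_mat cst (transpose_mat P * c0) = map_mat cst (- (c1 * P))"
        "map_mat cst (transpose_mat Q * c1) = map_mat cst (- (c0 * Q))" by simp_all
      then show "transpose_mat p * d0 = - (d1 * p)" "transpose_mat q * d1 = - (d0 * q)"
        using PQ c'(1,2) by (simp_all add: map_cst_mult tr map_cst_uminus p_def q_def d0_def d1_def)
    qed
    have sym: "transpose_mat d1 = form_sign kind \<cdot>\<^sub>m d0" "transpose_mat d0 = form_sign kind \<cdot>\<^sub>m d1"
    proof -
      have "transpose_mat c1 = form_sign kind \<cdot>\<^sub>m c0" "transpose_mat c0 = form_sign kind \<cdot>\<^sub>m c1"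
        using c ns True by (auto simp: is_form_iff c01 form_sign_source)
      from arg_cong[OF this(1), of "map_mat cst"] arg_cong[OF this(2), of "map_mat cst"]
      show "transpose_mat d1 = form_sign kind \<cdot>\<^sub>m d0" "transpose_mat d0 = form_sign kind \<cdot>\<^sub>m d1"
        by (simp_all add: tr d0_def d1_def map_hom_simps(3)[OF cst_hom] hom_form_sign[OF cst_hom])
    qed
    have Xc: "X \<in> carrier_mat (r + r) (r + r)" using car by (auto simp: X_def)
    have "invertible_mat (- d0)" "invertible_mat (- d1)"
      using invertible_uminus[OF car(3) inv(1)] invertible_uminus[OF car(4) inv(2)] by simp_all
    then have Xinv: "invertible_mat X" unfolding X_def using car by (subst antidiag_invertible) auto
    have 1: "transpose_mat (snd (theta (P, Q))) * X = X * fst (theta (P, Q))"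
      unfolding th_t unfolding th X_def using car e1
      by (subst (1 2) block_mult[of _ r]) (auto simp: mat_smult intro!: eq_matI simp del: index_mult_mat(1))
    have 2: "transpose_mat (fst (theta (P, Q))) * X = X * snd (theta (P, Q))"
      unfolding th_t unfolding th X_def using car e1
      by (subst (1 2) block_mult[of _ r]) (auto simp: mat_smult intro!: eq_matI simp del: index_mult_mat(1))
    have 3: "transpose_mat X = form_sign kind \<cdot>\<^sub>m X"
    proof -
      have "transpose_mat X = four_block_mat (0\<^sub>m r r) (- transpose_mat d1) (- transpose_mat d0) (0\<^sub>m r r)"
        unfolding X_def using car by (intro eq_matI) auto
      then show ?thesis unfolding sym unfolding X_def using car by (intro eq_matI) auto
    qed
    show ?thesis unfolding is_form_square[OF N] X using True Xc Xinv 1 2 3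
      by (simp add: form_dual_def dual_T_def)
  next
    case False
    then have ns: "twisted ?s" by (simp add: twisted_source)
    define X where "X = four_block_mat d1 (0\<^sub>m r r) (0\<^sub>m r r) d0"
    have X: "theta_form ?s c = (X, - X)"
      unfolding c01 X_def using theta_form_twisted_explicit[OF c'(1,2) ns] c'(1,2)
      by (auto simp: diag_block_def d0_def d1_def intro!: eq_matI)
    have e1: "transpose_mat q * d0 = d1 * p" "transpose_mat p * d1 = d0 * q"
    proof -
      have "transpose_mat Q * c0 = c1 * P" "transpose_mat P * c1 = c0 * Q"
        using c'(5,6) ns by (simp_all add: form_dual_def dual_T_def)
      then have "map_mat cst (transpose_mat Q * c0) = map_mat cst (c1 * P)"
        "map_mat cst (transpose_mat P * c1) = map_mat cst (c0 * Q)" by simp_all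
      then show "transpose_mat q * d0 = d1 * p" "transpose_mat p * d1 = d0 * q"
        using PQ c'(1,2) by (simp_all add: map_cst_mult tr p_def q_def d0_def d1_def)
    qed
    have sym: "transpose_mat d0 = - form_sign kind \<cdot>\<^sub>m d0" "transpose_mat d1 = - form_sign kind \<cdot>\<^sub>m d1"
    proof -
      have "transpose_mat c0 = (- form_sign kind) \<cdot>\<^sub>m c0" "transpose_mat c1 = (- form_sign kind) \<cdot>\<^sub>m c1"
        using c ns False by (auto simp: is_form_iff c01 form_sign_source)
      from arg_cong[OF this(1), of "map_mat cst"] arg_cong[OF this(2), of "map_mat cst"]
      show "transpose_mat d0 = - form_sign kind \<cdot>\<^sub>m d0" "transpose_mat d1 = - form_sign kind \<cdot>\<^sub>m d1"
        by (simp_all add: tr d0_def d1_def map_hom_simps(3)[OF cst_hom] hom_form_sign[OF cst_hom])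
    qed
    have Xc: "X \<in> carrier_mat (r + r) (r + r)" using car by (auto simp: X_def)
    have Xinv: "invertible_mat X" unfolding X_def by (rule diag_invertible[OF car(4,3) inv(2,1)])
    then have Xinv': "invertible_mat (- X)" by (rule invertible_uminus[OF Xc])
    have 1: "transpose_mat (snd (theta (P, Q))) * X = X * snd (theta (P, Q))"
      unfolding th_t unfolding th X_def using car e1
      by (subst (1 2) block_mult[of _ r]) (auto simp: mat_smult intro!: eq_matI simp del: index_mult_mat(1))
    have 2: "transpose_mat (fst (theta (P, Q))) * X = X * fst (theta (P, Q))"
      unfolding th_t unfolding th X_def using car e1
      by (subst (1 2) block_mult[of _ r]) (auto simp: mat_smult intro!: eq_matI simp del: index_mult_mat(1))
    have 3: "transpose_mat X = - form_sign kind \<cdot>\<^sub>m X"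
    proof -
      have "transpose_mat X = four_block_mat (transpose_mat d1) (0\<^sub>m r r) (0\<^sub>m r r) (transpose_mat d0)"
        unfolding X_def using car by (intro eq_matI) auto
      then show ?thesis unfolding sym unfolding X_def using car by (intro eq_matI) auto
    qed
    have 4: "transpose_mat (- X) = form_sign kind \<cdot>\<^sub>m X" "transpose_mat X = form_sign kind \<cdot>\<^sub>m - X"
    proof -
      have "transpose_mat (- X) = - transpose_mat X" by (rule eq_matI) auto
      then show "transpose_mat (- X) = form_sign kind \<cdot>\<^sub>m X" "transpose_mat X = form_sign kind \<cdot>\<^sub>m - X"
        unfolding 3 by (auto intro!: eq_matI)
    qed
    show ?thesis unfolding is_form_square[OF N] X using False Xc Xinv Xinv' 1 2 4 N
      by (simp add: form_dual_def dual_star_def)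
  qed
qed

definition sub :: "nat \<Rightarrow> nat \<Rightarrow> nat \<Rightarrow> 'a mat \<Rightarrow> 'a mat" where
  "sub r a b A = mat r r (\<lambda>(i, j). A $$ (a + i, b + j))"

lemma sub_carrier [simp]: "sub r a b A \<in> carrier_mat r r" "dim_row (sub r a b A) = r" "dim_col (sub r a b A) = r"
  by (simp_all add: sub_def)

lemma four_block_sub:
  assumes "A \<in> carrier_mat (r + r) (r + r)"
  shows "four_block_mat (sub r 0 0 A) (sub r 0 r A) (sub r r 0 A) (sub r r r A) = A"
  using assms by (intro eq_matI) (auto simp: sub_def)

definition const_part :: "'a::comm_ring_1 fps fps mat2 \<Rightarrow> 'a mat2" where
  "const_part = map2 (\<lambda>f. cf f 0 0)"

lemma cf_00_hom: "comm_ring_hom (\<lambda>f :: 'a::comm_ring_1 fps fps. cf f 0 0)"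
  by unfold_locales (simp_all add: cf_1 cf_mult)

text \<open>The form on \<open>(P, Q)\<close> whose image under \<open>\<theta>\<close> approximates the form \<open>B\<close> on \<open>\<theta>(P, Q)\<close>: the
  constant terms of two blocks of \<open>B\<close>, made symmetric or antisymmetric by averaging; \<open>h = 1/2\<close>.\<close>

definition split_form :: "'a::comm_ring_1 \<Rightarrow> form_kind \<Rightarrow> nat \<Rightarrow> 'a fps fps mat2 \<Rightarrow> 'a mat2" where
  "split_form h kind r B =
    (let b = const_part B; e = form_sign kind in
     if twisted kind then
       let u = sub r r 0 (fst b); v = sub r 0 r (snd b)
       in (- (h \<cdot>\<^sub>m (v + e \<cdot>\<^sub>m transpose_mat u)), - (h \<cdot>\<^sub>m (u + e \<cdot>\<^sub>m transpose_mat v)))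
     else
       let u = sub r 0 0 (fst b); v = - sub r r r (snd b)
       in (h \<cdot>\<^sub>m (v - e \<cdot>\<^sub>m transpose_mat v), h \<cdot>\<^sub>m (u - e \<cdot>\<^sub>m transpose_mat u)))"

lemma split_form_carrier:
  "fst (split_form h kind r B) \<in> carrier_mat r r" "snd (split_form h kind r B) \<in> carrier_mat r r"
  by (auto simp: split_form_def Let_def)

lemma split_form_symmetric:
  fixes h :: "'a::comm_ring_1"
  shows "if twisted kind then transpose_mat (snd (split_form h kind r B)) = form_sign kind \<cdot>\<^sub>m fst (split_form h kind r B)
      \<and> transpose_mat (fst (split_form h kind r B)) = form_sign kind \<cdot>\<^sub>m snd (split_form h kind r B)
    else transpose_mat (fst (split_form h kind r B)) = (- form_sign kind) \<cdot>\<^sub>m fst (split_form h kind r B)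
      \<and> transpose_mat (snd (split_form h kind r B)) = (- form_sign kind) \<cdot>\<^sub>m snd (split_form h kind r B)"
proof -
  have e: "form_sign kind * (form_sign kind * z) = z" for z :: 'a
    using form_sign_sq[of kind, where ?'a = 'a] by (simp add: mult.assoc[symmetric])
  have e': "form_sign kind * (z * (form_sign kind * w)) = z * w" for z w :: 'a
    using e[of "z * w"] by (simp add: mult.left_commute)
  show ?thesis
    by (auto simp: split_form_def Let_def algebra_simps e e' intro!: eq_matI)
qed

lemma split_form_map:
  assumes g: "comm_ring_hom g" and B: "fst B \<in> carrier_mat (r + r) (r + r)" "snd B \<in> carrier_mat (r + r) (r + r)"
    and G: "\<And>f. cf (G f) 0 0 = g (cf f 0 0)"
  shows "split_form (g h) kind r (map2 G B) = map2 g (split_form h kind r B)"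
proof -
  interpret comm_ring_hom g by (rule g)
  have "sub r a b (map_mat (\<lambda>f. cf f 0 0) (map_mat G A)) = map_mat g (sub r a b (map_mat (\<lambda>f. cf f 0 0) A))"
    if "A \<in> carrier_mat (r + r) (r + r)" "a \<le> r" "b \<le> r" for A a b
    using that by (intro eq_matI) (auto simp: sub_def G)
  from this[OF B(1)] this[OF B(2)] show ?thesis
    by (simp add: split_form_def Let_def const_part_def map2_def map_hom_simps[OF g] hom_form_sign[OF g])
qed

lemma theta_form_map:
  assumes g: "comm_ring_hom g" and G: "comm_ring_hom G" "\<And>a. G (cst a) = cst (g a)"
    and c: "fst c \<in> carrier_mat r r" "snd c \<in> carrier_mat r r"
  shows "map2 G (theta_form kind c) = theta_form kind (map2 g c)"
proof -
  obtain c0 c1 where c01: "c = (c0, c1)" by (cases c)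
  have cc: "c0 \<in> carrier_mat r r" "c1 \<in> carrier_mat r r" using c by (simp_all add: c01)
  have Gc: "map_mat G (map_mat cst A) = map_mat cst (map_mat g A)" for A by (rule eq_matI) (auto simp: G)
  have "map_mat G (four_block_mat A B C D) = four_block_mat (map_mat G A) (map_mat G B) (map_mat G C) (map_mat G D)"
    if "A \<in> carrier_mat r r" "B \<in> carrier_mat r r" "C \<in> carrier_mat r r" "D \<in> carrier_mat r r" for A B C D
    by (rule map_four_block_mat[OF that])
  then show ?thesis
    using theta_form_twisted_explicit[OF cc, of kind] theta_form_untwisted_explicit[OF cc, of kind]
      theta_form_twisted_explicit[of "map_mat g c0" r "map_mat g c1" r kind]
      theta_form_untwisted_explicit[of "map_mat g c0" r r "map_mat g c1" kind] cc
    by (cases "twisted kind") (simp_all add: c01 map2_def diag_block_def antidiag_block_def map_hom_simps[OF G(1)] Gc)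
qed

text \<open>For a form on \<open>M\<^sub>r\<close>, the equation that says that it is closed leaves only two blocks of constant terms.\<close>

lemma const_part_Mbar:
  fixes b :: "'k::field fps fps mat2"
  assumes b: "is_form kind (Mbar r) b" and h: "2 * h = (1 :: 'k)"
  shows "const_part b = const_part (theta_form (source_kind kind) (split_form h kind r b))"
proof -
  let ?n = "r + r"
  have N: "fst (Mbar r) \<in> carrier_mat ?n ?n" "snd (Mbar r) \<in> carrier_mat ?n ?n" by (simp_all add: Mbar_eq)
  obtain b0 b1 where b01: "b = (b0, b1)" by (cases b)
  have bc: "b0 \<in> carrier_mat ?n ?n" "b1 \<in> carrier_mat ?n ?n"
    and closed: "fst (form_dual kind (Mbar r)) * b0 = b1 * diag_xy r ?n" "snd (form_dual kind (Mbar r)) * b1 = b0 * diag_yx r ?n"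
    using b is_form_square[OF N, of kind b] by (auto simp: b01 Mbar_eq)
  have tr: "transpose_mat (diag_xy r ?n) = (diag_xy r ?n :: 'k fps fps mat)" "transpose_mat (diag_yx r ?n) = (diag_yx r ?n :: 'k fps fps mat)"
    by (auto intro!: eq_matI simp: diag_xy_def diag_yx_def)
  have h2: "h * 2 = 1" using h by (simp only: mult.commute)
  let ?c = "\<lambda>f :: 'k fps fps. cf f 0 0"
  note var_cf = cf_var_x_mult cf_var_y_mult
  have sc: "fst (split_form h kind r b) \<in> carrier_mat r r" "snd (split_form h kind r b) \<in> carrier_mat r r"
    by (rule split_form_carrier)+
  show ?thesis
  proof (cases "twisted kind")
    case True
    have E1: "(if i < r then var_y else var_x) * b0 $$ (i, j) = b1 $$ (i, j) * diag_var r j" if ij: "i < ?n" "j < ?n" for i j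
      using closed(1) True diag_mult_entry(3)[OF bc(1) ij, of r] diag_mult_entry(2)[OF bc(2) ij, of r]
      by (simp add: form_dual_def dual_T_def Mbar_eq tr del: index_mult_mat(1))
    have const: "?c (b0 $$ (i, j)) = (if i < r \<longleftrightarrow> j < r then 0 else ?c (b1 $$ (i, j)))"
      "i < r \<longleftrightarrow> j < r \<Longrightarrow> ?c (b1 $$ (i, j)) = 0" if ij: "i < ?n" "j < ?n" for i j
      using arg_cong[OF E1[OF ij], of "\<lambda>f. cf f 1 0"] arg_cong[OF E1[OF ij], of "\<lambda>f. cf f 0 1"]
      by (auto simp: var_cf diag_var_def mult.commute[of "b1 $$ _"] split: if_splits)
    have sym: "b0 $$ (j, i) = form_sign kind * b0 $$ (i, j)" if ij: "i < ?n" "j < ?n" for i j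
    proof -
      have "transpose_mat b0 = form_sign kind \<cdot>\<^sub>m b0" using b True by (simp add: is_form_iff b01)
      from arg_cong[OF this, of "\<lambda>X. X $$ (i, j)"] show ?thesis using ij bc by simp
    qed
    have "?c (form_sign kind * f) = form_sign kind * ?c f" for f
      by (cases kind) auto
    then have symc: "form_sign kind * ?c (b0 $$ (i, j)) = ?c (b0 $$ (j, i))" if "i < ?n" "j < ?n" for i j
      using sym[OF that] by simp
    have off: "?c (b1 $$ (i, j)) = ?c (b0 $$ (i, j))" if "i < ?n" "j < ?n" "\<not> (i < r \<longleftrightarrow> j < r)" for i j
      using const[OF that(1,2)] that(3) by simp
    have s0: "fst (split_form h kind r b) = - sub r 0 r (map_mat ?c b0)"
      using True bc by (intro eq_matI) (auto simp: split_form_def Let_def const_part_def b01 map2_def sub_def off symc h2)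
    have s1: "snd (split_form h kind r b) = - sub r r 0 (map_mat ?c b0)"
      using True bc by (intro eq_matI) (auto simp: split_form_def Let_def const_part_def b01 map2_def sub_def off symc h2)
    have "theta_form (source_kind kind) (split_form h kind r b)
       = (antidiag_block (- map_mat cst (fst (split_form h kind r b))) (- map_mat cst (snd (split_form h kind r b))),
          antidiag_block (- map_mat cst (fst (split_form h kind r b))) (- map_mat cst (snd (split_form h kind r b))))"
      using theta_form_untwisted_explicit[OF sc, of "source_kind kind"] True by (simp add: twisted_source)
    then show ?thesis unfolding s0 s1
      using bc const by (auto simp: const_part_def map2_def b01 antidiag_block_def sub_def ops_cst intro!: eq_matI)
  next
    case False
    have E1: "- (diag_var r i * b0 $$ (i, j)) = b1 $$ (i, j) * diag_var r j" if ij: "i < ?n" "j < ?n" for i j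
      using arg_cong[OF closed(1), of "\<lambda>X. X $$ (i, j)"] False diag_mult_entry(1)[OF bc(1) ij, of r] diag_mult_entry(2)[OF bc(2) ij, of r] ij bc
      by (simp add: form_dual_def dual_star_def Mbar_eq tr del: index_mult_mat(1))
    have const: "?c (b1 $$ (i, j)) = (if i < r \<longleftrightarrow> j < r then - ?c (b0 $$ (i, j)) else 0)"
      "\<not> (i < r \<longleftrightarrow> j < r) \<Longrightarrow> ?c (b0 $$ (i, j)) = 0" if ij: "i < ?n" "j < ?n" for i j
      using arg_cong[OF E1[OF ij], of "\<lambda>f. cf f 1 0"] arg_cong[OF E1[OF ij], of "\<lambda>f. cf f 0 1"]
      by (auto simp: var_cf diag_var_def mult.commute[of "b1 $$ _"] split: if_splits)
    have sym: "b1 $$ (j, i) = form_sign kind * b0 $$ (i, j)" if ij: "i < ?n" "j < ?n" for i j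
    proof -
      have "transpose_mat b1 = form_sign kind \<cdot>\<^sub>m b0" using b False by (simp add: is_form_iff b01)
      from arg_cong[OF this, of "\<lambda>X. X $$ (i, j)"] show ?thesis using ij bc by simp
    qed
    have "?c (form_sign kind * f) = form_sign kind * ?c f" for f
      by (cases kind) auto
    then have symc: "form_sign kind * ?c (b0 $$ (i, j)) = ?c (b1 $$ (j, i))" if "i < ?n" "j < ?n" for i j
      using sym[OF that] by simp
    have on: "?c (b1 $$ (i, j)) = - ?c (b0 $$ (i, j))" if "i < ?n" "j < ?n" "i < r \<longleftrightarrow> j < r" for i j
      using const[OF that(1,2)] that(3) by simp
    have s1: "snd (split_form h kind r b) = sub r 0 0 (map_mat ?c b0)"
      using False bc by (intro eq_matI) (auto simp: split_form_def Let_def const_part_def b01 map2_def sub_def on symc h2)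
    have s0: "fst (split_form h kind r b) = sub r r r (map_mat ?c b0)"
      using False bc by (intro eq_matI) (auto simp: split_form_def Let_def const_part_def b01 map2_def sub_def on symc h2)
    have "theta_form (source_kind kind) (split_form h kind r b)
       = (diag_block (map_mat cst (snd (split_form h kind r b))) (map_mat cst (fst (split_form h kind r b))),
          diag_block (- map_mat cst (snd (split_form h kind r b))) (- map_mat cst (fst (split_form h kind r b))))"
      using theta_form_twisted_explicit[OF sc, of "source_kind kind"] False by (simp add: twisted_source)
    then show ?thesis unfolding s0 s1
      using bc const by (auto simp: const_part_def map2_def b01 diag_block_def sub_def ops_cst intro!: eq_matI)
  qed
qed

text \<open>Conversely, the constant terms of the equation that says that \<open>B\<close> is closed say that
  \<open>split_form\<close> is closed.\<close>

lemma split_form_closed: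
  fixes P Q :: "'a::comm_ring_1 mat"
  assumes PQ: "P \<in> carrier_mat r r" "Q \<in> carrier_mat r r" and B: "is_form kind (theta (P, Q)) B"
  shows "fst (form_dual (source_kind kind) (P, Q)) * fst (split_form h kind r B) = snd (split_form h kind r B) * P"
    "snd (form_dual (source_kind kind) (P, Q)) * snd (split_form h kind r B) = fst (split_form h kind r B) * Q"
proof -
  let ?n = "r + r" and ?c = "\<lambda>f :: 'a fps fps. cf f 0 0"
  let ?N = "const_part (theta (P, Q))"
  have N: "fst ?N = four_block_mat (0\<^sub>m r r) P Q (0\<^sub>m r r)" "snd ?N = four_block_mat (0\<^sub>m r r) (- P) (- Q) (0\<^sub>m r r)"
    using PQ unfolding const_part_def theta_explicit[OF PQ]
    by (auto intro!: eq_matI simp: map2_def ops_cst cf_var_x_mult[of 1, simplified] cf_var_y_mult[of 1, simplified] )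
  have form: "is_form kind ?N (const_part B)"
    unfolding const_part_def by (rule is_form_map2[OF cf_00_hom theta_rk(3,4)[OF PQ] B])
  have Nc: "fst ?N \<in> carrier_mat ?n ?n" "snd ?N \<in> carrier_mat ?n ?n" unfolding N using PQ by auto
  have Nt: "transpose_mat (fst ?N) = four_block_mat (0\<^sub>m r r) (transpose_mat Q) (transpose_mat P) (0\<^sub>m r r)"
    "transpose_mat (snd ?N) = four_block_mat (0\<^sub>m r r) (- transpose_mat Q) (- transpose_mat P) (0\<^sub>m r r)"
    unfolding N using PQ by (auto intro!: eq_matI)
  have c: "fst (const_part B) \<in> carrier_mat ?n ?n" "snd (const_part B) \<in> carrier_mat ?n ?n"
    and cl: "fst (form_dual kind ?N) * fst (const_part B) = snd (const_part B) * fst ?N"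
      "snd (form_dual kind ?N) * snd (const_part B) = fst (const_part B) * snd ?N"
    using form is_form_square[OF Nc, of kind "const_part B"] by auto
  define a0 b0 c0 d0 where "a0 = sub r 0 0 (fst (const_part B))" and "b0 = sub r 0 r (fst (const_part B))"
    and "c0 = sub r r 0 (fst (const_part B))" and "d0 = sub r r r (fst (const_part B))"
  define a1 b1 c1 d1 where "a1 = sub r 0 0 (snd (const_part B))" and "b1 = sub r 0 r (snd (const_part B))"
    and "c1 = sub r r 0 (snd (const_part B))" and "d1 = sub r r r (snd (const_part B))"
  note defs = a0_def b0_def c0_def d0_def a1_def b1_def c1_def d1_def
  have car: "a0 \<in> carrier_mat r r" "b0 \<in> carrier_mat r r" "c0 \<in> carrier_mat r r" "d0 \<in> carrier_mat r r"
    "a1 \<in> carrier_mat r r" "b1 \<in> carrier_mat r r" "c1 \<in> carrier_mat r r" "d1 \<in> carrier_mat r r"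
    by (simp_all add: defs)
  have B0: "fst (const_part B) = four_block_mat a0 b0 c0 d0" and B1: "snd (const_part B) = four_block_mat a1 b1 c1 d1"
    using four_block_sub[OF c(1)] four_block_sub[OF c(2)] by (simp_all add: defs)
  have t: "transpose_mat (- A) = - transpose_mat A" "transpose_mat (A + D) = transpose_mat A + transpose_mat D" if "A \<in> carrier_mat r r" "D \<in> carrier_mat r r" for A D :: "'a mat"
    using that by (auto intro!: eq_matI)
  have neg: "- X = Y \<Longrightarrow> X = - Y" for X Y :: "'a mat" by auto
  show "fst (form_dual (source_kind kind) (P, Q)) * fst (split_form h kind r B) = snd (split_form h kind r B) * P"
    "snd (form_dual (source_kind kind) (P, Q)) * snd (split_form h kind r B) = fst (split_form h kind r B) * Q"
  proof -
    have res: "fst (form_dual (source_kind kind) (P, Q)) * fst (split_form h kind r B) = snd (split_form h kind r B) * P \<and>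
      snd (form_dual (source_kind kind) (P, Q)) * snd (split_form h kind r B) = fst (split_form h kind r B) * Q"
    proof (cases "twisted kind")
      case True
      have D: "fst (form_dual kind ?N) = four_block_mat (0\<^sub>m r r) (- transpose_mat Q) (- transpose_mat P) (0\<^sub>m r r)"
        "snd (form_dual kind ?N) = four_block_mat (0\<^sub>m r r) (transpose_mat Q) (transpose_mat P) (0\<^sub>m r r)"
        using True Nt by (simp_all add: form_dual_def dual_T_def)
      have tP: "transpose_mat P \<in> carrier_mat r r" "transpose_mat Q \<in> carrier_mat r r"
        "- transpose_mat P \<in> carrier_mat r r" "- transpose_mat Q \<in> carrier_mat r r" "- P \<in> carrier_mat r r" "- Q \<in> carrier_mat r r"
        using PQ by auto
      have m1: "four_block_mat (- transpose_mat Q * c0) (- transpose_mat Q * d0) (- transpose_mat P * a0) (- transpose_mat P * b0)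
          = four_block_mat (b1 * Q) (a1 * P) (d1 * Q) (c1 * P)"
        using cl(1) block_mult[OF zero_carrier_mat tP(4,3) zero_carrier_mat car(1-4)]
          block_mult[OF car(5-8) zero_carrier_mat PQ zero_carrier_mat] PQ car unfolding D N(1) B0 B1 by simp
      have m2: "four_block_mat (transpose_mat Q * c1) (transpose_mat Q * d1) (transpose_mat P * a1) (transpose_mat P * b1)
          = four_block_mat (- (b0 * Q)) (- (a0 * P)) (- (d0 * Q)) (- (c0 * P))"
        using cl(2) block_mult[OF zero_carrier_mat tP(2,1) zero_carrier_mat car(5-8)]
          block_mult[OF car(1-4) zero_carrier_mat tP(5,6) zero_carrier_mat] PQ car unfolding D N(2) B0 B1 by simp
      have QU: "- (transpose_mat Q * c0) = b1 * Q"
        using four_block_inject(1)[OF m1, of r r r r] PQ car by auto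
      have PV: "transpose_mat P * b1 = - (c0 * P)"
        using four_block_inject(4)[OF m2, of r r r r] PQ car by auto
      have QU': "transpose_mat Q * transpose_mat b1 = - (transpose_mat c0 * Q)"
        using arg_cong[OF QU, of transpose_mat] PQ car by (simp add: mat_transpose_mult t(1)[of _ "0\<^sub>m r r"])
      have PV': "transpose_mat b1 * P = - (transpose_mat P * transpose_mat c0)"
        using arg_cong[OF PV, of transpose_mat] PQ car by (simp add: mat_transpose_mult t(1)[of _ "0\<^sub>m r r"])
      have QU2: "transpose_mat Q * c0 = - (b1 * Q)" using QU by (rule neg)
      have s: "split_form h kind r B = (- (h \<cdot>\<^sub>m (b1 + form_sign kind \<cdot>\<^sub>m transpose_mat c0)), - (h \<cdot>\<^sub>m (c0 + form_sign kind \<cdot>\<^sub>m transpose_mat b1)))"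
        using True by (simp add: split_form_def Let_def defs)
      have d: "fst (form_dual (source_kind kind) (P, Q)) = - transpose_mat P" "snd (form_dual (source_kind kind) (P, Q)) = - transpose_mat Q"
        using True by (simp_all add: form_dual_def twisted_source dual_star_def)
      show ?thesis unfolding s d fst_conv snd_conv
        using PQ car PV PV' QU2 QU' by (simp add: mat_smult mat_distrib)
    next
      case False
      have D: "fst (form_dual kind ?N) = four_block_mat (0\<^sub>m r r) (- transpose_mat Q) (- transpose_mat P) (0\<^sub>m r r)"
        "snd (form_dual kind ?N) = four_block_mat (0\<^sub>m r r) (transpose_mat Q) (transpose_mat P) (0\<^sub>m r r)"
        using False Nt PQ by (auto simp: form_dual_def dual_star_def intro!: eq_matI)
      have tP: "transpose_mat P \<in> carrier_mat r r" "transpose_mat Q \<in> carrier_mat r r"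
        "- transpose_mat P \<in> carrier_mat r r" "- transpose_mat Q \<in> carrier_mat r r" "- P \<in> carrier_mat r r" "- Q \<in> carrier_mat r r"
        using PQ by auto
      have m1: "four_block_mat (- transpose_mat Q * c0) (- transpose_mat Q * d0) (- transpose_mat P * a0) (- transpose_mat P * b0)
          = four_block_mat (b1 * Q) (a1 * P) (d1 * Q) (c1 * P)"
        using cl(1) block_mult[OF zero_carrier_mat tP(4,3) zero_carrier_mat car(1-4)]
          block_mult[OF car(5-8) zero_carrier_mat PQ zero_carrier_mat] PQ car unfolding D N(1) B0 B1 by simp
      have m2: "four_block_mat (transpose_mat Q * c1) (transpose_mat Q * d1) (transpose_mat P * a1) (transpose_mat P * b1)
          = four_block_mat (- (b0 * Q)) (- (a0 * P)) (- (d0 * Q)) (- (c0 * P))"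
        using cl(2) block_mult[OF zero_carrier_mat tP(2,1) zero_carrier_mat car(5-8)]
          block_mult[OF car(1-4) zero_carrier_mat tP(5,6) zero_carrier_mat] PQ car unfolding D N(2) B0 B1 by simp
      have PU: "- (transpose_mat P * a0) = d1 * Q"
        using four_block_inject(3)[OF m1, of r r r r] PQ car by auto
      have QV: "transpose_mat Q * d1 = - (a0 * P)"
        using four_block_inject(2)[OF m2, of r r r r] PQ car by auto
      have PU2: "transpose_mat P * a0 = - (d1 * Q)" using PU by (rule neg)
      have PU': "transpose_mat Q * transpose_mat d1 = - (transpose_mat a0 * P)"
        using arg_cong[OF PU, of transpose_mat] PQ car by (simp add: mat_transpose_mult t(1)[of _ "0\<^sub>m r r"])
      have QV': "transpose_mat d1 * Q = - (transpose_mat P * transpose_mat a0)"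
        using arg_cong[OF QV, of transpose_mat] PQ car by (simp add: mat_transpose_mult t(1)[of _ "0\<^sub>m r r"])
      have s: "split_form h kind r B = (h \<cdot>\<^sub>m (- d1 - form_sign kind \<cdot>\<^sub>m - transpose_mat d1), h \<cdot>\<^sub>m (a0 - form_sign kind \<cdot>\<^sub>m transpose_mat a0))"
        using False t(1)[OF car(8,8)] by (simp add: split_form_def Let_def defs)
      have d: "fst (form_dual (source_kind kind) (P, Q)) = transpose_mat Q" "snd (form_dual (source_kind kind) (P, Q)) = transpose_mat P"
        using False by (simp_all add: form_dual_def twisted_source dual_T_def)
      show ?thesis unfolding s d fst_conv snd_conv
        using PQ car PU2 PU' QV QV' by (simp add: mat_smult mat_distrib)
    qed
    from res show "fst (form_dual (source_kind kind) (P, Q)) * fst (split_form h kind r B) = snd (split_form h kind r B) * P"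
      by (rule conjunct1)
    from res show "snd (form_dual (source_kind kind) (P, Q)) * snd (split_form h kind r B) = fst (split_form h kind r B) * Q"
      by (rule conjunct2)
  qed
qed

section \<open>Deformations with forms\<close>

lemma max_ideal_field: "max_ideal = {0 :: 'k::field}"
  by (auto simp: max_ideal_def dvd_field_iff)

lemma ideal_pow_field: "ideal_pow max_ideal n = (if n = 0 then UNIV else {0 :: 'k::field})"
proof (cases n)
  case 0 then show ?thesis by (simp add: ideal_pow_0)
next
  case (Suc m)
  have "is_ideal {0 :: 'k}" by (rule ring_subspaceI) auto
  then have "ideal_pow max_ideal n \<subseteq> {0 :: 'k}"
    using ideal_pow_anti[of 1 n "max_ideal :: 'k set"] ideal_pow_1[of "{0 :: 'k}"] Suc
    by (simp add: max_ideal_field)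
  then show ?thesis using ring_subspace_0[OF is_ideal_pow] Suc by auto
qed

text \<open>The statements about \<open>A\<close> also apply to \<open>A = k\<close>, that is, to \<open>M\<^sub>r\<close> itself.\<close>

lemma field_complete_algebra: "complete_algebra (\<lambda>a :: 'k::field. a)"
proof
  have "local_ring TYPE('k)"
    unfolding local_ring_def max_ideal_field by (rule ring_subspaceI) auto
  moreover have "noetherian TYPE('k)"
    unfolding noetherian_def
  proof (intro allI impI)
    fix I :: "'k set" assume I: "is_ideal I"
    show "\<exists>B. finite B \<and> I = ideal_gen B"
    proof (cases "I \<subseteq> {0}")
      case True
      then have "I = {0}" using ring_subspace_0[OF I] by auto
      then have "I = ideal_gen {0}" using I ring_span_eq_iff by metis
      then show ?thesis by blast
    next
      case False
      then obtain a where a: "a \<in> I" "a \<noteq> 0" by auto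
      have "c \<in> I" for c using ring_subspace_scale[OF I a(1), of "c / a"] a(2) by simp
      then have "I = UNIV" by auto
      moreover have "c * 1 \<in> ideal_gen {1}" for c :: 'k by (intro ring_span_scale ring_span_base) simp
      then have "ideal_gen {1 :: 'k} = UNIV" by auto
      ultimately have "I = ideal_gen {1}" by simp
      then show ?thesis by blast
    qed
  qed
  moreover have "adically_complete TYPE('k)"
    unfolding adically_complete_def
  proof (intro allI impI)
    fix s :: "nat \<Rightarrow> 'k" assume s: "\<forall>n. s (Suc n) - s n \<in> ideal_pow max_ideal n"
    have const: "s (Suc n) = s 1" for n
    proof (induction n)
      case (Suc n)
      then show ?case using s[rule_format, of "Suc n"] by (simp add: ideal_pow_field)
    qed simp
    show "\<exists>!l. \<forall>n. l - s n \<in> ideal_pow max_ideal n"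
    proof (rule ex1I[of _ "s 1"])
      show "\<forall>n. s 1 - s n \<in> ideal_pow max_ideal n"
      proof
        fix n show "s 1 - s n \<in> ideal_pow max_ideal n"
          by (cases n) (simp_all add: ideal_pow_field const del: One_nat_def)
      qed
      fix l assume "\<forall>n. l - s n \<in> ideal_pow max_ideal n"
      then show "l = s 1" by (auto simp: ideal_pow_field dest: spec[of _ 1])
    qed
  qed
  moreover have "comm_ring_hom (\<lambda>a :: 'k. a)" by unfold_locales auto
  ultimately show "complete_local_noetherian_algebra (\<lambda>a :: 'k. a)"
    unfolding complete_local_noetherian_algebra_def max_ideal_field by auto
qed

lemma (in complete_algebra) invertible_if_residue:
  fixes A :: "'a mat"
  assumes A: "A \<in> carrier_mat n n" and i: "invertible_mat (map_mat (residue \<iota>) A)"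
  shows "invertible_mat A"
proof (rule invertible_if_det_unit[OF A])
  interpret comm_ring_hom "residue \<iota>" by (rule residue_hom)
  have c: "map_mat (residue \<iota>) A \<in> carrier_mat n n" using A by simp
  obtain B where B: "B \<in> carrier_mat n n" "map_mat (residue \<iota>) A * B = 1\<^sub>m n"
    by (rule invertible_matE[OF i c])
  have "det (map_mat (residue \<iota>) A) * det B = 1" using det_mult[OF c B(1)] B(2) by simp
  then have "residue \<iota> (det A) \<noteq> 0" by (auto simp: hom_det)
  then show "det A dvd 1" by (simp add: unit_iff residue_zero_iff)
qed

lemma (in complete_algebra) map_red_theta:
  assumes PQ: "P \<in> carrier_mat r r" "Q \<in> carrier_mat r r" "mat_in max_ideal P" "mat_in max_ideal Q"
  shows "map2 (red \<iota>) (theta (P, Q)) = Mbar r"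
proof -
  interpret red: comm_ring_hom "red \<iota>" by (rule red_hom)
  interpret res: comm_ring_hom "residue \<iota>" by (rule residue_hom)
  have 0: "map_mat (red \<iota>) (map_mat cst A) = 0\<^sub>m r r" if "A \<in> carrier_mat r r" "mat_in max_ideal A" for A
  proof (rule eq_matI)
    fix i j assume ij: "i < dim_row (0\<^sub>m r r)" "j < dim_col (0\<^sub>m r r)"
    then have "residue \<iota> (A $$ (i, j)) = 0" using that by (auto simp: residue_zero_iff mat_in_def)
    then show "map_mat (red \<iota>) (map_mat cst A) $$ (i, j) = 0\<^sub>m r r $$ (i, j)" using ij that by simp
  qed (use that in auto)
  have fb: "map_mat (red \<iota>) (four_block_mat A B C D) = four_block_mat (map_mat (red \<iota>) A) (map_mat (red \<iota>) B) (map_mat (red \<iota>) C) (map_mat (red \<iota>) D)"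
    if "A \<in> carrier_mat r r" "B \<in> carrier_mat r r" "C \<in> carrier_mat r r" "D \<in> carrier_mat r r" for A B C D
    by (rule map_four_block_mat[OF that])
  have "- 0\<^sub>m r r = (0\<^sub>m r r :: 'k fps fps mat)" by (rule uminus_zero_mat)
  then show ?thesis
    using 0[OF PQ(1,3)] 0[OF PQ(2,4)] PQ(1,2)
    by (simp add: theta_explicit[OF PQ(1,2)] map2_def fb Mbar_def diag_block_def map_hom_simps[OF red_hom])
qed

lemma const_part_theta_form:
  assumes c: "fst c \<in> carrier_mat r r" "snd c \<in> carrier_mat r r"
  shows "const_part (theta_form kind c) =
    (if twisted kind then
      (four_block_mat (snd c) (0\<^sub>m r r) (0\<^sub>m r r) (fst c), four_block_mat (- snd c) (0\<^sub>m r r) (0\<^sub>m r r) (- fst c))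
     else
      (four_block_mat (0\<^sub>m r r) (- fst c) (- snd c) (0\<^sub>m r r), four_block_mat (0\<^sub>m r r) (- fst c) (- snd c) (0\<^sub>m r r)))"
proof -
  obtain c0 c1 where c01: "c = (c0, c1)" by (cases c)
  show ?thesis
    using theta_form_twisted_explicit[of c0 r c1 r kind] theta_form_untwisted_explicit[of c0 r r c1 kind] c
    by (auto simp: c01 const_part_def map2_def diag_block_def antidiag_block_def ops_cst intro!: eq_matI)
qed

lemma (in complete_algebra) form_splitting:
  fixes P Q :: "'a mat" and h :: 'k
  assumes h: "2 * h = 1" and PQ: "P \<in> carrier_mat r r" "Q \<in> carrier_mat r r" "mat_in max_ideal P" "mat_in max_ideal Q"
    and B: "is_form kind (theta (P, Q)) B"
  defines "c \<equiv> split_form (\<iota> h) kind r B"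
  defines "X \<equiv> theta_form (source_kind kind) c"
  shows "is_form (source_kind kind) (P, Q) c"
    and "map2 (red \<iota>) X = theta_form (source_kind kind) (split_form h kind r (map2 (red \<iota>) B))"
    and "\<exists>s. mf_iso (theta (P, Q)) (theta (P, Q)) s \<and> preserves_form kind s B X \<and>
      fst s \<in> carrier_mat (r + r) (r + r) \<and> snd s \<in> carrier_mat (r + r) (r + r) \<and>
      mat_in (W 1) (fst s - 1\<^sub>m (r + r)) \<and> mat_in (W 1) (snd s - 1\<^sub>m (r + r)) \<and>
      fst X * (fst s * fst s) = fst B \<and> snd X * (snd s * snd s) = snd B"
proof -
  let ?n = "r + r" and ?b = "map2 (red \<iota>) B" and ?s = "source_kind kind"
  interpret iota: comm_ring_hom \<iota> by (rule iota_hom)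
  have "2 * \<iota> h = \<iota> (2 * h)" by (simp only: mult_2 iota.hom_add)
  then have two: "2 * \<iota> h = 1" unfolding h by simp
  have N: "fst (theta (P, Q)) \<in> carrier_mat ?n ?n" "snd (theta (P, Q)) \<in> carrier_mat ?n ?n" by (rule theta_rk[OF PQ(1,2)])+
  have Bc: "fst B \<in> carrier_mat ?n ?n" "snd B \<in> carrier_mat ?n ?n" "invertible_mat (fst B)" "invertible_mat (snd B)"
    using B is_form_square[OF N] by auto
  have b: "is_form kind (Mbar r) ?b"
    using is_form_map2[OF red_hom N B] by (simp add: map_red_theta[OF PQ])
  have cc: "fst c \<in> carrier_mat r r" "snd c \<in> carrier_mat r r" unfolding c_def by (rule split_form_carrier)+
  have red_c: "split_form h kind r ?b = map2 (residue \<iota>) c"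
    using split_form_map[OF residue_hom Bc(1,2), of "red \<iota>" "\<iota> h" kind] by (simp add: c_def)
  show red_X: "map2 (red \<iota>) X = theta_form ?s (split_form h kind r ?b)"
    unfolding X_def red_c by (rule theta_form_map[OF residue_hom red_hom _ cc]) simp
  have const: "const_part ?b = const_part (map2 (red \<iota>) X)"
    unfolding red_X by (rule const_part_Mbar[OF b h])
  have "invertible_mat (fst (const_part ?b))"
    unfolding const_part_def map2_simps using Bc
    by (intro invertible_map_mat[OF cf_00_hom, of _ ?n] invertible_map_mat[OF red_hom, of _ ?n]) auto
  then have inv: "invertible_mat (fst (const_part (theta_form ?s (map2 (residue \<iota>) c))))"
    by (simp only: const red_X red_c)
  have rc: "map_mat (residue \<iota>) (fst c) \<in> carrier_mat r r" "map_mat (residue \<iota>) (snd c) \<in> carrier_mat r r" using cc by simp_all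
  have "invertible_mat (map_mat (residue \<iota>) (fst c)) \<and> invertible_mat (map_mat (residue \<iota>) (snd c))"
  proof (cases "twisted ?s")
    case True
    then show ?thesis using inv diag_invertible_blocks[OF rc(2,1)] rc by (simp add: const_part_theta_form[of _ r])
  next
    case False
    have m: "- map_mat (residue \<iota>) (fst c) \<in> carrier_mat r r" "- map_mat (residue \<iota>) (snd c) \<in> carrier_mat r r" using rc by simp_all
    have "invertible_mat (- map_mat (residue \<iota>) (fst c)) \<and> invertible_mat (- map_mat (residue \<iota>) (snd c))"
      using False inv antidiag_invertible[OF m] rc by (simp add: const_part_theta_form[of _ r])
    then show ?thesis using invertible_uminus[OF m(1)] invertible_uminus[OF m(2)] by simp
  qed
  then have c_inv: "invertible_mat (fst c)" "invertible_mat (snd c)" using invertible_if_residue cc by auto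
  have PQc: "fst (P, Q) \<in> carrier_mat r r" "snd (P, Q) \<in> carrier_mat r r" using PQ by simp_all
  show c: "is_form ?s (P, Q) c"
    unfolding is_form_square[OF PQc]
    using cc c_inv split_form_closed[OF PQ(1,2) B, of "\<iota> h"] split_form_symmetric[of kind "\<iota> h" r B]
    by (auto simp: c_def[symmetric] form_sign_source twisted_source split: if_splits)
  have X: "is_form kind (theta (P, Q)) X" unfolding X_def by (rule theta_form_is_form[OF PQ(1,2) c])
  have Xc: "fst X \<in> carrier_mat ?n ?n" "snd X \<in> carrier_mat ?n ?n" using X is_form_square[OF N] by auto
  have near: "mat_in (W 1) (A - D)"
    if eq: "map_mat (\<lambda>f. cf f 0 0) (map_mat (red \<iota>) A) = map_mat (\<lambda>f. cf f 0 0) (map_mat (red \<iota>) D)"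
      and "A \<in> carrier_mat ?n ?n" "D \<in> carrier_mat ?n ?n" for A D
    unfolding mat_in_def W1_iff
  proof (intro allI impI)
    fix i j assume ij: "i < dim_row (A - D)" "j < dim_col (A - D)"
    have "map_mat (\<lambda>f. cf f 0 0) (map_mat (red \<iota>) A) $$ (i, j) = map_mat (\<lambda>f. cf f 0 0) (map_mat (red \<iota>) D) $$ (i, j)"
      unfolding eq ..
    then have "residue \<iota> (cf (A $$ (i, j)) 0 0) = residue \<iota> (cf (D $$ (i, j)) 0 0)"
      using ij that(2,3) by simp
    then show "cf ((A - D) $$ (i, j)) 0 0 \<in> max_ideal" using ij that(2,3) by (simp add: residue_eq_iff)
  qed
  have nears: "mat_in (W 1) (fst B - fst X)" "mat_in (W 1) (snd B - snd X)"
    using arg_cong[OF const, of fst] arg_cong[OF const, of snd] Bc Xc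
    by (auto simp: const_part_def simp del: One_nat_def intro!: near)
  have "(2 :: 'a) dvd 1" by (rule dvdI[OF two[symmetric]])
  then obtain s where "mf_iso (theta (P, Q)) (theta (P, Q)) s" "preserves_form kind s B X"
    "fst s \<in> carrier_mat ?n ?n" "snd s \<in> carrier_mat ?n ?n"
    "mat_in (W 1) (fst s - 1\<^sub>m ?n)" "mat_in (W 1) (snd s - 1\<^sub>m ?n)"
    "fst X * (fst s * fst s) = fst B" "snd X * (snd s * snd s) = snd B"
    by (rule form_sqrt[OF _ N B X nears])
  then show "\<exists>s. mf_iso (theta (P, Q)) (theta (P, Q)) s \<and> preserves_form kind s B X \<and>
      fst s \<in> carrier_mat ?n ?n \<and> snd s \<in> carrier_mat ?n ?n \<and>
      mat_in (W 1) (fst s - 1\<^sub>m ?n) \<and> mat_in (W 1) (snd s - 1\<^sub>m ?n) \<and>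
      fst X * (fst s * fst s) = fst B \<and> snd X * (snd s * snd s) = snd B"
    by (intro exI[of _ s] conjI)
qed

lemma (in complete_algebra) sqrt_unique:
  fixes s :: "'a fps fps mat"
  assumes two: "(2 :: 'a) dvd 1"
    and s: "s \<in> carrier_mat n n" "mat_in (W 1) (s - 1\<^sub>m n)"
    and t: "t \<in> carrier_mat n n" "mat_in (W 1) (t - 1\<^sub>m n)"
    and X: "X \<in> carrier_mat n n" "invertible_mat X" and eq: "X * (s * s) = X * (t * t)"
  shows "s = t"
proof -
  have "s * s = t * t" by (rule mat_cancel_left[OF eq X, where m = n]) (use s t in auto)
  then have "s * s * 1\<^sub>m n = 1\<^sub>m n * (t * t)" using s t by simp
  from sylvester[OF two s t one_carrier_mat this] show ?thesis using s t by simp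
qed

lemma (in complete_algebra) form_deformation_is_theta:
  assumes char: "(2 :: 'k) \<noteq> 0" and b: "is_form kind (Mbar r) b"
  shows "\<exists>g. mf_iso (Mbar r) (Mbar r) g \<and>
           (constant_entries b \<longrightarrow> g = mf_id (Mbar r)) \<and>
           (\<forall>M B. is_form_deformation \<iota> r kind b M B \<longrightarrow>
              (\<exists>\<pi> \<in> max_ideal. \<exists>P Q c.
                 P \<in> carrier_mat r r \<and> elements_mat P \<subseteq> max_ideal \<and>
                 Q \<in> carrier_mat r r \<and> elements_mat Q \<subseteq> max_ideal \<and>
                 is_mf \<pi> (P, Q) \<and> is_form (source_kind kind) (P, Q) c \<and>
                 form_gauge_equivalent \<iota> kind g M B
                   (theta (P, Q)) (theta_form (source_kind kind) c)))"
proof -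
  let ?n = "r + r"
  obtain h :: 'k where h: "2 * h = 1" using right_inverse[OF char] by blast
  interpret K: complete_algebra "\<lambda>a :: 'k. a" by (rule field_complete_algebra)
  have two_k: "(2 :: 'k) dvd 1" by (rule dvdI[OF h[symmetric]])
  let ?X = "theta_form (source_kind kind) (split_form h kind r b)"
  have zero: "mat_in max_ideal (0\<^sub>m r r :: 'k mat)" by (simp add: mat_in_def max_ideal_field)
  have b': "is_form kind (theta (0\<^sub>m r r, 0\<^sub>m r r)) b" using b by (simp add: theta_zero)
  obtain g where g: "mf_iso (Mbar r) (Mbar r) g" "fst g \<in> carrier_mat ?n ?n" "snd g \<in> carrier_mat ?n ?n"
    "mat_in (W 1) (fst g - 1\<^sub>m ?n)" "mat_in (W 1) (snd g - 1\<^sub>m ?n)"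
    "fst ?X * (fst g * fst g) = fst b" "snd ?X * (snd g * snd g) = snd b"
    using K.form_splitting(3)[OF h zero_carrier_mat zero_carrier_mat zero zero b'] unfolding theta_zero by blast
  have X: "is_form kind (Mbar r) ?X"
    using theta_form_is_form[OF zero_carrier_mat zero_carrier_mat K.form_splitting(1)[OF h zero_carrier_mat zero_carrier_mat zero zero b']]
    by (simp add: theta_zero)
  have MN: "fst (Mbar r) \<in> carrier_mat ?n ?n" "snd (Mbar r) \<in> carrier_mat ?n ?n" by (simp_all add: Mbar_eq)
  have Xc: "fst ?X \<in> carrier_mat ?n ?n" "snd ?X \<in> carrier_mat ?n ?n" "invertible_mat (fst ?X)" "invertible_mat (snd ?X)"
    using X unfolding is_form_square[OF MN] by simp_all
  have unique: "g' = g" if "fst g' \<in> carrier_mat ?n ?n" "snd g' \<in> carrier_mat ?n ?n"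
    "mat_in (W 1) (fst g' - 1\<^sub>m ?n)" "mat_in (W 1) (snd g' - 1\<^sub>m ?n)"
    "fst ?X * (fst g' * fst g') = fst b" "snd ?X * (snd g' * snd g') = snd b" for g'
    using K.sqrt_unique[OF two_k that(1,3) g(2,4) Xc(1,3)] K.sqrt_unique[OF two_k that(2,4) g(3,5) Xc(2,4)] that(5,6) g(6,7)
    by (simp add: prod_eq_iff)
  have "g = mf_id (Mbar r)" if const: "constant_entries b"
  proof -
    let ?G = "\<lambda>f :: 'k fps fps. cst (cf f 0 0)"
    have G: "comm_ring_hom ?G"
      by unfold_locales (simp_all add: cf_1 cf_mult cst_add cst_mult)
    obtain b0 where b0: "b = map2 cst b0" using const unfolding constant_entries_def by blast
    have id: "comm_ring_hom (\<lambda>a :: 'k. a)" by unfold_locales auto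
    have map_id: "map2 (\<lambda>a. a) A = A" for A :: "'k mat2" by (cases A) (auto simp: map2_def intro!: eq_matI)
    have comp: "map2 cst (const_part A) = map2 ?G A" for A :: "'k fps fps mat2"
      by (auto simp: const_part_def map2_def intro!: eq_matI)
    have "?X = map2 ?G ?X"
      using theta_form_map[OF id G _ split_form_carrier, of "source_kind kind" h kind r b] by (simp add: ops_cst map_id)
    also have "\<dots> = map2 cst (const_part b)" unfolding comp[symmetric] const_part_Mbar[OF b h] ..
    also have "\<dots> = b" unfolding comp unfolding b0 by (auto simp: map2_def ops_cst intro!: eq_matI)
    finally have "?X = b" .
    then have "mf_id (Mbar r) = g"
      using Xc by (intro unique) (auto simp: mf_id_def Mbar_eq rk0_def rk1_def mat_in_def W_ideal)
    then show ?thesis by simp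
  qed
  moreover have "\<exists>\<pi> \<in> max_ideal. \<exists>P Q c.
                 P \<in> carrier_mat r r \<and> elements_mat P \<subseteq> max_ideal \<and>
                 Q \<in> carrier_mat r r \<and> elements_mat Q \<subseteq> max_ideal \<and>
                 is_mf \<pi> (P, Q) \<and> is_form (source_kind kind) (P, Q) c \<and>
                 form_gauge_equivalent \<iota> kind g M B
                   (theta (P, Q)) (theta_form (source_kind kind) c)"
    if def: "is_form_deformation \<iota> r kind b M B" for M B
  proof -
    have d: "is_deformation \<iota> r M" "is_form kind M B" and red_B: "map2 (red \<iota>) B = b"
      using def unfolding is_form_deformation_def by auto
    obtain \<alpha> \<pi> P Q f where \<alpha>: "gauge_aut \<iota> \<alpha>" and \<pi>: "\<pi> \<in> max_ideal"
      and PQ: "P \<in> carrier_mat r r" "Q \<in> carrier_mat r r" "mat_in max_ideal P" "mat_in max_ideal Q" "is_mf \<pi> (P, Q)"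
      and f: "mf_iso (map2 \<alpha> M) (theta (P, Q)) f" "map2 (red \<iota>) f = mf_id (Mbar r)"
      and M: "mf_shape (map2 \<alpha> M)" "rk0 M = ?n" "rk1 M = ?n"
      using deformation_normal_form[OF d(1)] by metis
    have \<alpha>': "comm_ring_hom \<alpha>" "\<And>f. red \<iota> (\<alpha> f) = red \<iota> f" using \<alpha> by (simp_all add: gauge_aut_def)
    have Mc: "fst M \<in> carrier_mat ?n ?n" "snd M \<in> carrier_mat ?n ?n"
      using M fst_carrier[of M] by (simp_all add: mf_shape_def)
    have \<alpha>Mc: "fst (map2 \<alpha> M) \<in> carrier_mat ?n ?n" "snd (map2 \<alpha> M) \<in> carrier_mat ?n ?n" using Mc by simp_all
    note T = theta_rk[OF PQ(1,2)]
    have fc: "fst f \<in> carrier_mat ?n ?n" "snd f \<in> carrier_mat ?n ?n"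
      using f(1) mf_iso_iff[of "map2 \<alpha> M" "theta (P, Q)" ?n ?n f] M T by auto
    obtain B1 where B1: "is_form kind (theta (P, Q)) B1" "preserves_form kind f (map2 \<alpha> B) B1"
      using form_transport[OF \<alpha>Mc T(3,4) f(1) is_form_map2[OF \<alpha>'(1) Mc d(2)]] by blast
    have B1c: "fst B1 \<in> carrier_mat ?n ?n" "snd B1 \<in> carrier_mat ?n ?n" using B1(1) is_form_square[OF T(3,4)] by auto
    have "map2 (red \<iota>) (map2 \<alpha> B) = b" unfolding red_B[symmetric] by (auto simp: map2_def \<alpha>' intro!: eq_matI)
    then have "preserves_form kind (mf_id (Mbar r)) b (map2 (red \<iota>) B1)"
      using preserves_form_map2[OF red_hom fc B1c B1(2)] by (simp add: f(2))
    then have red_B1: "map2 (red \<iota>) B1 = b"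
      using B1c by (auto simp: preserves_form_def mf_id_def Mbar_eq rk0_def rk1_def prod_eq_iff split: if_splits)
    let ?c = "split_form (\<iota> h) kind r B1"
    let ?Y = "theta_form (source_kind kind) ?c"
    note split = form_splitting[OF h PQ(1-4) B1(1)]
    obtain s where s: "mf_iso (theta (P, Q)) (theta (P, Q)) s" "preserves_form kind s B1 ?Y"
      "fst s \<in> carrier_mat ?n ?n" "snd s \<in> carrier_mat ?n ?n"
      "mat_in (W 1) (fst s - 1\<^sub>m ?n)" "mat_in (W 1) (snd s - 1\<^sub>m ?n)"
      "fst ?Y * (fst s * fst s) = fst B1" "snd ?Y * (snd s * snd s) = snd B1"
      using split(3) by blast
    have Yc: "fst ?Y \<in> carrier_mat ?n ?n" "snd ?Y \<in> carrier_mat ?n ?n"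
      using theta_form_is_form[OF PQ(1,2) split(1)] is_form_square[OF T(3,4)] by auto
    have W: "mat_in (W 1) (map_mat (red \<iota>) A - 1\<^sub>m ?n)" if A: "A \<in> carrier_mat ?n ?n" "mat_in (W 1) (A - 1\<^sub>m ?n)" for A
    proof -
      interpret red: comm_ring_hom "red \<iota>" by (rule red_hom)
      have "map_mat (red \<iota>) A - 1\<^sub>m ?n = map_mat (red \<iota>) (A - 1\<^sub>m ?n)" using A(1) by (simp add: map_hom_simps[OF red_hom])
      then show ?thesis using A
        by (auto simp: mat_in_def W1_iff K.W1_iff residue_zero_iff max_ideal_field simp del: One_nat_def index_minus_mat(1))
    qed
    have red_s: "map2 (red \<iota>) s = g"
    proof (rule unique)
      have "map_mat (red \<iota>) (fst ?Y * (fst s * fst s)) = fst b" "map_mat (red \<iota>) (snd ?Y * (snd s * snd s)) = snd b"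
        unfolding s(7,8) red_B1[symmetric] by simp_all
      moreover have "map_mat (red \<iota>) (fst ?Y) = fst ?X" "map_mat (red \<iota>) (snd ?Y) = snd ?X"
        using arg_cong[OF split(2), of fst] arg_cong[OF split(2), of snd] by (simp_all add: red_B1)
      ultimately show "fst ?X * (fst (map2 (red \<iota>) s) * fst (map2 (red \<iota>) s)) = fst b"
        "snd ?X * (snd (map2 (red \<iota>) s) * snd (map2 (red \<iota>) s)) = snd b"
        using Yc s(3,4) by (simp_all add: map_hom_mult[OF red_hom])
    qed (use s W in auto)
    let ?f = "mf_comp s f"
    have "gauge_takes \<iota> \<alpha> ?f M (theta (P, Q))"
      unfolding gauge_takes_def using \<alpha> mf_iso_comp[OF M(1) T(5,5) _ T(1,1) _ T(2,2) f(1) s(1)] M by simp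
    moreover have "map2 (red \<iota>) ?f = g"
    proof -
      have "map2 (red \<iota>) ?f = mf_comp (map2 (red \<iota>) s) (map2 (red \<iota>) f)"
        using s(3,4) fc by (simp add: mf_comp_def map2_def map_hom_mult[OF red_hom])
      then show ?thesis unfolding red_s f(2) using g(2,3) by (simp add: mf_comp_def mf_id_def Mbar_eq rk0_def rk1_def)
    qed
    moreover have "preserves_form kind ?f (map2 \<alpha> B) ?Y"
      by (rule preserves_form_comp[OF fc s(3,4) Yc B1(2) s(2)])
    ultimately have "form_gauge_equivalent \<iota> kind g M B (theta (P, Q)) ?Y"
      unfolding form_gauge_equivalent_def by blast
    then show ?thesis using \<pi> PQ split(1) unfolding elements_mat_subset by blast
  qed
  ultimately show ?thesis using g(1) by blast
qed

section \<open>The homotopy category\<close>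

lemma homotopic_iff:
  "(f, g) \<in> homotopic M N \<longleftrightarrow> f \<in> mf_hom M N \<and> g \<in> mf_hom M N \<and>
    (\<exists>h0 \<in> carrier_mat (rk1 N) (rk0 M). \<exists>h1 \<in> carrier_mat (rk0 N) (rk1 M).
      fst g - fst f = snd N * h0 + h1 * fst M \<and> snd g - snd f = fst N * h1 + h0 * snd M)"
  unfolding homotopic_def odd_maps_def D_odd_def by auto

lemma homotopicI:
  assumes "f \<in> mf_hom M N" "g \<in> mf_hom M N"
    and "h0 \<in> carrier_mat (rk1 N) (rk0 M)" "h1 \<in> carrier_mat (rk0 N) (rk1 M)"
    and "fst g - fst f = snd N * h0 + h1 * fst M" "snd g - snd f = fst N * h1 + h0 * snd M"
  shows "(f, g) \<in> homotopic M N"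
  unfolding homotopic_iff using assms by blast

lemma mf_homD:
  assumes "mf_shape M" "mf_shape N" "f \<in> mf_hom M (N :: 'a::comm_ring_1 mat2)"
  shows "fst f \<in> carrier_mat (rk0 N) (rk0 M)" "snd f \<in> carrier_mat (rk1 N) (rk1 M)"
    "fst N * fst f = snd f * fst M" "snd N * snd f = fst f * snd M"
  using assms mf_hom_iff[OF assms(1,2)] by auto

lemma mf_carriers:
  assumes "mf_shape M"
  shows "fst M \<in> carrier_mat (rk1 M) (rk0 M)" "snd M \<in> carrier_mat (rk0 M) (rk1 M)"
  using assms by (auto simp: fst_carrier mf_shape_def)

lemma homotopic_equiv:
  fixes M N :: "'a::comm_ring_1 mat2"
  assumes M: "mf_shape M" "mf_shape N"
  shows "equiv (mf_hom M N) (homotopic M N)"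
proof (rule equivI)
  note c = mf_carriers[OF M(1)] mf_carriers[OF M(2)]
  show "homotopic M N \<subseteq> mf_hom M N \<times> mf_hom M N" by (auto simp: homotopic_iff)
  show "refl_on (mf_hom M N) (homotopic M N)"
  proof (rule refl_onI)
    fix f assume f: "f \<in> mf_hom M N"
    note d = mf_homD[OF M f]
    show "(f, f) \<in> homotopic M N"
      by (rule homotopicI[of _ _ _ _ "0\<^sub>m (rk1 N) (rk0 M)" "0\<^sub>m (rk0 N) (rk1 M)"]) (use f c d in auto)
  qed
  show "sym (homotopic M N)"
  proof (rule symI)
    fix f g assume fg: "(f, g) \<in> homotopic M N"
    then obtain h0 h1 where h: "h0 \<in> carrier_mat (rk1 N) (rk0 M)" "h1 \<in> carrier_mat (rk0 N) (rk1 M)"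
      "fst g - fst f = snd N * h0 + h1 * fst M" "snd g - snd f = fst N * h1 + h0 * snd M"
      and hom: "f \<in> mf_hom M N" "g \<in> mf_hom M N" unfolding homotopic_iff by blast
    note d = mf_homD[OF M hom(1)] mf_homD[OF M hom(2)]
    have neg: "A - B = - (B - A)" if "A \<in> carrier_mat m n" "B \<in> carrier_mat m n" for A B :: "'a mat" and m n
      using that by (intro eq_matI) auto
    have neg2: "- (A + B) = - A + - B" if "A \<in> carrier_mat m n" "B \<in> carrier_mat m n" for A B :: "'a mat" and m n
      using that by (intro eq_matI) auto
    have p: "snd N * h0 \<in> carrier_mat (rk0 N) (rk0 M)" "h1 * fst M \<in> carrier_mat (rk0 N) (rk0 M)"
      "fst N * h1 \<in> carrier_mat (rk1 N) (rk1 M)" "h0 * snd M \<in> carrier_mat (rk1 N) (rk1 M)"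
      using c h(1,2) by auto
    have "fst f - fst g = snd N * (- h0) + (- h1) * fst M"
      unfolding neg[OF d(1,5)] h(3) neg2[OF p(1,2)] using c h(1,2) by simp
    moreover have "snd f - snd g = fst N * (- h1) + (- h0) * snd M"
      unfolding neg[OF d(2,6)] h(4) neg2[OF p(3,4)] using c h(1,2) by simp
    ultimately show "(g, f) \<in> homotopic M N"
      using homotopicI[OF hom(2,1), of "- h0" "- h1"] h(1,2) by simp
  qed
  show "trans (homotopic M N)"
  proof (rule transI)
    fix f g k assume fg: "(f, g) \<in> homotopic M N" and gk: "(g, k) \<in> homotopic M N"
    from fg obtain h0 h1 where h: "h0 \<in> carrier_mat (rk1 N) (rk0 M)" "h1 \<in> carrier_mat (rk0 N) (rk1 M)"
      "fst g - fst f = snd N * h0 + h1 * fst M" "snd g - snd f = fst N * h1 + h0 * snd M"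
      and hom: "f \<in> mf_hom M N" "g \<in> mf_hom M N" unfolding homotopic_iff by blast
    from gk obtain l0 l1 where l: "l0 \<in> carrier_mat (rk1 N) (rk0 M)" "l1 \<in> carrier_mat (rk0 N) (rk1 M)"
      "fst k - fst g = snd N * l0 + l1 * fst M" "snd k - snd g = fst N * l1 + l0 * snd M"
      and hom': "k \<in> mf_hom M N" unfolding homotopic_iff by blast
    note d = mf_homD[OF M hom(1)] mf_homD[OF M hom(2)] mf_homD[OF M hom']
    have "fst k - fst f = (fst k - fst g) + (fst g - fst f)" "snd k - snd f = (snd k - snd g) + (snd g - snd f)"
      using d by (auto intro!: eq_matI)
    then have "fst k - fst f = snd N * (l0 + h0) + (l1 + h1) * fst M" "snd k - snd f = fst N * (l1 + h1) + (l0 + h0) * snd M"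
      unfolding h(3,4) l(3,4) using c h(1,2) l(1,2)
      by (auto simp: mat_distrib intro!: eq_matI simp del: index_mult_mat(1))
    then show "(f, k) \<in> homotopic M N"
      using homotopicI[OF hom(1) hom', of "l0 + h0" "l1 + h1"] h(1,2) l(1,2) by simp
  qed
qed

lemma mf_id_hom:
  assumes "mf_shape M"
  shows "mf_id M \<in> mf_hom M (M :: 'a::comm_ring_1 mat2)"
  using mf_carriers[OF assms] by (subst mf_hom_iff[OF assms assms]) (auto simp: mf_id_def)

lemma mf_comp_hom:
  fixes L M N :: "'a::comm_ring_1 mat2"
  assumes M: "mf_shape L" "mf_shape M" "mf_shape N" and f: "f \<in> mf_hom L M" and g: "g \<in> mf_hom M N"
  shows "mf_comp g f \<in> mf_hom L N"
proof -
  note c = mf_carriers[OF M(1)] mf_carriers[OF M(2)] mf_carriers[OF M(3)]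
  note f = mf_homD[OF M(1,2) f] and g = mf_homD[OF M(2,3) g]
  have "fst N * (fst g * fst f) = fst N * fst g * fst f" using c f(1,2) g(1,2) by (simp add: mat_assoc)
  also have "\<dots> = snd g * (fst M * fst f)" unfolding g(3) using c f(1,2) g(1,2) by (simp add: mat_assoc)
  also have "\<dots> = snd g * snd f * fst L" unfolding f(3) using c f(1,2) g(1,2) by (simp add: mat_assoc)
  finally have 1: "fst N * (fst g * fst f) = snd g * snd f * fst L" .
  have "snd N * (snd g * snd f) = snd N * snd g * snd f" using c f(1,2) g(1,2) by (simp add: mat_assoc)
  also have "\<dots> = fst g * (snd M * snd f)" unfolding g(4) using c f(1,2) g(1,2) by (simp add: mat_assoc)
  also have "\<dots> = fst g * fst f * snd L" unfolding f(4) using c f(1,2) g(1,2) by (simp add: mat_assoc)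
  finally have 2: "snd N * (snd g * snd f) = fst g * fst f * snd L" .
  show ?thesis unfolding mf_hom_iff[OF M(1,3)] mf_comp_def using 1 2 f(1,2) g(1,2) by simp
qed

lemma homotopic_comp:
  fixes L M N :: "'a::comm_ring_1 mat2"
  assumes M: "mf_shape L" "mf_shape M" "mf_shape N"
    and f: "(f, f') \<in> homotopic L M" and g: "(g, g') \<in> homotopic M N"
  shows "(mf_comp g f, mf_comp g' f') \<in> homotopic L N"
proof -
  note c = mf_carriers[OF M(1)] mf_carriers[OF M(2)] mf_carriers[OF M(3)]
  from f obtain h0 h1 where h: "h0 \<in> carrier_mat (rk1 M) (rk0 L)" "h1 \<in> carrier_mat (rk0 M) (rk1 L)"
    "fst f' - fst f = snd M * h0 + h1 * fst L" "snd f' - snd f = fst M * h1 + h0 * snd L"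
    and fh: "f \<in> mf_hom L M" "f' \<in> mf_hom L M" unfolding homotopic_iff by blast
  from g obtain k0 k1 where k: "k0 \<in> carrier_mat (rk1 N) (rk0 M)" "k1 \<in> carrier_mat (rk0 N) (rk1 M)"
    "fst g' - fst g = snd N * k0 + k1 * fst M" "snd g' - snd g = fst N * k1 + k0 * snd M"
    and gh: "g \<in> mf_hom M N" "g' \<in> mf_hom M N" unfolding homotopic_iff by blast
  note f = mf_homD[OF M(1,2) fh(1)] and f' = mf_homD[OF M(1,2) fh(2)]
  note g = mf_homD[OF M(2,3) gh(1)] and g' = mf_homD[OF M(2,3) gh(2)]
  let ?l0 = "snd g' * h0 + k0 * fst f" and ?l1 = "fst g' * h1 + k1 * snd f"
  have expand: "X' * Y' - X * Y = X' * (Y' - Y) + (X' - X) * Y"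
    if "X \<in> carrier_mat m n" "X' \<in> carrier_mat m n" "Y \<in> carrier_mat n p" "Y' \<in> carrier_mat n p"
    for X X' Y Y' :: "'a mat" and m n p
    using that by (auto simp: mat_distrib intro!: eq_matI simp del: index_mult_mat(1))
  have "fst g' * fst f' - fst g * fst f = fst g' * (snd M * h0 + h1 * fst L) + (snd N * k0 + k1 * fst M) * fst f"
    unfolding expand[OF g(1) g'(1) f(1) f'(1)] h(3) k(3) ..
  also have "\<dots> = (fst g' * snd M) * h0 + fst g' * h1 * fst L + (snd N * k0 * fst f + k1 * (fst M * fst f))"
    using c f(1,2) g'(1,2) h(1,2) k(1,2) by (simp add: mat_distrib mat_assoc)
  also have "\<dots> = snd N * ?l0 + ?l1 * fst L"
    unfolding f(3) g'(4)[symmetric] using c f(1,2) g'(1,2) h(1,2) k(1,2)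
    by (simp add: mat_distrib mat_assoc) (rule eq_matI; simp del: index_mult_mat(1))
  finally have 1: "fst g' * fst f' - fst g * fst f = snd N * ?l0 + ?l1 * fst L" .
  have "snd g' * snd f' - snd g * snd f = snd g' * (fst M * h1 + h0 * snd L) + (fst N * k1 + k0 * snd M) * snd f"
    unfolding expand[OF g(2) g'(2) f(2) f'(2)] h(4) k(4) ..
  also have "\<dots> = (snd g' * fst M) * h1 + snd g' * h0 * snd L + (fst N * k1 * snd f + k0 * (snd M * snd f))"
    using c f(1,2) g'(1,2) h(1,2) k(1,2) by (simp add: mat_distrib mat_assoc)
  also have "\<dots> = fst N * ?l1 + ?l0 * snd L"
    unfolding f(4) g'(3)[symmetric] using c f(1,2) g'(1,2) h(1,2) k(1,2)
    by (simp add: mat_distrib mat_assoc) (rule eq_matI; simp del: index_mult_mat(1))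
  finally have 2: "snd g' * snd f' - snd g * snd f = fst N * ?l1 + ?l0 * snd L" .
  show ?thesis
  proof (rule homotopicI[of _ _ _ _ ?l0 ?l1])
    show "mf_comp g f \<in> mf_hom L N" "mf_comp g' f' \<in> mf_hom L N"
      using mf_comp_hom[OF M fh(1) gh(1)] mf_comp_hom[OF M fh(2) gh(2)] by auto
    show "?l0 \<in> carrier_mat (rk1 N) (rk0 L)" "?l1 \<in> carrier_mat (rk0 N) (rk1 L)"
      using h(1,2) k(1,2) f(1,2) g'(1,2) by auto
  qed (use 1 2 in \<open>simp_all add: mf_comp_def\<close>)
qed

abbreviation hcls :: "'a::comm_ring_1 mat2 \<Rightarrow> 'a mat2 \<Rightarrow> 'a mat2 \<Rightarrow> 'a mat2 set" where
  "hcls M N f \<equiv> homotopic M N `` {f}"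

lemma MF_simps [simp]:
  "Obj (MF w) = {M. is_mf w M}" "Mor (MF w) = Ext0" "Idt (MF w) M = hcls M M (mf_id M)"
  by (simp_all add: MF_def)

lemma hcls_Ext0: "f \<in> mf_hom M N \<Longrightarrow> hcls M N f \<in> Ext0 M N"
  unfolding Ext0_def by (rule quotientI)

lemma Ext0_cases:
  assumes "F \<in> Ext0 M N"
  obtains f where "f \<in> mf_hom M N" "F = hcls M N f"
  using assms unfolding Ext0_def by (rule quotientE)

lemma hcls_eq_iff:
  assumes "mf_shape M" "mf_shape N" "f \<in> mf_hom M N" "g \<in> mf_hom M N"
  shows "hcls M N f = hcls M N g \<longleftrightarrow> (f, g) \<in> homotopic M N"
  using eq_equiv_class_iff[OF homotopic_equiv[OF assms(1,2)] assms(3,4)] .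

lemma Cmp_hcls:
  assumes M: "mf_shape L" "mf_shape M" "mf_shape N" and f: "f \<in> mf_hom L M" and g: "g \<in> mf_hom M N"
  shows "Cmp (MF w) L M N (hcls M N g) (hcls L M f) = hcls L N (mf_comp g f)"
proof -
  note LM = homotopic_equiv[OF M(1,2)] and MN = homotopic_equiv[OF M(2,3)] and LN = homotopic_equiv[OF M(1,3)]
  have "(mf_comp g f, k) \<in> homotopic L N"
    if "(g, g') \<in> homotopic M N" "(f, f') \<in> homotopic L M" "(mf_comp g' f', k) \<in> homotopic L N" for f' g' k
    using homotopic_comp[OF M that(2,1)] that(3) LN by (meson equivE transD)
  moreover have "(f, f) \<in> homotopic L M" "(g, g) \<in> homotopic M N"
    using LM MN f g by (auto simp: equiv_def refl_on_def)
  ultimately have "k \<in> Cmp (MF w) L M N (hcls M N g) (hcls L M f) \<longleftrightarrow> (mf_comp g f, k) \<in> homotopic L N" for k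
    unfolding MF_def by (simp only: cat.select_convs Image_iff Image_singleton_iff) blast
  then show ?thesis by blast
qed

lemma mf_comp_assoc:
  fixes K L M N :: "'a::comm_ring_1 mat2"
  assumes M: "mf_shape K" "mf_shape L" "mf_shape M" "mf_shape N"
    and f: "f \<in> mf_hom K L" and g: "g \<in> mf_hom L M" and h: "h \<in> mf_hom M N"
  shows "mf_comp h (mf_comp g f) = mf_comp (mf_comp h g) f"
  using mf_homD[OF M(1,2) f] mf_homD[OF M(2,3) g] mf_homD[OF M(3,4) h] by (simp add: mf_comp_def mat_assoc)

lemma mf_comp_id:
  fixes M N :: "'a::comm_ring_1 mat2"
  assumes M: "mf_shape M" "mf_shape N" and f: "f \<in> mf_hom M N"
  shows "mf_comp f (mf_id M) = f" "mf_comp (mf_id N) f = f"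
  using mf_homD[OF M f] by (simp_all add: mf_comp_def mf_id_def)

lemma MF_category: "category (MF w :: ('a::comm_ring_1 mat2, 'a mat2 set) cat)"
  unfolding category_def
proof (intro conjI ballI)
  fix M :: "'a mat2" assume "M \<in> Obj (MF w)"
  then have M: "mf_shape M" by (auto intro: is_mf_shape)
  then show "Idt (MF w) M \<in> Mor (MF w) M M" by (simp add: hcls_Ext0 mf_id_hom)
  fix N :: "'a mat2" assume "N \<in> Obj (MF w)"
  then have N: "mf_shape N" by (auto intro: is_mf_shape)
  fix F assume "F \<in> Mor (MF w) M N"
  then obtain f where f: "f \<in> mf_hom M N" "F = hcls M N f" by (auto elim: Ext0_cases)
  show "Cmp (MF w) M M N F (Idt (MF w) M) = F" "Cmp (MF w) M N N (Idt (MF w) N) F = F"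
    using Cmp_hcls[OF M M N mf_id_hom[OF M] f(1)] Cmp_hcls[OF M N N f(1) mf_id_hom[OF N]] mf_comp_id[OF M N f(1)]
    by (simp_all add: f(2))
next
  fix L M N :: "'a mat2" and F G
  assume "L \<in> Obj (MF w)" "M \<in> Obj (MF w)" "N \<in> Obj (MF w)" "F \<in> Mor (MF w) L M" "G \<in> Mor (MF w) M N"
  then have M: "mf_shape L" "mf_shape M" "mf_shape N" and FG: "F \<in> Ext0 L M" "G \<in> Ext0 M N" by (auto intro: is_mf_shape)
  obtain f where f: "f \<in> mf_hom L M" "F = hcls L M f" by (rule Ext0_cases[OF FG(1)])
  obtain g where g: "g \<in> mf_hom M N" "G = hcls M N g" by (rule Ext0_cases[OF FG(2)])
  show "Cmp (MF w) L M N G F \<in> Mor (MF w) L N"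
    using Cmp_hcls[OF M f(1) g(1)] mf_comp_hom[OF M f(1) g(1)] by (simp add: f(2) g(2) hcls_Ext0)
next
  fix K L M N :: "'a mat2" and F G H
  assume "K \<in> Obj (MF w)" "L \<in> Obj (MF w)" "M \<in> Obj (MF w)" "N \<in> Obj (MF w)"
    "F \<in> Mor (MF w) K L" "G \<in> Mor (MF w) L M" "H \<in> Mor (MF w) M N"
  then have M: "mf_shape K" "mf_shape L" "mf_shape M" "mf_shape N"
    and FGH: "F \<in> Ext0 K L" "G \<in> Ext0 L M" "H \<in> Ext0 M N" by (auto intro: is_mf_shape)
  obtain f where f: "f \<in> mf_hom K L" "F = hcls K L f" by (rule Ext0_cases[OF FGH(1)])
  obtain g where g: "g \<in> mf_hom L M" "G = hcls L M g" by (rule Ext0_cases[OF FGH(2)])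
  obtain h where h: "h \<in> mf_hom M N" "H = hcls M N h" by (rule Ext0_cases[OF FGH(3)])
  have "Cmp (MF w) K L M G F = hcls K M (mf_comp g f)" "Cmp (MF w) L M N H G = hcls L N (mf_comp h g)"
    unfolding f(2) g(2) h(2) using Cmp_hcls M f(1) g(1) h(1) by blast+
  then show "Cmp (MF w) K M N H (Cmp (MF w) K L M G F) = Cmp (MF w) K L N (Cmp (MF w) L M N H G) F"
    using Cmp_hcls[OF M(1,3,4) mf_comp_hom[OF M(1-3) f(1) g(1)] h(1)]
      Cmp_hcls[OF M(1,2,4) f(1) mf_comp_hom[OF M(2-4) g(1) h(1)]] mf_comp_assoc[OF M f(1) g(1) h(1)]
    by (simp add: f(2) h(2))
qed

text \<open>Maps in the two directions that are inverse to each other up to homotopy give an isomorphism.\<close>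

lemma MF_isoI:
  assumes M: "mf_shape M" "mf_shape N" and f: "f \<in> mf_hom M N" and g: "g \<in> mf_hom N M"
    and "(mf_comp g f, mf_id M) \<in> homotopic M M" "(mf_comp f g, mf_id N) \<in> homotopic N N"
  shows "cat_iso (MF w) M N (hcls M N f)"
  unfolding cat_iso_def
proof (intro conjI bexI[of _ "hcls N M g"])
  show "Cmp (MF w) M N M (hcls N M g) (hcls M N f) = Idt (MF w) M"
    unfolding Cmp_hcls[OF M(1,2,1) f g] MF_simps
    using assms(5) hcls_eq_iff[OF M(1,1) mf_comp_hom[OF M(1,2,1) f g] mf_id_hom[OF M(1)]] by simp
  show "Cmp (MF w) N M N (hcls M N f) (hcls N M g) = Idt (MF w) N"
    unfolding Cmp_hcls[OF M(2,1,2) g f] MF_simps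
    using assms(6) hcls_eq_iff[OF M(2,2) mf_comp_hom[OF M(2,1,2) g f] mf_id_hom[OF M(2)]] by simp
qed (use f g in \<open>simp_all add: hcls_Ext0\<close>)

section \<open>Equivalences of categories\<close>

lemma cat_iso_comp:
  assumes C: "category C" and X: "X \<in> Obj C" "Y \<in> Obj C" "Z \<in> Obj C"
    and f: "cat_iso C X Y f" and g: "cat_iso C Y Z g"
  shows "cat_iso C X Z (Cmp C X Y Z g f)"
proof -
  obtain f' where f': "f \<in> Mor C X Y" "f' \<in> Mor C Y X" "Cmp C X Y X f' f = Idt C X" "Cmp C Y X Y f f' = Idt C Y"
    using f unfolding cat_iso_def by blast
  obtain g' where g': "g \<in> Mor C Y Z" "g' \<in> Mor C Z Y" "Cmp C Y Z Y g' g = Idt C Y" "Cmp C Z Y Z g g' = Idt C Z"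
    using g unfolding cat_iso_def by blast
  have comp: "\<And>L M N f g. L \<in> Obj C \<Longrightarrow> M \<in> Obj C \<Longrightarrow> N \<in> Obj C \<Longrightarrow> f \<in> Mor C L M \<Longrightarrow> g \<in> Mor C M N \<Longrightarrow> Cmp C L M N g f \<in> Mor C L N"
    and id: "\<And>M N f. M \<in> Obj C \<Longrightarrow> N \<in> Obj C \<Longrightarrow> f \<in> Mor C M N \<Longrightarrow> Cmp C M M N f (Idt C M) = f"
      "\<And>M N f. M \<in> Obj C \<Longrightarrow> N \<in> Obj C \<Longrightarrow> f \<in> Mor C M N \<Longrightarrow> Cmp C M N N (Idt C N) f = f"
    and assoc: "\<And>K L M N f g h. K \<in> Obj C \<Longrightarrow> L \<in> Obj C \<Longrightarrow> M \<in> Obj C \<Longrightarrow> N \<in> Obj C \<Longrightarrow>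
      f \<in> Mor C K L \<Longrightarrow> g \<in> Mor C L M \<Longrightarrow> h \<in> Mor C M N \<Longrightarrow>
      Cmp C K M N h (Cmp C K L M g f) = Cmp C K L N (Cmp C L M N h g) f"
    using C unfolding category_def by blast+
  have "Cmp C X Z X (Cmp C Z Y X f' g') (Cmp C X Y Z g f) = Idt C X"
    using X f' g' by (simp add: assoc[symmetric, of X Z Y X] assoc[of X Y Z Y] comp id)
  moreover have "Cmp C Z X Z (Cmp C X Y Z g f) (Cmp C Z Y X f' g') = Idt C Z"
    using X f' g' by (simp add: assoc[symmetric, of Z X Y Z] assoc[of Z Y X Y] comp id)
  ultimately show ?thesis unfolding cat_iso_def using X f' g' comp by blast
qed

text \<open>A fully faithful and essentially surjective functor is an equivalence: a quasi-inverse is obtained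
  by choosing, for each object of the target, an isomorphism from the image of an object of the source.\<close>

lemma equivalenceI:
  assumes F: "is_functor C D Fo Fm"
    and ff: "\<And>M N. M \<in> Obj C \<Longrightarrow> N \<in> Obj C \<Longrightarrow> bij_betw (Fm M N) (Mor C M N) (Mor D (Fo M) (Fo N))"
    and es: "\<And>Y. Y \<in> Obj D \<Longrightarrow> \<exists>X \<in> Obj C. \<exists>e. cat_iso D (Fo X) Y e"
  shows "is_equivalence C D Fo Fm"
proof -
  have C: "category C" and D: "category D" and Fo: "\<And>M. M \<in> Obj C \<Longrightarrow> Fo M \<in> Obj D"
    and Fm: "\<And>M N f. M \<in> Obj C \<Longrightarrow> N \<in> Obj C \<Longrightarrow> f \<in> Mor C M N \<Longrightarrow> Fm M N f \<in> Mor D (Fo M) (Fo N)"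
    and Fid: "\<And>M. M \<in> Obj C \<Longrightarrow> Fm M M (Idt C M) = Idt D (Fo M)"
    and Fcomp: "\<And>L M N f g. L \<in> Obj C \<Longrightarrow> M \<in> Obj C \<Longrightarrow> N \<in> Obj C \<Longrightarrow> f \<in> Mor C L M \<Longrightarrow> g \<in> Mor C M N \<Longrightarrow>
      Fm L N (Cmp C L M N g f) = Cmp D (Fo L) (Fo M) (Fo N) (Fm M N g) (Fm L M f)"
    using F unfolding is_functor_def by simp_all
  have compC: "\<And>L M N f g. L \<in> Obj C \<Longrightarrow> M \<in> Obj C \<Longrightarrow> N \<in> Obj C \<Longrightarrow> f \<in> Mor C L M \<Longrightarrow> g \<in> Mor C M N \<Longrightarrow> Cmp C L M N g f \<in> Mor C L N"
    and idC: "\<And>M. M \<in> Obj C \<Longrightarrow> Idt C M \<in> Mor C M M"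
    using C unfolding category_def by simp_all
  have comp: "\<And>L M N f g. L \<in> Obj D \<Longrightarrow> M \<in> Obj D \<Longrightarrow> N \<in> Obj D \<Longrightarrow> f \<in> Mor D L M \<Longrightarrow> g \<in> Mor D M N \<Longrightarrow> Cmp D L M N g f \<in> Mor D L N"
    and idD: "\<And>M. M \<in> Obj D \<Longrightarrow> Idt D M \<in> Mor D M M"
    and id: "\<And>M N f. M \<in> Obj D \<Longrightarrow> N \<in> Obj D \<Longrightarrow> f \<in> Mor D M N \<Longrightarrow> Cmp D M M N f (Idt D M) = f"
      "\<And>M N f. M \<in> Obj D \<Longrightarrow> N \<in> Obj D \<Longrightarrow> f \<in> Mor D M N \<Longrightarrow> Cmp D M N N (Idt D N) f = f"
    and assoc: "\<And>K L M N f g h. K \<in> Obj D \<Longrightarrow> L \<in> Obj D \<Longrightarrow> M \<in> Obj D \<Longrightarrow> N \<in> Obj D \<Longrightarrow>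
      f \<in> Mor D K L \<Longrightarrow> g \<in> Mor D L M \<Longrightarrow> h \<in> Mor D M N \<Longrightarrow>
      Cmp D K M N h (Cmp D K L M g f) = Cmp D K L N (Cmp D L M N h g) f"
    using D unfolding category_def by simp_all
  have "\<exists>p. \<forall>Y \<in> Obj D. fst (p Y) \<in> Obj C \<and> fst (snd (p Y)) \<in> Mor D (Fo (fst (p Y))) Y
      \<and> snd (snd (p Y)) \<in> Mor D Y (Fo (fst (p Y)))
      \<and> Cmp D (Fo (fst (p Y))) Y (Fo (fst (p Y))) (snd (snd (p Y))) (fst (snd (p Y))) = Idt D (Fo (fst (p Y)))
      \<and> Cmp D Y (Fo (fst (p Y))) Y (fst (snd (p Y))) (snd (snd (p Y))) = Idt D Y"
  proof (rule bchoice, rule ballI)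
    fix Y assume "Y \<in> Obj D"
    from es[OF this] obtain X e where "X \<in> Obj C" "cat_iso D (Fo X) Y e" by blast
    moreover from this(2) obtain e' where "e \<in> Mor D (Fo X) Y" "e' \<in> Mor D Y (Fo X)"
      "Cmp D (Fo X) Y (Fo X) e' e = Idt D (Fo X)" "Cmp D Y (Fo X) Y e e' = Idt D Y"
      unfolding cat_iso_def by auto
    ultimately show "\<exists>p. fst p \<in> Obj C \<and> fst (snd p) \<in> Mor D (Fo (fst p)) Y \<and> snd (snd p) \<in> Mor D Y (Fo (fst p))
      \<and> Cmp D (Fo (fst p)) Y (Fo (fst p)) (snd (snd p)) (fst (snd p)) = Idt D (Fo (fst p))
      \<and> Cmp D Y (Fo (fst p)) Y (fst (snd p)) (snd (snd p)) = Idt D Y"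
      by (intro exI[of _ "(X, e, e')"]) simp
  qed
  then obtain p where p: "\<forall>Y \<in> Obj D. fst (p Y) \<in> Obj C \<and> fst (snd (p Y)) \<in> Mor D (Fo (fst (p Y))) Y
      \<and> snd (snd (p Y)) \<in> Mor D Y (Fo (fst (p Y)))
      \<and> Cmp D (Fo (fst (p Y))) Y (Fo (fst (p Y))) (snd (snd (p Y))) (fst (snd (p Y))) = Idt D (Fo (fst (p Y)))
      \<and> Cmp D Y (Fo (fst (p Y))) Y (fst (snd (p Y))) (snd (snd (p Y))) = Idt D Y" by (rule exE)
  define Go where "Go Y = fst (p Y)" for Y
  define e where "e Y = fst (snd (p Y))" for Y
  define e' where "e' Y = snd (snd (p Y))" for Y
  note P = bspec[OF p, folded Go_def e_def e'_def]
  have Go: "Go Y \<in> Obj C" if "Y \<in> Obj D" for Y by (rule P[OF that, THEN conjunct1])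
  have e: "e Y \<in> Mor D (Fo (Go Y)) Y" if "Y \<in> Obj D" for Y
    by (rule P[OF that, THEN conjunct2, THEN conjunct1])
  have e': "e' Y \<in> Mor D Y (Fo (Go Y))" if "Y \<in> Obj D" for Y
    by (rule P[OF that, THEN conjunct2, THEN conjunct2, THEN conjunct1])
  have e'e: "Cmp D (Fo (Go Y)) Y (Fo (Go Y)) (e' Y) (e Y) = Idt D (Fo (Go Y))" if "Y \<in> Obj D" for Y
    by (rule P[OF that, THEN conjunct2, THEN conjunct2, THEN conjunct2, THEN conjunct1])
  have ee': "Cmp D Y (Fo (Go Y)) Y (e Y) (e' Y) = Idt D Y" if "Y \<in> Obj D" for Y
    by (rule P[OF that, THEN conjunct2, THEN conjunct2, THEN conjunct2, THEN conjunct2])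
  have FG: "\<And>Y. Y \<in> Obj D \<Longrightarrow> Fo (Go Y) \<in> Obj D" by (intro Fo Go)
  define pre where "pre M N = inv_into (Mor C M N) (Fm M N)" for M N
  have pre: "pre M N f \<in> Mor C M N" "Fm M N (pre M N f) = f"
    if "M \<in> Obj C" "N \<in> Obj C" "f \<in> Mor D (Fo M) (Fo N)" for M N f
  proof -
    have "f \<in> Fm M N ` Mor C M N" using that(3) bij_betw_imp_surj_on[OF ff[OF that(1,2)]] by simp
    then show "pre M N f \<in> Mor C M N" "Fm M N (pre M N f) = f"
      unfolding pre_def by (rule inv_into_into, rule f_inv_into_f)
  qed
  have pre_eq: "pre M N (Fm M N f) = f" if "M \<in> Obj C" "N \<in> Obj C" "f \<in> Mor C M N" for M N f
    unfolding pre_def by (rule inv_into_f_f[OF bij_betw_imp_inj_on[OF ff[OF that(1,2)]] that(3)])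
  have inj: "f = g" if "M \<in> Obj C" "N \<in> Obj C" "f \<in> Mor C M N" "g \<in> Mor C M N" "Fm M N f = Fm M N g" for M N f g
  proof -
    have "f = pre M N (Fm M N f)" by (rule pre_eq[OF that(1,2,3), symmetric])
    also have "\<dots> = g" unfolding that(5) by (rule pre_eq[OF that(1,2,4)])
    finally show ?thesis .
  qed
  define conj where "conj Y Z f = Cmp D (Fo (Go Y)) Z (Fo (Go Z)) (e' Z) (Cmp D (Fo (Go Y)) Y Z f (e Y))" for Y Z f
  have conj: "conj Y Z f \<in> Mor D (Fo (Go Y)) (Fo (Go Z))" if "Y \<in> Obj D" "Z \<in> Obj D" "f \<in> Mor D Y Z" for Y Z f
    unfolding conj_def using that by (intro comp e e' FG)
  define Gm where "Gm Y Z f = pre (Go Y) (Go Z) (conj Y Z f)" for Y Z f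
  have Gm: "Gm Y Z f \<in> Mor C (Go Y) (Go Z)" "Fm (Go Y) (Go Z) (Gm Y Z f) = conj Y Z f"
    if "Y \<in> Obj D" "Z \<in> Obj D" "f \<in> Mor D Y Z" for Y Z f
    unfolding Gm_def using pre[OF Go[OF that(1)] Go[OF that(2)] conj[OF that]] by auto
  have e_conj: "Cmp D (Fo (Go Y)) (Fo (Go Z)) Z (e Z) (conj Y Z f) = Cmp D (Fo (Go Y)) Y Z f (e Y)"
    if "Y \<in> Obj D" "Z \<in> Obj D" "f \<in> Mor D Y Z" for Y Z f
  proof -
    have fe: "Cmp D (Fo (Go Y)) Y Z f (e Y) \<in> Mor D (Fo (Go Y)) Z" using that by (intro comp e FG)
    have "Cmp D (Fo (Go Y)) (Fo (Go Z)) Z (e Z) (conj Y Z f)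
        = Cmp D (Fo (Go Y)) Z Z (Cmp D Z (Fo (Go Z)) Z (e Z) (e' Z)) (Cmp D (Fo (Go Y)) Y Z f (e Y))"
      unfolding conj_def by (rule assoc[OF FG[OF that(1)] that(2) FG[OF that(2)] that(2) fe e'[OF that(2)] e[OF that(2)]])
    then show ?thesis using id(2)[OF FG[OF that(1)] that(2) fe] ee'[OF that(2)] by simp
  qed
  have "is_functor D C Go Gm"
    unfolding is_functor_def
  proof (intro conjI ballI C D)
    fix Y assume Y: "Y \<in> Obj D"
    show "Go Y \<in> Obj C" using Go Y .
    have "conj Y Y (Idt D Y) = Idt D (Fo (Go Y))"
      unfolding conj_def using id(2)[OF FG[OF Y] Y e[OF Y]] e'e[OF Y] by simp
    then show "Gm Y Y (Idt D Y) = Idt C (Go Y)"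
      unfolding Gm_def using pre_eq[OF Go[OF Y] Go[OF Y] idC[OF Go[OF Y]]] Fid[OF Go[OF Y]] by simp
  next
    fix Y Z f assume "Y \<in> Obj D" "Z \<in> Obj D" "f \<in> Mor D Y Z"
    then show "Gm Y Z f \<in> Mor C (Go Y) (Go Z)" by (rule Gm)
  next
    fix X Y Z f g assume X: "X \<in> Obj D" and Y: "Y \<in> Obj D" and Z: "Z \<in> Obj D" and f: "f \<in> Mor D X Y" and g: "g \<in> Mor D Y Z"
    have gf: "Cmp D X Y Z g f \<in> Mor D X Z" by (rule comp[OF X Y Z f g])
    have ge: "Cmp D (Fo (Go Y)) Y Z g (e Y) \<in> Mor D (Fo (Go Y)) Z" by (rule comp[OF FG[OF Y] Y Z e[OF Y] g])
    have fe: "Cmp D (Fo (Go X)) X Y f (e X) \<in> Mor D (Fo (Go X)) Y" by (rule comp[OF FG[OF X] X Y e[OF X] f])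
    have "Cmp D (Fo (Go X)) (Fo (Go Y)) (Fo (Go Z)) (conj Y Z g) (conj X Y f)
      = Cmp D (Fo (Go X)) Z (Fo (Go Z)) (e' Z) (Cmp D (Fo (Go X)) (Fo (Go Y)) Z (Cmp D (Fo (Go Y)) Y Z g (e Y)) (conj X Y f))"
      unfolding conj_def[of Y Z] by (rule assoc[OF FG[OF X] FG[OF Y] Z FG[OF Z] conj[OF X Y f] ge e'[OF Z], symmetric])
    also have "Cmp D (Fo (Go X)) (Fo (Go Y)) Z (Cmp D (Fo (Go Y)) Y Z g (e Y)) (conj X Y f)
      = Cmp D (Fo (Go X)) Y Z g (Cmp D (Fo (Go X)) (Fo (Go Y)) Y (e Y) (conj X Y f))"
      by (rule assoc[OF FG[OF X] FG[OF Y] Y Z conj[OF X Y f] e[OF Y] g, symmetric])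
    also have "\<dots> = Cmp D (Fo (Go X)) Y Z g (Cmp D (Fo (Go X)) X Y f (e X))" by (simp only: e_conj[OF X Y f])
    also have "\<dots> = Cmp D (Fo (Go X)) X Z (Cmp D X Y Z g f) (e X)" by (rule assoc[OF FG[OF X] X Y Z e[OF X] f g])
    finally have "conj X Z (Cmp D X Y Z g f) = Cmp D (Fo (Go X)) (Fo (Go Y)) (Fo (Go Z)) (conj Y Z g) (conj X Y f)"
      by (simp only: conj_def[of X Z])
    moreover note c = compC[OF Go[OF X] Go[OF Y] Go[OF Z] Gm(1)[OF X Y f] Gm(1)[OF Y Z g]]
    moreover have "Fm (Go X) (Go Z) (Cmp C (Go X) (Go Y) (Go Z) (Gm Y Z g) (Gm X Y f))
      = Cmp D (Fo (Go X)) (Fo (Go Y)) (Fo (Go Z)) (conj Y Z g) (conj X Y f)"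
      unfolding Fcomp[OF Go[OF X] Go[OF Y] Go[OF Z] Gm(1)[OF X Y f] Gm(1)[OF Y Z g]] Gm(2)[OF X Y f] Gm(2)[OF Y Z g] ..
    ultimately show "Gm X Z (Cmp D X Y Z g f) = Cmp C (Go X) (Go Y) (Go Z) (Gm Y Z g) (Gm X Y f)"
      using inj[OF Go[OF X] Go[OF Z] Gm(1)[OF X Z gf] c] Gm(2)[OF X Z gf] by simp
  qed
  moreover have "natural_iso D D (\<lambda>M. Fo (Go M)) (\<lambda>M N f. Fm (Go M) (Go N) (Gm M N f)) (\<lambda>M. M) (\<lambda>M N f. f) e"
    unfolding natural_iso_def
  proof (intro conjI ballI)
    fix Y assume Y: "Y \<in> Obj D"
    show "cat_iso D (Fo (Go Y)) Y (e Y)"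
      unfolding cat_iso_def using e[OF Y] e'[OF Y] e'e[OF Y] ee'[OF Y] by blast
  next
    fix Y Z f assume YZ: "Y \<in> Obj D" "Z \<in> Obj D" "f \<in> Mor D Y Z"
    show "Cmp D (Fo (Go Y)) Y Z f (e Y) = Cmp D (Fo (Go Y)) (Fo (Go Z)) Z (e Z) (Fm (Go Y) (Go Z) (Gm Y Z f))"
      by (simp only: Gm(2)[OF YZ] e_conj[OF YZ])
  qed
  moreover have "natural_iso C C (\<lambda>M. M) (\<lambda>M N f. f) (\<lambda>M. Go (Fo M)) (\<lambda>M N f. Gm (Fo M) (Fo N) (Fm M N f))
      (\<lambda>M. pre M (Go (Fo M)) (e' (Fo M)))"
    unfolding natural_iso_def
  proof (intro conjI ballI)
    fix M assume M: "M \<in> Obj C"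
    note FM = Fo[OF M] and GM = Go[OF Fo[OF M]]
    note a = pre[OF M GM e'[OF FM]] and b = pre[OF GM M e[OF FM]]
    show "cat_iso C M (Go (Fo M)) (pre M (Go (Fo M)) (e' (Fo M)))"
      unfolding cat_iso_def
    proof (intro conjI bexI[of _ "pre (Go (Fo M)) M (e (Fo M))"] a b)
      show "Cmp C M (Go (Fo M)) M (pre (Go (Fo M)) M (e (Fo M))) (pre M (Go (Fo M)) (e' (Fo M))) = Idt C M"
        by (rule inj[OF M M compC[OF M GM M a(1) b(1)] idC[OF M]])
          (simp only: Fcomp[OF M GM M a(1) b(1)] a(2) b(2) Fid[OF M] ee'[OF FM])
      show "Cmp C (Go (Fo M)) M (Go (Fo M)) (pre M (Go (Fo M)) (e' (Fo M))) (pre (Go (Fo M)) M (e (Fo M))) = Idt C (Go (Fo M))"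
        by (rule inj[OF GM GM compC[OF GM M GM b(1) a(1)] idC[OF GM]])
          (simp only: Fcomp[OF GM M GM b(1) a(1)] a(2) b(2) Fid[OF GM] e'e[OF FM])
    qed
  next
    fix M N f assume M: "M \<in> Obj C" and N: "N \<in> Obj C" and f: "f \<in> Mor C M N"
    note FM = Fo[OF M] and GM = Go[OF Fo[OF M]] and FN = Fo[OF N] and GN = Go[OF Fo[OF N]]
    note a = pre[OF M GM e'[OF FM]] and b = pre[OF N GN e'[OF FN]]
    note Ff = Fm[OF M N f]
    note g = Gm[OF FM FN Ff]
    note FGM = FG[OF FM] and FGN = FG[OF FN]
    have fe: "Cmp D (Fo (Go (Fo M))) (Fo M) (Fo N) (Fm M N f) (e (Fo M)) \<in> Mor D (Fo (Go (Fo M))) (Fo N)"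
      by (rule comp[OF FGM FM FN e[OF FM] Ff])
    have "Cmp D (Fo M) (Fo (Go (Fo M))) (Fo (Go (Fo N))) (conj (Fo M) (Fo N) (Fm M N f)) (e' (Fo M))
      = Cmp D (Fo M) (Fo N) (Fo (Go (Fo N))) (e' (Fo N))
          (Cmp D (Fo M) (Fo (Go (Fo M))) (Fo N) (Cmp D (Fo (Go (Fo M))) (Fo M) (Fo N) (Fm M N f) (e (Fo M))) (e' (Fo M)))"
      unfolding conj_def by (rule assoc[OF FM FGM FN FGN e'[OF FM] fe e'[OF FN], symmetric])
    also have "Cmp D (Fo M) (Fo (Go (Fo M))) (Fo N) (Cmp D (Fo (Go (Fo M))) (Fo M) (Fo N) (Fm M N f) (e (Fo M))) (e' (Fo M))
      = Cmp D (Fo M) (Fo M) (Fo N) (Fm M N f) (Cmp D (Fo M) (Fo (Go (Fo M))) (Fo M) (e (Fo M)) (e' (Fo M)))"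
      by (rule assoc[OF FM FGM FM FN e'[OF FM] e[OF FM] Ff, symmetric])
    also have "\<dots> = Fm M N f" by (simp only: ee'[OF FM] id(1)[OF FM FN Ff])
    finally have eq: "Cmp D (Fo M) (Fo (Go (Fo M))) (Fo (Go (Fo N))) (conj (Fo M) (Fo N) (Fm M N f)) (e' (Fo M))
      = Cmp D (Fo M) (Fo N) (Fo (Go (Fo N))) (e' (Fo N)) (Fm M N f)" .
    show "Cmp C M (Go (Fo M)) (Go (Fo N)) (Gm (Fo M) (Fo N) (Fm M N f)) (pre M (Go (Fo M)) (e' (Fo M)))
      = Cmp C M N (Go (Fo N)) (pre N (Go (Fo N)) (e' (Fo N))) f"
      by (rule inj[OF M GN compC[OF M GM GN a(1) g(1)] compC[OF M N GN f b(1)]])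
        (simp only: Fcomp[OF M GM GN a(1) g(1)] Fcomp[OF M N GN f b(1)] a(2) b(2) g(2) eq)
  qed
  ultimately show ?thesis
    unfolding is_equivalence_def using F by - (intro conjI exI[of _ Go] exI[of _ Gm]; (assumption | (rule exI, assumption)))
qed

section \<open>The functor is fully faithful\<close>

lemma theta_pair: "theta M = theta (fst M, snd M)"
  by simp

lemma theta_blocks:
  assumes "mf_shape (M :: 'a::comm_ring_1 mat2)"
  shows "fst (theta M) = four_block_mat (var_x \<cdot>\<^sub>m 1\<^sub>m (rk1 M)) (map_mat cst (fst M)) (map_mat cst (snd M)) (var_y \<cdot>\<^sub>m 1\<^sub>m (rk0 M))"
    "snd (theta M) = four_block_mat (var_y \<cdot>\<^sub>m 1\<^sub>m (rk1 M)) (- map_mat cst (fst M)) (- map_mat cst (snd M)) (var_x \<cdot>\<^sub>m 1\<^sub>m (rk0 M))"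
    "rk0 (theta M) = rk1 M + rk0 M" "rk1 (theta M) = rk1 M + rk0 M" "mf_shape (theta M)"
  using theta_explicit[OF mf_carriers[OF assms]] theta_rk[OF mf_carriers[OF assms]] by simp_all

lemma theta_map_blocks:
  assumes "fst f \<in> carrier_mat m0 n0" "snd f \<in> carrier_mat m1 n1"
  shows "fst (theta_map f) = four_block_mat (map_mat cst (snd f)) (0\<^sub>m m1 n0) (0\<^sub>m m0 n1) (map_mat cst (fst f))"
    "snd (theta_map f) = four_block_mat (map_mat cst (snd f)) (0\<^sub>m m1 n0) (0\<^sub>m m0 n1) (map_mat cst (fst f))"
proof -
  obtain f0 f1 where f: "f = (f0, f1)" by (cases f)
  show "fst (theta_map f) = four_block_mat (map_mat cst (snd f)) (0\<^sub>m m1 n0) (0\<^sub>m m0 n1) (map_mat cst (fst f))"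
    "snd (theta_map f) = four_block_mat (map_mat cst (snd f)) (0\<^sub>m m1 n0) (0\<^sub>m m0 n1) (map_mat cst (fst f))"
    using assms theta_map_explicit[of f0 m0 n0 f1 m1 n1] by (simp_all add: f diag_block_def)
qed

lemma theta_map_hom:
  fixes M N :: "'a::comm_ring_1 mat2"
  assumes M: "mf_shape M" "mf_shape N" and f: "f \<in> mf_hom M N"
  shows "theta_map f \<in> mf_hom (theta M) (theta N)"
proof -
  note c = mf_carriers[OF M(1)] mf_carriers[OF M(2)]
  note f = mf_homD[OF M f]
  define p q p' q' d e where "p = map_mat cst (fst M)" and "q = map_mat cst (snd M)"
    and "p' = map_mat cst (fst N)" and "q' = map_mat cst (snd N)"
    and "d = map_mat cst (fst f)" and "e = map_mat cst (snd f)"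
  have car: "p \<in> carrier_mat (rk1 M) (rk0 M)" "q \<in> carrier_mat (rk0 M) (rk1 M)"
    "p' \<in> carrier_mat (rk1 N) (rk0 N)" "q' \<in> carrier_mat (rk0 N) (rk1 N)"
    "d \<in> carrier_mat (rk0 N) (rk0 M)" "e \<in> carrier_mat (rk1 N) (rk1 M)"
    using c f(1,2) by (simp_all add: p_def q_def p'_def q'_def d_def e_def)
  have eq: "p' * d = e * p" "q' * e = d * q"
    using arg_cong[OF f(3), of "map_mat cst"] arg_cong[OF f(4), of "map_mat cst"] c f(1,2)
    by (simp_all add: map_cst_mult p_def q_def p'_def q'_def d_def e_def)
  note tb = theta_blocks[OF M(1)] theta_blocks[OF M(2)]
  note fb = theta_map_blocks[OF f(1,2)]
  note defs = p_def[symmetric] q_def[symmetric] p'_def[symmetric] q'_def[symmetric] d_def[symmetric] e_def[symmetric]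
  have 1: "fst (theta N) * fst (theta_map f) = snd (theta_map f) * fst (theta M)"
    unfolding tb fb defs
    by (subst (1 2) mult_four_block_mat) (use car eq in \<open>auto simp: mat_smult intro!: eq_matI simp del: index_mult_mat(1)\<close>)
  have 2: "snd (theta N) * snd (theta_map f) = fst (theta_map f) * snd (theta M)"
    unfolding tb fb defs
    by (subst (1 2) mult_four_block_mat) (use car eq in \<open>auto simp: mat_smult intro!: eq_matI simp del: index_mult_mat(1)\<close>)
  have "fst (theta_map f) \<in> carrier_mat (rk1 N + rk0 N) (rk1 M + rk0 M)"
    "snd (theta_map f) \<in> carrier_mat (rk1 N + rk0 N) (rk1 M + rk0 M)"
    unfolding fb using f(1,2) by auto
  then show ?thesis
    unfolding mf_hom_iff[OF tb(5,10)] tb(3,4,8,9) using 1 2 by (auto simp: tb)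
qed

lemma theta_map_homotopic:
  fixes M N :: "'a::comm_ring_1 mat2"
  assumes M: "mf_shape M" "mf_shape N" and fg: "(f, g) \<in> homotopic M N"
  shows "(theta_map f, theta_map g) \<in> homotopic (theta M) (theta N)"
proof -
  from fg obtain k0 k1 where k: "k0 \<in> carrier_mat (rk1 N) (rk0 M)" "k1 \<in> carrier_mat (rk0 N) (rk1 M)"
    "fst g - fst f = snd N * k0 + k1 * fst M" "snd g - snd f = fst N * k1 + k0 * snd M"
    and hom: "f \<in> mf_hom M N" "g \<in> mf_hom M N" unfolding homotopic_iff by blast
  note c = mf_carriers[OF M(1)] mf_carriers[OF M(2)]
  note f = mf_homD[OF M hom(1)] and g = mf_homD[OF M hom(2)]
  define p q p' q' l0 l1 where "p = map_mat cst (fst M)" and "q = map_mat cst (snd M)"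
    and "p' = map_mat cst (fst N)" and "q' = map_mat cst (snd N)"
    and "l0 = map_mat cst k0" and "l1 = map_mat cst k1"
  have car: "p \<in> carrier_mat (rk1 M) (rk0 M)" "q \<in> carrier_mat (rk0 M) (rk1 M)"
    "p' \<in> carrier_mat (rk1 N) (rk0 N)" "q' \<in> carrier_mat (rk0 N) (rk1 N)"
    "l0 \<in> carrier_mat (rk1 N) (rk0 M)" "l1 \<in> carrier_mat (rk0 N) (rk1 M)"
    using c k(1,2) by (simp_all add: p_def q_def p'_def q'_def l0_def l1_def)
  have eq: "map_mat cst (fst g) - map_mat cst (fst f) = q' * l0 + l1 * p"
    "map_mat cst (snd g) - map_mat cst (snd f) = p' * l1 + l0 * q"
    using arg_cong[OF k(3), of "map_mat cst"] arg_cong[OF k(4), of "map_mat cst"] c f(1,2) g(1,2) k(1,2)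
    by (simp_all add: map_cst_mult map_hom_simps[OF cst_hom] p_def q_def p'_def q'_def l0_def l1_def)
  let ?z = "\<lambda>A B. four_block_mat (0\<^sub>m (rk1 N) (rk1 M)) A B (0\<^sub>m (rk0 N) (rk0 M))"
  let ?H1 = "?z l0 l1" and ?H0 = "?z (- l0) (- l1)"
  note tb = theta_blocks[OF M(1)] theta_blocks[OF M(2)]
  note fb = theta_map_blocks[OF f(1,2)] theta_map_blocks[OF g(1,2)]
  note defs = p_def[symmetric] q_def[symmetric] p'_def[symmetric] q'_def[symmetric]
  let ?D = "four_block_mat (p' * l1 + l0 * q) (0\<^sub>m (rk1 N) (rk0 M)) (0\<^sub>m (rk0 N) (rk1 M)) (q' * l0 + l1 * p)"
  have diff: "fst (theta_map g) - fst (theta_map f) = ?D" "snd (theta_map g) - snd (theta_map f) = ?D"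
    unfolding fb eq[symmetric] using f(1,2) g(1,2) by (auto intro!: eq_matI)
  have 1: "snd (theta N) * ?H0 + ?H1 * fst (theta M) = ?D"
    unfolding tb defs
    by (subst (1 2) mult_four_block_mat) (use car in \<open>auto simp: mat_smult intro!: eq_matI simp del: index_mult_mat(1)\<close>)
  have 2: "fst (theta N) * ?H1 + ?H0 * snd (theta M) = ?D"
    unfolding tb defs
    by (subst (1 2) mult_four_block_mat) (use car in \<open>auto simp: mat_smult intro!: eq_matI simp del: index_mult_mat(1)\<close>)
  show ?thesis
    by (rule homotopicI[of _ _ _ _ ?H0 ?H1]) (use theta_map_hom[OF M hom(1)] theta_map_hom[OF M hom(2)] 1 2 diff car in \<open>simp_all add: tb(3,4,8,9)\<close>)
qed

lemma theta_class_hcls: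
  fixes M N :: "'a::comm_ring_1 mat2"
  assumes M: "mf_shape M" "mf_shape N" and f: "f \<in> mf_hom M N"
  shows "theta_class M N (hcls M N f) = hcls (theta M) (theta N) (theta_map f)"
proof -
  note E = homotopic_equiv[OF M] and E' = homotopic_equiv[OF theta_blocks(5)[OF M(1)] theta_blocks(5)[OF M(2)]]
  have "(theta_map f, k) \<in> homotopic (theta M) (theta N)"
    if "(f, f') \<in> homotopic M N" "(theta_map f', k) \<in> homotopic (theta M) (theta N)" for f' k
    using theta_map_homotopic[OF M that(1)] that(2) E' by (meson equivE transD)
  moreover have "(f, f) \<in> homotopic M N" using E f by (auto simp: equiv_def refl_on_def)
  ultimately have "k \<in> theta_class M N (hcls M N f) \<longleftrightarrow> (theta_map f, k) \<in> homotopic (theta M) (theta N)" for k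
    unfolding theta_class_def by (simp add: Image_iff) blast
  then show ?thesis by blast
qed

lemma theta_map_comp:
  assumes f: "fst f \<in> carrier_mat m0 n0" "snd f \<in> carrier_mat m1 n1"
    and g: "fst g \<in> carrier_mat l0 m0" "snd g \<in> carrier_mat l1 (m1 :: nat)"
  shows "theta_map (mf_comp g f) = mf_comp (theta_map g) (theta_map (f :: 'a::comm_ring_1 mat2))"
proof -
  have gf: "fst (mf_comp g f) \<in> carrier_mat l0 n0" "snd (mf_comp g f) \<in> carrier_mat l1 n1"
    using f g by (auto simp: mf_comp_def)
  have "four_block_mat (map_mat cst (snd g)) (0\<^sub>m l1 m0) (0\<^sub>m l0 m1) (map_mat cst (fst g)) *
      four_block_mat (map_mat cst (snd f)) (0\<^sub>m m1 n0) (0\<^sub>m m0 n1) (map_mat cst (fst f))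
    = four_block_mat (map_mat cst (snd g * snd f)) (0\<^sub>m l1 n0) (0\<^sub>m l0 n1) (map_mat cst (fst g * fst f))"
    by (subst mult_four_block_mat) (use f g in \<open>auto simp: map_cst_mult\<close>)
  then show ?thesis
    using theta_map_blocks[OF f] theta_map_blocks[OF g] theta_map_blocks[OF gf]
    by (simp add: prod_eq_iff mf_comp_def)
qed

lemma theta_map_id:
  assumes "mf_shape (M :: 'a::comm_ring_1 mat2)"
  shows "theta_map (mf_id M) = mf_id (theta M)"
proof -
  have "map_mat cst (1\<^sub>m n :: 'a mat) = 1\<^sub>m n" for n by (rule map_hom_simps(1)[OF cst_hom])
  then show ?thesis
    using theta_map_blocks[of "mf_id M" "rk0 M" "rk0 M" "rk1 M" "rk1 M"]
    by (simp add: prod_eq_iff mf_id_def theta_blocks(3,4)[OF assms])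
qed

lemma theta_functor:
  "is_functor (MF \<pi> :: ('a::comm_ring_1 mat2, 'a mat2 set) cat) (MF (var_x * var_y - cst \<pi>)) theta theta_class"
  unfolding is_functor_def
proof (intro conjI ballI MF_category)
  fix M :: "'a mat2" assume M: "M \<in> Obj (MF \<pi>)"
  then have mf: "is_mf \<pi> M" and s: "mf_shape M" by (auto intro: is_mf_shape)
  show "theta M \<in> Obj (MF (var_x * var_y - cst \<pi>))"
    using is_mf_theta[OF mf_carriers[OF s]] mf by simp
  show "theta_class M M (Idt (MF \<pi>) M) = Idt (MF (var_x * var_y - cst \<pi>)) (theta M)"
    using theta_class_hcls[OF s s mf_id_hom[OF s]] by (simp add: theta_map_id[OF s])
next
  fix M N :: "'a mat2" and F assume "M \<in> Obj (MF \<pi>)" "N \<in> Obj (MF \<pi>)" "F \<in> Mor (MF \<pi>) M N"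
  then have M: "mf_shape M" "mf_shape N" and F: "F \<in> Ext0 M N" by (auto intro: is_mf_shape)
  obtain f where f: "f \<in> mf_hom M N" "F = hcls M N f" by (rule Ext0_cases[OF F])
  show "theta_class M N F \<in> Mor (MF (var_x * var_y - cst \<pi>)) (theta M) (theta N)"
    unfolding f(2) theta_class_hcls[OF M f(1)] by (simp add: hcls_Ext0 theta_map_hom[OF M f(1)])
next
  fix L M N :: "'a mat2" and F G
  assume "L \<in> Obj (MF \<pi>)" "M \<in> Obj (MF \<pi>)" "N \<in> Obj (MF \<pi>)" "F \<in> Mor (MF \<pi>) L M" "G \<in> Mor (MF \<pi>) M N"
  then have M: "mf_shape L" "mf_shape M" "mf_shape N" and FG: "F \<in> Ext0 L M" "G \<in> Ext0 M N" by (auto intro: is_mf_shape)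
  obtain f where f: "f \<in> mf_hom L M" "F = hcls L M f" by (rule Ext0_cases[OF FG(1)])
  obtain g where g: "g \<in> mf_hom M N" "G = hcls M N g" by (rule Ext0_cases[OF FG(2)])
  note T = theta_blocks(5)[OF M(1)] theta_blocks(5)[OF M(2)] theta_blocks(5)[OF M(3)]
  have "theta_map (mf_comp g f) = mf_comp (theta_map g) (theta_map f)"
    using mf_homD(1,2)[OF M(1,2) f(1)] mf_homD(1,2)[OF M(2,3) g(1)] by (rule theta_map_comp)
  then show "theta_class L N (Cmp (MF \<pi>) L M N G F)
    = Cmp (MF (var_x * var_y - cst \<pi>)) (theta L) (theta M) (theta N) (theta_class M N G) (theta_class L M F)"
    unfolding f(2) g(2) Cmp_hcls[OF M f(1) g(1)] theta_class_hcls[OF M(1,2) f(1)] theta_class_hcls[OF M(2,3) g(1)]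
      theta_class_hcls[OF M(1,3) mf_comp_hom[OF M f(1) g(1)]]
      Cmp_hcls[OF T theta_map_hom[OF M(1,2) f(1)] theta_map_hom[OF M(2,3) g(1)]]
    by simp
qed

text \<open>Only the constant terms of two off-diagonal blocks of a null-homotopy of \<open>\<theta>(f)\<close> matter; they
  form a null-homotopy of \<open>f\<close>.\<close>

lemma theta_faithful:
  fixes M N :: "'a::comm_ring_1 mat2"
  assumes M: "mf_shape M" "mf_shape N" and fg: "f \<in> mf_hom M N" "g \<in> mf_hom M N"
    and hom: "(theta_map f, theta_map g) \<in> homotopic (theta M) (theta N)"
  shows "(f, g) \<in> homotopic M N"
proof -
  note c = mf_carriers[OF M(1)] mf_carriers[OF M(2)]
  note f = mf_homD[OF M fg(1)] and g = mf_homD[OF M fg(2)]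
  note tb = theta_blocks[OF M(1)] theta_blocks[OF M(2)]
  note fb = theta_map_blocks[OF f(1,2)] theta_map_blocks[OF g(1,2)]
  let ?n = "rk1 M + rk0 M" and ?m = "rk1 N + rk0 N"
  let ?c = "map_mat (\<lambda>f :: 'a fps fps. cf f 0 0)"
  obtain H0 H1 where H: "H0 \<in> carrier_mat ?m ?n" "H1 \<in> carrier_mat ?m ?n"
    "fst (theta_map g) - fst (theta_map f) = snd (theta N) * H0 + H1 * fst (theta M)"
    "snd (theta_map g) - snd (theta_map f) = fst (theta N) * H1 + H0 * snd (theta M)"
    using hom unfolding homotopic_iff tb(3,4,8,9) by blast
  have cst: "?c (map_mat cst A) = A" for A by (rule eq_matI) (auto simp: ops_cst)
  have fbm: "?c (four_block_mat A B C D) = four_block_mat (?c A) (?c B) (?c C) (?c D)"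
    if "A \<in> carrier_mat a d" "B \<in> carrier_mat a e" "C \<in> carrier_mat b d" "D \<in> carrier_mat b e" for A B C D a b d e
    by (rule map_four_block_mat[OF that])
  note hs = map_hom_simps[OF cf_00_hom] map_hom_mult[OF cf_00_hom]
  have var: "?c (var_x \<cdot>\<^sub>m 1\<^sub>m k) = 0\<^sub>m k k" "?c (var_y \<cdot>\<^sub>m 1\<^sub>m k) = 0\<^sub>m k k" for k
    by (rule eq_matI; simp add: cf_var_x_mult[of 1, simplified] cf_var_y_mult[of 1, simplified])+
  have T: "?c (fst (theta M)) = four_block_mat (0\<^sub>m (rk1 M) (rk1 M)) (fst M) (snd M) (0\<^sub>m (rk0 M) (rk0 M))"
    "?c (snd (theta M)) = four_block_mat (0\<^sub>m (rk1 M) (rk1 M)) (- fst M) (- snd M) (0\<^sub>m (rk0 M) (rk0 M))"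
    "?c (fst (theta N)) = four_block_mat (0\<^sub>m (rk1 N) (rk1 N)) (fst N) (snd N) (0\<^sub>m (rk0 N) (rk0 N))"
    "?c (snd (theta N)) = four_block_mat (0\<^sub>m (rk1 N) (rk1 N)) (- fst N) (- snd N) (0\<^sub>m (rk0 N) (rk0 N))"
    unfolding tb using c by (simp_all add: fbm[of _ "rk1 M" "rk1 M" _ "rk0 M" _ "rk0 M"] fbm[of _ "rk1 N" "rk1 N" _ "rk0 N" _ "rk0 N"] var cst hs(1,2,4-7))
  have fbm2: "?c (four_block_mat (map_mat cst A) (0\<^sub>m a e) (0\<^sub>m b d) (map_mat cst D)) = four_block_mat A (0\<^sub>m a e) (0\<^sub>m b d) D"
    if "A \<in> carrier_mat a d" "D \<in> carrier_mat b e" for A D a b d e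
    using that by (subst fbm[of _ a d _ e _ b]) (auto simp: cst hs(1-7))
  let ?d = "four_block_mat (snd g - snd f) (0\<^sub>m (rk1 N) (rk0 M)) (0\<^sub>m (rk0 N) (rk1 M)) (fst g - fst f)"
  have fm: "fst (theta_map f) \<in> carrier_mat ?m ?n" "snd (theta_map f) \<in> carrier_mat ?m ?n"
    "fst (theta_map g) \<in> carrier_mat ?m ?n" "snd (theta_map g) \<in> carrier_mat ?m ?n"
    unfolding fb using f(1,2) g(1,2) by auto
  have D: "?c (fst (theta_map g) - fst (theta_map f)) = ?d" "?c (snd (theta_map g) - snd (theta_map f)) = ?d"
  proof -
    have "?c (fst (theta_map g)) - ?c (fst (theta_map f)) = ?d" "?c (snd (theta_map g)) - ?c (snd (theta_map f)) = ?d"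
      unfolding fb fbm2[OF f(2,1)] fbm2[OF g(2,1)] using f(1,2) g(1,2) by (auto intro!: eq_matI)
    then show "?c (fst (theta_map g) - fst (theta_map f)) = ?d" "?c (snd (theta_map g) - snd (theta_map f)) = ?d"
      using fm by (simp_all add: hs(5))
  qed
  obtain A0 B0 C0 D0 where sp0: "split_block (?c H0) (rk1 N) (rk1 M) = (A0, B0, C0, D0)" by (rule prod_cases4)
  obtain A1 B1 C1 D1 where sp1: "split_block (?c H1) (rk1 N) (rk1 M) = (A1, B1, C1, D1)" by (rule prod_cases4)
  have h0: "A0 \<in> carrier_mat (rk1 N) (rk1 M)" "B0 \<in> carrier_mat (rk1 N) (rk0 M)" "C0 \<in> carrier_mat (rk0 N) (rk1 M)"
    "D0 \<in> carrier_mat (rk0 N) (rk0 M)" "?c H0 = four_block_mat A0 B0 C0 D0"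
    using split_block[OF sp0, of "rk0 N" "rk0 M"] H(1) by auto
  have h1: "A1 \<in> carrier_mat (rk1 N) (rk1 M)" "B1 \<in> carrier_mat (rk1 N) (rk0 M)" "C1 \<in> carrier_mat (rk0 N) (rk1 M)"
    "D1 \<in> carrier_mat (rk0 N) (rk0 M)" "?c H1 = four_block_mat A1 B1 C1 D1"
    using split_block[OF sp1, of "rk0 N" "rk0 M"] H(2) by auto
  have tc: "fst (theta M) \<in> carrier_mat ?n ?n" "snd (theta M) \<in> carrier_mat ?n ?n"
    "fst (theta N) \<in> carrier_mat ?m ?m" "snd (theta N) \<in> carrier_mat ?m ?m"
    unfolding tb using c by auto
  have "?d = ?c (snd (theta N)) * ?c H0 + ?c H1 * ?c (fst (theta M))"
    unfolding D(1)[symmetric] H(3) using H(1,2) tc by (simp add: hs(6,8))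
  also have "\<dots> = four_block_mat (- (fst N * C0) + B1 * snd M) (- (fst N * D0) + A1 * fst M) (- (snd N * A0) + D1 * snd M) (- (snd N * B0) + C1 * fst M)"
    unfolding T h0(5) h1(5)
    by (subst (1 2) mult_four_block_mat) (use c h0(1-4) h1(1-4) in \<open>auto intro!: eq_matI simp del: index_mult_mat(1)\<close>)
  finally have e1: "?d = \<dots>" .
  have "?d = ?c (fst (theta N)) * ?c H1 + ?c H0 * ?c (snd (theta M))"
    unfolding D(2)[symmetric] H(4) using H(1,2) tc by (simp add: hs(6,8))
  also have "\<dots> = four_block_mat (fst N * C1 + - (B0 * snd M)) (fst N * D1 + - (A0 * fst M)) (snd N * A1 + - (D0 * snd M)) (snd N * B1 + - (C0 * fst M))"
    unfolding T h0(5) h1(5)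
    by (subst (1 2) mult_four_block_mat) (use c h0(1-4) h1(1-4) in \<open>auto intro!: eq_matI simp del: index_mult_mat(1)\<close>)
  finally have e2: "?d = \<dots>" .
  have gf: "snd g - snd f \<in> carrier_mat (rk1 N) (rk1 M)" "fst g - fst f \<in> carrier_mat (rk0 N) (rk0 M)"
    by (intro minus_carrier_mat f(1,2))+
  have 1: "snd g - snd f = - (fst N * C0) + B1 * snd M"
    using four_block_inject(1)[OF e1, of "rk1 N" "rk1 M" "rk0 M" "rk0 N"] c h0(1-4) h1(1-4) gf by auto
  have 2: "fst g - fst f = snd N * B1 + - (C0 * fst M)"
    using four_block_inject(4)[OF e2, of "rk1 N" "rk1 M" "rk0 M" "rk0 N"] c h0(1-4) h1(1-4) gf by auto
  show ?thesis
    by (rule homotopicI[of _ _ _ _ B1 "- C0"]) (use fg 1 2 c h0(1-4) h1(1-4) in \<open>auto intro!: eq_matI simp del: index_mult_mat(1)\<close>)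
qed

lemma four_block_cases:
  assumes "X \<in> carrier_mat (m + m') (n + n')"
  obtains A B C D where "A \<in> carrier_mat m n" "B \<in> carrier_mat m n'" "C \<in> carrier_mat m' n" "D \<in> carrier_mat m' n'"
    "X = four_block_mat A B C D"
proof -
  obtain A B C D where "split_block X m n = (A, B, C, D)" by (rule prod_cases4)
  from split_block[OF this, of m' n'] assms show ?thesis by (intro that) auto
qed

text \<open>Applies to \<^term>\<open>Dx\<close>, \<^term>\<open>Dy0\<close> and the projection to constants, which are linear over constants.\<close>

lemma map_linear:
  fixes T :: "'a::comm_ring_1 fps fps \<Rightarrow> 'a fps fps"
  assumes add: "\<And>f g. T (f + g) = T f + T g" and cst: "\<And>a f. T (cst a * f) = cst a * T f"
  shows "dim_row A = dim_row B \<Longrightarrow> dim_col A = dim_col B \<Longrightarrow> map_mat T (A + B) = map_mat T A + map_mat T B"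
    "dim_row A = dim_row B \<Longrightarrow> dim_col A = dim_col B \<Longrightarrow> map_mat T (A - B) = map_mat T A - map_mat T B"
    "map_mat T (- A) = - map_mat T A"
    "dim_col U = dim_row A \<Longrightarrow> map_mat T (map_mat cst U * A) = map_mat cst U * map_mat T A"
    "dim_col A = dim_row U \<Longrightarrow> map_mat T (A * map_mat cst U) = map_mat T A * map_mat cst U"
proof -
  have neg: "T (- f) = - T f" for f using cst[of "- 1" f] by simp
  have diff: "T (f - g) = T f - T g" for f g using add[of f "- g"] neg by simp
  have 0: "T 0 = 0" using cst[of 0 0] by simp
  have sum: "T (sum h K) = (\<Sum>k\<in>K. T (h k))" for h :: "nat \<Rightarrow> _" and K
    by (induction K rule: infinite_finite_induct) (simp_all add: 0 add)
  have cst': "T (f * cst a) = T f * cst a" for f a using cst[of a f] by (simp add: mult.commute)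
  show "dim_row A = dim_row B \<Longrightarrow> dim_col A = dim_col B \<Longrightarrow> map_mat T (A + B) = map_mat T A + map_mat T B"
    "dim_row A = dim_row B \<Longrightarrow> dim_col A = dim_col B \<Longrightarrow> map_mat T (A - B) = map_mat T A - map_mat T B"
    "map_mat T (- A) = - map_mat T A"
    by (auto intro!: eq_matI simp: add diff neg)
  show "dim_col U = dim_row A \<Longrightarrow> map_mat T (map_mat cst U * A) = map_mat cst U * map_mat T A"
    by (rule eq_matI) (simp_all add: mult_entry sum cst del: index_mult_mat(1))
  show "dim_col A = dim_row U \<Longrightarrow> map_mat T (A * map_mat cst U) = map_mat T A * map_mat cst U"
    by (rule eq_matI) (simp_all add: mult_entry sum cst' del: index_mult_mat(1))
qed

abbreviation cst_part :: "'a::comm_ring_1 fps fps \<Rightarrow> 'a fps fps" where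
  "cst_part f \<equiv> cst (cf f 0 0)"

lemmas map_Dx = map_linear[of Dx, OF ops_add(1) ops_cst_mult(1)]
lemmas map_Dy0 = map_linear[of Dy0, OF ops_add(5) ops_cst_mult(3)]

lemma map_cst_part:
  shows "dim_row A = dim_row B \<Longrightarrow> dim_col A = dim_col B \<Longrightarrow> map_mat cst_part (A + B) = map_mat cst_part A + map_mat cst_part (B :: 'a::comm_ring_1 fps fps mat)"
    "dim_row A = dim_row B \<Longrightarrow> dim_col A = dim_col B \<Longrightarrow> map_mat cst_part (A - B) = map_mat cst_part A - map_mat cst_part B"
    "map_mat cst_part (- A) = - map_mat cst_part A"
    "dim_col U = dim_row A \<Longrightarrow> map_mat cst_part (map_mat cst U * A) = map_mat cst U * map_mat cst_part A"
    "dim_col A = dim_row U \<Longrightarrow> map_mat cst_part (A * map_mat cst U) = map_mat cst_part A * map_mat cst U"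
  by (rule map_linear[of cst_part]; simp add: cst_add cst_mult ops_cst_mult)+

lemma map_var:
  "map_mat Dx (var_x \<cdot>\<^sub>m A) = A" "map_mat Dx (var_y \<cdot>\<^sub>m A) = var_y \<cdot>\<^sub>m map_mat Dx A"
  "map_mat Dy0 (var_x \<cdot>\<^sub>m A) = 0\<^sub>m (dim_row A) (dim_col A)" "map_mat Dy0 (var_y \<cdot>\<^sub>m A) = map_mat at_x0 A"
  "map_mat cst_part (var_x \<cdot>\<^sub>m A) = 0\<^sub>m (dim_row A) (dim_col A)" "map_mat cst_part (var_y \<cdot>\<^sub>m A) = 0\<^sub>m (dim_row A) (dim_col A)"
  by (auto intro!: eq_matI simp: ops_var_mult)

lemma add_uminus_mat: "A + - B = A - (B :: 'a::comm_ring_1 mat)"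
  by (rule eq_matI) auto

lemma uminus_add_mat:
  "dim_row A = dim_row B \<Longrightarrow> dim_col A = dim_col B \<Longrightarrow> - B + A = A - (B :: 'a::comm_ring_1 mat)"
  by (rule eq_matI) auto

lemma zero_minus_mat:
  fixes A :: "'a::comm_ring_1 mat"
  shows "dim_row A = k \<Longrightarrow> dim_col A = l \<Longrightarrow> 0\<^sub>m k l - A = - A"
    "dim_row A = k \<Longrightarrow> dim_col A = l \<Longrightarrow> A - 0\<^sub>m k l = A"
  by (auto intro!: eq_matI)

lemma mat_linear:
  fixes A B C D E F G :: "'a::comm_ring_1 mat"
  shows "A + B + C = D \<Longrightarrow> A \<in> carrier_mat k l \<Longrightarrow> B \<in> carrier_mat k l \<Longrightarrow> C \<in> carrier_mat k l \<Longrightarrow> C + B = D - A"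
    "A - B = C - D \<Longrightarrow> A \<in> carrier_mat k l \<Longrightarrow> B \<in> carrier_mat k l \<Longrightarrow> C \<in> carrier_mat k l \<Longrightarrow> D \<in> carrier_mat k l \<Longrightarrow>
      A - B + D = C"
    "A + B = C \<Longrightarrow> B + D = E \<Longrightarrow> A \<in> carrier_mat k l \<Longrightarrow> B \<in> carrier_mat k l \<Longrightarrow> D \<in> carrier_mat k l \<Longrightarrow> - A + (D + C) = E"
    "G - B = C - D \<Longrightarrow> E + F + A = G \<Longrightarrow> A \<in> carrier_mat k l \<Longrightarrow> B \<in> carrier_mat k l \<Longrightarrow> C \<in> carrier_mat k l \<Longrightarrow>
      D \<in> carrier_mat k l \<Longrightarrow> E \<in> carrier_mat k l \<Longrightarrow> F \<in> carrier_mat k l \<Longrightarrow> F - B + (D + A) = C - E"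
    "G + B = C + D \<Longrightarrow> E + F + A = G \<Longrightarrow> A \<in> carrier_mat k l \<Longrightarrow> B \<in> carrier_mat k l \<Longrightarrow> C \<in> carrier_mat k l \<Longrightarrow>
      D \<in> carrier_mat k l \<Longrightarrow> E \<in> carrier_mat k l \<Longrightarrow> F \<in> carrier_mat k l \<Longrightarrow> F + B + (A - D) = C - E"
    "A - B = - C \<Longrightarrow> A + D = E \<Longrightarrow> A \<in> carrier_mat k l \<Longrightarrow> B \<in> carrier_mat k l \<Longrightarrow> C \<in> carrier_mat k l \<Longrightarrow>
      D \<in> carrier_mat k l \<Longrightarrow> B + (D - C) = E"
    "A + B = C + D \<Longrightarrow> A \<in> carrier_mat k l \<Longrightarrow> B \<in> carrier_mat k l \<Longrightarrow> C \<in> carrier_mat k l \<Longrightarrow> D \<in> carrier_mat k l \<Longrightarrow>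
      A + B - D = C"
proof -
  have e: "X $$ (i, j) = Y $$ (i, j)" if "X = Y" for X Y :: "'a mat" and i j using that by simp
  show "A + B + C = D \<Longrightarrow> A \<in> carrier_mat k l \<Longrightarrow> B \<in> carrier_mat k l \<Longrightarrow> C \<in> carrier_mat k l \<Longrightarrow> C + B = D - A"
    by (auto intro!: eq_matI)
  show *: "A - B = C - D \<Longrightarrow> A \<in> carrier_mat k l \<Longrightarrow> B \<in> carrier_mat k l \<Longrightarrow> C \<in> carrier_mat k l \<Longrightarrow> D \<in> carrier_mat k l \<Longrightarrow>
      A - B + D = C" for A B C D :: "'a mat"
    by (simp only:) (auto intro!: eq_matI)
  show "A + B = C \<Longrightarrow> B + D = E \<Longrightarrow> A \<in> carrier_mat k l \<Longrightarrow> B \<in> carrier_mat k l \<Longrightarrow> D \<in> carrier_mat k l \<Longrightarrow> - A + (D + C) = E"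
    by (auto intro!: eq_matI)
  show "F - B + (D + A) = C - E" if h: "G - B = C - D" "E + F + A = G" "A \<in> carrier_mat k l" "B \<in> carrier_mat k l" "C \<in> carrier_mat k l"
      "D \<in> carrier_mat k l" "E \<in> carrier_mat k l" "F \<in> carrier_mat k l"
  proof -
    have "C = E + F + A - B + D" using *[OF h(1)] h(2-) by auto
    then show ?thesis using h(3-) by (auto intro!: eq_matI simp: algebra_simps)
  qed
  show **: "A + B = C + D \<Longrightarrow> A \<in> carrier_mat k l \<Longrightarrow> B \<in> carrier_mat k l \<Longrightarrow> C \<in> carrier_mat k l \<Longrightarrow> D \<in> carrier_mat k l \<Longrightarrow>
      A + B - D = C" for A B C D :: "'a mat"
    by (simp only:) (auto intro!: eq_matI)
  show "F + B + (A - D) = C - E" if h: "G + B = C + D" "E + F + A = G" "A \<in> carrier_mat k l" "B \<in> carrier_mat k l" "C \<in> carrier_mat k l"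
      "D \<in> carrier_mat k l" "E \<in> carrier_mat k l" "F \<in> carrier_mat k l"
  proof -
    have "C = E + F + A + B - D" using **[OF h(1)] h(2-) by auto
    then show ?thesis using h(3-) by (auto intro!: eq_matI simp: algebra_simps)
  qed
  show "B + (D - C) = E" if h: "A - B = - C" "A + D = E" "A \<in> carrier_mat k l" "B \<in> carrier_mat k l" "C \<in> carrier_mat k l"
      "D \<in> carrier_mat k l"
  proof -
    have "A = (A - B) + B" using h(3,4) by (auto intro!: eq_matI)
    then have "A = - C + B" unfolding h(1) .
    then show ?thesis using h(2-) by (auto intro!: eq_matI simp: algebra_simps)
  qed
qed

text \<open>A closed even map \<open>f\<close> of the images is corrected by an explicit homotopy, built from the divided
  differences of its blocks, to the image of a map with entries in \<open>A\<close>.\<close>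

lemma theta_full:
  fixes M N :: "'a::comm_ring_1 mat2"
  assumes M: "mf_shape M" "mf_shape N" and hom: "f \<in> mf_hom (theta M) (theta N)"
  obtains g where "g \<in> mf_hom M N" "(theta_map g, f) \<in> homotopic (theta M) (theta N)"
proof -
  note tb = theta_blocks[OF M(1)] theta_blocks[OF M(2)]
  define n0 n1 m0 m1 where n: "n0 = rk0 M" "n1 = rk1 M" and m: "m0 = rk0 N" "m1 = rk1 N"
  note f = mf_homD[OF tb(5,10) hom, unfolded tb(3,4,8,9), folded n m]
  define p q p' q' where "p = map_mat cst (fst M)" and "q = map_mat cst (snd M)"
    and "p' = map_mat cst (fst N)" and "q' = map_mat cst (snd N)"
  have car: "p \<in> carrier_mat n1 n0" "q \<in> carrier_mat n0 n1" "p' \<in> carrier_mat m1 m0" "q' \<in> carrier_mat m0 m1"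
    using mf_carriers[OF M(1)] mf_carriers[OF M(2)] by (simp_all add: p_def q_def p'_def q'_def n m)
  note T = tb(1,2,6,7)[folded p_def q_def p'_def q'_def n m]
  obtain a b c d where 0: "a \<in> carrier_mat m1 n1" "b \<in> carrier_mat m1 n0" "c \<in> carrier_mat m0 n1" "d \<in> carrier_mat m0 n0"
    "fst f = four_block_mat a b c d"
    by (rule four_block_cases[OF f(1)])
  obtain a' b' c' d' where 1: "a' \<in> carrier_mat m1 n1" "b' \<in> carrier_mat m1 n0" "c' \<in> carrier_mat m0 n1" "d' \<in> carrier_mat m0 n0"
    "snd f = four_block_mat a' b' c' d'"
    by (rule four_block_cases[OF f(2)])
  have e: "four_block_mat (var_x \<cdot>\<^sub>m a + p' * c) (var_x \<cdot>\<^sub>m b + p' * d) (q' * a + var_y \<cdot>\<^sub>m c) (q' * b + var_y \<cdot>\<^sub>m d)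
    = four_block_mat (var_x \<cdot>\<^sub>m a' + b' * q) (a' * p + var_y \<cdot>\<^sub>m b') (var_x \<cdot>\<^sub>m c' + d' * q) (c' * p + var_y \<cdot>\<^sub>m d')"
    using f(3) unfolding T 0(5) 1(5)
    by (subst (asm) (1 2) mult_four_block_mat) (use car 0(1-4) 1(1-4) in \<open>auto simp: mat_smult\<close>)
  have e': "four_block_mat (var_y \<cdot>\<^sub>m a' - p' * c') (var_y \<cdot>\<^sub>m b' - p' * d') (var_x \<cdot>\<^sub>m c' - q' * a') (var_x \<cdot>\<^sub>m d' - q' * b')
    = four_block_mat (var_y \<cdot>\<^sub>m a - b * q) (var_x \<cdot>\<^sub>m b - a * p) (var_y \<cdot>\<^sub>m c - d * q) (var_x \<cdot>\<^sub>m d - c * p)"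
  proof -
    have "four_block_mat (var_y \<cdot>\<^sub>m a' - p' * c') (var_y \<cdot>\<^sub>m b' - p' * d') (var_x \<cdot>\<^sub>m c' - q' * a') (var_x \<cdot>\<^sub>m d' - q' * b')
      = snd (theta N) * snd f"
      unfolding T 1(5)
      by (subst mult_four_block_mat) (use car 1(1-4) in \<open>auto simp: mat_smult intro!: eq_matI simp del: index_mult_mat(1)\<close>)
    moreover have "\<dots> = fst f * snd (theta M)" by (rule f(4))
    moreover have "\<dots> = four_block_mat (var_y \<cdot>\<^sub>m a - b * q) (var_x \<cdot>\<^sub>m b - a * p) (var_y \<cdot>\<^sub>m c - d * q) (var_x \<cdot>\<^sub>m d - c * p)"
      unfolding T 0(5)
      by (subst mult_four_block_mat) (use car 0(1-4) in \<open>auto simp: mat_smult intro!: eq_matI simp del: index_mult_mat(1)\<close>)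
    ultimately show ?thesis by simp
  qed
  note E = four_block_inject[OF e, of m1 n1 n0 m0] and G = four_block_inject[OF e', of m1 n1 n0 m0]
  have mc: "p' * c' \<in> carrier_mat m1 n1" "p' * d' \<in> carrier_mat m1 n0" "q' * a' \<in> carrier_mat m0 n1" "q' * b' \<in> carrier_mat m0 n0"
    "b * q \<in> carrier_mat m1 n1" "a * p \<in> carrier_mat m1 n0" "d * q \<in> carrier_mat m0 n1" "c * p \<in> carrier_mat m0 n0"
    using car 0(1-4) 1(1-4) by simp_all
  have E1: "var_x \<cdot>\<^sub>m a + p' * c = var_x \<cdot>\<^sub>m a' + b' * q" using E(1) car 0(1-4) 1(1-4) by simp
  have E3: "q' * a + var_y \<cdot>\<^sub>m c = var_x \<cdot>\<^sub>m c' + d' * q" using E(3) car 0(1-4) 1(1-4) by simp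
  have G2: "var_y \<cdot>\<^sub>m b' - p' * d' = var_x \<cdot>\<^sub>m b - a * p" 
    by (rule G(2)) (rule minus_carrier_mat mc)+
  have G4: "var_x \<cdot>\<^sub>m d' - q' * b' = var_x \<cdot>\<^sub>m d - c * p" 
    by (rule G(4)) (rule minus_carrier_mat mc)+
  let ?X = "map_mat Dx" and ?Y = "map_mat Dy0" and ?c = "map_mat cst_part" and ?x0 = "map_mat at_x0"
  have E1x: "a + p' * ?X c = a' + ?X b' * q"
    using arg_cong[OF E1, of ?X] car 0(1-4) 1(1-4)
    unfolding p'_def q_def by (simp add: map_Dx map_var)
  have E3x: "q' * ?X a + var_y \<cdot>\<^sub>m ?X c = c' + ?X d' * q" and E3y: "q' * ?Y a + ?x0 c = ?Y d' * q"
    and E3c: "q' * ?c a = ?c d' * q"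
    using arg_cong[OF E3, of ?X] arg_cong[OF E3, of ?Y] arg_cong[OF E3, of ?c] car 0(1-4) 1(1-4)
    unfolding q'_def q_def by (simp_all add: map_Dx map_Dy0 map_cst_part map_var)
  have G2x: "var_y \<cdot>\<^sub>m ?X b' - p' * ?X d' = b - ?X a * p" and G2y: "?x0 b' - p' * ?Y d' = - (?Y a * p)"
    and G2c: "- (p' * ?c d') = - (?c a * p)"
    using arg_cong[OF G2, of ?X] arg_cong[OF G2, of ?Y] arg_cong[OF G2, of ?c] car 0(1-4) 1(1-4)
    unfolding p'_def p_def by (simp_all add: map_Dx map_Dy0 map_cst_part map_var zero_minus_mat)
  have G4x: "d' - q' * ?X b' = d - ?X c * p"
    using arg_cong[OF G4, of ?X] car 0(1-4) 1(1-4)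
    unfolding q'_def p_def by (simp add: map_Dx map_var)
  define u v where "u = map_mat (\<lambda>f. cf f 0 0) a" and "v = map_mat (\<lambda>f. cf f 0 0) d'"
  have uv: "v \<in> carrier_mat m0 n0" "u \<in> carrier_mat m1 n1" using 0 1 by (auto simp: u_def v_def)
  have cuv: "?c a = map_mat cst u" "?c d' = map_mat cst v" by (auto simp: u_def v_def intro!: eq_matI)
  have "p' * ?c d' = ?c a * p" using arg_cong[OF G2c, of uminus] by simp
  then have "fst N * v = u * fst M"
    unfolding cuv p'_def p_def using car uv
    by - (rule map_cst_inject, simp add: map_cst_mult p_def p'_def)
  moreover have "snd N * u = v * snd M"
    using E3c unfolding cuv q'_def q_def using car uv
    by - (rule map_cst_inject, simp add: map_cst_mult q_def q'_def)
  ultimately have g: "(v, u) \<in> mf_hom M N"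
    using uv by (simp add: mf_hom_iff[OF M] n m)
  let ?H0 = "four_block_mat (?Y a) (?X b') (0\<^sub>m m0 n1) (?X d')"
  let ?H1 = "four_block_mat (?X a) (0\<^sub>m m1 n0) (?X c) (?Y d')"
  have split: "?c A + var_x \<cdot>\<^sub>m ?X A + var_y \<cdot>\<^sub>m ?Y A = A" "?x0 A + var_x \<cdot>\<^sub>m ?X A = A" for A :: "'a fps fps mat"
    by (auto intro!: eq_matI simp: split_00[symmetric] split_x0[symmetric])
  let ?u = "map_mat cst u" and ?v = "map_mat cst v"
  have tm: "fst (theta_map (v, u)) = four_block_mat ?u (0\<^sub>m m1 n0) (0\<^sub>m m0 n1) ?v"
    "snd (theta_map (v, u)) = four_block_mat ?u (0\<^sub>m m1 n0) (0\<^sub>m m0 n1) ?v"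
    using theta_map_blocks[of "(v, u)" m0 n0 m1 n1] uv by simp_all
  have car': "p' * ?X d' \<in> carrier_mat m1 n0" "p' * ?Y d' \<in> carrier_mat m1 n0" "p' * ?X c \<in> carrier_mat m1 n1"
    "q' * ?X b' \<in> carrier_mat m0 n0" "q' * ?Y a \<in> carrier_mat m0 n1" "q' * ?X a \<in> carrier_mat m0 n1"
    "?X a * p \<in> carrier_mat m1 n0" "?Y a * p \<in> carrier_mat m1 n0" "?X c * p \<in> carrier_mat m0 n0"
    "?X b' * q \<in> carrier_mat m1 n1" "?X d' * q \<in> carrier_mat m0 n1" "?Y d' * q \<in> carrier_mat m0 n1"
    using car 0(1-4) 1(1-4) by auto
  note car'' = car' car 0(1-4) 1(1-4)
  have 2: "var_y \<cdot>\<^sub>m ?Y a + var_x \<cdot>\<^sub>m ?X a = a - ?u"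
    "var_y \<cdot>\<^sub>m ?X b' - p' * ?X d' + ?X a * p = b"
    "- (q' * ?Y a) + (var_x \<cdot>\<^sub>m ?X c + ?Y d' * q) = c"
    "var_x \<cdot>\<^sub>m ?X d' - q' * ?X b' + (?X c * p + var_y \<cdot>\<^sub>m ?Y d') = d - ?v"
    by (rule mat_linear(1)[OF split(1)[of a, unfolded cuv]] mat_linear(2)[OF G2x]
        mat_linear(3)[OF E3y split(2)[of c]] mat_linear(4)[OF G4x split(1)[of d', unfolded cuv]]; use car'' uv in auto)+
  have 3: "var_x \<cdot>\<^sub>m ?X a + p' * ?X c + (var_y \<cdot>\<^sub>m ?Y a - ?X b' * q) = a' - ?u"
    "p' * ?Y d' + (var_x \<cdot>\<^sub>m ?X b' - ?Y a * p) = b'"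
    "q' * ?X a + var_y \<cdot>\<^sub>m ?X c - ?X d' * q = c'"
    "var_y \<cdot>\<^sub>m ?Y d' + var_x \<cdot>\<^sub>m ?X d' = d' - ?v"
    by (rule mat_linear(5)[OF E1x split(1)[of a, unfolded cuv]] mat_linear(6)[OF G2y split(2)[of b']]
        mat_linear(7)[OF E3x] mat_linear(1)[OF split(1)[of d', unfolded cuv]]; use car'' uv in auto)+
  have D0: "fst f - fst (theta_map (v, u)) = snd (theta N) * ?H0 + ?H1 * fst (theta M)"
  proof -
    have A: "snd (theta N) * ?H0 = four_block_mat (var_y \<cdot>\<^sub>m ?Y a) (var_y \<cdot>\<^sub>m ?X b' - p' * ?X d') (- (q' * ?Y a)) (var_x \<cdot>\<^sub>m ?X d' - q' * ?X b')"
      unfolding T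
      by (subst mult_four_block_mat[of _ m1 m1 _ m0 _ m0 _ _ n1 _ n0]) (use car 0(1-4) 1(1-4) in \<open>simp_all add: mat_smult add_uminus_mat uminus_add_mat\<close>)
    have B: "?H1 * fst (theta M) = four_block_mat (var_x \<cdot>\<^sub>m ?X a) (?X a * p) (var_x \<cdot>\<^sub>m ?X c + ?Y d' * q) (?X c * p + var_y \<cdot>\<^sub>m ?Y d')"
      unfolding T
      by (subst mult_four_block_mat[of _ m1 n1 _ n0 _ m0 _ _ n1 _ n0]) (use car 0(1-4) 1(1-4) in \<open>simp_all add: mat_smult add_uminus_mat uminus_add_mat\<close>)
    have "snd (theta N) * ?H0 + ?H1 * fst (theta M) = four_block_mat (a - ?u) b c (d - ?v)"
      unfolding A B by (subst add_four_block_mat[of _ m1 n1 _ n0 _ m0]) (use car'' in \<open>simp_all add: minus_carrier_mat uminus_carrier_mat 2\<close>)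
    moreover have "fst f - fst (theta_map (v, u)) = four_block_mat (a - ?u) b c (d - ?v)"
      unfolding tm 0(5) using 0(1-4) uv by (auto intro!: eq_matI)
    ultimately show ?thesis by simp
  qed
  have D1: "snd f - snd (theta_map (v, u)) = fst (theta N) * ?H1 + ?H0 * snd (theta M)"
  proof -
    have A: "fst (theta N) * ?H1 = four_block_mat (var_x \<cdot>\<^sub>m ?X a + p' * ?X c) (p' * ?Y d') (q' * ?X a + var_y \<cdot>\<^sub>m ?X c) (var_y \<cdot>\<^sub>m ?Y d')"
      unfolding T
      by (subst mult_four_block_mat[of _ m1 m1 _ m0 _ m0 _ _ n1 _ n0]) (use car 0(1-4) 1(1-4) in \<open>simp_all add: mat_smult add_uminus_mat uminus_add_mat\<close>)
    have B: "?H0 * snd (theta M) = four_block_mat (var_y \<cdot>\<^sub>m ?Y a - ?X b' * q) (var_x \<cdot>\<^sub>m ?X b' - ?Y a * p) (- (?X d' * q)) (var_x \<cdot>\<^sub>m ?X d')"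
      unfolding T
      by (subst mult_four_block_mat[of _ m1 n1 _ n0 _ m0 _ _ n1 _ n0]) (use car 0(1-4) 1(1-4) in \<open>simp_all add: mat_smult add_uminus_mat uminus_add_mat zero_minus_mat\<close>)
    have "fst (theta N) * ?H1 + ?H0 * snd (theta M) = four_block_mat (a' - ?u) b' (q' * ?X a + var_y \<cdot>\<^sub>m ?X c + - (?X d' * q)) (d' - ?v)"
      unfolding A B by (subst add_four_block_mat[of _ m1 n1 _ n0 _ m0]) (use car'' in \<open>simp_all add: minus_carrier_mat uminus_carrier_mat 3(1,2,4)\<close>)
    moreover have "q' * ?X a + var_y \<cdot>\<^sub>m ?X c + - (?X d' * q) = c'"
      unfolding add_uminus_mat 3(3) ..
    moreover have "snd f - snd (theta_map (v, u)) = four_block_mat (a' - ?u) b' c' (d' - ?v)"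
      unfolding tm 1(5) using 1(1-4) uv by (auto intro!: eq_matI)
    ultimately show ?thesis by simp
  qed
  have "(theta_map (v, u), f) \<in> homotopic (theta M) (theta N)"
    by (rule homotopicI[OF theta_map_hom[OF M g] hom _ _ D0 D1]) (use 0(1-4) 1(1-4) in \<open>auto simp: tb(3,4,8,9) n[symmetric] m[symmetric]\<close>)
  with g show ?thesis by (rule that)
qed

lemma theta_fully_faithful:
  fixes M N :: "'a::comm_ring_1 mat2"
  assumes M: "mf_shape M" "mf_shape N"
  shows "bij_betw (theta_class M N) (Ext0 M N) (Ext0 (theta M) (theta N))"
proof (rule bij_betw_imageI)
  note T = theta_blocks(5)[OF M(1)] theta_blocks(5)[OF M(2)]
  show "inj_on (theta_class M N) (Ext0 M N)"
  proof (rule inj_onI)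
  fix F G assume FG: "F \<in> Ext0 M N" "G \<in> Ext0 M N" and eq: "theta_class M N F = theta_class M N G"
  obtain f where f: "f \<in> mf_hom M N" "F = hcls M N f" by (rule Ext0_cases[OF FG(1)])
  obtain g where g: "g \<in> mf_hom M N" "G = hcls M N g" by (rule Ext0_cases[OF FG(2)])
  have "(theta_map f, theta_map g) \<in> homotopic (theta M) (theta N)"
    using eq unfolding f(2) g(2) theta_class_hcls[OF M f(1)] theta_class_hcls[OF M g(1)]
      hcls_eq_iff[OF T theta_map_hom[OF M f(1)] theta_map_hom[OF M g(1)]] .
  then have "(f, g) \<in> homotopic M N" by (rule theta_faithful[OF M f(1) g(1)])
  then show "F = G" unfolding f(2) g(2) hcls_eq_iff[OF M f(1) g(1)] .
  qed
  show "theta_class M N ` Ext0 M N = Ext0 (theta M) (theta N)"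
  proof (intro equalityI subsetI)
  fix H assume "H \<in> theta_class M N ` Ext0 M N"
  then obtain F where F: "F \<in> Ext0 M N" and H: "H = theta_class M N F" by (rule imageE)
  obtain f where f: "f \<in> mf_hom M N" "F = hcls M N f" by (rule Ext0_cases[OF F])
  show "H \<in> Ext0 (theta M) (theta N)"
    unfolding H f(2) theta_class_hcls[OF M f(1)] by (rule hcls_Ext0[OF theta_map_hom[OF M f(1)]])
  next
  fix H assume H: "H \<in> Ext0 (theta M) (theta N)"
  obtain h where h: "h \<in> mf_hom (theta M) (theta N)" "H = hcls (theta M) (theta N) h" by (rule Ext0_cases[OF H])
  obtain g where g: "g \<in> mf_hom M N" "(theta_map g, h) \<in> homotopic (theta M) (theta N)"
    by (rule theta_full[OF M h(1)])
  have "theta_class M N (hcls M N g) = H"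
    unfolding h(2) theta_class_hcls[OF M g(1)] hcls_eq_iff[OF T theta_map_hom[OF M g(1)] h(1)] by (rule g(2))
  then show "H \<in> theta_class M N ` Ext0 M N" using hcls_Ext0[OF g(1)] by blast
  qed
qed

section \<open>Minimal matrix factorizations\<close>

text \<open>Splitting off a contractible summand: if the identity of \<open>M\<close> is homotopic to \<open>f g\<close> with
  \<open>g f = 1\<close>, then \<open>M\<close> is homotopy equivalent to the image of the idempotent \<open>f g\<close>.\<close>

lemma split_idempotent:
  fixes M :: "'a::comm_ring_1 mat2"
  assumes mf: "is_mf w M"
    and f: "f0 \<in> carrier_mat (rk0 M) k0" "f1 \<in> carrier_mat (rk1 M) k1"
    and g: "g0 \<in> carrier_mat k0 (rk0 M)" "g1 \<in> carrier_mat k1 (rk1 M)"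
    and h: "h0 \<in> carrier_mat (rk1 M) (rk0 M)" "h1 \<in> carrier_mat (rk0 M) (rk1 M)"
    and gf: "g0 * f0 = 1\<^sub>m k0" "g1 * f1 = 1\<^sub>m k1"
    and fg: "f0 * g0 = 1\<^sub>m (rk0 M) - (snd M * h0 + h1 * fst M)" "f1 * g1 = 1\<^sub>m (rk1 M) - (fst M * h1 + h0 * snd M)"
  shows "is_mf w (g1 * fst M * f0, g0 * snd M * f1)"
    "\<exists>e. cat_iso (MF w) (g1 * fst M * f0, g0 * snd M * f1) M e"
proof -
  note c = mf_carriers[OF is_mf_shape[OF mf]]
  define N where "N = (g1 * fst M * f0, g0 * snd M * f1)"
  have N: "fst N \<in> carrier_mat k1 k0" "snd N \<in> carrier_mat k0 k1" using c f g by (simp_all add: N_def)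
  then have rkN: "rk0 N = k0" "rk1 N = k1" by (auto simp: rk0_def rk1_def)
  have sN: "mf_shape N" using N by (simp add: mf_shape_def rkN)
  have w: "snd M * fst M = w \<cdot>\<^sub>m 1\<^sub>m (rk0 M)" "fst M * snd M = w \<cdot>\<^sub>m 1\<^sub>m (rk1 M)"
    using mf by (simp_all add: is_mf_def)
  have closed0: "fst M * (f0 * g0) = (f1 * g1) * fst M"
  proof -
    have "fst M * (f0 * g0) = fst M - ((fst M * snd M) * h0 + fst M * h1 * fst M)"
      unfolding fg using c h by (simp add: mat_distrib mat_assoc)
    also have "\<dots> = fst M - (fst M * h1 * fst M + h0 * (snd M * fst M))"
      unfolding w using c h by (simp add: mat_smult comm_add_mat[of _ "rk1 M" "rk0 M"])
    also have "\<dots> = (f1 * g1) * fst M"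
      unfolding fg using c h by (simp add: mat_distrib mat_assoc)
    finally show ?thesis .
  qed
  have closed1: "snd M * (f1 * g1) = (f0 * g0) * snd M"
  proof -
    have "snd M * (f1 * g1) = snd M - ((snd M * fst M) * h1 + snd M * h0 * snd M)"
      unfolding fg using c h by (simp add: mat_distrib mat_assoc)
    also have "\<dots> = snd M - (snd M * h0 * snd M + h1 * (fst M * snd M))"
      unfolding w using c h by (simp add: mat_smult comm_add_mat[of _ "rk0 M" "rk1 M"])
    also have "\<dots> = (f0 * g0) * snd M"
      unfolding fg using c h by (simp add: mat_distrib mat_assoc)
    finally show ?thesis .
  qed
  note d = c f g
  have f_hom0: "fst M * f0 = f1 * fst N"
  proof -
    have "f1 * fst N = (f1 * g1) * fst M * f0" unfolding N_def using d by (simp add: mat_assoc)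
    also have "\<dots> = fst M * f0 * (g0 * f0)" unfolding closed0[symmetric] using d by (simp add: mat_assoc del: gf)
    finally show ?thesis unfolding gf using d by simp
  qed
  have f_hom1: "snd M * f1 = f0 * snd N"
  proof -
    have "f0 * snd N = (f0 * g0) * snd M * f1" unfolding N_def using d by (simp add: mat_assoc)
    also have "\<dots> = snd M * f1 * (g1 * f1)" unfolding closed1[symmetric] using d by (simp add: mat_assoc)
    finally show ?thesis unfolding gf using d by simp
  qed
  have g_hom0: "fst N * g0 = g1 * fst M"
  proof -
    have "fst N * g0 = g1 * (fst M * (f0 * g0))" unfolding N_def using d by (simp add: mat_assoc)
    also have "\<dots> = (g1 * f1) * g1 * fst M" unfolding closed0 using d by (simp add: mat_assoc)
    finally show ?thesis unfolding gf using d by simp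
  qed
  have g_hom1: "snd N * g1 = g0 * snd M"
  proof -
    have "snd N * g1 = g0 * (snd M * (f1 * g1))" unfolding N_def using d by (simp add: mat_assoc)
    also have "\<dots> = (g0 * f0) * g0 * snd M" unfolding closed1 using d by (simp add: mat_assoc)
    finally show ?thesis unfolding gf using d by simp
  qed
  have "snd N * fst N = snd N * g1 * fst M * f0" unfolding N_def using d by (simp add: mat_assoc)
  also have "\<dots> = g0 * (snd M * fst M) * f0" unfolding g_hom1 using d by (simp add: mat_assoc)
  also have "\<dots> = w \<cdot>\<^sub>m 1\<^sub>m k0" unfolding w using d gf by (simp add: mat_smult)
  finally have 1: "snd N * fst N = w \<cdot>\<^sub>m 1\<^sub>m k0" .
  have "fst N * snd N = fst N * g0 * snd M * f1" unfolding N_def using d by (simp add: mat_assoc)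
  also have "\<dots> = g1 * (fst M * snd M) * f1" unfolding g_hom0 using d by (simp add: mat_assoc)
  also have "\<dots> = w \<cdot>\<^sub>m 1\<^sub>m k1" unfolding w using d gf by (simp add: mat_smult)
  finally have 2: "fst N * snd N = w \<cdot>\<^sub>m 1\<^sub>m k1" .
  show "is_mf w (g1 * fst M * f0, g0 * snd M * f1)"
    unfolding N_def[symmetric] is_mf_def rkN using 1 2 N by simp
  have fh: "(f0, f1) \<in> mf_hom N M" and gh: "(g0, g1) \<in> mf_hom M N"
    using f g f_hom0 f_hom1 g_hom0 g_hom1
    by (simp_all add: mf_hom_iff[OF sN is_mf_shape[OF mf]] mf_hom_iff[OF is_mf_shape[OF mf] sN] rkN)
  have "mf_comp (g0, g1) (f0, f1) = mf_id N" by (simp add: mf_comp_def mf_id_def rkN gf)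
  then have i1: "(mf_comp (g0, g1) (f0, f1), mf_id N) \<in> homotopic N N"
    using homotopic_equiv[OF sN sN] mf_id_hom[OF sN] by (simp add: equiv_def refl_on_def)
  have diff: "A - (A - B) = B" if "A \<in> carrier_mat k l" "B \<in> carrier_mat k l" for A B :: "'a mat" and k l
    using that by (auto intro!: eq_matI)
  have i2: "(mf_comp (f0, f1) (g0, g1), mf_id M) \<in> homotopic M M"
  proof (rule homotopicI[OF mf_comp_hom[OF is_mf_shape[OF mf] sN is_mf_shape[OF mf] gh fh] mf_id_hom[OF is_mf_shape[OF mf]] h])
    show "fst (mf_id M) - fst (mf_comp (f0, f1) (g0, g1)) = snd M * h0 + h1 * fst M"
      unfolding mf_comp_def mf_id_def fst_conv snd_conv fg by (rule diff[of _ "rk0 M" "rk0 M"]) (use c h in auto)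
    show "snd (mf_id M) - snd (mf_comp (f0, f1) (g0, g1)) = fst M * h1 + h0 * snd M"
      unfolding mf_comp_def mf_id_def fst_conv snd_conv fg by (rule diff[of _ "rk1 M" "rk1 M"]) (use c h in auto)
  qed
  show "\<exists>e. cat_iso (MF w) (g1 * fst M * f0, g0 * snd M * f1) M e"
    unfolding N_def[symmetric] by (rule exI, rule MF_isoI[OF sN is_mf_shape[OF mf] fh gh i1 i2])
qed

lemma mf_iso_cat_iso:
  fixes M N :: "'a::comm_ring_1 mat2"
  assumes mf: "is_mf w M" "is_mf w N" and rk: "rk0 N = rk0 M" "rk1 N = rk1 M" and iso: "mf_iso M N s"
  shows "\<exists>e. cat_iso (MF w) N M e"
proof -
  note s = mf_iso_iff[OF is_mf_shape[OF mf(1)] is_mf_shape[OF mf(2)] refl rk(1) refl rk(2), THEN iffD1, OF iso]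
  note c = mf_carriers[OF is_mf_shape[OF mf(1)]] mf_carriers[OF is_mf_shape[OF mf(2)], unfolded rk]
  from s have c': "fst s \<in> carrier_mat (rk0 M) (rk0 M)" "snd s \<in> carrier_mat (rk1 M) (rk1 M)"
    and i: "invertible_mat (fst s)" "invertible_mat (snd s)"
    and e: "fst N * fst s = snd s * fst M" "snd N * snd s = fst s * snd M" by auto
  obtain t0 where t0: "t0 \<in> carrier_mat (rk0 M) (rk0 M)" "fst s * t0 = 1\<^sub>m (rk0 M)" "t0 * fst s = 1\<^sub>m (rk0 M)"
    by (rule invertible_matE[OF i(1) c'(1)])
  obtain t1 where t1: "t1 \<in> carrier_mat (rk1 M) (rk1 M)" "snd s * t1 = 1\<^sub>m (rk1 M)" "t1 * snd s = 1\<^sub>m (rk1 M)"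
    by (rule invertible_matE[OF i(2) c'(2)])
  have "snd s * fst M * t0 = fst N" unfolding e(1)[symmetric] using c c' t0(1) by (simp add: mat_assoc t0(2))
  moreover have "fst s * snd M * t1 = snd N" unfolding e(2)[symmetric] using c c' t1(1) by (simp add: mat_assoc t1(2))
  ultimately have N: "(snd s * fst M * t0, fst s * snd M * t1) = N" by simp
  have "1\<^sub>m n - (0\<^sub>m n n + 0\<^sub>m n n) = (1\<^sub>m n :: 'a mat)" for n by (rule eq_matI) auto
  then show ?thesis
    using split_idempotent(2)[OF mf(1) t0(1) t1(1) c', of "0\<^sub>m (rk1 M) (rk0 M)" "0\<^sub>m (rk0 M) (rk1 M)"] c t0 t1
    unfolding N by simp
qed

text \<open>The idempotent \<open>1 - Z\<close> splits by dropping the row and column \<open>j\<close>.\<close>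

lemma split_row:
  fixes Z :: "'a::comm_ring_1 mat"
  assumes Z: "Z \<in> carrier_mat n n" and j: "j < n" and row: "\<And>a c. a < n \<Longrightarrow> c < n \<Longrightarrow> a \<noteq> j \<Longrightarrow> Z $$ (a, c) = 0"
    and one: "Z $$ (j, j) = 1"
  obtains f g where "f \<in> carrier_mat n (n - 1)" "g \<in> carrier_mat (n - 1) n" "f * g = 1\<^sub>m n - Z" "g * f = 1\<^sub>m (n - 1)"
proof
  define s where "s b = (if b < j then b else Suc b)" for b
  have s_less: "s b < n" if "b < n - 1" for b using that j by (auto simp: s_def)
  have s_j: "s b \<noteq> j" for b by (auto simp: s_def)
  have s_inj: "s b = s b' \<longleftrightarrow> b = b'" for b b' by (auto simp: s_def)
  have s_surj: "\<exists>b < n - 1. c = s b" if "c < n" "c \<noteq> j" for c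
    using that j by (intro exI[of _ "if c < j then c else c - 1"]) (auto simp: s_def)
  define f where "f = mat n (n - 1) (\<lambda>(a, b). (1\<^sub>m n - Z) $$ (a, s b))"
  define g where "g = (mat (n - 1) n (\<lambda>(b, c). if c = s b then 1 else 0) :: 'a mat)"
  show f: "f \<in> carrier_mat n (n - 1)" and g: "g \<in> carrier_mat (n - 1) n" by (auto simp: f_def g_def)
  show "f * g = 1\<^sub>m n - Z"
  proof (rule eq_matI)
    fix a c assume "a < dim_row (1\<^sub>m n - Z)" "c < dim_col (1\<^sub>m n - Z)"
    then have ac: "a < n" "c < n" using Z by auto
    have "(f * g) $$ (a, c) = (\<Sum>b<n - 1. (1\<^sub>m n - Z) $$ (a, s b) * (if c = s b then 1 else 0))"
      using ac f g by (simp add: mult_entry f_def g_def del: index_mult_mat(1) index_minus_mat)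
    also have "\<dots> = (1\<^sub>m n - Z) $$ (a, c)"
    proof (cases "c = j")
      case True
      then have "(1\<^sub>m n - Z) $$ (a, c) = 0" using ac Z row one by (cases "a = j") auto
      moreover have "c \<noteq> s b" for b using s_j True by metis
      ultimately show ?thesis by simp
    next
      case False
      then obtain b0 where b0: "b0 < n - 1" "c = s b0" using s_surj ac by blast
      then have "(\<Sum>b<n - 1. (1\<^sub>m n - Z) $$ (a, s b) * (if c = s b then 1 else 0))
          = (\<Sum>b<n - 1. if b0 = b then (1\<^sub>m n - Z) $$ (a, s b) else 0)"
        by (intro sum.cong refl) (simp add: s_inj)
      then show ?thesis using b0 by simp
    qed
    finally show "(f * g) $$ (a, c) = (1\<^sub>m n - Z) $$ (a, c)" .
  qed (use f g Z in auto)
  show "g * f = 1\<^sub>m (n - 1)"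
  proof (rule eq_matI)
    fix b b' assume "b < dim_row (1\<^sub>m (n - 1) :: 'a mat)" "b' < dim_col (1\<^sub>m (n - 1) :: 'a mat)"
    then have bb: "b < n - 1" "b' < n - 1" by auto
    have "(g * f) $$ (b, b') = (\<Sum>a<n. if s b = a then (1\<^sub>m n - Z) $$ (a, s b') else 0)"
      using bb f g by (auto simp add: mult_entry f_def g_def mult_delta_left simp del: index_mult_mat(1) index_minus_mat)
    also have "\<dots> = (1\<^sub>m n - Z) $$ (s b, s b')" using s_less[OF bb(1)] by simp
    also have "\<dots> = (if b = b' then 1 else 0)"
      using Z s_less[OF bb(1)] s_less[OF bb(2)] row[OF s_less[OF bb(1)] s_less[OF bb(2)] s_j] by (simp add: s_inj)
    finally show "(g * f) $$ (b, b') = 1\<^sub>m (n - 1) $$ (b, b')" using bb by simp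
  qed (use f g in auto)
qed

lemma split_col:
  fixes Z :: "'a::comm_ring_1 mat"
  assumes Z: "Z \<in> carrier_mat n n" and j: "j < n" and col: "\<And>a c. a < n \<Longrightarrow> c < n \<Longrightarrow> c \<noteq> j \<Longrightarrow> Z $$ (a, c) = 0"
    and one: "Z $$ (j, j) = 1"
  obtains f g where "f \<in> carrier_mat n (n - 1)" "g \<in> carrier_mat (n - 1) n" "f * g = 1\<^sub>m n - Z" "g * f = 1\<^sub>m (n - 1)"
proof -
  obtain f g where fg: "f \<in> carrier_mat n (n - 1)" "g \<in> carrier_mat (n - 1) n"
    "f * g = 1\<^sub>m n - transpose_mat Z" "g * f = 1\<^sub>m (n - 1)"
    by (rule split_row[of "transpose_mat Z" n j]) (use assms in auto)
  have "transpose_mat g * transpose_mat f = transpose_mat (f * g)" using fg(1,2) by (simp add: mat_transpose_mult)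
  also have "\<dots> = 1\<^sub>m n - Z" unfolding fg(3) using Z by (auto intro!: eq_matI)
  finally have 1: "transpose_mat g * transpose_mat f = 1\<^sub>m n - Z" .
  have "transpose_mat f * transpose_mat g = transpose_mat (g * f)" using fg(1,2) by (simp add: mat_transpose_mult)
  then have "transpose_mat f * transpose_mat g = 1\<^sub>m (n - 1)" unfolding fg(4) by simp
  with 1 fg(1,2) show ?thesis by (intro that[of "transpose_mat g" "transpose_mat f"]) auto
qed

definition elementary :: "nat \<Rightarrow> nat \<Rightarrow> nat \<Rightarrow> nat \<Rightarrow> 'a::zero \<Rightarrow> 'a mat" where
  "elementary m n i j d = mat m n (\<lambda>(a, b). if a = i \<and> b = j then d else 0)"

lemma elementary_mult:
  fixes A :: "'a::comm_ring_1 mat"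
  assumes A: "A \<in> carrier_mat m n" and ij: "i < m" "j < n"
  shows "a < n \<Longrightarrow> b < n \<Longrightarrow> (elementary n m j i d * A) $$ (a, b) = (if a = j then d * A $$ (i, b) else 0)"
    "a < m \<Longrightarrow> b < m \<Longrightarrow> (A * elementary n m j i d) $$ (a, b) = (if b = i then A $$ (a, j) * d else 0)"
proof -
  assume "a < n" "b < n"
  then have "(elementary n m j i d * A) $$ (a, b) = (\<Sum>k<m. if k = i then (if a = j then d * A $$ (i, b) else 0) else 0)"
    using A by (auto simp add: mult_entry elementary_def mult_delta_left mult_delta_right simp del: index_mult_mat(1))
  then show "(elementary n m j i d * A) $$ (a, b) = (if a = j then d * A $$ (i, b) else 0)" using ij by simp
next
  assume "a < m" "b < m"
  then have "(A * elementary n m j i d) $$ (a, b) = (\<Sum>k<n. if k = j then (if b = i then A $$ (a, j) * d else 0) else 0)"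
    using A by (auto simp add: mult_entry elementary_def mult_delta_left mult_delta_right simp del: index_mult_mat(1))
  then show "(A * elementary n m j i d) $$ (a, b) = (if b = i then A $$ (a, j) * d else 0)" using ij by simp
qed

lemma elementary_split:
  fixes A :: "'a::comm_ring_1 mat"
  assumes A: "A \<in> carrier_mat m n" and ij: "i < m" "j < n" and d: "A $$ (i, j) * d = 1"
  obtains f0 g0 f1 g1 where "f0 \<in> carrier_mat n (n - 1)" "g0 \<in> carrier_mat (n - 1) n" "f1 \<in> carrier_mat m (m - 1)" "g1 \<in> carrier_mat (m - 1) m"
    "f0 * g0 = 1\<^sub>m n - elementary n m j i d * A" "g0 * f0 = 1\<^sub>m (n - 1)"
    "f1 * g1 = 1\<^sub>m m - A * elementary n m j i d" "g1 * f1 = 1\<^sub>m (m - 1)"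
proof -
  note e = elementary_mult[OF A ij, of _ _ d]
  have c: "elementary n m j i d \<in> carrier_mat n m" by (simp add: elementary_def)
  obtain f0 g0 where 0: "f0 \<in> carrier_mat n (n - 1)" "g0 \<in> carrier_mat (n - 1) n"
    "f0 * g0 = 1\<^sub>m n - elementary n m j i d * A" "g0 * f0 = 1\<^sub>m (n - 1)"
    by (rule split_row[of "elementary n m j i d * A" n j])
      (use A c ij d e in \<open>simp_all add: mult.commute[of d] del: index_mult_mat(1)\<close>)
  obtain f1 g1 where 1: "f1 \<in> carrier_mat m (m - 1)" "g1 \<in> carrier_mat (m - 1) m"
    "f1 * g1 = 1\<^sub>m m - A * elementary n m j i d" "g1 * f1 = 1\<^sub>m (m - 1)"
    by (rule split_col[of "A * elementary n m j i d" m i])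
      (use A c ij d e in \<open>simp_all del: index_mult_mat(1)\<close>)
  show ?thesis by (rule that[OF 0(1,2) 1(1,2) 0(3,4) 1(3,4)])
qed

text \<open>A unit entry \<open>c\<close> of \<open>\<phi>\<close> or \<open>\<psi>\<close> gives a contractible summand; the matrix with the one entry
  \<open>c\<^sup>-\<^sup>1\<close> is a contraction of it.\<close>

lemma reduce_unit_entry:
  fixes M :: "'a::comm_ring_1 mat2"
  assumes mf: "is_mf w M" and unit: "\<not> (mat_in max_ideal (fst M) \<and> mat_in max_ideal (snd M))"
  obtains N e where "is_mf w N" "rk0 N + rk1 N < rk0 M + rk1 M" "cat_iso (MF w) N M e"
proof -
  note c = mf_carriers[OF is_mf_shape[OF mf]]
  have less: "rk0 (g1 * fst M * f0, g0 * snd M * f1) + rk1 (g1 * fst M * f0, g0 * snd M * f1) < rk0 M + rk1 M"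
    if "f0 \<in> carrier_mat (rk0 M) (rk0 M - 1)" "g1 \<in> carrier_mat (rk1 M - 1) (rk1 M)" "0 < rk0 M" "0 < rk1 M"
    for f0 g0 f1 g1 :: "'a mat"
    using that by (auto simp: rk0_def rk1_def)
  have z: "A * 0\<^sub>m m n + B = B" "B + 0\<^sub>m l m * A' = B"
    if "A \<in> carrier_mat l m" "A' \<in> carrier_mat m n" "B \<in> carrier_mat l n" for A A' B :: "'a mat" and l m n
    using that by auto
  have z': "B + 0\<^sub>m l m * A' = B" if "A' \<in> carrier_mat m n" "B \<in> carrier_mat l n" for A' B :: "'a mat" and l m n
    using that by auto
  from unit consider i j where "i < rk1 M" "j < rk0 M" "fst M $$ (i, j) dvd 1"
    | i j where "i < rk0 M" "j < rk1 M" "snd M $$ (i, j) dvd 1"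
    using c by (auto simp: mat_in_def max_ideal_def)
  then show ?thesis
  proof cases
    case 1
    from 1(3) obtain d where "fst M $$ (i, j) * d = 1" by (auto elim: dvdE)
    from elementary_split[OF c(1) 1(1,2) this] obtain f0 g0 f1 g1 where s:
      "f0 \<in> carrier_mat (rk0 M) (rk0 M - 1)" "g0 \<in> carrier_mat (rk0 M - 1) (rk0 M)"
      "f1 \<in> carrier_mat (rk1 M) (rk1 M - 1)" "g1 \<in> carrier_mat (rk1 M - 1) (rk1 M)"
      "f0 * g0 = 1\<^sub>m (rk0 M) - elementary (rk0 M) (rk1 M) j i d * fst M" "g0 * f0 = 1\<^sub>m (rk0 M - 1)"
      "f1 * g1 = 1\<^sub>m (rk1 M) - fst M * elementary (rk0 M) (rk1 M) j i d" "g1 * f1 = 1\<^sub>m (rk1 M - 1)" .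
    have h: "0\<^sub>m (rk1 M) (rk0 M) \<in> carrier_mat (rk1 M) (rk0 M)" "elementary (rk0 M) (rk1 M) j i d \<in> carrier_mat (rk0 M) (rk1 M)"
      by (auto simp: elementary_def)
    note S = split_idempotent[OF mf s(1,3,2,4) h s(6,8)]
    have "f0 * g0 = 1\<^sub>m (rk0 M) - (snd M * 0\<^sub>m (rk1 M) (rk0 M) + elementary (rk0 M) (rk1 M) j i d * fst M)"
      "f1 * g1 = 1\<^sub>m (rk1 M) - (fst M * elementary (rk0 M) (rk1 M) j i d + 0\<^sub>m (rk1 M) (rk0 M) * snd M)"
      unfolding s(5,7) using c h by simp_all
    note S = S[OF this]
    from S(2) obtain e where "cat_iso (MF w) (g1 * fst M * f0, g0 * snd M * f1) M e" ..
    then show ?thesis using that[OF S(1)] less[OF s(1,4)] 1 by auto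
  next
    case 2
    from 2(3) obtain d where "snd M $$ (i, j) * d = 1" by (auto elim: dvdE)
    from elementary_split[OF c(2) 2(1,2) this] obtain f1 g1 f0 g0 where s:
      "f1 \<in> carrier_mat (rk1 M) (rk1 M - 1)" "g1 \<in> carrier_mat (rk1 M - 1) (rk1 M)"
      "f0 \<in> carrier_mat (rk0 M) (rk0 M - 1)" "g0 \<in> carrier_mat (rk0 M - 1) (rk0 M)"
      "f1 * g1 = 1\<^sub>m (rk1 M) - elementary (rk1 M) (rk0 M) j i d * snd M" "g1 * f1 = 1\<^sub>m (rk1 M - 1)"
      "f0 * g0 = 1\<^sub>m (rk0 M) - snd M * elementary (rk1 M) (rk0 M) j i d" "g0 * f0 = 1\<^sub>m (rk0 M - 1)" .
    have h: "elementary (rk1 M) (rk0 M) j i d \<in> carrier_mat (rk1 M) (rk0 M)" "0\<^sub>m (rk0 M) (rk1 M) \<in> carrier_mat (rk0 M) (rk1 M)"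
      by (auto simp: elementary_def)
    note S = split_idempotent[OF mf s(3,1,4,2) h s(8,6)]
    have "f0 * g0 = 1\<^sub>m (rk0 M) - (snd M * elementary (rk1 M) (rk0 M) j i d + 0\<^sub>m (rk0 M) (rk1 M) * fst M)"
      "f1 * g1 = 1\<^sub>m (rk1 M) - (fst M * 0\<^sub>m (rk0 M) (rk1 M) + elementary (rk1 M) (rk0 M) j i d * snd M)"
      unfolding s(5,7) using c h by simp_all
    note S = S[OF this]
    from S(2) obtain e where "cat_iso (MF w) (g1 * fst M * f0, g0 * snd M * f1) M e" ..
    then show ?thesis using that[OF S(1)] less[OF s(3,2)] 2 by auto
  qed
qed

lemma minimal_model:
  fixes M :: "'a::comm_ring_1 mat2"
  assumes "is_mf w M"
  shows "\<exists>N e. is_mf w N \<and> mat_in max_ideal (fst N) \<and> mat_in max_ideal (snd N) \<and> cat_iso (MF w) N M e"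
  using assms
proof (induction "rk0 M + rk1 M" arbitrary: M rule: less_induct)
  case less
  note s = is_mf_shape[OF less.prems]
  show ?case
  proof (cases "mat_in max_ideal (fst M) \<and> mat_in max_ideal (snd M)")
    case True
    have "(mf_comp (mf_id M) (mf_id M), mf_id M) \<in> homotopic M M"
      unfolding mf_comp_id(1)[OF s s mf_id_hom[OF s]]
      using homotopic_equiv[OF s s] mf_id_hom[OF s] by (simp add: equiv_def refl_on_def)
    from MF_isoI[OF s s mf_id_hom[OF s] mf_id_hom[OF s] this this] True less.prems show ?thesis by blast
  next
    case False
    obtain N e where N: "is_mf w N" "rk0 N + rk1 N < rk0 M + rk1 M" "cat_iso (MF w) N M e"
      by (rule reduce_unit_entry[OF less.prems False])
    from less.hyps[OF N(2,1)] obtain N' e' where N': "is_mf w N'" "mat_in max_ideal (fst N')" "mat_in max_ideal (snd N')"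
      "cat_iso (MF w) N' N e'" by blast
    have "cat_iso (MF w) N' M (Cmp (MF w) N' N M e e')"
      by (rule cat_iso_comp[OF MF_category _ _ _ N'(4) N(3)]) (use N N' less.prems in simp_all)
    with N'(1-3) show ?thesis by blast
  qed
qed

section \<open>Essential surjectivity\<close>

text \<open>A factorization \<open>E = C R\<close> of least possible inner size splits the idempotent \<open>E\<close>: if \<open>R C\<close> were
  singular, the inner size could be reduced, and an invertible \<open>R C\<close> satisfies \<open>(R C)\<^sup>3 = (R C)\<^sup>2\<close>.\<close>

lemma idempotent_splits:
  fixes E :: "'k::field mat"
  assumes E: "E \<in> carrier_mat n n" "E * E = E"
  obtains p C R where "C \<in> carrier_mat n p" "R \<in> carrier_mat p n" "C * R = E" "R * C = 1\<^sub>m p"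
proof -
  define F where "F p \<longleftrightarrow> (\<exists>C R. C \<in> carrier_mat n p \<and> R \<in> carrier_mat p n \<and> C * R = E)" for p
  have "F n" unfolding F_def using E by (intro exI[of _ E] exI[of _ "1\<^sub>m n"]) simp
  then have "F (LEAST p. F p)" by (rule LeastI)
  moreover define p where "p = (LEAST p. F p)"
  ultimately obtain C R where C: "C \<in> carrier_mat n p" and R: "R \<in> carrier_mat p n" and CR: "C * R = E"
    unfolding F_def by auto
  have least: "p \<le> p'" if "F p'" for p' unfolding p_def using that by (rule Least_le)
  define Z where "Z = R * C"
  have Z: "Z \<in> carrier_mat p p" using C R by (simp add: Z_def)
  have CZR: "C * Z * R = E"
  proof -
    have "C * Z * R = (C * R) * (C * R)" unfolding Z_def using C R by (simp add: mat_assoc)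
    then show ?thesis unfolding CR E(2) .
  qed
  have inv: "invertible_mat Z"
  proof (rule ccontr)
    assume "\<not> invertible_mat Z"
    then have "det Z = 0" using invertible_if_det_unit[OF Z] by (metis dvd_field_iff one_neq_zero)
    then obtain v where v: "v \<in> carrier_vec p" "v \<noteq> 0\<^sub>v p" "Z *\<^sub>v v = 0\<^sub>v p"
      using det_0_iff_vec_prod_zero_field[OF Z] by auto
    then obtain j where j: "j < p" "v $ j \<noteq> 0" by (metis eq_vecI carrier_vecD index_zero_vec)
    define V where "V = mat p p (\<lambda>(a, b). if b = j then v $ a / v $ j else 0)"
    have V: "V \<in> carrier_mat p p" by (simp add: V_def)
    have "Z * V = 0\<^sub>m p p"
    proof (rule eq_matI)
      fix a b assume "a < dim_row (0\<^sub>m p p :: 'k mat)" "b < dim_col (0\<^sub>m p p :: 'k mat)"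
      then have ab: "a < p" "b < p" by auto
      have "(\<Sum>k<p. Z $$ (a, k) * v $ k) = (Z *\<^sub>v v) $ a"
        using ab Z v(1) by (simp add: mult_mat_vec_def scalar_prod_def lessThan_atLeast0)
      then have 0: "(\<Sum>k<p. Z $$ (a, k) * v $ k) = 0" using v(3) ab by simp
      have "(Z * V) $$ (a, b) = (\<Sum>k<p. Z $$ (a, k) * (if b = j then v $ k / v $ j else 0))"
        using ab Z V by (simp add: mult_entry V_def del: index_mult_mat(1))
      also have "\<dots> = (if b = j then (\<Sum>k<p. Z $$ (a, k) * v $ k) / v $ j else 0)"
        by (simp add: sum_divide_distrib)
      finally show "(Z * V) $$ (a, b) = 0\<^sub>m p p $$ (a, b)" using ab 0 by simp
    qed (use Z V in auto)
    moreover obtain f g where fg: "f \<in> carrier_mat p (p - 1)" "g \<in> carrier_mat (p - 1) p" "f * g = 1\<^sub>m p - V"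
      by (rule split_col[OF V j(1)]) (use j in \<open>auto simp: V_def\<close>)
    ultimately have "Z * (f * g) = Z" unfolding fg(3) using Z V by (simp add: mat_distrib) (auto intro!: eq_matI)
    then have "(C * Z * f) * (g * R) = E"
      using CZR C R Z fg(1,2) by (simp add: mat_assoc[symmetric] del: assoc_mult_mat) (simp add: mat_assoc)
    moreover have "C * Z * f \<in> carrier_mat n (p - 1)" "g * R \<in> carrier_mat (p - 1) n" using C R Z fg(1,2) by auto
    ultimately have "F (p - 1)" unfolding F_def by blast
    from least[OF this] j(1) show False by simp
  qed
  have "Z * (Z * Z) = R * (C * Z * R) * C" unfolding Z_def using C R by (simp add: mat_assoc)
  also have "\<dots> = R * (C * R) * C" unfolding CZR CR ..
  also have "\<dots> = Z * Z" unfolding Z_def using C R by (simp add: mat_assoc)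
  finally have "Z * Z = Z" by (rule mat_cancel_left[OF _ Z inv]) (use Z in auto)
  then have "Z * Z = Z * 1\<^sub>m p" using Z by simp
  then have "Z = 1\<^sub>m p" by (rule mat_cancel_left[OF _ Z inv]) (use Z in auto)
  with C R CR show ?thesis by (intro that) (auto simp: Z_def)
qed

lemma idempotent_diagonal:
  fixes E :: "'k::field mat"
  assumes E: "E \<in> carrier_mat n n" "E * E = E"
  obtains p q U V where "U \<in> carrier_mat (p + q) n" "V \<in> carrier_mat n (p + q)" "U * V = 1\<^sub>m (p + q)" "V * U = 1\<^sub>m n"
    "U * E * V = four_block_mat (1\<^sub>m p) (0\<^sub>m p q) (0\<^sub>m q p) (0\<^sub>m q q)"
proof -
  define E' where "E' = 1\<^sub>m n - E"
  have E': "E' \<in> carrier_mat n n" "E' * E' = E'" "E * E' = 0\<^sub>m n n" "E' * E = 0\<^sub>m n n"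
    using E by (auto simp: E'_def mat_distrib intro!: eq_matI simp del: index_mult_mat(1))
  obtain p C R where C: "C \<in> carrier_mat n p" "R \<in> carrier_mat p n" "C * R = E" "R * C = 1\<^sub>m p"
    by (rule idempotent_splits[OF E])
  obtain q C' R' where C': "C' \<in> carrier_mat n q" "R' \<in> carrier_mat q n" "C' * R' = E'" "R' * C' = 1\<^sub>m q"
    by (rule idempotent_splits[OF E'(1,2)])
  have RC': "R * C' = 0\<^sub>m p q"
  proof -
    have "R * C' = (R * C) * (R * C') * (R' * C')" unfolding C(4) C'(4) using C(1,2) C'(1,2) by simp
    also have "\<dots> = R * ((C * R) * (C' * R')) * C'" using C(1,2) C'(1,2) by (simp add: mat_assoc)
    also have "\<dots> = 0\<^sub>m p q" unfolding C(3) C'(3) E'(3) using C(1,2) C'(1,2) by simp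
    finally show ?thesis .
  qed
  have R'C: "R' * C = 0\<^sub>m q p"
  proof -
    have "R' * C = (R' * C') * (R' * C) * (R * C)" unfolding C(4) C'(4) using C(1,2) C'(1,2) by simp
    also have "\<dots> = R' * ((C' * R') * (C * R)) * C" using C(1,2) C'(1,2) by (simp add: mat_assoc)
    also have "\<dots> = 0\<^sub>m q p" unfolding C(3) C'(3) E'(4) using C(1,2) C'(1,2) by simp
    finally show ?thesis .
  qed
  define U where "U = four_block_mat R (0\<^sub>m p 0) R' (0\<^sub>m q 0)"
  define V where "V = four_block_mat C C' (0\<^sub>m 0 p) (0\<^sub>m 0 q)"
  let ?D = "four_block_mat (1\<^sub>m p) (0\<^sub>m p q) (0\<^sub>m q p) (0\<^sub>m q q) :: 'k mat"
  have UV: "U \<in> carrier_mat (p + q) n" "V \<in> carrier_mat n (p + q)" and D: "?D \<in> carrier_mat (p + q) (p + q)"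
    using C(1,2) C'(1,2) by (auto simp: U_def V_def)
  have collapse: "four_block_mat A (0\<^sub>m n 0) (0\<^sub>m 0 n) (0\<^sub>m 0 0) = A" if "A \<in> carrier_mat n n" for A :: "'k mat"
    using that by (intro eq_matI) auto
  have 1: "U * V = 1\<^sub>m (p + q)"
    unfolding U_def V_def
    by (subst mult_four_block_mat[of _ p n _ 0 _ q _ _ p _ q]) (use C(1,2,4) C'(1,2,4) RC' R'C in simp_all)
  have 2: "V * U = 1\<^sub>m n"
  proof -
    have "V * U = four_block_mat (C * R + C' * R') (0\<^sub>m n 0) (0\<^sub>m 0 n) (0\<^sub>m 0 0)"
      unfolding U_def V_def
      by (subst mult_four_block_mat[of _ n p _ q _ 0 _ _ n _ 0]) (use C(1,2) C'(1,2) in simp_all)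
    also have "\<dots> = C * R + C' * R'" by (rule collapse) (use C C' in auto)
    also have "\<dots> = 1\<^sub>m n" unfolding C(3) C'(3) E'_def using E by (intro eq_matI) auto
    finally show ?thesis .
  qed
  have 3: "V * ?D * U = E"
  proof -
    have "V * ?D = four_block_mat C (0\<^sub>m n q) (0\<^sub>m 0 p) (0\<^sub>m 0 q)"
      unfolding V_def by (subst mult_four_block_mat[of _ n p _ q _ 0 _ _ p _ q]) (use C(1,2) C'(1,2) in simp_all)
    also have "\<dots> * U = four_block_mat E (0\<^sub>m n 0) (0\<^sub>m 0 n) (0\<^sub>m 0 0)"
      unfolding U_def by (subst mult_four_block_mat[of _ n p _ q _ 0 _ _ n _ 0]) (use C(1,2,3) C'(1,2) E in simp_all)
    finally show ?thesis using collapse[OF E(1)] by simp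
  qed
  have "U * E * V = (U * V) * ?D * (U * V)" unfolding 3[symmetric] using UV D by (simp add: mat_assoc)
  then have "U * E * V = ?D" unfolding 1 using D by simp
  with UV 1 2 show ?thesis by (rule that)
qed

definition res_coeff :: "('k::field \<Rightarrow> 'a::comm_ring_1) \<Rightarrow> nat \<Rightarrow> nat \<Rightarrow> 'a fps fps mat \<Rightarrow> 'k mat" where
  "res_coeff \<iota> i j A = map_mat (\<lambda>f. residue \<iota> (cf f i j)) A"

lemma res_coeff_carrier [simp]:
  "res_coeff \<iota> i j A \<in> carrier_mat m n \<longleftrightarrow> A \<in> carrier_mat m n"
  "dim_row (res_coeff \<iota> i j A) = dim_row A" "dim_col (res_coeff \<iota> i j A) = dim_col A"
  by (auto simp: res_coeff_def)

lemma (in complete_algebra) residue_sum: "residue \<iota> (sum h K) = (\<Sum>k\<in>K. residue \<iota> (h k :: 'a))"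
proof -
  interpret comm_ring_hom "residue \<iota>" by (rule residue_hom)
  show ?thesis by (induction K rule: infinite_finite_induct) (simp_all add: hom_add)
qed

lemma (in complete_algebra) res_coeff_mult:
  assumes AB: "mat_in (W 1) A" "mat_in (W 1) B" "dim_col A = dim_row B"
  shows "res_coeff \<iota> 2 0 (A * B) = res_coeff \<iota> 1 0 A * res_coeff \<iota> 1 0 B"
    "res_coeff \<iota> 0 2 (A * B) = res_coeff \<iota> 0 1 A * res_coeff \<iota> 0 1 B"
    "res_coeff \<iota> 1 1 (A * B) = res_coeff \<iota> 1 0 A * res_coeff \<iota> 0 1 B + res_coeff \<iota> 0 1 A * res_coeff \<iota> 1 0 B"
proof -
  interpret comm_ring_hom "residue \<iota>" by (rule residue_hom)
  have e: "residue \<iota> (cf (f * g) 2 0) = residue \<iota> (cf f 1 0) * residue \<iota> (cf g 1 0)"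
    "residue \<iota> (cf (f * g) 0 2) = residue \<iota> (cf f 0 1) * residue \<iota> (cf g 0 1)"
    "residue \<iota> (cf (f * g) 1 1) = residue \<iota> (cf f 1 0) * residue \<iota> (cf g 0 1) + residue \<iota> (cf f 0 1) * residue \<iota> (cf g 1 0)"
    if "f \<in> W 1" "g \<in> W 1" for f g
    using that unfolding W1_iff residue_zero_iff[symmetric]
    by (simp_all add: cf_mult numeral_2_eq_2 hom_add hom_mult)
  have W: "A $$ (i, k) \<in> W 1" "B $$ (k, j) \<in> W 1" if "i < dim_row A" "k < dim_row B" "j < dim_col B" for i j k
    using AB that unfolding mat_in_def by auto
  show "res_coeff \<iota> 2 0 (A * B) = res_coeff \<iota> 1 0 A * res_coeff \<iota> 1 0 B"
    "res_coeff \<iota> 0 2 (A * B) = res_coeff \<iota> 0 1 A * res_coeff \<iota> 0 1 B"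
    "res_coeff \<iota> 1 1 (A * B) = res_coeff \<iota> 1 0 A * res_coeff \<iota> 0 1 B + res_coeff \<iota> 0 1 A * res_coeff \<iota> 1 0 B"
    using AB(3) W
    by (auto simp: res_coeff_def mult_entry cf_sum residue_sum e sum.distrib intro!: eq_matI simp del: index_mult_mat(1) One_nat_def)
qed

lemma (in complete_algebra) res_coeff_const:
  assumes "dim_col U = dim_row A" "dim_col A = dim_row V"
  shows "res_coeff \<iota> i j (map_mat (\<lambda>a. cst (\<iota> a)) U * A * map_mat (\<lambda>a. cst (\<iota> a)) V) = U * res_coeff \<iota> i j A * V"
proof -
  interpret comm_ring_hom "residue \<iota>" by (rule residue_hom)
  have *: "residue \<iota> (cf (cst (\<iota> a) * f) i j) = a * residue \<iota> (cf f i j)" "residue \<iota> (cf (f * cst (\<iota> a)) i j) = residue \<iota> (cf f i j) * a" for a f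
    by (simp_all add: cf_cst_mult mult.commute[of _ "cst (\<iota> a)"] hom_mult)
  have 1: "res_coeff \<iota> i j (map_mat (\<lambda>a. cst (\<iota> a)) U * A) = U * res_coeff \<iota> i j A" if "dim_col U = dim_row A" for U A
    using that by (auto simp: res_coeff_def mult_entry cf_sum residue_sum * intro!: eq_matI simp del: index_mult_mat(1))
  have 2: "res_coeff \<iota> i j (A * map_mat (\<lambda>a. cst (\<iota> a)) U) = res_coeff \<iota> i j A * U" if "dim_col A = dim_row U" for U A
    using that by (auto simp: res_coeff_def mult_entry cf_sum residue_sum * intro!: eq_matI simp del: index_mult_mat(1))
  show ?thesis using assms by (simp add: 1 2)
qed

lemma (in complete_algebra) res_coeff_scalar:
  "res_coeff \<iota> i j ((var_x * var_y - cst \<pi>) \<cdot>\<^sub>m 1\<^sub>m n) = (if i = 1 \<and> j = 1 then 1\<^sub>m n else if i = 0 \<and> j = 0 then residue \<iota> (- \<pi>) \<cdot>\<^sub>m 1\<^sub>m n else 0\<^sub>m n n)"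
proof -
  interpret comm_ring_hom "residue \<iota>" by (rule residue_hom)
  have "cf var_y i j = (if i = 0 \<and> j = 1 then 1 else 0 :: 'a)" for i j
    using cf_var_y_mult[of "1 :: 'a fps fps" i j] by (auto simp: cf_1)
  then have "cf (var_x * var_y) i j = (if i = 1 \<and> j = 1 then 1 else 0 :: 'a)" by (auto simp: cf_var_x_mult)
  then show ?thesis by (auto simp: res_coeff_def cf_cst intro!: eq_matI)
qed

lemma (in complete_algebra) mat_in_W1_iff: "mat_in (W 1) A \<longleftrightarrow> res_coeff \<iota> 0 0 A = 0\<^sub>m (dim_row A) (dim_col A)"
  unfolding mat_in_def W1_iff residue_zero_iff[symmetric] mat_eq_iff by (simp add: res_coeff_def)

text \<open>In the leading coefficients \<open>\<phi> \<equiv> x a\<^sub>1 + y a\<^sub>2\<close>, \<open>\<psi> \<equiv> x b\<^sub>1 + y b\<^sub>2\<close> of a minimal factorization the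
  equations \<open>\<phi> \<psi> = \<psi> \<phi> = x y\<close> say that \<open>a\<^sub>1 + a\<^sub>2\<close> and \<open>b\<^sub>1 + b\<^sub>2\<close> are inverse to each other and that
  \<open>a\<^sub>1 b\<^sub>2\<close> is an idempotent with complement \<open>a\<^sub>2 b\<^sub>1\<close>. A constant change of bases that
  diagonalizes it brings the leading part of \<open>\<phi>\<close> into the form \<open>diag(x, y)\<close>.\<close>

lemma (in complete_algebra) theta_essentially_surjective:
  assumes mf: "is_mf (var_x * var_y - cst \<pi>) (M :: 'a fps fps mat2)"
  shows "\<exists>X. is_mf \<pi> X \<and> (\<exists>e. cat_iso (MF (var_x * var_y - cst \<pi>)) (theta X) M e)"
proof -
  let ?w = "var_x * var_y - cst \<pi>"
  let ?cc = "map_mat (\<lambda>a. cst (\<iota> a) :: 'a fps fps)"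
  obtain N eN where N: "is_mf ?w N" "mat_in max_ideal (fst N)" "mat_in max_ideal (snd N)" and NM: "cat_iso (MF ?w) N M eN"
    using minimal_model[OF mf] by blast
  then have W: "mat_in (W 1) (fst N)" "mat_in (W 1) (snd N)" by (simp_all only: max_ideal_power_series(2))
  define n0 n1 where n: "n0 = rk0 N" "n1 = rk1 N"
  note c = mf_carriers[OF is_mf_shape[OF N(1)], folded n]
  have w: "snd N * fst N = ?w \<cdot>\<^sub>m 1\<^sub>m n0" "fst N * snd N = ?w \<cdot>\<^sub>m 1\<^sub>m n1"
    using N(1) by (simp_all add: is_mf_def n)
  define a1 a2 b1 b2 where "a1 = res_coeff \<iota> 1 0 (fst N)" and "a2 = res_coeff \<iota> 0 1 (fst N)"
    and "b1 = res_coeff \<iota> 1 0 (snd N)" and "b2 = res_coeff \<iota> 0 1 (snd N)"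
  have ab: "a1 \<in> carrier_mat n1 n0" "a2 \<in> carrier_mat n1 n0" "b1 \<in> carrier_mat n0 n1" "b2 \<in> carrier_mat n0 n1"
    using c by (simp_all add: a1_def a2_def b1_def b2_def)
  have 1: "a1 * b1 = 0\<^sub>m n1 n1" "a2 * b2 = 0\<^sub>m n1 n1" "a1 * b2 + a2 * b1 = 1\<^sub>m n1"
    using res_coeff_mult[OF W] res_coeff_scalar[of _ _ \<pi> n1] c unfolding w a1_def a2_def b1_def b2_def by auto
  have 2: "b1 * a1 = 0\<^sub>m n0 n0" "b2 * a2 = 0\<^sub>m n0 n0" "b1 * a2 + b2 * a1 = 1\<^sub>m n0"
    using res_coeff_mult[OF W(2,1)] res_coeff_scalar[of _ _ \<pi> n0] c unfolding w a1_def a2_def b1_def b2_def by auto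
  define E where "E = a1 * b2"
  have E: "E \<in> carrier_mat n1 n1" using ab by (simp add: E_def)
  have "E = a1 * (b1 * a2 + b2 * a1) * b2" unfolding 2 E_def using ab by simp
  also have "\<dots> = (a1 * b1) * (a2 * b2) + E * E" using ab by (simp add: E_def mat_distrib mat_assoc)
  also have "\<dots> = E * E" unfolding 1 using E by simp
  finally have EE: "E * E = E" ..
  define X Y where "X = a1 + a2" and "Y = b1 + b2"
  have XY: "X \<in> carrier_mat n1 n0" "Y \<in> carrier_mat n0 n1" using ab by (simp_all add: X_def Y_def)
  have a1Y: "a1 * Y = E" unfolding Y_def E_def using ab 1(1) by (simp add: mat_distrib)
  have a2Y: "a2 * Y = 1\<^sub>m n1 - E"
  proof -
    have "a2 * Y = a2 * b1" unfolding Y_def using ab 1(2) by (simp add: mat_distrib)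
    also have "\<dots> = 1\<^sub>m n1 - E" unfolding 1(3)[symmetric] E_def using ab by (intro eq_matI) (auto simp del: index_mult_mat(1))
    finally show ?thesis .
  qed
  have "X * Y = 1\<^sub>m n1"
    unfolding X_def using ab XY a1Y a2Y E by (simp add: mat_distrib) (auto intro!: eq_matI)
  moreover have "Y * X = 1\<^sub>m n0"
  proof -
    have "Y * X = (b1 * a1 + b2 * a1) + (b1 * a2 + b2 * a2)" unfolding X_def Y_def using ab by (simp add: mat_distrib)
    also have "\<dots> = b1 * a2 + b2 * a1" unfolding 2(1,2) using ab by (intro eq_matI) (auto simp del: index_mult_mat(1))
    finally show ?thesis unfolding 2(3) .
  qed
  moreover obtain p q U V where UV: "U \<in> carrier_mat (p + q) n1" "V \<in> carrier_mat n1 (p + q)" "U * V = 1\<^sub>m (p + q)" "V * U = 1\<^sub>m n1"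
    and D: "U * E * V = four_block_mat (1\<^sub>m p) (0\<^sub>m p q) (0\<^sub>m q p) (0\<^sub>m q q)"
    by (rule idempotent_diagonal[OF E EE])
  ultimately have "(U * X) * (Y * V) = 1\<^sub>m (p + q)" "(Y * V) * (U * X) = 1\<^sub>m n0"
  proof -
    assume XY1: "X * Y = 1\<^sub>m n1" and YX1: "Y * X = 1\<^sub>m n0"
    have "(U * X) * (Y * V) = U * (X * Y) * V" using XY UV(1,2) by (simp add: mat_assoc)
    then show "(U * X) * (Y * V) = 1\<^sub>m (p + q)" unfolding XY1 using UV by simp
    have "(Y * V) * (U * X) = Y * (V * U) * X" using XY UV(1,2) by (simp add: mat_assoc)
    then show "(Y * V) * (U * X) = 1\<^sub>m n0" unfolding UV(4) using XY YX1 by simp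
  qed
  note UXYV = this
  let ?f0 = "?cc (Y * V)" and ?g0 = "?cc (U * X)" and ?f1 = "?cc V" and ?g1 = "?cc U"
  have cc_hom: "comm_ring_hom (\<lambda>a. cst (\<iota> a) :: 'a fps fps)"
  proof -
    interpret comm_ring_hom \<iota> by (rule iota_hom)
    show ?thesis by unfold_locales (simp_all add: hom_add hom_mult cst_add cst_mult)
  qed
  have car: "?f0 \<in> carrier_mat n0 (p + q)" "?f1 \<in> carrier_mat n1 (p + q)" "?g0 \<in> carrier_mat (p + q) n0" "?g1 \<in> carrier_mat (p + q) n1"
    using XY UV by auto
  have inv: "?g0 * ?f0 = 1\<^sub>m (p + q)" "?g1 * ?f1 = 1\<^sub>m (p + q)" "?f0 * ?g0 = 1\<^sub>m n0" "?f1 * ?g1 = 1\<^sub>m n1"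
    using UXYV UV XY by (simp_all add: map_hom_mult[OF cc_hom, symmetric] map_hom_simps(1)[OF cc_hom])
  define M' where "M' = (?g1 * fst N * ?f0, ?g0 * snd N * ?f1)"
  have z: "A = A - (B * 0\<^sub>m m k + 0\<^sub>m k l * B')" if "A \<in> carrier_mat k k" "B \<in> carrier_mat k m" "B' \<in> carrier_mat l k"
    for A B B' :: "'a fps fps mat" and k l m
    using that by (auto intro!: eq_matI)
  have id: "?f0 * ?g0 = 1\<^sub>m n0 - (snd N * 0\<^sub>m n1 n0 + 0\<^sub>m n0 n1 * fst N)"
    "?f1 * ?g1 = 1\<^sub>m n1 - (fst N * 0\<^sub>m n0 n1 + 0\<^sub>m n1 n0 * snd N)"
    unfolding inv using c by (auto intro!: z)
  note S = split_idempotent[OF N(1), folded n, OF car zero_carrier_mat zero_carrier_mat inv(1,2) id, folded M'_def]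
  have M'c: "fst M' \<in> carrier_mat (p + q) (p + q)" "snd M' \<in> carrier_mat (p + q) (p + q)"
    using car c by (auto simp: M'_def)
  have near: "mat_in (UNIV \<inter> W 2) (fst M' - diag_xy p (p + q))"
  proof -
    let ?D = "four_block_mat (1\<^sub>m p) (0\<^sub>m p q) (0\<^sub>m q p) (0\<^sub>m q q) :: 'k mat"
    have rc: "res_coeff \<iota> i j (fst M') = U * res_coeff \<iota> i j (fst N) * (Y * V)" for i j
      unfolding M'_def fst_conv using c UV XY by (intro res_coeff_const) auto
    have r00: "res_coeff \<iota> 0 0 (fst M') = 0\<^sub>m (p + q) (p + q)"
      unfolding rc W(1)[unfolded mat_in_W1_iff] using c UV XY by simp
    have r10: "res_coeff \<iota> 1 0 (fst M') = ?D"
    proof -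
      have "res_coeff \<iota> 1 0 (fst M') = U * (a1 * Y) * V" unfolding rc a1_def[symmetric] using ab UV XY by (simp add: mat_assoc)
      then show ?thesis unfolding a1Y D .
    qed
    have r01: "res_coeff \<iota> 0 1 (fst M') = 1\<^sub>m (p + q) - ?D"
    proof -
      have "res_coeff \<iota> 0 1 (fst M') = U * (a2 * Y) * V" unfolding rc a2_def[symmetric] using ab UV XY by (simp add: mat_assoc)
      also have "\<dots> = U * V - U * E * V" unfolding a2Y using UV E by (simp add: mat_distrib mat_assoc)
      finally show ?thesis unfolding D UV(3) .
    qed
    interpret comm_ring_hom "residue \<iota>" by (rule residue_hom)
    have var: "cf var_x 0 0 = (0 :: 'a)" "cf var_x 1 0 = (1 :: 'a)" "cf var_x 0 1 = (0 :: 'a)"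
      "cf var_y 0 0 = (0 :: 'a)" "cf var_y 1 0 = (0 :: 'a)" "cf var_y 0 1 = (1 :: 'a)"
      using cf_var_x_mult[of "1 :: 'a fps fps"] cf_var_y_mult[of "1 :: 'a fps fps"] by (simp_all add: cf_1)
    have "fst M' $$ (i, j) - diag_xy p (p + q) $$ (i, j) \<in> W 2" if ij: "i < p + q" "j < p + q" for i j
    proof -
      have e: "residue \<iota> (cf (fst M' $$ (i, j)) k l) = res_coeff \<iota> k l (fst M') $$ (i, j)" for k l
        using M'c ij by (simp add: res_coeff_def)
      have "residue \<iota> (cf (fst M' $$ (i, j)) 0 0) = 0" unfolding e r00 using ij by simp
      moreover have "residue \<iota> (cf (fst M' $$ (i, j)) 1 0) = (if i = j \<and> i < p then 1 else 0)" unfolding e r10 using ij by auto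
      moreover have "residue \<iota> (cf (fst M' $$ (i, j)) 0 1) = (if i = j \<and> \<not> i < p then 1 else 0)" unfolding e r01 using ij by auto
      moreover have "diag_xy p (p + q) $$ (i, j) = (if i = j then if i < p then var_x else var_y else (0 :: 'a fps fps))"
        using ij by (simp add: diag_xy_def diag_var_def)
      ultimately show ?thesis
        unfolding W2_iff residue_zero_iff[symmetric] cf_simps hom_minus by (simp add: var del: One_nat_def)
    qed
    then show ?thesis using M'c by (auto simp: mat_in_def)
  qed
  have near': "mat_in (W 1) (snd M')"
    unfolding mat_in_W1_iff using W(2) c XY UV unfolding M'_def mat_in_W1_iff
    by (simp add: res_coeff_const)
  obtain P Q f where PQ: "P \<in> carrier_mat p q" "Q \<in> carrier_mat q p" "is_mf \<pi> (P, Q)" "mf_iso M' (theta (P, Q)) f"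
    by (rule mf_normal_form[OF S(1) M'c(1) refl disjI1[OF refl] near near'])
  have th: "is_mf ?w (theta (P, Q))" by (rule is_mf_theta[OF PQ(1,2,3)])
  have rk: "rk0 M' = p + q" "rk1 M' = p + q" using M'c by (auto simp: rk0_def rk1_def)
  obtain e1 where e1: "cat_iso (MF ?w) (theta (P, Q)) M' e1"
    using mf_iso_cat_iso[OF S(1) th _ _ PQ(4)] theta_rk(1,2)[OF PQ(1,2)] rk by auto
  obtain e2 where e2: "cat_iso (MF ?w) M' N e2" using S(2) by blast
  have "cat_iso (MF ?w) (theta (P, Q)) N (Cmp (MF ?w) (theta (P, Q)) M' N e2 e1)"
    by (rule cat_iso_comp[OF MF_category _ _ _ e1 e2]) (use th S(1) N(1) in simp_all)
  from cat_iso_comp[OF MF_category _ _ _ this NM] th mf N(1)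
  have "cat_iso (MF ?w) (theta (P, Q)) M (Cmp (MF ?w) (theta (P, Q)) N M eN (Cmp (MF ?w) (theta (P, Q)) M' N e2 e1))" by simp
  with PQ(3) show ?thesis by blast
qed

theorem mainTheorem2:
  fixes \<iota> :: "'k::{alg_closed_field, field_char_0} \<Rightarrow> 'a::comm_ring_1" and r :: nat
  assumes "complete_local_noetherian_algebra \<iota>" and "r \<ge> 1"
  shows
    \<comment> \<open>(i), without forms\<close>
    "(\<forall>M. is_deformation \<iota> r M \<longrightarrow>
        (\<exists>\<pi> \<in> max_ideal. \<exists>P Q.
           P \<in> carrier_mat r r \<and> elements_mat P \<subseteq> max_ideal \<and>
           Q \<in> carrier_mat r r \<and> elements_mat Q \<subseteq> max_ideal \<and>
           is_mf \<pi> (P, Q) \<and>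
           gauge_equivalent \<iota> r M (theta (P, Q))))
    \<comment> \<open>(i), with forms\<close>
     \<and> (\<forall>kind b. is_form kind (Mbar r) b \<longrightarrow>
        (\<exists>g. mf_iso (Mbar r) (Mbar r) g \<and>
           (constant_entries b \<longrightarrow> g = mf_id (Mbar r)) \<and>
           (\<forall>M B. is_form_deformation \<iota> r kind b M B \<longrightarrow>
              (\<exists>\<pi> \<in> max_ideal. \<exists>P Q c.
                 P \<in> carrier_mat r r \<and> elements_mat P \<subseteq> max_ideal \<and>
                 Q \<in> carrier_mat r r \<and> elements_mat Q \<subseteq> max_ideal \<and>
                 is_mf \<pi> (P, Q) \<and> is_form (source_kind kind) (P, Q) c \<and>
                 form_gauge_equivalent \<iota> kind g M B
                   (theta (P, Q)) (theta_form (source_kind kind) c)))))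
    \<comment> \<open>(ii)\<close>
     \<and> (\<forall>\<pi> \<in> (max_ideal :: 'a set).
          is_equivalence (MF \<pi>) (MF (var_x * var_y - cst \<pi>)) theta theta_class)"
proof -
  interpret complete_algebra \<iota> by (rule complete_algebra.intro[OF assms(1)])
  have equivalence: "is_equivalence (MF \<pi> :: ('a mat2, 'a mat2 set) cat) (MF (var_x * var_y - cst \<pi>)) theta theta_class" for \<pi>
  proof (rule equivalenceI[OF theta_functor])
    fix M N :: "'a mat2" assume "M \<in> Obj (MF \<pi>)" "N \<in> Obj (MF \<pi>)"
    then have "mf_shape M" "mf_shape N" by (auto intro: is_mf_shape)
    from theta_fully_faithful[OF this]
    show "bij_betw (theta_class M N) (Mor (MF \<pi>) M N) (Mor (MF (var_x * var_y - cst \<pi>)) (theta M) (theta N))" by simp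
  next
    fix Y :: "'a fps fps mat2" assume "Y \<in> Obj (MF (var_x * var_y - cst \<pi>))"
    then have "is_mf (var_x * var_y - cst \<pi>) Y" by simp
    from theta_essentially_surjective[OF this]
    show "\<exists>X \<in> Obj (MF \<pi>). \<exists>e. cat_iso (MF (var_x * var_y - cst \<pi>)) (theta X) Y e" by simp
  qed
  have two: "(2 :: 'k) \<noteq> 0" by simp
  show ?thesis
    using deformation_is_theta form_deformation_is_theta[OF two] equivalence by (intro conjI allI impI ballI) simp_all
qed

end
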